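(* Assume (H1), (H2), (H3). Let $a>0$. Then there exist $\varepsilon_0\in(0,1/4)$, a constant $c>0$ (which may depend on $a$) and, for every $\varepsilon\in(0,\varepsilon_0)$, a constant $c_\varepsilon>0$ (which may depend on $\varepsilon$ and $a$) such that for any $\varepsilon\in(0,\varepsilon_0)$, any non-negative function $\psi:\mathbb X\to\mathbb R_+$, any $y\in\mathbb R$ and any integer $n\geqslant 3\varepsilon^{-3}$, \[ \sup_{x\in\mathbb X,\ z\geqslant 0} n\left|\mathbb E_x\big(\psi(X_n)\,;\,y+S_n\in[z,z+a],\ \tau_y>n\big)-\frac{2a\,\nu(\psi)\,V(x,y)}{\sqrt{2\pi}\,\sigma^2\,n}\,\varphi_+\!\Big(\frac{z}{\sqrt n\,\sigma}\Big)\right| \leqslant c\,(1+\max(y,0))\,\|\psi\|_\infty\Big(\sqrt{\varepsilon}+\frac{c_\varepsilon(1+\max(y,0))}{n^{\varepsilon}}\Big), \] where $\varphi_+(t)=t e^{-t^2/2}\mathbf 1_{\{t\geqslant0\}}$.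
   Context: Let $\mathbb X$ be a finite set and $(X_n)_{n\geqslant0}$ a homogeneous Markov chain on $\mathbb X$ with transition matrix $\mathbf P$; $\mathbb P_x,\mathbb E_x$ denote probability and expectation when $X_0=x$. For $g:\mathbb X\to\mathbb C$, $\|g\|_\infty=\max_{x}|g(x)|$ and $\mathbf Pg(x)=\sum_{x'}g(x')\mathbf P(x,x')$. (H1): there exists $k_0\geqslant1$ such that $\mathbf P^{k_0}g(x)>0$ for all $x\in\mathbb X$ and every non-negative, not identically zero $g$. Under (H1) there is a unique invariant probability $\nu$ of $\mathbf P$, and $\nu(x)>0$ for all $x$; write $\nu(g)=\sum_x g(x)\nu(x)$. Let $f:\mathbb X\to\mathbb R$, $S_0=0$, $S_n=f(X_1)+\dots+f(X_n)$, and for $y\in\mathbb R$ let $\tau_y=\inf\{k\geqslant1:\ y+S_k\leqslant0\}$. (H2): $\nu(f)=0$. (H3): for every $(\theta,a)\in\mathbb R^2$ there exist $n\geqslant0$ and $x_0,\dots,x_n\in\mathbb X$ with $\mathbf P(x_0,x_1)\cdots\mathbf P(x_{n-1},x_n)\mathbf P(x_n,x_0)>0$ and $f(x_0)+\dots+f(x_n)-(n+1)\theta\notin a\mathbb Z$. Let $\sigma^2=\nu(f^2)+2\sum_{n\geqslant1}\nu(f\,\mathbf P^nf)$ (which is $>0$ under (H1)–(H3)). Under (H1)–(H3) it is known that for every $x\in\mathbb X$, $y\in\mathbb R$ the limit $\lim_{n\to\infty}\sqrt n\,\mathbb P_x(\tau_y>n)$ exists and is finite; define $V(x,y)=\frac{\sqrt{2\pi}\,\sigma}{2}\lim_{n\to\infty}\sqrt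 n\,\mathbb P_x(\tau_y>n)$ (this is a non-negative function, non-decreasing in $y$, with $\mathbb E_x(V(X_n,y+S_n);\tau_y>n)=V(x,y)$). *)

theory Defs
  imports "HOL-Analysis.Analysis"
begin

text \<open>A Markov chain on a finite state space (a type of class finite) is given by its
transition matrix P. All quantities below only depend on the first n steps of the chain,
so they are written as finite sums over trajectories (x_1,...,x_n) started at X_0 = x.\<close>

definition stochastic :: "('x::finite \<Rightarrow> 'x \<Rightarrow> real) \<Rightarrow> bool" where
  "stochastic P \<longleftrightarrow> (\<forall>x x'. P x x' \<ge> 0) \<and> (\<forall>x. (\<Sum>x'\<in>UNIV. P x x') = 1)"

fun Ppow :: "('x::finite \<Rightarrow> 'x \<Rightarrow> real) \<Rightarrow> nat \<Rightarrow> 'x \<Rightarrow> 'x \<Rightarrow> real" where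
  "Ppow P 0 x x' = (if x = x' then 1 else 0)"
| "Ppow P (Suc n) x x' = (\<Sum>w\<in>UNIV. Ppow P n x w * P w x')"

definition Papply :: "('x::finite \<Rightarrow> 'x \<Rightarrow> real) \<Rightarrow> nat \<Rightarrow> ('x \<Rightarrow> real) \<Rightarrow> 'x \<Rightarrow> real" where
  "Papply P n g x = (\<Sum>x'\<in>UNIV. g x' * Ppow P n x x')"

definition H1 :: "('x::finite \<Rightarrow> 'x \<Rightarrow> real) \<Rightarrow> bool" where
  "H1 P \<longleftrightarrow> (\<exists>k0\<ge>1. \<forall>g::'x \<Rightarrow> real. (\<forall>x. g x \<ge> 0) \<and> (\<exists>x. g x \<noteq> 0)
                 \<longrightarrow> (\<forall>x. Papply P k0 g x > 0))"

definition invariant_prob :: "('x::finite \<Rightarrow> 'x \<Rightarrow> real) \<Rightarrow> ('x \<Rightarrow> real) \<Rightarrow> bool" where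
  "invariant_prob P \<mu> \<longleftrightarrow> (\<forall>x. \<mu> x \<ge> 0) \<and> (\<Sum>x\<in>UNIV. \<mu> x) = 1 \<and>
      (\<forall>x'. (\<Sum>x\<in>UNIV. \<mu> x * P x x') = \<mu> x')"

text \<open>The (unique under H1) invariant probability nu.\<close>
definition inv_nu :: "('x::finite \<Rightarrow> 'x \<Rightarrow> real) \<Rightarrow> 'x \<Rightarrow> real" where
  "inv_nu P = (THE \<mu>. invariant_prob P \<mu>)"

definition nu_int :: "('x::finite \<Rightarrow> 'x \<Rightarrow> real) \<Rightarrow> ('x \<Rightarrow> real) \<Rightarrow> real" where
  "nu_int P g = (\<Sum>x\<in>UNIV. g x * inv_nu P x)"

definition H2 :: "('x::finite \<Rightarrow> 'x \<Rightarrow> real) \<Rightarrow> ('x \<Rightarrow> real) \<Rightarrow> bool" where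
  "H2 P f \<longleftrightarrow> nu_int P f = 0"

definition H3 :: "('x::finite \<Rightarrow> 'x \<Rightarrow> real) \<Rightarrow> ('x \<Rightarrow> real) \<Rightarrow> bool" where
  "H3 P f \<longleftrightarrow> (\<forall>\<theta> a::real. \<exists>n::nat. \<exists>xs::'x list. length xs = n + 1 \<and>
      (\<Prod>i<n. P (xs ! i) (xs ! (i+1))) * P (xs ! n) (xs ! 0) > 0 \<and>
      (\<Sum>i\<le>n. f (xs ! i)) - real (n+1) * \<theta> \<notin> {a * of_int k | k. True})"

definition sigma2 :: "('x::finite \<Rightarrow> 'x \<Rightarrow> real) \<Rightarrow> ('x \<Rightarrow> real) \<Rightarrow> real" where
  "sigma2 P f = nu_int P (\<lambda>x. f x ^ 2)
      + 2 * (\<Sum>n. nu_int P (\<lambda>x. f x * Papply P (Suc n) f x))"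

definition sigma :: "('x::finite \<Rightarrow> 'x \<Rightarrow> real) \<Rightarrow> ('x \<Rightarrow> real) \<Rightarrow> real" where
  "sigma P f = sqrt (sigma2 P f)"

text \<open>Trajectories xs = [X_1,...,X_n]; probability under P_x (X_0 = x).\<close>
definition paths :: "nat \<Rightarrow> 'x list set" where
  "paths n = {xs. length xs = n}"

definition pathprob :: "('x \<Rightarrow> 'x \<Rightarrow> real) \<Rightarrow> 'x \<Rightarrow> 'x list \<Rightarrow> real" where
  "pathprob P x xs = (\<Prod>i<length xs. P ((x # xs) ! i) (xs ! i))"

definition Ssum :: "('x \<Rightarrow> real) \<Rightarrow> 'x list \<Rightarrow> nat \<Rightarrow> real" where
  "Ssum f xs k = (\<Sum>i<k. f (xs ! i))"

definition tau_gt :: "('x \<Rightarrow> real) \<Rightarrow> real \<Rightarrow> 'x list \<Rightarrow> nat \<Rightarrow> bool" where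
  "tau_gt f y xs n \<longleftrightarrow> (\<forall>k\<in>{1..n}. y + Ssum f xs k > 0)"

definition expect_n :: "('x::finite \<Rightarrow> 'x \<Rightarrow> real) \<Rightarrow> 'x \<Rightarrow> nat \<Rightarrow> ('x list \<Rightarrow> real) \<Rightarrow> real" where
  "expect_n P x n F = (\<Sum>xs\<in>paths n. pathprob P x xs * F xs)"

definition prob_tau_gt :: "('x::finite \<Rightarrow> 'x \<Rightarrow> real) \<Rightarrow> ('x \<Rightarrow> real) \<Rightarrow> 'x \<Rightarrow> real \<Rightarrow> nat \<Rightarrow> real" where
  "prob_tau_gt P f x y n = expect_n P x n (\<lambda>xs. if tau_gt f y xs n then 1 else 0)"

definition Vfun :: "('x::finite \<Rightarrow> 'x \<Rightarrow> real) \<Rightarrow> ('x \<Rightarrow> real) \<Rightarrow> 'x \<Rightarrow> real \<Rightarrow> real" where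
  "Vfun P f x y = sqrt (2 * pi) * sigma P f / 2 * lim (\<lambda>n. sqrt (real n) * prob_tau_gt P f x y n)"

definition phi_plus :: "real \<Rightarrow> real" where
  "phi_plus t = (if t \<ge> 0 then t * exp (- (t^2) / 2) else 0)"

definition sup_norm :: "('x::finite \<Rightarrow> real) \<Rightarrow> real" where
  "sup_norm g = Max (range (\<lambda>x. \<bar>g x\<bar>))"

end

theory Submission
  imports Defs "HOL-Probability.Probability"
begin

text \<open>
  The chain \<open>(X\<^sub>n, y + S\<^sub>n)\<close>, killed when it leaves the positive half line, has transition operator \<open>Q\<close>.
  Fourier analysis of the twisted operators \<open>g \<mapsto> P (exp (\<i> s f) g)\<close>, with (H3) excluding large frequencies,
  gives a local limit theorem for the free walk with Gaussian density \<open>phi\<close>. Time reversal and the bound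
  \<open>surv n = O((1 + y\<^sup>+) / sqrt n)\<close> give the size \<open>O((1 + z) / n)\<close> of the killed density near the boundary; away from the
  boundary it is the reflected density \<open>phi t (y - z) - phi t (y + z)\<close>.
  One then runs the killed walk for time \<open>n / 2\<close> against an odd Gaussian \<open>W z\<close>: corrected by the solution \<open>r\<close> of the
  Poisson equation, \<open>W z\<close> is linear near the boundary with slope \<open>D n z\<close>, and \<open>y + r x\<close> is a martingale,
  so the result is \<open>D n z\<close> times the harmonic function \<open>V x y\<close>, the limit of \<open>Q\<^sup>k (y + r)\<close>.
  Integrating the local theorem over \<open>z\<close> identifies \<open>V\<close> with the limit of \<open>sqrt n * surv n\<close> in the definition of \<open>Vfun\<close>.
\<close>

section \<open>Transition operators\<close>

text \<open>(H3) makes the twisted operators contract at each nonzero frequency, uniformly on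
  compact sets but with no control at infinity. Hence the local theorem is tested on Fejer kernels,
  whose Fourier transform has compact support, and its error is o(1 / sqrt t) without a rate.
  Splitting the time into two halves turns this into o(1 / n): survival during the first half
  supplies the missing 1 / sqrt n. For \<open>z\<close> small compared with sqrt n the main term is
  itself small compared with 1 / n, so absolute bounds suffice there, and the reflection comparison
  is only run for \<open>z \<ge> \<eta> * sqrt n\<close>. The missing rate fixes the shape of the
  result: for each \<open>\<kappa>\<close> the error is \<open>\<kappa> (1 + max y 0) / n\<close>
  plus a term of order n^(-3/2) once \<open>n\<close> exceeds a threshold \<open>N \<kappa>\<close>
  that depends on neither \<open>y\<close> nor \<open>z\<close>. The claim absorbs this with
  \<open>\<kappa> = sqrt \<epsilon>\<close> and a constant larger than
  \<open>N (sqrt \<epsilon>)\<close>: for smaller \<open>n\<close> its right side already dominates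
  an a priori bound of order \<open>(1 + max y 0) / n\<close>. Since the walk is killed only after a
  move, starts slightly below 0 stay in play; \<open>B\<close>, a bound for the jumps, delimits
  them.\<close>

definition step :: "('x::finite \<Rightarrow> 'x \<Rightarrow> real) \<Rightarrow> ('x \<Rightarrow> real) \<Rightarrow> ('x \<Rightarrow> real \<Rightarrow> 'b::real_vector) \<Rightarrow> 'x \<Rightarrow> real \<Rightarrow> 'b" where
  "step P f G x y = (\<Sum>x'\<in>UNIV. P x x' *\<^sub>R G x' (y + f x'))"

text \<open>Killing is tested at the point of arrival and never at the start, in accordance with
  \<open>tau_gt\<close>, which looks at times from 1 on. A start \<open>y \<le> 0\<close> can
  therefore survive.\<close>

definition kstep :: "('x::finite \<Rightarrow> 'x \<Rightarrow> real) \<Rightarrow> ('x \<Rightarrow> real) \<Rightarrow> ('x \<Rightarrow> real \<Rightarrow> 'b::real_vector) \<Rightarrow> 'x \<Rightarrow> real \<Rightarrow> 'b" where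
  "kstep P f G = step P f (\<lambda>x y. if 0 < y then G x y else 0)"

text \<open>The part of a free move that leaves the half line, weighted by the value of
  \<open>G\<close> at the overshoot point.\<close>

definition estep :: "('x::finite \<Rightarrow> 'x \<Rightarrow> real) \<Rightarrow> ('x \<Rightarrow> real) \<Rightarrow> ('x \<Rightarrow> real \<Rightarrow> 'b::real_vector) \<Rightarrow> 'x \<Rightarrow> real \<Rightarrow> 'b" where
  "estep P f G = step P f (\<lambda>x y. if 0 < y then 0 else G x y)"

lemma step_split: "step P f G x y = kstep P f G x y + estep P f G x y"
  by (auto simp: step_def kstep_def estep_def sum.distrib[symmetric] intro!: sum.cong)

lemma step_add: "step P f (\<lambda>x y. G x y + H x y) = (\<lambda>x y. step P f G x y + step P f H x y)"
  by (simp add: step_def fun_eq_iff scaleR_add_right sum.distrib)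

lemma step_diff: "step P f (\<lambda>x y. G x y - H x y) = (\<lambda>x y. step P f G x y - step P f H x y)"
  by (simp add: step_def fun_eq_iff scaleR_diff_right sum_subtractf)

lemma step_scaleR: "step P f (\<lambda>x y. c *\<^sub>R G x y) = (\<lambda>x y. c *\<^sub>R step P f G x y)"
  by (simp add: step_def fun_eq_iff scaleR_sum_right mult.commute)

lemma step_of_real: "step P f (\<lambda>x y. of_real (G x y) :: 'b::real_algebra_1) = (\<lambda>x y. of_real (step P f G x y))"
  by (simp add: step_def fun_eq_iff scaleR_conv_of_real)

lemma kstep_add: "kstep P f (\<lambda>x y. G x y + H x y) = (\<lambda>x y. kstep P f G x y + kstep P f H x y)"
  by (auto simp: step_def kstep_def fun_eq_iff sum.distrib[symmetric] scaleR_add_right intro!: sum.cong)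

lemma kstep_diff: "kstep P f (\<lambda>x y. G x y - H x y) = (\<lambda>x y. kstep P f G x y - kstep P f H x y)"
  by (auto simp: step_def kstep_def fun_eq_iff sum_subtractf[symmetric] scaleR_diff_right intro!: sum.cong)

lemma kstep_scaleR: "kstep P f (\<lambda>x y. c *\<^sub>R G x y) = (\<lambda>x y. c *\<^sub>R kstep P f G x y)"
  by (auto simp: step_def kstep_def fun_eq_iff scaleR_sum_right intro!: sum.cong)

lemma kstep_of_real: "kstep P f (\<lambda>x y. of_real (G x y) :: 'b::real_algebra_1) = (\<lambda>x y. of_real (kstep P f G x y))"
  by (auto simp: step_def kstep_def fun_eq_iff scaleR_conv_of_real intro!: sum.cong)

lemma kpow_add: "(kstep P f ^^ n) (\<lambda>x y. G x y + H x y) = (\<lambda>x y. (kstep P f ^^ n) G x y + (kstep P f ^^ n) H x y)"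
  by (induction n) (simp_all add: kstep_add)

lemma kpow_diff: "(kstep P f ^^ n) (\<lambda>x y. G x y - H x y) = (\<lambda>x y. (kstep P f ^^ n) G x y - (kstep P f ^^ n) H x y)"
  by (induction n) (simp_all add: kstep_diff)

lemma kpow_scaleR: "(kstep P f ^^ n) (\<lambda>x y. c *\<^sub>R G x y) = (\<lambda>x y. c *\<^sub>R (kstep P f ^^ n) G x y)"
  by (induction n) (simp_all add: kstep_scaleR)

lemma kpow_mult: "(kstep P f ^^ n) (\<lambda>x y. c * G x y) = (\<lambda>x y. c * (kstep P f ^^ n) G x y)" for c :: real
  using kpow_scaleR[of n P f c G] by simp

lemma kpow_of_real: "(kstep P f ^^ n) (\<lambda>x y. of_real (G x y) :: 'b::real_algebra_1) = (\<lambda>x y. of_real ((kstep P f ^^ n) G x y))"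
  by (induction n) (simp_all add: kstep_of_real)

lemma kpow_zero: "(kstep P f ^^ n) (\<lambda>x y. 0) = (\<lambda>x y. 0)"
  using kpow_scaleR[of n P f 0 "\<lambda>x y. 0"] by simp

lemma kpow_sum: "finite I \<Longrightarrow> (kstep P f ^^ n) (\<lambda>x y. \<Sum>i\<in>I. G i x y) = (\<lambda>x y. \<Sum>i\<in>I. (kstep P f ^^ n) (G i) x y)"
  by (induction I rule: finite_induct) (simp_all add: kpow_zero kpow_add)

lemma tpow_mult: "(step P f ^^ n) (\<lambda>x y. c * G x y) = (\<lambda>x y. c * (step P f ^^ n) G x y)" for c :: real
proof (induction n)
  case (Suc n)
  then show ?case using step_scaleR[of P f c "(step P f ^^ n) G"] by simp
qed simp

lemma tpow_add: "(step P f ^^ n) (\<lambda>x y. G x y + H x y) = (\<lambda>x y. (step P f ^^ n) G x y + (step P f ^^ n) H x y)"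
  by (induction n) (simp_all add: step_add)

lemma tpow_diff: "(step P f ^^ n) (\<lambda>x y. G x y - H x y) = (\<lambda>x y. (step P f ^^ n) G x y - (step P f ^^ n) H x y)"
  by (induction n) (simp_all add: step_diff)

lemma tpow_shift: "(step P f ^^ n) (\<lambda>x y. G x (y + h)) = (\<lambda>x y. (step P f ^^ n) G x (y + h))"
  by (induction n) (simp_all add: step_def fun_eq_iff add_ac)

section \<open>Path sums\<close>

lemma paths_0: "paths 0 = {[]}"
  by (auto simp: paths_def)

lemma paths_Suc: "paths (Suc n) = (\<lambda>(x, xs). x # xs) ` (UNIV \<times> paths n)"
  by (auto simp: paths_def length_Suc_conv image_iff)

lemma sum_paths_Suc:
  "(\<Sum>xs\<in>paths (Suc n). h xs) = (\<Sum>x\<in>UNIV. \<Sum>xs\<in>paths n. h (x # xs))" for h :: "'x::finite list \<Rightarrow> 'b::comm_monoid_add"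
proof -
  have inj: "inj_on (\<lambda>(x, xs). x # xs) (UNIV \<times> (paths n :: 'x list set))"
    by (auto simp: inj_on_def)
  show ?thesis
    unfolding paths_Suc by (subst sum.reindex[OF inj]) (simp add: sum.cartesian_product case_prod_beta)
qed

lemma pathprob_Cons: "pathprob P x (x' # xs) = P x x' * pathprob P x' xs"
  unfolding pathprob_def by (simp add: prod.lessThan_Suc_shift del: prod.lessThan_Suc)

lemma Ssum_Cons: "Ssum f (x' # xs) (Suc k) = f x' + Ssum f xs k"
  unfolding Ssum_def by (simp add: sum.lessThan_Suc_shift del: sum.lessThan_Suc)

lemma tau_gt_Cons: "tau_gt f y (x' # xs) (Suc n) \<longleftrightarrow> 0 < y + f x' \<and> tau_gt f (y + f x') xs n"
proof -
  have eq: "{1..Suc n} = insert 1 (Suc ` {1..n})"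
    by auto
  have 1: "Ssum f xs 0 = 0"
    by (simp add: Ssum_def)
  show ?thesis
    unfolding tau_gt_def eq by (simp add: Ssum_Cons 1 add.assoc del: image_Suc_atLeastAtMost)
qed

text \<open>Conditioning on the first move peels one factor off the path sum. Indexing
  \<open>x # xs\<close> instead of \<open>xs\<close> makes time 0 return the starting state.\<close>

lemma expect_killed:
  "expect_n P x n (\<lambda>xs. G ((x # xs) ! n) (y + Ssum f xs n) * (if tau_gt f y xs n then 1 else 0))
     = (kstep P f ^^ n) G x y"
proof (induction n arbitrary: x y)
  case 0
  then show ?case
    by (simp add: expect_n_def paths_0 pathprob_def Ssum_def tau_gt_def)
next
  case (Suc n)
  have "expect_n P x (Suc n) (\<lambda>xs. G ((x # xs) ! Suc n) (y + Ssum f xs (Suc n)) * (if tau_gt f y xs (Suc n) then 1 else 0))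
     = (\<Sum>x'\<in>UNIV. P x x' * (if 0 < y + f x' then
        expect_n P x' n (\<lambda>xs. G ((x' # xs) ! n) (y + f x' + Ssum f xs n) * (if tau_gt f (y + f x') xs n then 1 else 0)) else 0))"
    by (auto simp: expect_n_def sum_paths_Suc pathprob_Cons Ssum_Cons tau_gt_Cons sum_distrib_left mult.assoc add.assoc
        intro!: sum.cong)
  also have "\<dots> = (kstep P f ^^ Suc n) G x y"
    by (auto simp: Suc.IH kstep_def[of P f "(kstep P f ^^ n) G"] step_def intro!: sum.cong)
  finally show ?case .
qed

lemma expect_free:
  "expect_n P x n (\<lambda>xs. G ((x # xs) ! n) (y + Ssum f xs n)) = (step P f ^^ n) G x y"
proof (induction n arbitrary: x y)
  case 0
  then show ?case
    by (simp add: expect_n_def paths_0 pathprob_def Ssum_def)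
next
  case (Suc n)
  have "expect_n P x (Suc n) (\<lambda>xs. G ((x # xs) ! Suc n) (y + Ssum f xs (Suc n)))
     = (\<Sum>x'\<in>UNIV. P x x' * expect_n P x' n (\<lambda>xs. G ((x' # xs) ! n) (y + f x' + Ssum f xs n)))"
    by (auto simp: expect_n_def sum_paths_Suc pathprob_Cons Ssum_Cons sum_distrib_left mult.assoc add.assoc
        intro!: sum.cong)
  also have "\<dots> = (step P f ^^ Suc n) G x y"
    by (simp add: Suc.IH step_def[of P f "(step P f ^^ n) G"])
  finally show ?case .
qed

section \<open>Positivity and telescoping\<close>

locale markov_walk =
  fixes P :: "'x::finite \<Rightarrow> 'x \<Rightarrow> real" and f :: "'x \<Rightarrow> real"
  assumes stoch: "stochastic P"
begin

abbreviation T :: "('x \<Rightarrow> real \<Rightarrow> 'b::real_vector) \<Rightarrow> 'x \<Rightarrow> real \<Rightarrow> 'b" where "T \<equiv> step P f"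
abbreviation Q :: "('x \<Rightarrow> real \<Rightarrow> 'b::real_vector) \<Rightarrow> 'x \<Rightarrow> real \<Rightarrow> 'b" where "Q \<equiv> kstep P f"
abbreviation K :: "('x \<Rightarrow> real \<Rightarrow> 'b::real_vector) \<Rightarrow> 'x \<Rightarrow> real \<Rightarrow> 'b" where "K \<equiv> estep P f"

lemma P_nonneg: "0 \<le> P x x'" and P_sum: "(\<Sum>x'\<in>UNIV. P x x') = 1"
  using stoch by (auto simp: stochastic_def)

lemma step_mono:
  fixes G H :: "'x \<Rightarrow> real \<Rightarrow> real"
  assumes "\<And>x'. G x' (y + f x') \<le> H x' (y + f x')"
  shows "T G x y \<le> T H x y"
  unfolding step_def by (auto intro!: sum_mono mult_left_mono assms P_nonneg)

lemma step_const: "T (\<lambda>_ _. c) = (\<lambda>_ _. c)"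
  by (simp add: step_def fun_eq_iff scaleR_sum_left[symmetric] P_sum)

lemma norm_step: "norm (T G x y) \<le> T (\<lambda>x y. norm (G x y)) x y"
  for G :: "'x \<Rightarrow> real \<Rightarrow> 'b::real_normed_vector"
  unfolding step_def by (rule order_trans[OF norm_sum]) (simp add: P_nonneg)

lemma kstep_mono_on:
  fixes G H :: "'x \<Rightarrow> real \<Rightarrow> real"
  assumes "\<And>x y. 0 < y \<Longrightarrow> G x y \<le> H x y"
  shows "Q G x y \<le> Q H x y"
  unfolding kstep_def by (rule step_mono) (auto intro: assms)

text \<open>Every surviving move ends at a positive height, hence above \<open>b \<le> 0\<close>. A
  comparison is thus needed only on \<open>y \<ge> b\<close>; the later uses take
  \<open>b = - B\<close> or \<open>b = 0\<close>.\<close>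

lemma kpow_mono_on:
  fixes G H :: "'x \<Rightarrow> real \<Rightarrow> real"
  assumes "b \<le> 0" and "\<And>x y. b \<le> y \<Longrightarrow> G x y \<le> H x y" and "b \<le> y"
  shows "(Q ^^ n) G x y \<le> (Q ^^ n) H x y"
  using assms(3)
proof (induction n arbitrary: x y)
  case (Suc n)
  show ?case using assms(1) by (auto intro!: kstep_mono_on Suc.IH)
qed (use assms(2) in auto)

lemma kpow_mono:
  fixes G H :: "'x \<Rightarrow> real \<Rightarrow> real"
  assumes "\<And>x y. G x y \<le> H x y"
  shows "(Q ^^ n) G x y \<le> (Q ^^ n) H x y"
  using kpow_mono_on[of "min y 0" G H y n x] assms by auto

text \<open>After at least one killed move the argument of \<open>G\<close> is positive, whatever
  the start; \<open>0 < n\<close> ensures that such a move takes place.\<close>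

lemma kpow_mono_pos:
  fixes G H :: "'x \<Rightarrow> real \<Rightarrow> real"
  assumes "\<And>x y. 0 < y \<Longrightarrow> G x y \<le> H x y" and "0 < n"
  shows "(Q ^^ n) G x y \<le> (Q ^^ n) H x y"
proof -
  have trunc: "(\<lambda>x y. if 0 < y then if 0 < y then g x y else 0 else 0) = (\<lambda>x y. if 0 < y then g x y else 0)"
    for g :: "'x \<Rightarrow> real \<Rightarrow> real"
    by (auto simp: fun_eq_iff)
  have "Q G = Q (\<lambda>x y. if 0 < y then G x y else 0)" "Q H = Q (\<lambda>x y. if 0 < y then H x y else 0)"
    by (simp_all only: kstep_def trunc)
  then have Qeq: "Q G = Q (\<lambda>x y. if 0 < y then G x y else 0)" "Q H = Q (\<lambda>x y. if 0 < y then H x y else 0)" .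
  obtain m where m: "n = Suc m"
    using \<open>0 < n\<close> by (cases n) auto
  have eq: "(Q ^^ n) G = (Q ^^ n) (\<lambda>x y. if 0 < y then G x y else 0)"
      "(Q ^^ n) H = (Q ^^ n) (\<lambda>x y. if 0 < y then H x y else 0)"
    unfolding m funpow_Suc_right comp_def by (simp_all only: Qeq[symmetric])
  show ?thesis
    unfolding eq by (rule kpow_mono) (auto intro: assms)
qed

lemma norm_kstep: "norm (Q G x y) \<le> Q (\<lambda>x y. norm (G x y)) x y"
  for G :: "'x \<Rightarrow> real \<Rightarrow> 'b::real_normed_vector"
  unfolding kstep_def by (rule order_trans[OF norm_step]) (auto intro!: step_mono)

lemma norm_kpow: "norm ((Q ^^ n) G x y) \<le> (Q ^^ n) (\<lambda>x y. norm (G x y)) x y"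
  for G :: "'x \<Rightarrow> real \<Rightarrow> 'b::real_normed_vector"
proof (induction n arbitrary: x y)
  case (Suc n)
  have "norm ((Q ^^ Suc n) G x y) \<le> Q (\<lambda>x y. norm ((Q ^^ n) G x y)) x y"
    by (simp add: norm_kstep)
  also have "\<dots> \<le> Q ((Q ^^ n) (\<lambda>x y. norm (G x y))) x y"
    by (rule kstep_mono_on) (rule Suc.IH)
  finally show ?case by simp
qed simp

lemma norm_kpow_le:
  fixes G :: "'x \<Rightarrow> real \<Rightarrow> 'b::real_normed_vector"
  assumes "b \<le> 0" and "\<And>x y. b \<le> y \<Longrightarrow> norm (G x y) \<le> H x y" and "b \<le> y"
  shows "norm ((Q ^^ n) G x y) \<le> (Q ^^ n) H x y"
  using norm_kpow[of n G x y] kpow_mono_on[of b "\<lambda>x y. norm (G x y)" H y n x] assms by force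

lemma kpow_nonneg: "(\<And>x y. 0 \<le> G x y) \<Longrightarrow> 0 \<le> (Q ^^ n) G x y" for G :: "'x \<Rightarrow> real \<Rightarrow> real"
  using kpow_mono[of "\<lambda>_ _. 0" G n x y] by (simp add: kpow_zero)

lemma tpow_mono:
  fixes G H :: "'x \<Rightarrow> real \<Rightarrow> real"
  assumes "\<And>x y. G x y \<le> H x y"
  shows "(T ^^ n) G x y \<le> (T ^^ n) H x y"
  using assms by (induction n arbitrary: x y) (auto intro!: step_mono)

lemma tpow_const: "(T ^^ n) (\<lambda>_ _. c) = (\<lambda>_ _. c)"
  by (induction n) (simp_all add: step_const)

lemma tpow_nonneg: "(\<And>x y. 0 \<le> G x y) \<Longrightarrow> 0 \<le> (T ^^ n) G x y" for G :: "'x \<Rightarrow> real \<Rightarrow> real"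
  using tpow_mono[of "\<lambda>_ _. 0" G n x y] by (simp add: tpow_const)

lemma kpow_le_tpow: "(\<And>x y. 0 \<le> G x y) \<Longrightarrow> (Q ^^ n) G x y \<le> (T ^^ n) G x y" for G :: "'x \<Rightarrow> real \<Rightarrow> real"
proof (induction n arbitrary: x y)
  case (Suc n)
  have "(Q ^^ Suc n) G x y \<le> Q ((T ^^ n) G) x y"
    by (auto intro!: kstep_mono_on Suc)
  also have "\<dots> \<le> T ((T ^^ n) G) x y"
    unfolding kstep_def by (rule step_mono) (auto intro: tpow_nonneg Suc)
  finally show ?case by simp
qed simp

definition surv :: "nat \<Rightarrow> 'x \<Rightarrow> real \<Rightarrow> real" where
  "surv n = (Q ^^ n) (\<lambda>_ _. 1)"

lemma surv_0: "surv 0 x y = 1"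
  by (simp add: surv_def)

lemma surv_nonneg: "0 \<le> surv n x y"
  unfolding surv_def by (rule kpow_nonneg) simp

lemma surv_le_1: "surv n x y \<le> 1"
  unfolding surv_def using kpow_le_tpow[of "\<lambda>_ _. 1" n x y] by (simp add: tpow_const)

lemma kpow_const: "(Q ^^ n) (\<lambda>_ _. c) x y = c * surv n x y" for c :: real
  using kpow_mult[of n P f c "\<lambda>_ _. 1"] by (simp add: surv_def)

lemma kpow_surv: "(Q ^^ n) (surv m) = surv (n + m)"
  by (simp add: surv_def funpow_add)

lemma surv_Suc_le: "surv (Suc n) x y \<le> surv n x y"
proof -
  have "surv (Suc n) x y = (Q ^^ n) (surv 1) x y"
    by (simp add: kpow_surv)
  also have "\<dots> \<le> surv n x y"
    using kpow_mono[of "surv 1" "\<lambda>_ _. 1" n x y] surv_le_1[of 1] by (simp add: surv_def[of n])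
  finally show ?thesis .
qed

lemma surv_antimono: "m \<le> n \<Longrightarrow> surv n x y \<le> surv m x y"
  by (rule lift_Suc_antimono_le[of "\<lambda>n. surv n x y"]) (auto intro: surv_Suc_le)

lemma surv_mono: "y \<le> y' \<Longrightarrow> surv n x y \<le> surv n x y'"
proof (induction n arbitrary: x y y')
  case (Suc n)
  then show ?case
    unfolding surv_def by (auto simp: kstep_def step_def intro!: sum_mono mult_left_mono P_nonneg)
      (metis surv_def surv_nonneg)+
qed (simp add: surv_0)

lemma estep_1: "K (\<lambda>_ _. 1) x y = 1 - surv 1 x y"
  using step_split[of P f "\<lambda>_ _. 1::real" x y] by (simp add: step_const surv_def)

text \<open>\<open>K (\<lambda>_ _. 1)\<close> is the probability of exit at the next move, so this
  is the law of the exit time: alive after \<open>j\<close> moves, killed at move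
  \<open>j + 1\<close>.\<close>

lemma kpow_estep: "(Q ^^ j) (K (\<lambda>_ _. 1)) x y = surv j x y - surv (Suc j) x y"
proof -
  have "K (\<lambda>_ _. 1) = (\<lambda>x y. 1 - surv 1 x y)"
    by (simp add: fun_eq_iff estep_1)
  then show ?thesis
    by (simp add: kpow_diff kpow_surv) (simp add: surv_def)
qed

text \<open>Discrete Duhamel formula for a time-dependent family \<open>H\<close> that is meant to
  satisfy \<open>Q (H t) = H (t + 1)\<close> approximately.\<close>

lemma kpow_telescope:
  fixes H :: "nat \<Rightarrow> 'x \<Rightarrow> real \<Rightarrow> 'b::real_vector"
  shows "(Q ^^ k) (H m) x y - H (m + k) x y
     = (\<Sum>j<k. (Q ^^ j) (\<lambda>x y. Q (H (m + k - Suc j)) x y - H (m + k - j) x y) x y)"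
proof (induction k arbitrary: m)
  case (Suc k)
  have "(Q ^^ Suc k) (H m) x y - H (m + Suc k) x y
      = ((Q ^^ k) (Q (H m)) x y - (Q ^^ k) (H (Suc m)) x y) + ((Q ^^ k) (H (Suc m)) x y - H (Suc m + k) x y)"
    by (simp add: funpow_Suc_right del: funpow.simps)
  also have "(Q ^^ k) (Q (H m)) x y - (Q ^^ k) (H (Suc m)) x y = (Q ^^ k) (\<lambda>x y. Q (H m) x y - H (Suc m) x y) x y"
    by (simp add: kpow_diff)
  finally show ?case
    using Suc.IH[of "Suc m"] by simp
qed simp

text \<open>The defect \<open>Q (H t) - H (t + 1)\<close> is the defect of the free evolution, paid
  once per unit of time spent alive, minus the value of \<open>H t\<close> at an exit, paid once and
  weighted by the law of the exit time. A jump of size at most \<open>B\<close> from a height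
  \<open>y \<ge> - B\<close> lands at or above \<open>- 2 * B\<close>, which is why
  \<open>bdry\<close> concerns this strip only.\<close>

lemma kpow_telescope_bound:
  fixes H :: "nat \<Rightarrow> 'x \<Rightarrow> real \<Rightarrow> 'b::real_normed_vector"
  assumes f: "\<And>x. \<bar>f x\<bar> \<le> B"
    and err: "\<And>t x y. \<lbrakk>m \<le> t; t < m + k; - B \<le> y\<rbrakk> \<Longrightarrow> norm (T (H t) x y - H (Suc t) x y) \<le> e"
    and bdry: "\<And>t x y. \<lbrakk>m \<le> t; t < m + k; - 2 * B \<le> y; y \<le> 0\<rbrakk> \<Longrightarrow> norm (H t x y) \<le> \<beta> t"
    and y: "- B \<le> y"
  shows "norm ((Q ^^ k) (H m) x y - H (m + k) x y)
      \<le> e * (\<Sum>j<k. surv j x y) + (\<Sum>j<k. \<beta> (m + k - Suc j) * (surv j x y - surv (Suc j) x y))"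
proof -
  have B: "0 \<le> B" using f[of undefined] by linarith
  have "norm ((Q ^^ k) (H m) x y - H (m + k) x y)
     \<le> (\<Sum>j<k. norm ((Q ^^ j) (\<lambda>x y. Q (H (m + k - Suc j)) x y - H (m + k - j) x y) x y))"
    unfolding kpow_telescope by (rule norm_sum)
  also have "\<dots> \<le> (\<Sum>j<k. e * surv j x y + \<beta> (m + k - Suc j) * (surv j x y - surv (Suc j) x y))"
  proof (rule sum_mono)
    fix j assume "j \<in> {..<k}"
    then have j: "j < k" by simp
    define t where "t = m + k - Suc j"
    have t: "m \<le> t" "t < m + k" "m + k - j = Suc t" using j by (auto simp: t_def)
    have one: "norm (Q (H t) x y - H (Suc t) x y) \<le> e + \<beta> t * K (\<lambda>_ _. 1) x y" if y: "- B \<le> y" for x y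
    proof -
      have "norm (K (H t) x y) \<le> T (\<lambda>x y. norm (if 0 < y then 0 else H t x y)) x y"
        unfolding estep_def by (rule norm_step)
      also have "\<dots> \<le> T (\<lambda>x y. \<beta> t *\<^sub>R (if 0 < y then 0 else 1)) x y"
      proof (rule step_mono)
        fix x'
        have "- 2 * B \<le> y + f x'" using f[of x'] y by (simp add: abs_le_iff)
        then show "norm (if 0 < y + f x' then 0 else H t x' (y + f x')) \<le> \<beta> t *\<^sub>R (if 0 < y + f x' then 0 else 1)"
          using bdry[of t "y + f x'" x'] t by auto
      qed
      also have "\<dots> = \<beta> t * K (\<lambda>_ _. 1) x y"
        unfolding step_scaleR estep_def by simp
      finally have 1: "norm (K (H t) x y) \<le> \<beta> t * K (\<lambda>_ _. 1) x y" .
      have "Q (H t) x y - H (Suc t) x y = (T (H t) x y - H (Suc t) x y) - K (H t) x y"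
        by (simp add: step_split)
      then have "norm (Q (H t) x y - H (Suc t) x y) \<le> norm (T (H t) x y - H (Suc t) x y) + norm (K (H t) x y)"
        by (metis norm_triangle_ineq4)
      then show ?thesis using 1 err[of t y x] t y by linarith
    qed
    have "norm ((Q ^^ j) (\<lambda>x y. Q (H t) x y - H (Suc t) x y) x y) \<le> (Q ^^ j) (\<lambda>x y. e + \<beta> t * K (\<lambda>_ _. 1) x y) x y"
      by (rule norm_kpow_le[of "- B"]) (use B one y in auto)
    also have "\<dots> = e * surv j x y + \<beta> t * (surv j x y - surv (Suc j) x y)"
      by (simp add: kpow_add kpow_mult kpow_estep kpow_const)
    finally show "norm ((Q ^^ j) (\<lambda>x y. Q (H (m + k - Suc j)) x y - H (m + k - j) x y) x y)
      \<le> e * surv j x y + \<beta> (m + k - Suc j) * (surv j x y - surv (Suc j) x y)"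
      using t by (simp add: t_def)
  qed
  finally show ?thesis
    by (simp add: sum.distrib sum_distrib_left)
qed

lemma sum_surv_diff: "(\<Sum>j<k. surv j x y - surv (Suc j) x y) = 1 - surv k x y"
  by (induction k) (simp_all add: surv_0)

end

section \<open>Ergodicity and the Poisson equation\<close>

context markov_walk
begin

lemma Ppow_nonneg: "0 \<le> Ppow P n x w"
  by (induction n arbitrary: w) (auto intro!: sum_nonneg mult_nonneg_nonneg P_nonneg)

lemma Ppow_sum: "(\<Sum>w\<in>UNIV. Ppow P n x w) = 1"
proof (induction n)
  case (Suc n)
  have "(\<Sum>w\<in>UNIV. Ppow P (Suc n) x w) = (\<Sum>v\<in>UNIV. \<Sum>w\<in>UNIV. Ppow P n x v * P v w)"
    unfolding Ppow.simps by (rule sum.swap)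
  also have "\<dots> = 1"
    by (simp add: sum_distrib_left[symmetric] P_sum Suc)
  finally show ?case .
qed simp

lemma Ppow_add: "Ppow P (m + n) x w = (\<Sum>v\<in>UNIV. Ppow P m x v * Ppow P n v w)"
proof (induction n arbitrary: w)
  case 0
  then show ?case by (simp add: if_distrib[of "\<lambda>c. _ * c"] cong: if_cong)
next
  case (Suc n)
  have "Ppow P (m + Suc n) x w = (\<Sum>u\<in>UNIV. \<Sum>v\<in>UNIV. Ppow P m x v * Ppow P n v u * P u w)"
    by (simp add: Suc sum_distrib_right)
  also have "\<dots> = (\<Sum>v\<in>UNIV. \<Sum>u\<in>UNIV. Ppow P m x v * (Ppow P n v u * P u w))"
    by (subst sum.swap) (simp add: mult.assoc)
  finally show ?case
    by (simp add: sum_distrib_left)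
qed

lemma Ppow_1: "Ppow P (Suc 0) x w = P x w"
  by (simp add: if_distrib[of "\<lambda>c. c * _"] cong: if_cong)

lemma Papply_Suc: "Papply P (Suc n) g x = (\<Sum>v\<in>UNIV. P x v * Papply P n g v)"
proof -
  have "Papply P (Suc n) g x = (\<Sum>w\<in>UNIV. \<Sum>v\<in>UNIV. g w * (P x v * Ppow P n v w))"
    unfolding Papply_def using Ppow_add[of "Suc 0" n x]
    by (simp add: Ppow_1 sum_distrib_left del: Ppow.simps)
  also have "\<dots> = (\<Sum>v\<in>UNIV. P x v * Papply P n g v)"
    unfolding Papply_def by (subst sum.swap) (simp add: sum_distrib_left mult_ac)
  finally show ?thesis .
qed

lemma Papply_0: "Papply P 0 g x = g x"
  by (simp add: Papply_def if_distrib[of "\<lambda>c. _ * c"] cong: if_cong)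

end

locale ergodic_chain = markov_walk P f for P :: "'x::finite \<Rightarrow> 'x \<Rightarrow> real" and f :: "'x \<Rightarrow> real" +
  assumes H1: "H1 P"
begin

text \<open>(H1) applied to indicators of points makes all entries of one power positive; finiteness
  gives a common lower bound.\<close>

lemma doeblin: "\<exists>k \<delta>. 0 < k \<and> 0 < \<delta> \<and> \<delta> \<le> 1 \<and> (\<forall>x w. \<delta> \<le> Ppow P k x w)"
proof -
  obtain k0 where k0: "k0 \<ge> 1"
    "\<And>g x. (\<forall>x. g x \<ge> 0) \<and> (\<exists>x. g x \<noteq> 0) \<Longrightarrow> Papply P k0 g x > 0"
    using H1 unfolding H1_def by blast
  have pos: "Ppow P k0 x w > 0" for x w
  proof -
    have "Papply P k0 (\<lambda>v. if v = w then 1 else 0) x > 0"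
      by (rule k0) auto
    then show ?thesis
      by (simp add: Papply_def if_distrib[of "\<lambda>c. c * _"] cong: if_cong)
  qed
  define \<delta> where "\<delta> = Min (range (\<lambda>(x, w). Ppow P k0 x w))"
  have "\<delta> \<in> range (\<lambda>(x, w). Ppow P k0 x w)"
    unfolding \<delta>_def by (rule Min_in) auto
  then have "0 < \<delta>" using pos by auto
  moreover have le: "\<delta> \<le> Ppow P k0 x w" for x w
    unfolding \<delta>_def by (rule Min_le) auto
  moreover have "\<delta> \<le> 1"
  proof -
    have "Ppow P k0 undefined undefined \<le> (\<Sum>w\<in>UNIV. Ppow P k0 undefined w)"
      by (rule member_le_sum) (auto intro: Ppow_nonneg)
    then show ?thesis using le[of undefined undefined] Ppow_sum[of k0 undefined] by linarith
  qed
  ultimately show ?thesis using k0(1) by (intro exI[of _ k0] exI[of _ \<delta>]) auto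
qed

lemma avg_bounds:
  fixes p h :: "'a::finite \<Rightarrow> real"
  assumes "\<And>v. 0 \<le> p v" "(\<Sum>v\<in>UNIV. p v) = 1" "\<And>v. \<alpha> \<le> h v" "\<And>v. h v \<le> \<beta>"
  shows "\<alpha> \<le> (\<Sum>v\<in>UNIV. p v * h v)" "(\<Sum>v\<in>UNIV. p v * h v) \<le> \<beta>"
proof -
  have "(\<Sum>v\<in>UNIV. p v * \<alpha>) \<le> (\<Sum>v\<in>UNIV. p v * h v)" "(\<Sum>v\<in>UNIV. p v * h v) \<le> (\<Sum>v\<in>UNIV. p v * \<beta>)"
    using assms by (auto intro!: sum_mono mult_left_mono)
  then show "\<alpha> \<le> (\<Sum>v\<in>UNIV. p v * h v)" "(\<Sum>v\<in>UNIV. p v * h v) \<le> \<beta>"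
    by (simp_all add: sum_distrib_right[symmetric] assms(2))
qed

text \<open>Look at the value of \<open>h\<close> at one fixed state \<open>u\<close>. If it lies in
  the lower half of the range, the mass \<open>\<delta>\<close> sitting at \<open>u\<close> lowers
  every upper bound by \<open>\<delta> * D / 2\<close>; otherwise it raises every lower bound by as
  much.\<close>

lemma contraction:
  assumes \<delta>: "\<And>x w. \<delta> \<le> Ppow P k x w" "0 < \<delta>"
    and h: "\<And>v. \<alpha> \<le> h v" "\<And>v. h v \<le> \<alpha> + D"
  shows "\<exists>\<alpha>'. \<forall>x. \<alpha>' \<le> (\<Sum>v\<in>UNIV. Ppow P k x v * h v) \<and> (\<Sum>v\<in>UNIV. Ppow P k x v * h v) \<le> \<alpha>' + (1 - \<delta> / 2) * D"
proof -
  have split: "(\<Sum>v\<in>UNIV. Ppow P k x v * g v) = Ppow P k x u * g u + (\<Sum>v\<in>-{u}. Ppow P k x v * g v)" for x u and g :: "'x \<Rightarrow> real"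
    using sum.remove[of UNIV u "\<lambda>v. Ppow P k x v * g v"] by (simp add: Compl_eq_Diff_UNIV)
  define u :: 'x where "u = undefined"
  have D: "0 \<le> D" using h[of u] by linarith
  show ?thesis
  proof (cases "h u \<le> \<alpha> + D / 2")
    case True
    have "(\<Sum>v\<in>UNIV. Ppow P k x v * h v) \<le> \<alpha> + (1 - \<delta> / 2) * D" for x
    proof -
      have "(\<Sum>v\<in>UNIV. Ppow P k x v * (\<alpha> + D - h v)) \<ge> Ppow P k x u * (\<alpha> + D - h u)"
        unfolding split[of x "\<lambda>v. \<alpha> + D - h v" u] using h by (auto intro!: sum_nonneg mult_nonneg_nonneg Ppow_nonneg)
      also have "Ppow P k x u * (\<alpha> + D - h u) \<ge> \<delta> * (D / 2)"
        using True \<delta> D by (intro mult_mono) (auto intro: Ppow_nonneg)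
      finally show ?thesis
        by (simp add: algebra_simps sum_subtractf sum.distrib sum_distrib_left[symmetric] Ppow_sum)
    qed
    then show ?thesis
      using avg_bounds(1)[OF Ppow_nonneg Ppow_sum h] by (intro exI[of _ \<alpha>]) auto
  next
    case False
    have "(\<Sum>v\<in>UNIV. Ppow P k x v * h v) \<ge> \<alpha> + \<delta> / 2 * D" for x
    proof -
      have "(\<Sum>v\<in>UNIV. Ppow P k x v * (h v - \<alpha>)) \<ge> Ppow P k x u * (h u - \<alpha>)"
        unfolding split[of x "\<lambda>v. h v - \<alpha>" u] using h by (auto intro!: sum_nonneg mult_nonneg_nonneg Ppow_nonneg)
      also have "Ppow P k x u * (h u - \<alpha>) \<ge> \<delta> * (D / 2)"
        using False \<delta> D by (intro mult_mono) (auto intro: Ppow_nonneg)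
      finally show ?thesis
        by (simp add: algebra_simps sum_subtractf sum.distrib sum_distrib_left[symmetric] Ppow_sum)
    qed
    moreover have "(\<Sum>v\<in>UNIV. Ppow P k x v * h v) \<le> \<alpha> + D" for x
      by (rule avg_bounds(2)[OF Ppow_nonneg Ppow_sum h])
    ultimately show ?thesis
      by (intro exI[of _ "\<alpha> + \<delta> / 2 * D"]) (auto simp: algebra_simps)
  qed
qed

text \<open>Blocks of \<open>k\<close> steps shrink the oscillation of each column by
  \<open>\<theta>\<close>. As \<open>\<rho> ^ k = \<theta>\<close>, the factor
  \<open>1 / \<theta>\<close> pays for the incomplete block \<open>n mod k\<close>.\<close>

lemma oscillation: "\<exists>C \<rho>. 0 < C \<and> 0 < \<rho> \<and> \<rho> < 1 \<and> (\<forall>n x x' w. \<bar>Ppow P n x w - Ppow P n x' w\<bar> \<le> C * \<rho> ^ n)"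
proof -
  obtain k \<delta> where k: "0 < k" "0 < \<delta>" "\<delta> \<le> 1" "\<And>x w. \<delta> \<le> Ppow P k x w"
    using doeblin by blast
  define \<theta> where "\<theta> = 1 - \<delta> / 2"
  have \<theta>: "0 < \<theta>" "\<theta> < 1" using k by (auto simp: \<theta>_def)
  have 1: "\<exists>\<alpha>. \<forall>x. \<alpha> \<le> Ppow P (k * j) x w \<and> Ppow P (k * j) x w \<le> \<alpha> + \<theta> ^ j" for j w
  proof (induction j)
    case 0
    then show ?case by (intro exI[of _ 0]) auto
  next
    case (Suc j)
    then obtain \<alpha> where a: "\<And>x. \<alpha> \<le> Ppow P (k * j) x w" "\<And>x. Ppow P (k * j) x w \<le> \<alpha> + \<theta> ^ j" by blast
    from contraction[OF k(4) k(2) a] show ?case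
      by (simp add: Ppow_add \<theta>_def)
  qed
  define \<rho> where "\<rho> = root k \<theta>"
  have \<rho>: "0 < \<rho>" "\<rho> < 1" "\<rho> ^ k = \<theta>"
    using \<theta> k by (auto simp: \<rho>_def)
  have "\<bar>Ppow P n x w - Ppow P n x' w\<bar> \<le> (1 / \<theta>) * \<rho> ^ n" for n x x' w
  proof -
    define j where "j = n div k"
    have n: "n = n mod k + k * j" by (simp add: j_def)
    obtain \<alpha> where a: "\<And>x. \<alpha> \<le> Ppow P (k * j) x w" "\<And>x. Ppow P (k * j) x w \<le> \<alpha> + \<theta> ^ j" using 1 by blast
    have "\<alpha> \<le> Ppow P n x w \<and> Ppow P n x w \<le> \<alpha> + \<theta> ^ j" for x
      using avg_bounds[OF Ppow_nonneg Ppow_sum a, of "n mod k" x] Ppow_add[of "n mod k" "k * j" x w]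
      by (simp add: n[symmetric])
    from this[of x] this[of x'] have 2: "\<bar>Ppow P n x w - Ppow P n x' w\<bar> \<le> \<theta> ^ j" by linarith
    have le: "\<theta> ^ j * \<theta> \<le> \<theta> ^ j * \<rho> ^ (n mod k)"
    proof (rule mult_left_mono)
      have "n mod k \<le> k" using k by (simp add: less_imp_le)
      then have "\<rho> ^ k \<le> \<rho> ^ (n mod k)"
        by (rule power_decreasing) (use \<rho> in auto)
      then show "\<theta> \<le> \<rho> ^ (n mod k)" using \<rho>(3) by linarith
    qed (use \<theta> in simp)
    have "\<theta> ^ j \<le> (1 / \<theta>) * \<rho> ^ n"
    proof -
      have "\<rho> ^ n = \<rho> ^ (n mod k) * \<theta> ^ j"
        unfolding \<rho>(3)[symmetric] power_mult[symmetric] power_add[symmetric] using n by simp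
      then show ?thesis using le \<theta> by (simp add: field_simps)
    qed
    then show ?thesis using 2 by linarith
  qed
  then show ?thesis using \<theta> \<rho> by (intro exI[of _ "1 / \<theta>"] exI[of _ \<rho>]) auto
qed

lemma Ppow_converges:
  "\<exists>\<mu> C \<rho>. 0 < C \<and> 0 < \<rho> \<and> \<rho> < 1 \<and> (\<forall>n x w. \<bar>Ppow P n x w - \<mu> w\<bar> \<le> C * \<rho> ^ n)"
proof -
  obtain C \<rho> where C: "0 < C" "0 < \<rho>" "\<rho> < 1" "\<And>n x x' w. \<bar>Ppow P n x w - Ppow P n x' w\<bar> \<le> C * \<rho> ^ n"
    using oscillation by blast
  have lim0: "(\<lambda>n. C * \<rho> ^ n) \<longlonglongrightarrow> 0"
    using C by (auto intro!: tendsto_eq_intros LIMSEQ_power_zero)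
  \<comment> \<open>Rows of a later power are averages of rows of an earlier one, so they stay
    within its oscillation. This yields both the Cauchy property and a limit independent of the
    start.\<close>
  have close: "\<bar>Ppow P n x w - Ppow P (m + n) x' w\<bar> \<le> C * \<rho> ^ n" for n m x x' w
  proof -
    have "Ppow P n x w - C * \<rho> ^ n \<le> Ppow P n v w" "Ppow P n v w \<le> Ppow P n x w + C * \<rho> ^ n" for v
      using C(4)[of n x w v] by (simp_all add: abs_le_iff)
    from avg_bounds[OF Ppow_nonneg Ppow_sum this, of m x' "\<lambda>v. v"] show ?thesis
      unfolding Ppow_add by (simp add: abs_le_iff)
  qed
  \<comment> \<open>\<open>undefined\<close> is used as an arbitrary base state.\<close>
  have "\<exists>l. (\<lambda>n. Ppow P n undefined w) \<longlonglongrightarrow> l" for w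
  proof -
    have "Cauchy (\<lambda>n. Ppow P n undefined w)"
    proof (rule CauchyI')
      fix e :: real assume "0 < e"
      from order_tendstoD(2)[OF lim0 this] obtain M where M: "\<And>n. n \<ge> M \<Longrightarrow> C * \<rho> ^ n < e"
        by (auto simp: eventually_sequentially)
      show "\<exists>M. \<forall>m\<ge>M. \<forall>n>m. dist (Ppow P m undefined w) (Ppow P n undefined w) < e"
      proof (intro exI allI impI)
        fix m n :: nat assume mn: "M \<le> m" "m < n"
        show "dist (Ppow P m undefined w) (Ppow P n undefined w) < e"
          using close[of m undefined w "n - m" undefined] M[of m] mn by (simp add: dist_real_def)
      qed
    qed
    then show ?thesis by (simp add: Cauchy_convergent_iff convergent_def)
  qed
  then obtain \<mu> where \<mu>: "\<And>w. (\<lambda>n. Ppow P n undefined w) \<longlonglongrightarrow> \<mu> w" by metis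
  have "\<bar>Ppow P n x w - \<mu> w\<bar> \<le> C * \<rho> ^ n" for n x w
  proof (rule tendsto_upperbound)
    show "(\<lambda>m. \<bar>Ppow P n x w - Ppow P (m + n) undefined w\<bar>) \<longlonglongrightarrow> \<bar>Ppow P n x w - \<mu> w\<bar>"
      by (intro tendsto_intros LIMSEQ_ignore_initial_segment \<mu>)
  qed (use close in auto)
  then show ?thesis using C by blast
qed

definition nu :: "'x \<Rightarrow> real" where "nu = inv_nu P"

lemma nu_props:
  "invariant_prob P nu" "0 < nu x"
  "\<exists>C \<rho>. 0 < C \<and> 0 < \<rho> \<and> \<rho> < 1 \<and> (\<forall>n x w. \<bar>Ppow P n x w - nu w\<bar> \<le> C * \<rho> ^ n)"
  and nu_unique: "invariant_prob P \<mu>' \<Longrightarrow> \<mu>' = nu"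
proof -
  obtain \<mu> C \<rho> where C: "0 < C" "0 < \<rho>" "\<rho> < 1" "\<And>n x w. \<bar>Ppow P n x w - \<mu> w\<bar> \<le> C * \<rho> ^ n"
    using Ppow_converges by blast
  have "(\<lambda>n. C * \<rho> ^ n) \<longlonglongrightarrow> 0"
    using C by (auto intro!: tendsto_eq_intros LIMSEQ_power_zero)
  then have "(\<lambda>n. Ppow P n x w - \<mu> w) \<longlonglongrightarrow> 0" for x w
    by (rule Lim_null_comparison[rotated]) (use C(4) in simp)
  then have lim: "(\<lambda>n. Ppow P n x w) \<longlonglongrightarrow> \<mu> w" for x w
    by (rule LIM_zero_cancel)
  have nn: "0 \<le> \<mu> w" for w
    by (rule LIMSEQ_le_const[OF lim[of undefined]]) (auto intro: Ppow_nonneg)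
  have "(\<lambda>n. \<Sum>w\<in>UNIV. Ppow P n undefined w) \<longlonglongrightarrow> (\<Sum>w\<in>UNIV. \<mu> w)"
    by (intro tendsto_sum lim)
  then have sum1: "(\<Sum>w\<in>UNIV. \<mu> w) = 1"
    by (simp add: Ppow_sum LIMSEQ_const_iff)
  have inv: "(\<Sum>x\<in>UNIV. \<mu> x * P x w) = \<mu> w" for w
  proof (rule LIMSEQ_unique)
    show "(\<lambda>n. Ppow P (Suc n) undefined w) \<longlonglongrightarrow> (\<Sum>x\<in>UNIV. \<mu> x * P x w)"
      by (simp, intro tendsto_intros lim)
    show "(\<lambda>n. Ppow P (Suc n) undefined w) \<longlonglongrightarrow> \<mu> w"
      by (rule LIMSEQ_Suc[OF lim])
  qed
  have prob: "invariant_prob P \<mu>" using nn sum1 inv by (simp add: invariant_prob_def)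
  have pow_inv: "(\<Sum>x\<in>UNIV. \<mu>' x * Ppow P n x w) = \<mu>' w" if "invariant_prob P \<mu>'" for \<mu>' n w
  proof (induction n arbitrary: w)
    case 0
    then show ?case by (simp add: if_distrib[of "\<lambda>c. _ * c"] cong: if_cong)
  next
    case (Suc n)
    have "(\<Sum>x\<in>UNIV. \<mu>' x * Ppow P (Suc n) x w) = (\<Sum>v\<in>UNIV. \<Sum>x\<in>UNIV. \<mu>' x * Ppow P n x v * P v w)"
      by (simp add: sum_distrib_left mult.assoc) (rule sum.swap)
    also have "\<dots> = (\<Sum>v\<in>UNIV. \<mu>' v * P v w)"
      by (simp add: sum_distrib_right[symmetric] Suc)
    finally show ?case using that by (simp add: invariant_prob_def)
  qed
  have uniq: "\<mu>' = \<mu>" if "invariant_prob P \<mu>'" for \<mu>'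
  proof
    fix w
    have "(\<lambda>n. \<Sum>x\<in>UNIV. \<mu>' x * Ppow P n x w) \<longlonglongrightarrow> (\<Sum>x\<in>UNIV. \<mu>' x * \<mu> w)"
      by (intro tendsto_intros lim)
    then show "\<mu>' w = \<mu> w"
      using that by (simp add: pow_inv LIMSEQ_const_iff sum_distrib_right[symmetric] invariant_prob_def)
  qed
  have nu: "nu = \<mu>"
    unfolding nu_def inv_nu_def using prob uniq by (rule the_equality)
  obtain k \<delta> where k: "0 < k" "0 < \<delta>" "\<delta> \<le> 1" "\<And>x w. \<delta> \<le> Ppow P k x w"
    using doeblin by blast
  have "\<delta> \<le> \<mu> x"
  proof -
    have "(\<Sum>v\<in>UNIV. \<mu> v * \<delta>) \<le> (\<Sum>v\<in>UNIV. \<mu> v * Ppow P k v x)"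
      by (intro sum_mono mult_left_mono k nn)
    then show ?thesis using pow_inv[OF prob] by (simp add: sum_distrib_right[symmetric] sum1)
  qed
  then show "0 < nu x" using k nu by simp
  show "invariant_prob P nu" using prob nu by simp
  show "\<exists>C \<rho>. 0 < C \<and> 0 < \<rho> \<and> \<rho> < 1 \<and> (\<forall>n x w. \<bar>Ppow P n x w - nu w\<bar> \<le> C * \<rho> ^ n)"
    using C nu by blast
  show "\<mu>' = nu" if "invariant_prob P \<mu>'" using uniq[OF that] nu by simp
qed

lemma nu_nonneg: "0 \<le> nu x" using nu_props(2)[of x] by simp

lemma nu_sum: "(\<Sum>x\<in>UNIV. nu x) = 1"
  and nu_inv: "(\<Sum>x\<in>UNIV. nu x * P x w) = nu w"
  using nu_props(1) by (auto simp: invariant_prob_def)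

lemma nu_int_eq: "nu_int P g = (\<Sum>x\<in>UNIV. g x * nu x)"
  by (simp add: nu_int_def nu_def)

lemma Papply_converges:
  "\<exists>C \<rho>. 0 < C \<and> 0 < \<rho> \<and> \<rho> < 1 \<and> (\<forall>n x. \<bar>Papply P n g x - nu_int P g\<bar> \<le> C * \<rho> ^ n)"
proof -
  obtain C \<rho> where C: "0 < C" "0 < \<rho>" "\<rho> < 1" "\<And>n x w. \<bar>Ppow P n x w - nu w\<bar> \<le> C * \<rho> ^ n"
    using nu_props(3) by blast
  define S where "S = 1 + (\<Sum>w\<in>UNIV. \<bar>g w\<bar>)"
  have S: "0 < S" by (simp add: S_def add_pos_nonneg sum_nonneg)
  have "\<bar>Papply P n g x - nu_int P g\<bar> \<le> (C * S) * \<rho> ^ n" for n x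
  proof -
    have "\<bar>Papply P n g x - nu_int P g\<bar> = \<bar>\<Sum>w\<in>UNIV. g w * (Ppow P n x w - nu w)\<bar>"
      by (simp add: Papply_def nu_int_eq sum_subtractf right_diff_distrib)
    also have "\<dots> \<le> (\<Sum>w\<in>UNIV. \<bar>g w\<bar> * (C * \<rho> ^ n))"
      by (rule order_trans[OF sum_abs]) (auto simp: abs_mult intro!: sum_mono mult_left_mono C)
    also have "\<dots> = (S - 1) * (C * \<rho> ^ n)"
      by (simp only: S_def sum_distrib_right[symmetric]) simp
    also have "\<dots> \<le> S * (C * \<rho> ^ n)"
      using C by (intro mult_right_mono) auto
    finally show ?thesis by (simp add: mult_ac)
  qed
  moreover have "0 < C * S" using C S by simp
  ultimately show ?thesis using C by blast
qed

lemma Papply_summable: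
  assumes "nu_int P g = 0"
  shows "summable (\<lambda>n. Papply P n g x)"
proof -
  obtain C \<rho> where C: "0 < C" "0 < \<rho>" "\<rho> < 1" "\<And>n x. \<bar>Papply P n g x - nu_int P g\<bar> \<le> C * \<rho> ^ n"
    using Papply_converges by blast
  show ?thesis
    by (rule summable_comparison_test'[of "\<lambda>n. C * \<rho> ^ n" 0]) (use C assms in \<open>auto intro!: summable_mult summable_geometric\<close>)
qed

text \<open>The series starts with the first power of \<open>P\<close>, not with \<open>g\<close>
  itself, because the state at time 0 does not contribute to the walk: the mean of
  \<open>g + poisson g\<close> after one move is then \<open>poisson g\<close> at the start.\<close>

definition poisson :: "('x \<Rightarrow> real) \<Rightarrow> 'x \<Rightarrow> real" where
  "poisson g x = (\<Sum>n. Papply P (Suc n) g x)"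

lemma poisson_eq:
  assumes "nu_int P g = 0"
  shows "(\<Sum>x'\<in>UNIV. P x x' * (g x' + poisson g x')) = poisson g x"
proof -
  have s: "summable (\<lambda>n. Papply P n g v)" for v
    by (rule Papply_summable[OF assms])
  have "poisson g x = (\<Sum>n. \<Sum>v\<in>UNIV. P x v * Papply P n g v)"
    by (simp add: poisson_def Papply_Suc)
  also have "\<dots> = (\<Sum>v\<in>UNIV. \<Sum>n. P x v * Papply P n g v)"
    by (rule suminf_sum) (intro summable_mult s)
  also have "\<dots> = (\<Sum>v\<in>UNIV. P x v * (\<Sum>n. Papply P n g v))"
    by (simp add: suminf_mult[OF s])
  also have "\<dots> = (\<Sum>v\<in>UNIV. P x v * (g v + poisson g v))"
    by (simp add: suminf_split_head[OF s] poisson_def Papply_0)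
  finally show ?thesis ..
qed

lemma nu_int_step: "nu_int P (\<lambda>x. \<Sum>v\<in>UNIV. P x v * g v) = nu_int P g"
proof -
  have "nu_int P (\<lambda>x. \<Sum>v\<in>UNIV. P x v * g v) = (\<Sum>x\<in>UNIV. \<Sum>v\<in>UNIV. g v * (nu x * P x v))"
    unfolding nu_int_eq sum_distrib_right by (simp add: mult_ac)
  also have "\<dots> = nu_int P g"
    by (subst sum.swap) (simp add: sum_distrib_left[symmetric] nu_inv nu_int_eq)
  finally show ?thesis .
qed

end

locale centered_walk = ergodic_chain P f for P :: "'x::finite \<Rightarrow> 'x \<Rightarrow> real" and f :: "'x \<Rightarrow> real" +
  assumes H2: "H2 P f"
begin

definition r :: "'x \<Rightarrow> real" where "r = poisson f"

lemma r_eq: "(\<Sum>x'\<in>UNIV. P x x' * (f x' + r x')) = r x"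
  using poisson_eq[of f x] H2 by (simp add: r_def H2_def)

lemma sigma2_eq: "sigma2 P f = nu_int P (\<lambda>x. f x ^ 2 + 2 * f x * r x)"
proof -
  have s: "summable (\<lambda>n. Papply P (Suc n) f x)" for x
    using Papply_summable[of f x] H2 by (subst summable_Suc_iff) (simp add: H2_def)
  have "(\<Sum>n. nu_int P (\<lambda>x. f x * Papply P (Suc n) f x))
      = (\<Sum>n. \<Sum>x\<in>UNIV. (f x * nu x) * Papply P (Suc n) f x)"
    by (simp add: nu_int_eq mult_ac)
  also have "\<dots> = (\<Sum>x\<in>UNIV. \<Sum>n. (f x * nu x) * Papply P (Suc n) f x)"
    by (rule suminf_sum) (intro summable_mult s)
  also have "\<dots> = (\<Sum>x\<in>UNIV. (f x * nu x) * r x)"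
    by (simp add: suminf_mult[OF s] r_def poisson_def)
  finally show ?thesis
    by (simp add: sigma2_def nu_int_eq sum_distrib_left sum.distrib[symmetric] algebra_simps)
qed

text \<open>The right side is the stationary second moment of the increments of the martingale
  \<open>y + r x\<close>, which exhibits \<open>sigma2 P f\<close> as a sum of nonnegative
  terms.\<close>

lemma sigma2_square:
  "sigma2 P f = (\<Sum>x\<in>UNIV. nu x * (\<Sum>x'\<in>UNIV. P x x' * (f x' + r x' - r x)\<^sup>2))"
proof -
  have "(\<Sum>x'\<in>UNIV. P x x' * (f x' + r x' - r x)\<^sup>2) = (\<Sum>x'\<in>UNIV. P x x' * (f x' + r x')\<^sup>2) - (r x)\<^sup>2" for x
  proof -
    have "(\<Sum>x'\<in>UNIV. P x x' * (f x' + r x' - r x)\<^sup>2)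
      = (\<Sum>x'\<in>UNIV. P x x' * (f x' + r x')\<^sup>2 - 2 * r x * (P x x' * (f x' + r x')) + (r x)\<^sup>2 * P x x')"
      by (rule sum.cong) (auto simp: power2_eq_square algebra_simps)
    also have "\<dots> = (\<Sum>x'\<in>UNIV. P x x' * (f x' + r x')\<^sup>2) - 2 * r x * r x + (r x)\<^sup>2"
      by (simp add: sum.distrib sum_subtractf sum_distrib_left[symmetric] r_eq P_sum)
    finally show ?thesis by (simp add: power2_eq_square)
  qed
  then have "(\<Sum>x\<in>UNIV. nu x * (\<Sum>x'\<in>UNIV. P x x' * (f x' + r x' - r x)\<^sup>2))
     = nu_int P (\<lambda>x. \<Sum>x'\<in>UNIV. P x x' * (f x' + r x')\<^sup>2) - nu_int P (\<lambda>x. (r x)\<^sup>2)"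
    by (simp add: nu_int_eq right_diff_distrib sum_subtractf mult.commute)
  also have "\<dots> = sigma2 P f"
    by (simp add: nu_int_step sigma2_eq) (simp add: nu_int_eq sum_subtractf[symmetric] power2_eq_square algebra_simps)
  finally show ?thesis ..
qed

text \<open>Zero variance forces \<open>f x' = r x - r x'\<close> along every edge of positive
  probability. The sum of \<open>f\<close> over any cycle then vanishes, against (H3) with both
  parameters 0.\<close>

lemma sigma2_pos:
  assumes "H3 P f"
  shows "0 < sigma2 P f"
proof (rule ccontr)
  assume "\<not> 0 < sigma2 P f"
  then have le: "(\<Sum>x\<in>UNIV. nu x * (\<Sum>x'\<in>UNIV. P x x' * (f x' + r x' - r x)\<^sup>2)) \<le> 0"
    by (simp add: sigma2_square)
  have edge: "f x' + r x' = r x" if "P x x' > 0" for x x'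
  proof -
    have nn: "0 \<le> (\<Sum>x'\<in>UNIV. P x x' * (f x' + r x' - r x)\<^sup>2)" for x
      by (intro sum_nonneg mult_nonneg_nonneg P_nonneg) auto
    have "nu x * (\<Sum>x'\<in>UNIV. P x x' * (f x' + r x' - r x)\<^sup>2) \<le> 0"
      by (rule order_trans[OF member_le_sum[of x UNIV "\<lambda>x. nu x * (\<Sum>x'\<in>UNIV. P x x' * (f x' + r x' - r x)\<^sup>2)"] le])
        (auto intro!: mult_nonneg_nonneg nn nu_nonneg)
    then have "(\<Sum>x'\<in>UNIV. P x x' * (f x' + r x' - r x)\<^sup>2) \<le> 0"
      using nu_props(2)[of x] by (simp add: mult_le_0_iff)
    then have "P x x' * (f x' + r x' - r x)\<^sup>2 \<le> 0"
      by (rule order_trans[OF member_le_sum[of x' UNIV "\<lambda>x'. P x x' * (f x' + r x' - r x)\<^sup>2"], rotated 3])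
        (auto intro!: mult_nonneg_nonneg P_nonneg)
    then show ?thesis using that by (simp add: mult_le_0_iff)
  qed
  from assms[unfolded H3_def, rule_format, of 0 0]
  obtain n :: nat and xs :: "'x list" where xs: "length xs = n + 1"
    "(\<Prod>i<n. P (xs ! i) (xs ! (i+1))) * P (xs ! n) (xs ! 0) > 0"
    "(\<Sum>i\<le>n. f (xs ! i)) - real (n+1) * 0 \<notin> {0 * of_int k | k. True}"
    by (elim exE conjE)
  have pos: "P (xs ! i) (xs ! (i+1)) > 0" if "i < n" for i
  proof (rule ccontr)
    assume "\<not> ?thesis"
    then have "P (xs ! i) (xs ! (i+1)) = 0" using P_nonneg[of "xs ! i" "xs ! (i+1)"] by linarith
    then have "(\<Prod>i<n. P (xs ! i) (xs ! (i+1))) = 0" using that by (auto intro!: prod_zero)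
    then show False using xs(2) by (simp only: mult_zero_left less_irrefl)
  qed
  have last: "P (xs ! n) (xs ! 0) > 0"
    using xs(2) P_nonneg[of "xs ! n" "xs ! 0"] by (cases "P (xs ! n) (xs ! 0) = 0") auto
  have part: "(\<Sum>i<Suc j. f (xs ! i)) = f (xs ! 0) + r (xs ! 0) - r (xs ! j)" if "j \<le> n" for j
    using that
  proof (induction j)
    case (Suc j)
    then show ?case using edge[OF pos[of j]] by simp
  qed simp
  have "(\<Sum>i\<le>n. f (xs ! i)) = 0"
    using part[of n] edge[OF last] by (simp add: lessThan_Suc_atMost)
  then show False using xs(3) by auto
qed

end

section \<open>Survival probabilities and the harmonic function\<close>

locale diffusive_walk = centered_walk P f for P :: "'x::finite \<Rightarrow> 'x \<Rightarrow> real" and f :: "'x \<Rightarrow> real" +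
  assumes s2_pos: "0 < sigma2 P f"
begin

abbreviation s2 :: real where "s2 \<equiv> sigma2 P f"

text \<open>Second corrector: the function inside is centred because of \<open>sigma2_eq\<close>. It
  gives the quadratic function \<open>N\<close> the constant drift \<open>s2 / 2\<close>, and it is
  also the second order coefficient of the approximate eigenfunction \<open>Gs\<close>.\<close>

definition q :: "'x \<Rightarrow> real" where "q = poisson (\<lambda>x. f x ^ 2 / 2 + f x * r x - s2 / 2)"

lemma q_eq: "(\<Sum>x'\<in>UNIV. P x x' * (f x' ^ 2 / 2 + f x' * r x' + q x')) = q x + s2 / 2"
proof -
  have "nu_int P (\<lambda>x. f x ^ 2 / 2 + f x * r x - s2 / 2) = nu_int P (\<lambda>x. f x ^ 2 + 2 * f x * r x) / 2 - s2 / 2 * (\<Sum>x\<in>UNIV. nu x)"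
    unfolding nu_int_eq sum_distrib_left sum_divide_distrib sum_subtractf[symmetric]
    by (rule sum.cong) (auto simp: field_simps)
  then have "nu_int P (\<lambda>x. f x ^ 2 / 2 + f x * r x - s2 / 2) = 0"
    by (simp add: nu_sum sigma2_eq[symmetric])
  from poisson_eq[OF this, of x]
  have "q x = (\<Sum>x'\<in>UNIV. P x x' * (f x' ^ 2 / 2 + f x' * r x' - s2 / 2 + q x'))"
    by (simp add: q_def)
  also have "\<dots> = (\<Sum>x'\<in>UNIV. P x x' * (f x' ^ 2 / 2 + f x' * r x' + q x')) - s2 / 2 * (\<Sum>x'\<in>UNIV. P x x')"
    unfolding sum_distrib_left sum_subtractf[symmetric] by (rule sum.cong) (auto simp: algebra_simps)
  finally show ?thesis by (simp add: P_sum)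
qed

text \<open>A common bound for the jumps and both correctors. The summand 1 ensures
  \<open>1 \<le> B\<close>, so that lower powers of \<open>B\<close> can be absorbed into higher
  ones.\<close>

definition B :: real where "B = 1 + (\<Sum>x\<in>UNIV. \<bar>f x\<bar> + \<bar>r x\<bar> + \<bar>q x\<bar>)"

lemma B_ge_1: "1 \<le> B"
  by (simp add: B_def sum_nonneg)

lemma B_bounds: "\<bar>f x\<bar> \<le> B" "\<bar>r x\<bar> \<le> B" "\<bar>q x\<bar> \<le> B"
proof -
  have "\<bar>f x\<bar> + \<bar>r x\<bar> + \<bar>q x\<bar> \<le> (\<Sum>x\<in>UNIV. \<bar>f x\<bar> + \<bar>r x\<bar> + \<bar>q x\<bar>)"
    by (rule member_le_sum) auto
  then show "\<bar>f x\<bar> \<le> B" "\<bar>r x\<bar> \<le> B" "\<bar>q x\<bar> \<le> B"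
    unfolding B_def by linarith+
qed

definition M :: "'x \<Rightarrow> real \<Rightarrow> real" where "M x y = y + r x"
definition N :: "'x \<Rightarrow> real \<Rightarrow> real" where "N x y = y\<^sup>2 / 2 + r x * y + q x"

lemma step_M: "T M x y = M x y"
proof -
  have "T M x y = y * (\<Sum>x'\<in>UNIV. P x x') + (\<Sum>x'\<in>UNIV. P x x' * (f x' + r x'))"
    unfolding step_def M_def sum_distrib_left sum.distrib[symmetric]
    by (rule sum.cong) (auto simp: algebra_simps)
  then show ?thesis by (simp add: P_sum r_eq M_def)
qed

lemma step_N: "T N x y = N x y + s2 / 2"
proof -
  have "T N x y = y\<^sup>2 / 2 * (\<Sum>x'\<in>UNIV. P x x') + y * (\<Sum>x'\<in>UNIV. P x x' * (f x' + r x'))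
      + (\<Sum>x'\<in>UNIV. P x x' * (f x' ^ 2 / 2 + f x' * r x' + q x'))"
    unfolding step_def N_def sum_distrib_left sum.distrib[symmetric]
    by (rule sum.cong) (auto simp: field_simps power2_eq_square)
  then show ?thesis by (simp add: P_sum r_eq q_eq N_def)
qed

lemma N_le: "N x y \<le> (\<bar>y\<bar> + B)\<^sup>2"
proof -
  have 1: "r x * y \<le> B * \<bar>y\<bar>"
  proof -
    have "\<bar>r x * y\<bar> \<le> B * \<bar>y\<bar>" unfolding abs_mult by (intro mult_right_mono B_bounds) auto
    then show ?thesis by linarith
  qed
  have 2: "q x \<le> B" using B_bounds(3)[of x] by linarith
  have 3: "B \<le> B\<^sup>2" using B_ge_1 by (simp add: power2_eq_square)
  have "(\<bar>y\<bar> + B)\<^sup>2 = y\<^sup>2 + 2 * (B * \<bar>y\<bar>) + B\<^sup>2"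
    by (simp add: power2_eq_square algebra_simps)
  moreover have "0 \<le> B * \<bar>y\<bar>" using B_ge_1 by simp
  moreover have "0 \<le> y\<^sup>2" by simp
  ultimately show ?thesis using 1 2 3 unfolding N_def by linarith
qed

lemma N_ge: "y\<^sup>2 / 4 - 2 * B\<^sup>2 \<le> N x y"
proof -
  have 1: "- (B * \<bar>y\<bar>) \<le> r x * y"
  proof -
    have "\<bar>r x * y\<bar> \<le> B * \<bar>y\<bar>" unfolding abs_mult by (intro mult_right_mono B_bounds) auto
    then show ?thesis by linarith
  qed
  have 2: "- B \<le> q x" using B_bounds(3)[of x] by linarith
  have 3: "B \<le> B\<^sup>2" using B_ge_1 by (simp add: power2_eq_square)
  have "0 \<le> (\<bar>y\<bar> / 2 - B)\<^sup>2" by simp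
  then have "B * \<bar>y\<bar> \<le> y\<^sup>2 / 4 + B\<^sup>2"
    by (simp add: power2_eq_square algebra_simps)
  then show ?thesis using 1 2 3 unfolding N_def by linarith
qed

lemma surv_sum_Suc: "(\<Sum>j<Suc k. surv j x y) = 1 + Q (\<lambda>x y. \<Sum>j<k. surv j x y) x y"
proof -
  have "Q (\<lambda>x y. \<Sum>j<k. surv j x y) x y = (\<Sum>j<k. surv (Suc j) x y)"
    using kpow_sum[of "{..<k}" 1 P f surv] by (simp add: surv_def)
  then show ?thesis
    by (simp add: sum.lessThan_Suc_shift surv_0 del: sum.lessThan_Suc)
qed

text \<open>The function \<open>G = A (M + 4 B) - (2 / \<sigma>\<^sup>2) N\<close> decreases by exactly 1 in mean at each step,
  so it dominates the expected time spent alive below height \<open>sqrt n\<close>.\<close>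

lemma surv_sum_bound: "\<exists>C>0. \<forall>n x y. (\<Sum>j<n. surv j x y) \<le> C * (1 + max y 0) * sqrt (real n)"
proof -
  \<comment> \<open>Up to height \<open>L + B\<close> one has
    \<open>N x y \<le> 21 * B * L * (y + 3 * B)\<close>, and this is multiplied by
    \<open>2 / s2\<close>. The additional 1 leaves exactly the margin stated in
    \<open>G_ge\<close>.\<close>
  define \<kappa> where "\<kappa> = 42 * B / s2 + 1"
  have \<kappa>: "1 \<le> \<kappa>" using B_ge_1 s2_pos by (simp add: \<kappa>_def)
  define C where "C = 6 * B * \<kappa> + 4 * B\<^sup>2 / s2"
  have C: "1 \<le> C"
  proof -
    have "1 * 1 \<le> B * \<kappa>" using B_ge_1 \<kappa> by (intro mult_mono) auto
    moreover have "0 \<le> 4 * B\<^sup>2 / s2" using s2_pos by simp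
    ultimately show ?thesis by (simp add: C_def)
  qed
  have main: "(\<Sum>j<n. surv j x y) \<le> C * (1 + y) * sqrt (real n)" if y0: "0 \<le> y" and n0: "0 < n" for n x y
  proof -
    define L where "L = sqrt (real n)"
    have L: "1 \<le> L" "L * L = real n" using n0 by (auto simp: L_def)
    define G where "G x y = \<kappa> * L * (M x y + 4 * B) - 2 / s2 * N x y" for x y
    have G_ge: "L * (y + 3 * B) \<le> G x y" if y: "- 2 * B \<le> y" "y \<le> L + B" for x y
    proof -
      have "\<bar>y\<bar> + B \<le> y + 5 * B" using y B_ge_1 by (simp add: abs_le_iff)
      then have "(\<bar>y\<bar> + B)\<^sup>2 \<le> (y + 5 * B)\<^sup>2" using B_ge_1 by (intro power_mono) auto
      also have "\<dots> \<le> (3 * (y + 3 * B)) * (7 * B * L)"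
        unfolding power2_eq_square
      proof (rule mult_mono)
        have "B * 1 \<le> B * L" using L B_ge_1 by (intro mult_left_mono) auto
        moreover have "1 * L \<le> B * L" using L B_ge_1 by (intro mult_right_mono) auto
        ultimately show "y + 5 * B \<le> 7 * B * L" using y by linarith
      qed (use y B_ge_1 in auto)
      finally have "N x y \<le> 21 * B * L * (y + 3 * B)" using N_le[of x y] by (simp add: algebra_simps)
      then have "2 / s2 * N x y \<le> 2 / s2 * (21 * B * L * (y + 3 * B))"
        using s2_pos by (intro mult_left_mono) auto
      also have "\<dots> = (42 * B / s2) * L * (y + 3 * B)" by simp
      finally have 1: "2 / s2 * N x y \<le> (42 * B / s2) * L * (y + 3 * B)" .
      have "\<kappa> * L * (y + 3 * B) \<le> \<kappa> * L * (M x y + 4 * B)"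
        using \<kappa> L B_bounds(2)[of x] by (intro mult_left_mono) (auto simp: M_def abs_le_iff)
      then show ?thesis using 1 unfolding G_def \<kappa>_def by (simp add: algebra_simps)
    qed
    have step_G: "T G x y = G x y - 1" for x y
    proof -
      have "T G x y = \<kappa> * L * (T M x y + 4 * B) - 2 / s2 * T N x y"
      proof -
        have "G = (\<lambda>x y. ((\<kappa> * L) *\<^sub>R M x y + (\<kappa> * L * (4 * B))) - (2 / s2) *\<^sub>R N x y)"
          by (auto simp: G_def fun_eq_iff algebra_simps)
        then have "T G x y = (\<kappa> * L) *\<^sub>R T M x y + \<kappa> * L * (4 * B) - (2 / s2) *\<^sub>R T N x y"
          by (simp only: step_diff step_add step_scaleR step_const)
        then show ?thesis by (simp add: algebra_simps)
      qed
      then show ?thesis using s2_pos by (simp add: step_M step_N G_def field_simps)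
    qed
    \<comment> \<open>The induction stays below height \<open>L\<close>. Once a jump passes
      \<open>L\<close>, the trivial count of at most \<open>n = L * L\<close> remaining steps is
      already below \<open>G\<close>; this is why \<open>G_ge\<close> is proved up to
      \<open>L + B\<close>. An exit lands where \<open>G\<close> is still nonnegative.\<close>
    have ind: "(\<Sum>j<k. surv j x y) \<le> G x y" if "k \<le> n" "- B \<le> y" "y \<le> L" for k x y
      using that
    proof (induction k arbitrary: x y)
      case 0
      have "0 \<le> L * (y + 3 * B)" using 0 L B_ge_1 by (intro mult_nonneg_nonneg) auto
      then show ?case using G_ge[of y x] 0 B_ge_1 by simp
    next
      case (Suc k)
      have "Q (\<lambda>x y. \<Sum>j<k. surv j x y) x y \<le> T G x y"
        unfolding kstep_def
      proof (rule step_mono)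
        fix x'
        define v where "v = y + f x'"
        have v: "- 2 * B \<le> v" "v \<le> L + B"
          using Suc.prems B_bounds(1)[of x'] by (auto simp: v_def abs_le_iff)
        consider "v \<le> 0" | "0 < v" "v \<le> L" | "L < v" by linarith
        then show "(if 0 < y + f x' then \<Sum>j<k. surv j x' (y + f x') else 0) \<le> G x' (y + f x')"
          unfolding v_def[symmetric]
        proof cases
          case 1
          have "0 \<le> L * (v + 3 * B)" using v L B_ge_1 by (intro mult_nonneg_nonneg) auto
          then show "(if 0 < v then \<Sum>j<k. surv j x' v else 0) \<le> G x' v" using 1 G_ge[of v x'] v by simp
        next
          case 2
          then show "(if 0 < v then \<Sum>j<k. surv j x' v else 0) \<le> G x' v" using Suc.IH[of v x'] Suc.prems B_ge_1 by simp
        next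
          case 3
          have "(\<Sum>j<k. surv j x' v) \<le> (\<Sum>j<k. 1)" by (intro sum_mono surv_le_1)
          also have "\<dots> \<le> L * L" using L Suc.prems by simp
          also have "\<dots> \<le> L * (v + 3 * B)" using L 3 B_ge_1 by (intro mult_left_mono) auto
          also have "\<dots> \<le> G x' v" using G_ge v by simp
          finally show "(if 0 < v then \<Sum>j<k. surv j x' v else 0) \<le> G x' v" using 3 L by simp
        qed
      qed
      then show ?case unfolding surv_sum_Suc step_G by simp
    qed
    show ?thesis
    proof (cases "y \<le> L")
      case True
      have "(\<Sum>j<n. surv j x y) \<le> G x y" using ind[of n y x] True y0 B_ge_1 by simp
      also have "\<dots> \<le> \<kappa> * L * (6 * B * (1 + y)) + 2 / s2 * (2 * B\<^sup>2)"
      proof -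
        have "y * 1 \<le> y * (6 * B)" using y0 B_ge_1 by (intro mult_left_mono) auto
        then have "M x y + 4 * B \<le> 6 * B * (1 + y)"
          using B_bounds(2)[of x] B_ge_1 y0 by (simp add: M_def abs_le_iff algebra_simps)
        then have "\<kappa> * L * (M x y + 4 * B) \<le> \<kappa> * L * (6 * B * (1 + y))"
          using \<kappa> L by (intro mult_left_mono) auto
        moreover have "2 / s2 * (- N x y) \<le> 2 / s2 * (2 * B\<^sup>2)"
        proof (intro mult_left_mono)
          have "0 \<le> y\<^sup>2" by simp
          then show "- N x y \<le> 2 * B\<^sup>2" using N_ge[of y x] by linarith
        qed (use s2_pos in auto)
        ultimately show ?thesis unfolding G_def by (simp add: algebra_simps)
      qed
      also have "2 / s2 * (2 * B\<^sup>2) \<le> (4 * B\<^sup>2 / s2) * ((1 + y) * L)"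
      proof -
        have "1 * 1 \<le> (1 + y) * L" using y0 L by (intro mult_mono) auto
        then have "(4 * B\<^sup>2 / s2) * 1 \<le> (4 * B\<^sup>2 / s2) * ((1 + y) * L)"
          using s2_pos by (intro mult_left_mono) auto
        then show ?thesis by simp
      qed
      finally show ?thesis
        unfolding C_def L_def[symmetric] by (simp add: algebra_simps)
    next
      case False
      have "(\<Sum>j<n. surv j x y) \<le> (\<Sum>j<n. 1)" by (intro sum_mono surv_le_1)
      also have "\<dots> \<le> L * L" using L by simp
      also have "\<dots> \<le> (1 + y) * L" using False L by (intro mult_right_mono) auto
      also have "\<dots> \<le> C * ((1 + y) * L)" using C y0 L mult_right_mono[of 1 C "(1 + y) * L"] by simp
      finally show ?thesis unfolding L_def by (simp add: mult.assoc)
    qed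
  qed
  have "(\<Sum>j<n. surv j x y) \<le> C * (1 + max y 0) * sqrt (real n)" for n x y
  proof (cases "n = 0")
    case False
    have "(\<Sum>j<n. surv j x y) \<le> (\<Sum>j<n. surv j x (max y 0))"
      by (intro sum_mono surv_mono) auto
    also have "\<dots> \<le> C * (1 + max y 0) * sqrt (real n)"
      using main[of "max y 0" n x] False by simp
    finally show ?thesis .
  qed simp
  then show ?thesis using C by (intro exI[of _ C]) auto
qed

text \<open>Survival decreases in time, so \<open>n\<close> times its last value is at most the sum
  of the first \<open>n\<close> values.\<close>

lemma surv_bound: "\<exists>C>0. \<forall>n x y. 0 < n \<longrightarrow> surv n x y \<le> C * (1 + max y 0) / sqrt (real n)"
proof -
  obtain C where C: "0 < C" "\<And>n x y. (\<Sum>j<n. surv j x y) \<le> C * (1 + max y 0) * sqrt (real n)"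
    using surv_sum_bound by blast
  have "surv n x y \<le> C * (1 + max y 0) / sqrt (real n)" if "0 < n" for n x y
  proof -
    have "real n * surv n x y = (\<Sum>j<n. surv n x y)" by simp
    also have "\<dots> \<le> (\<Sum>j<n. surv j x y)"
      by (intro sum_mono surv_antimono) auto
    also have "\<dots> \<le> C * (1 + max y 0) * sqrt (real n)" by (rule C)
    finally have "(sqrt (real n) * sqrt (real n)) * surv n x y \<le> C * (1 + max y 0) * sqrt (real n)"
      by simp
    then have "sqrt (real n) * (sqrt (real n) * surv n x y) \<le> sqrt (real n) * (C * (1 + max y 0))"
      by (simp only: mult_ac)
    then have "sqrt (real n) * surv n x y \<le> C * (1 + max y 0)"
      using that by (simp add: mult_le_cancel_left_pos)
    then show ?thesis using that by (simp add: pos_le_divide_eq mult.commute)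
  qed
  then show ?thesis using C by blast
qed

lemma surv_tendsto_0: "(\<lambda>n. surv n x y) \<longlonglongrightarrow> 0"
proof -
  obtain C where C: "0 < C" "\<And>n x y. 0 < n \<Longrightarrow> surv n x y \<le> C * (1 + max y 0) / sqrt (real n)"
    using surv_bound by blast
  have "(\<lambda>n. C * (1 + max y 0) / sqrt (real n)) \<longlonglongrightarrow> 0"
    by (intro tendsto_divide_0[OF tendsto_const] filterlim_at_top_imp_at_infinity filterlim_compose[OF sqrt_at_top] filterlim_real_sequentially)
  moreover have "eventually (\<lambda>n. norm (surv n x y) \<le> C * (1 + max y 0) / sqrt (real n)) sequentially"
    using eventually_gt_at_top[of 0] by eventually_elim (use C surv_nonneg in auto)
  ultimately show ?thesis by (rule Lim_null_comparison[rotated])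
qed

section \<open>The harmonic function as the limit of killed means of the martingale
  \<open>M\<close>\<close>

definition V :: "'x \<Rightarrow> real \<Rightarrow> real" where
  "V x y = lim (\<lambda>k. (Q ^^ k) M x y)"

text \<open>\<open>M\<close> is a martingale of the free walk, so its killed mean changes only
  through the exits. These happen in the strip from \<open>- 2 * B\<close> to 0, where
  \<open>\<bar>M x y\<bar> \<le> 3 * B\<close>, and the exit probabilities telescope.\<close>

lemma kpow_M_diff:
  assumes y: "- B \<le> y"
  shows "\<bar>(Q ^^ k) M x y - (Q ^^ (k + l)) M x y\<bar> \<le> 3 * B * (surv k x y - surv (k + l) x y)"
proof (induction l)
  case (Suc l)
  have "\<bar>(Q ^^ (k + l)) M x y - (Q ^^ Suc (k + l)) M x y\<bar> = \<bar>(Q ^^ (k + l)) (\<lambda>x y. M x y - Q M x y) x y\<bar>"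
    by (simp add: kpow_diff funpow_swap1)
  also have "\<dots> \<le> (Q ^^ (k + l)) (\<lambda>x y. 3 * B * K (\<lambda>_ _. 1) x y) x y"
    unfolding real_norm_def[symmetric]
  proof (rule norm_kpow_le[of "- B"])
    fix x y assume y: "- B \<le> y"
    have "M x y - Q M x y = K M x y" using step_split[of P f M x y] by (simp add: step_M)
    also have "norm \<dots> \<le> T (\<lambda>x y. norm (if 0 < y then 0 else M x y)) x y"
      unfolding estep_def by (rule norm_step)
    also have "\<dots> \<le> T (\<lambda>x y. (3 * B) *\<^sub>R (if 0 < y then 0 else 1)) x y"
    proof (rule step_mono)
      fix x' show "norm (if 0 < y + f x' then 0 else M x' (y + f x')) \<le> (3 * B) *\<^sub>R (if 0 < y + f x' then 0 else 1)"
        using y B_bounds(1,2)[of x'] B_ge_1 by (auto simp: M_def abs_le_iff)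
    qed
    also have "\<dots> = 3 * B * K (\<lambda>_ _. 1) x y"
      by (simp only: step_scaleR estep_def) simp
    finally show "norm (M x y - Q M x y) \<le> 3 * B * K (\<lambda>_ _. 1) x y" .
  qed (use y B_ge_1 in auto)
  also have "\<dots> = 3 * B * (surv (k + l) x y - surv (Suc (k + l)) x y)"
    by (simp add: kpow_mult kpow_estep)
  finally show ?case using Suc.IH by (simp add: algebra_simps abs_le_iff)
qed simp

lemma V_converges:
  assumes y: "- B \<le> y"
  shows "(\<lambda>k. (Q ^^ k) M x y) \<longlonglongrightarrow> V x y"
proof -
  have "Cauchy (\<lambda>k. (Q ^^ k) M x y)"
  proof (rule CauchyI')
    fix e :: real assume e: "0 < e"
    have "(\<lambda>n. 3 * B * surv n x y) \<longlonglongrightarrow> 3 * B * 0" by (intro tendsto_intros surv_tendsto_0)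
    then have "eventually (\<lambda>n. 3 * B * surv n x y < e) sequentially"
      using e by (intro order_tendstoD(2)) auto
    then obtain n0 where n0: "\<And>n. n \<ge> n0 \<Longrightarrow> 3 * B * surv n x y < e"
      by (auto simp: eventually_sequentially)
    show "\<exists>M'. \<forall>m\<ge>M'. \<forall>n>m. dist ((Q ^^ m) M x y) ((Q ^^ n) M x y) < e"
    proof (intro exI allI impI)
      fix m n :: nat assume mn: "n0 \<le> m" "m < n"
      have "3 * B * (surv m x y - surv n x y) \<le> 3 * B * surv m x y"
        using B_ge_1 surv_nonneg[of n x y] by (intro mult_left_mono) auto
      then show "dist ((Q ^^ m) M x y) ((Q ^^ n) M x y) < e"
        using kpow_M_diff[OF y, of m x "n - m"] n0[of m] mn by (simp add: dist_real_def)
    qed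
  qed
  then show ?thesis
    unfolding V_def by (simp add: Cauchy_convergent_iff convergent_LIMSEQ_iff)
qed

text \<open>Let the second time in \<open>kpow_M_diff\<close> tend to infinity. The speed of
  convergence is the survival probability itself, of order 1 / sqrt k.\<close>

lemma V_approx:
  assumes y: "- B \<le> y"
  shows "\<bar>(Q ^^ k) M x y - V x y\<bar> \<le> 3 * B * surv k x y"
proof (rule tendsto_upperbound)
  show "(\<lambda>l. \<bar>(Q ^^ k) M x y - (Q ^^ (l + k)) M x y\<bar>) \<longlonglongrightarrow> \<bar>(Q ^^ k) M x y - V x y\<bar>"
    by (intro tendsto_intros LIMSEQ_ignore_initial_segment V_converges y)
  have "\<bar>(Q ^^ k) M x y - (Q ^^ (l + k)) M x y\<bar> \<le> 3 * B * surv k x y" for l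
  proof -
    have "3 * B * (surv k x y - surv (k + l) x y) \<le> 3 * B * surv k x y"
      using B_ge_1 surv_nonneg[of "k + l" x y] by (intro mult_left_mono) auto
    then show ?thesis using kpow_M_diff[OF y, of k x l] by (simp add: add.commute)
  qed
  then show "eventually (\<lambda>l. \<bar>(Q ^^ k) M x y - (Q ^^ (l + k)) M x y\<bar> \<le> 3 * B * surv k x y) sequentially"
    by simp
qed simp

lemma V_bound:
  assumes y: "- B \<le> y"
  shows "\<bar>V x y\<bar> \<le> 5 * B * (1 + max y 0)"
proof -
  have "\<bar>V x y\<bar> \<le> \<bar>M x y\<bar> + 3 * B"
    using V_approx[OF y, of 0 x] by (simp add: surv_0)
  moreover have "\<bar>M x y\<bar> \<le> max y 0 + 2 * B"
    using B_bounds(2)[of x] y B_ge_1 by (auto simp: M_def abs_le_iff max_def)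
  moreover have "1 * max y 0 \<le> 5 * B * max y 0"
    using B_ge_1 by (intro mult_right_mono) auto
  ultimately show ?thesis unfolding distrib_left by linarith
qed

end

section \<open>Fourier transform of the transition operator\<close>

definition chop :: "('x::finite \<Rightarrow> 'x \<Rightarrow> real) \<Rightarrow> ('x \<Rightarrow> real) \<Rightarrow> real \<Rightarrow> ('x \<Rightarrow> complex) \<Rightarrow> 'x \<Rightarrow> complex" where
  "chop P f s g x = (\<Sum>x'\<in>UNIV. P x x' *\<^sub>R (iexp (s * f x') * g x'))"

text \<open>A free move maps waves to waves and acts on their amplitude by \<open>chop\<close>: all
  Fourier arguments reduce the walk to powers of this finite-dimensional operator.\<close>

lemma step_iexp: "step P f (\<lambda>x y. iexp (s * y) * g x) x y = iexp (s * y) * chop P f s g x"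
  unfolding step_def chop_def sum_distrib_left
  by (rule sum.cong) (auto simp: exp_add[symmetric] distrib_left mult_ac scaleR_conv_of_real)

lemma iexp_approx_2: "cmod (iexp t - (1 + \<i> * t - t\<^sup>2 / 2)) \<le> \<bar>t\<bar> ^ 3 / 6"
  using iexp_approx1[of t 2] by (simp add: numeral_2_eq_2 numeral_3_eq_3 power_mult_distrib algebra_simps)

lemma iexp_approx_1: "cmod (iexp t - (1 + \<i> * t)) \<le> t\<^sup>2 / 2"
  using iexp_approx1[of t 1] by (simp add: numeral_2_eq_2 algebra_simps)

lemma iexp_approx_0: "cmod (iexp t - 1) \<le> \<bar>t\<bar>"
  using iexp_approx1[of t 0] by simp

lemma exp_minus_approx:
  assumes "0 \<le> (u::real)"
  shows "\<bar>exp (- u) - (1 - u)\<bar> \<le> u\<^sup>2 / 2" "\<bar>1 - exp (- u)\<bar> \<le> u"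
proof -
  have 1: "1 - u \<le> exp (- u)" using exp_ge_add_one_self[of "- u"] by simp
  have "\<exists>v. \<bar>v\<bar> \<le> \<bar>- u\<bar> \<and> exp (- u) = (\<Sum>m<2. (- u) ^ m / fact m) + exp v / fact 2 * (- u) ^ 2"
    by (rule Maclaurin_exp_le)
  moreover have "exp (- u) \<le> 1 - u + u\<^sup>2 / 2"
  proof -
    define h where "h x = 1 - x + x\<^sup>2 / 2 - exp (- x)" for x :: real
    have "h 0 \<le> h u"
    proof (rule DERIV_nonneg_imp_nondecreasing[OF assms])
      fix x :: real assume "0 \<le> x" "x \<le> u"
      have "(h has_real_derivative (- 1 + x + exp (- x))) (at x)"
        unfolding h_def by (auto intro!: derivative_eq_intros)
      moreover have "0 \<le> - 1 + x + exp (- x)" using exp_ge_add_one_self[of "- x"] by simp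
      ultimately show "\<exists>y. (h has_real_derivative y) (at x) \<and> 0 \<le> y" by blast
    qed
    then show ?thesis by (simp add: h_def)
  qed
  ultimately show "\<bar>exp (- u) - (1 - u)\<bar> \<le> u\<^sup>2 / 2" using 1 by (simp add: abs_le_iff)
  show "\<bar>1 - exp (- u)\<bar> \<le> u" using 1 assms by simp
qed

context markov_walk
begin

lemma norm_chop_le:
  assumes "\<And>x. cmod (g x) \<le> c"
  shows "cmod (chop P f s g x) \<le> c"
proof -
  have "cmod (chop P f s g x) \<le> (\<Sum>x'\<in>UNIV. P x x' * c)"
    unfolding chop_def
    by (rule order_trans[OF norm_sum]) (auto intro!: sum_mono mult_left_mono assms simp: P_nonneg norm_mult)
  then show ?thesis by (simp add: sum_distrib_right[symmetric] P_sum)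
qed

lemma norm_chop_pow_le:
  assumes "\<And>x. cmod (g x) \<le> c"
  shows "cmod ((chop P f s ^^ n) g x) \<le> c"
  using assms by (induction n arbitrary: x) (auto intro!: norm_chop_le)

end

lemma chop_diff: "chop P f s (\<lambda>x. g x - h x) = (\<lambda>x. chop P f s g x - chop P f s h x)"
  by (simp add: chop_def fun_eq_iff scaleR_diff_right right_diff_distrib sum_subtractf)

lemma chop_mult: "chop P f s (\<lambda>x. c * g x) = (\<lambda>x. c * chop P f s g x)"
  by (simp add: chop_def fun_eq_iff sum_distrib_left mult_ac)

lemma chop_pow_diff: "(chop P f s ^^ n) (\<lambda>x. g x - h x) = (\<lambda>x. (chop P f s ^^ n) g x - (chop P f s ^^ n) h x)"
  by (induction n) (simp_all add: chop_diff)

lemma chop_pow_mult: "(chop P f s ^^ n) (\<lambda>x. c * g x) = (\<lambda>x. c * (chop P f s ^^ n) g x)"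
  by (induction n) (simp_all add: chop_mult)

context diffusive_walk
begin

text \<open>Second order approximation of the leading eigenfunction of \<open>chop P f s\<close>,
  whose eigenvalue is close to \<open>exp (- \<sigma>\<^sup>2 s\<^sup>2 / 2)\<close>.\<close>

definition Gs :: "real \<Rightarrow> 'x \<Rightarrow> complex" where
  "Gs s x = 1 + \<i> * of_real (s * r x) - of_real (s\<^sup>2 * q x)"

lemma norm_Gs: "cmod (Gs s x) \<le> 1 + B * \<bar>s\<bar> + B * s\<^sup>2"
proof -
  have "cmod (Gs s x) \<le> cmod (1 + \<i> * of_real (s * r x)) + cmod (of_real (s\<^sup>2 * q x))"
    unfolding Gs_def by (rule norm_triangle_ineq4)
  also have "cmod (1 + \<i> * of_real (s * r x)) \<le> cmod 1 + cmod (\<i> * of_real (s * r x))"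
    by (rule norm_triangle_ineq)
  also have "cmod (\<i> * of_real (s * r x)) = \<bar>r x\<bar> * \<bar>s\<bar>"
    by (simp add: norm_mult abs_mult)
  also have "cmod (of_real (s\<^sup>2 * q x)) = \<bar>q x\<bar> * s\<^sup>2"
    by (simp only: norm_of_real abs_mult) simp
  finally show ?thesis
    using mult_right_mono[OF B_bounds(2), of "\<bar>s\<bar>" x] mult_right_mono[OF B_bounds(3), of "s\<^sup>2" x] by simp
qed

lemma norm_Gs_diff: "cmod (Gs s x - 1) \<le> B * \<bar>s\<bar> + B * s\<^sup>2"
proof -
  have "cmod (Gs s x - 1) = cmod (\<i> * of_real (s * r x) - of_real (s\<^sup>2 * q x))"
    by (simp add: Gs_def)
  also have "\<dots> \<le> cmod (\<i> * of_real (s * r x)) + cmod (of_real (s\<^sup>2 * q x))"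
    by (rule norm_triangle_ineq4)
  also have "cmod (\<i> * of_real (s * r x)) = \<bar>r x\<bar> * \<bar>s\<bar>"
    by (simp add: norm_mult abs_mult)
  also have "cmod (of_real (s\<^sup>2 * q x)) = \<bar>q x\<bar> * s\<^sup>2"
    by (simp only: norm_of_real abs_mult) simp
  finally show ?thesis
    using mult_right_mono[OF B_bounds(2), of "\<bar>s\<bar>" x] mult_right_mono[OF B_bounds(3), of "s\<^sup>2" x] by simp
qed

text \<open>The coefficients of \<open>s\<close> and \<open>s\<^sup>2\<close> in the product
  \<open>iexp (s * f x) * Gs s x\<close> are \<open>u\<close> and \<open>v\<close>; the equations
  for \<open>r\<close> and \<open>q\<close> compute their one-step means. Everything else is of
  third order.\<close>

lemma chop_Gs_expansion:
  assumes s: "\<bar>s\<bar> \<le> 1"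
  shows "cmod (chop P f s (Gs s) x - (1 + \<i> * of_real (s * r x) - of_real (s\<^sup>2 * (q x + s2 / 2)))) \<le> 4 * B ^ 4 * \<bar>s\<bar> ^ 3"
proof -
  define u where "u x = f x + r x" for x
  define v where "v x = f x ^ 2 / 2 + f x * r x + q x" for x
  have main: "(\<Sum>x'\<in>UNIV. P x x' *\<^sub>R (1 + \<i> * of_real (s * u x') - of_real (s\<^sup>2 * v x')))
      = 1 + \<i> * of_real (s * r x) - of_real (s\<^sup>2 * (q x + s2 / 2))"
  proof -
    have "(\<Sum>x'\<in>UNIV. P x x' *\<^sub>R (1 + \<i> * of_real (s * u x') - of_real (s\<^sup>2 * v x')))
      = of_real (\<Sum>x'\<in>UNIV. P x x') + \<i> * of_real (s * (\<Sum>x'\<in>UNIV. P x x' * u x')) - of_real (s\<^sup>2 * (\<Sum>x'\<in>UNIV. P x x' * v x'))"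
      unfolding sum_distrib_left of_real_sum sum.distrib[symmetric] sum_subtractf[symmetric]
      by (rule sum.cong) (auto simp: scaleR_conv_of_real algebra_simps)
    then show ?thesis using r_eq[of x] q_eq[of x] by (simp add: P_sum u_def v_def)
  qed
  have one: "cmod (iexp (s * f x) * Gs s x - (1 + \<i> * of_real (s * u x) - of_real (s\<^sup>2 * v x))) \<le> 4 * B ^ 4 * \<bar>s\<bar> ^ 3" for x
  proof -
    define e where "e = 1 + \<i> * of_real (s * f x) - of_real (s\<^sup>2 * (f x)\<^sup>2 / 2)"
    have s2': "s\<^sup>2 \<le> 1" using s by (simp add: abs_square_le_1)
    have B3: "B ^ j \<le> B ^ 4" if "j \<le> 4" for j using that B_ge_1 by (intro power_increasing) auto
    have "cmod (iexp (s * f x) - e) \<le> \<bar>s * f x\<bar> ^ 3 / 6"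
      using iexp_approx_2[of "s * f x"] by (simp add: e_def power_mult_distrib)
    also have "\<dots> \<le> \<bar>s\<bar> ^ 3 * B ^ 3 / 6"
      unfolding abs_mult power_mult_distrib by (intro divide_right_mono mult_left_mono power_mono B_bounds) auto
    finally have 1: "cmod (iexp (s * f x) - e) \<le> \<bar>s\<bar> ^ 3 * B ^ 3 / 6" .
    have g: "cmod (Gs s x) \<le> 3 * B"
    proof -
      have "B * \<bar>s\<bar> \<le> B * 1" "B * s\<^sup>2 \<le> B * 1" using s s2' B_ge_1 by (intro mult_left_mono; simp)+
      then show ?thesis using norm_Gs[of s x] B_ge_1 by linarith
    qed
    have "cmod ((iexp (s * f x) - e) * Gs s x) \<le> (\<bar>s\<bar> ^ 3 * B ^ 3 / 6) * (3 * B)"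
      unfolding norm_mult using 1 g B_ge_1 by (intro mult_mono) auto
    also have "\<dots> = B ^ 4 * \<bar>s\<bar> ^ 3 / 2" by (simp add: power_numeral_reduce)
    finally have 2: "cmod ((iexp (s * f x) - e) * Gs s x) \<le> B ^ 4 * \<bar>s\<bar> ^ 3 / 2" .
    \<comment> \<open>The orders 0 to 2 cancel exactly; the two surviving terms are of orders 3 and
      4.\<close>
    have R: "e * Gs s x - (1 + \<i> * of_real (s * u x) - of_real (s\<^sup>2 * v x))
        = of_real (s ^ 4 * ((f x)\<^sup>2 * q x / 2)) - \<i> * of_real (s ^ 3 * (f x * q x + (f x)\<^sup>2 * r x / 2))"
      by (simp add: e_def Gs_def u_def v_def power2_eq_square power_numeral_reduce field_simps)
    have fq: "\<bar>f x * q x\<bar> \<le> B ^ 4" "\<bar>(f x)\<^sup>2 * r x\<bar> \<le> B ^ 4" "\<bar>(f x)\<^sup>2 * q x\<bar> \<le> B ^ 4"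
    proof -
      have "\<bar>f x * q x\<bar> \<le> B * B" unfolding abs_mult by (intro mult_mono B_bounds) (use B_ge_1 in auto)
      then show "\<bar>f x * q x\<bar> \<le> B ^ 4" using B3[of 2] by (simp add: power2_eq_square)
      have "\<bar>(f x)\<^sup>2 * r x\<bar> \<le> B\<^sup>2 * B" "\<bar>(f x)\<^sup>2 * q x\<bar> \<le> B\<^sup>2 * B"
        unfolding abs_mult using power_mono[OF B_bounds(1)[of x], of 2] B_ge_1
        by (intro mult_mono B_bounds; simp)+
      then show "\<bar>(f x)\<^sup>2 * r x\<bar> \<le> B ^ 4" "\<bar>(f x)\<^sup>2 * q x\<bar> \<le> B ^ 4"
        using B3[of 3] by (simp_all add: power2_eq_square power3_eq_cube)
    qed
    have "cmod (e * Gs s x - (1 + \<i> * of_real (s * u x) - of_real (s\<^sup>2 * v x)))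
        \<le> cmod (of_real (s ^ 4 * ((f x)\<^sup>2 * q x / 2))) + cmod (\<i> * of_real (s ^ 3 * (f x * q x + (f x)\<^sup>2 * r x / 2)))"
      unfolding R by (rule norm_triangle_ineq4)
    also have "\<dots> = \<bar>s\<bar> ^ 4 * \<bar>(f x)\<^sup>2 * q x / 2\<bar> + \<bar>s\<bar> ^ 3 * \<bar>f x * q x + (f x)\<^sup>2 * r x / 2\<bar>"
      by (simp only: norm_mult norm_of_real abs_mult power_abs norm_ii mult_1_left)
    also have "\<dots> \<le> \<bar>s\<bar> ^ 3 * (B ^ 4 / 2) + \<bar>s\<bar> ^ 3 * (B ^ 4 * 3 / 2)"
    proof (intro add_mono mult_mono)
      show "\<bar>s\<bar> ^ 4 \<le> \<bar>s\<bar> ^ 3" using s by (intro power_decreasing) auto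
      show "\<bar>(f x)\<^sup>2 * q x / 2\<bar> \<le> B ^ 4 / 2" using fq(3) by simp
      show "\<bar>f x * q x + (f x)\<^sup>2 * r x / 2\<bar> \<le> B ^ 4 * 3 / 2" using fq(1,2) by linarith
    qed auto
    finally have 3: "cmod (e * Gs s x - (1 + \<i> * of_real (s * u x) - of_real (s\<^sup>2 * v x))) \<le> 2 * B ^ 4 * \<bar>s\<bar> ^ 3"
      by (simp add: algebra_simps)
    have "iexp (s * f x) * Gs s x - (1 + \<i> * of_real (s * u x) - of_real (s\<^sup>2 * v x))
       = (iexp (s * f x) - e) * Gs s x + (e * Gs s x - (1 + \<i> * of_real (s * u x) - of_real (s\<^sup>2 * v x)))"
      by (simp add: algebra_simps)
    then have "cmod (iexp (s * f x) * Gs s x - (1 + \<i> * of_real (s * u x) - of_real (s\<^sup>2 * v x)))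
      \<le> B ^ 4 * \<bar>s\<bar> ^ 3 / 2 + 2 * B ^ 4 * \<bar>s\<bar> ^ 3"
      using norm_triangle_mono[OF 2 3] by (simp only:)
    also have "\<dots> \<le> 4 * B ^ 4 * \<bar>s\<bar> ^ 3" using B_ge_1 by simp
    finally show ?thesis .
  qed
  have "cmod (chop P f s (Gs s) x - (1 + \<i> * of_real (s * r x) - of_real (s\<^sup>2 * (q x + s2 / 2))))
     = cmod (\<Sum>x'\<in>UNIV. P x x' *\<^sub>R (iexp (s * f x') * Gs s x' - (1 + \<i> * of_real (s * u x') - of_real (s\<^sup>2 * v x'))))"
    unfolding main[symmetric] chop_def by (simp only: sum_subtractf[symmetric] scaleR_diff_right[symmetric])
  also have "\<dots> \<le> (\<Sum>x'\<in>UNIV. P x x' * (4 * B ^ 4 * \<bar>s\<bar> ^ 3))"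
    by (rule order_trans[OF norm_sum], unfold norm_scaleR abs_of_nonneg[OF P_nonneg])
      (intro sum_mono mult_left_mono one P_nonneg)
  also have "\<dots> = 4 * B ^ 4 * \<bar>s\<bar> ^ 3"
    unfolding sum_distrib_right[symmetric] by (simp add: P_sum)
  finally show ?thesis .
qed

text \<open>For \<open>\<bar>s\<bar> \<le> 1\<close> the expansion is compared with that of the
  exponential; beyond, both terms grow at most like \<open>s\<^sup>2\<close> and the cubic bound
  holds trivially. A bound valid for every \<open>s\<close> allows integration over the whole line
  without a cutoff.\<close>

lemma chop_Gs: "\<exists>C>0. \<forall>s x. cmod (chop P f s (Gs s) x - of_real (exp (- (s2 * s\<^sup>2 / 2))) * Gs s x) \<le> C * \<bar>s\<bar> ^ 3"
proof -
  define C where "C = 4 * B ^ 4 + s2\<^sup>2 * B + s2 * B + 6 * B"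
  have small: "cmod (chop P f s (Gs s) x - of_real (exp (- (s2 * s\<^sup>2 / 2))) * Gs s x) \<le> C * \<bar>s\<bar> ^ 3"
    if s: "\<bar>s\<bar> \<le> 1" for s x
  proof -
    define u where "u = s2 * s\<^sup>2 / 2"
    have u0: "0 \<le> u" using s2_pos by (simp add: u_def)
    define m where "m = 1 + \<i> * of_real (s * r x) - of_real (s\<^sup>2 * (q x + s2 / 2))"
    have s2': "s\<^sup>2 \<le> 1" using s by (simp add: abs_square_le_1)
    have "\<bar>s\<bar> * \<bar>s\<bar> \<le> \<bar>s\<bar> * 1" using s by (intro mult_left_mono) auto
    then have "s\<^sup>2 \<le> \<bar>s\<bar>" by (simp add: power2_eq_square)
    then have "B * \<bar>s\<bar> \<le> B * 1" "B * s\<^sup>2 \<le> B * \<bar>s\<bar>"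
      using s B_ge_1 by (auto intro!: mult_left_mono)
    then have g: "cmod (Gs s x) \<le> 3 * B" "cmod (Gs s x - 1) \<le> 2 * B * \<bar>s\<bar>"
      using norm_Gs[of s x] norm_Gs_diff[of s x] B_ge_1 by linarith+
    have eq: "of_real (exp (- u)) * Gs s x - m = of_real (exp (- u) - (1 - u)) * Gs s x - of_real u * (Gs s x - 1)"
      by (simp add: m_def Gs_def u_def algebra_simps)
    have "cmod (of_real (exp (- u)) * Gs s x - m) \<le> \<bar>exp (- u) - (1 - u)\<bar> * cmod (Gs s x) + \<bar>u\<bar> * cmod (Gs s x - 1)"
      unfolding eq by (rule order_trans[OF norm_triangle_ineq4]) (simp only: norm_mult norm_of_real order_refl)
    also have "\<dots> \<le> (u\<^sup>2 / 2) * (3 * B) + u * (2 * B * \<bar>s\<bar>)"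
      using exp_minus_approx(1)[OF u0] g u0 B_ge_1 by (intro add_mono mult_mono) auto
    also have "\<dots> = (3 / 8) * s2\<^sup>2 * B * \<bar>s\<bar> ^ 4 + s2 * B * \<bar>s\<bar> ^ 3"
    proof -
      have "\<bar>s\<bar> ^ 4 = s\<^sup>2 * s\<^sup>2" "\<bar>s\<bar> ^ 3 = s\<^sup>2 * \<bar>s\<bar>"
        by (simp_all add: power_numeral_reduce)
      then show ?thesis by (simp add: u_def power2_eq_square field_simps)
    qed
    also have "\<dots> \<le> s2\<^sup>2 * B * \<bar>s\<bar> ^ 3 + s2 * B * \<bar>s\<bar> ^ 3"
    proof -
      have "(3 / 8) * (s2\<^sup>2 * B * \<bar>s\<bar> ^ 4) \<le> 1 * (s2\<^sup>2 * B * \<bar>s\<bar> ^ 3)"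
        using s B_ge_1 by (intro mult_mono mult_left_mono power_decreasing) auto
      then show ?thesis by simp
    qed
    finally have 1: "cmod (of_real (exp (- u)) * Gs s x - m) \<le> s2\<^sup>2 * B * \<bar>s\<bar> ^ 3 + s2 * B * \<bar>s\<bar> ^ 3" .
    have 2: "cmod (chop P f s (Gs s) x - m) \<le> 4 * B ^ 4 * \<bar>s\<bar> ^ 3"
      unfolding m_def by (rule chop_Gs_expansion[OF s])
    have "cmod (chop P f s (Gs s) x - of_real (exp (- u)) * Gs s x)
       \<le> cmod (chop P f s (Gs s) x - m) + cmod (of_real (exp (- u)) * Gs s x - m)"
      using norm_triangle_ineq4[of "chop P f s (Gs s) x - m" "of_real (exp (- u)) * Gs s x - m"] by simp
    also have "\<dots> \<le> C * \<bar>s\<bar> ^ 3 - 6 * B * \<bar>s\<bar> ^ 3"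
      using 1 2 by (simp add: C_def algebra_simps)
    finally show ?thesis using B_ge_1 unfolding u_def by (smt (verit) mult_nonneg_nonneg zero_le_power abs_ge_zero)
  qed
  have large: "cmod (chop P f s (Gs s) x - of_real (exp (- (s2 * s\<^sup>2 / 2))) * Gs s x) \<le> C * \<bar>s\<bar> ^ 3"
    if s: "1 < \<bar>s\<bar>" for s x
  proof -
    define A where "A = 1 + B * \<bar>s\<bar> + B * s\<^sup>2"
    have "cmod (chop P f s (Gs s) x) \<le> A"
      unfolding A_def by (rule norm_chop_le) (rule norm_Gs)
    moreover have "cmod (of_real (exp (- (s2 * s\<^sup>2 / 2))) * Gs s x) \<le> 1 * A"
      unfolding norm_mult using norm_Gs[of s x] s2_pos by (intro mult_mono) (auto simp: A_def)
    ultimately have "cmod (chop P f s (Gs s) x - of_real (exp (- (s2 * s\<^sup>2 / 2))) * Gs s x) \<le> 2 * A"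
      using norm_triangle_ineq4[of "chop P f s (Gs s) x" "of_real (exp (- (s2 * s\<^sup>2 / 2))) * Gs s x"] by linarith
    also have "A \<le> 3 * B * \<bar>s\<bar> ^ 3"
    proof -
      have s3: "1 \<le> \<bar>s\<bar> ^ 3" "\<bar>s\<bar> \<le> \<bar>s\<bar> ^ 3" "s\<^sup>2 \<le> \<bar>s\<bar> ^ 3"
        using s power_increasing[of 1 3 "\<bar>s\<bar>"] power_increasing[of 2 3 "\<bar>s\<bar>"] power_increasing[of 0 3 "\<bar>s\<bar>"] by auto
      have "1 * 1 \<le> B * \<bar>s\<bar> ^ 3" "B * \<bar>s\<bar> \<le> B * \<bar>s\<bar> ^ 3" "B * s\<^sup>2 \<le> B * \<bar>s\<bar> ^ 3"
        using B_ge_1 s3 by (intro mult_mono; simp)+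
      then show ?thesis by (simp add: A_def)
    qed
    also have "2 * (3 * B * \<bar>s\<bar> ^ 3) \<le> C * \<bar>s\<bar> ^ 3"
    proof -
      have "6 * B \<le> C" using B_ge_1 s2_pos by (simp add: C_def)
      then have "6 * B * \<bar>s\<bar> ^ 3 \<le> C * \<bar>s\<bar> ^ 3" by (intro mult_right_mono) auto
      then show ?thesis by simp
    qed
    finally show ?thesis by simp
  qed
  have "0 < C" using B_ge_1 s2_pos unfolding C_def by (smt (verit) mult_nonneg_nonneg zero_le_power zero_le_power2)
  then show ?thesis using small large by (meson not_le)
qed

section \<open>Gaussian integrals\<close>

text \<open>Characteristic function of the centred Gaussian law with variance
  \<open>s2 * t\<close>.\<close>

definition gam :: "real \<Rightarrow> real \<Rightarrow> real" where
  "gam t s = exp (- (s2 / 2 * (t * s\<^sup>2)))"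

definition Imom :: "nat \<Rightarrow> real" where
  "Imom k = (LINT s|lborel. \<bar>s\<bar> ^ k * gam 1 s)"

lemma gam_pos: "0 < gam t s" by (simp add: gam_def)

lemma gam_measurable [measurable]: "gam t \<in> borel_measurable borel"
  unfolding gam_def by measurable

lemma gam_add: "gam (t + u) s = gam t s * gam u s"
  by (simp add: gam_def exp_add[symmetric] algebra_simps)

lemma gam_1_integrable: "integrable lborel (\<lambda>s. \<bar>s\<bar> ^ k * gam 1 s)"
proof -
  define \<sigma> where "\<sigma> = 1 / sqrt s2"
  have \<sigma>: "0 < \<sigma>" "\<sigma>\<^sup>2 = 1 / s2" using s2_pos by (auto simp: \<sigma>_def power_divide)
  have "integrable lborel (\<lambda>x. sqrt (2 * pi * \<sigma>\<^sup>2) * (normal_density 0 \<sigma> x * \<bar>x - 0\<bar> ^ k))"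
    using integrable_normal_moment_abs[of \<sigma> 0 k] \<sigma> by (intro integrable_mult_right) auto
  also have "(\<lambda>x. sqrt (2 * pi * \<sigma>\<^sup>2) * (normal_density 0 \<sigma> x * \<bar>x - 0\<bar> ^ k)) = (\<lambda>s. \<bar>s\<bar> ^ k * gam 1 s)"
    using \<sigma> s2_pos by (auto simp: normal_density_def gam_def fun_eq_iff field_simps)
  finally show ?thesis .
qed

lemma Imom_nonneg: "0 \<le> Imom k"
  unfolding Imom_def by (intro integral_nonneg_AE) (auto simp: less_imp_le[OF gam_pos])

lemma gam_moment:
  assumes "0 < t"
  shows "integrable lborel (\<lambda>s. \<bar>s\<bar> ^ k * gam t s)"
    and "(LINT s|lborel. \<bar>s\<bar> ^ k * gam t s) = Imom k / sqrt t ^ (k + 1)"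
proof -
  define c where "c = sqrt t"
  have c: "0 < c" "c\<^sup>2 = t" using assms by (auto simp: c_def)
  have eq: "\<bar>0 + c * s\<bar> ^ k * gam 1 (0 + c * s) = c ^ k * (\<bar>s\<bar> ^ k * gam t s)" for s
    using c by (simp add: gam_def abs_mult power_mult_distrib)
  have "integrable lborel (\<lambda>s. \<bar>0 + c * s\<bar> ^ k * gam 1 (0 + c * s))"
    using gam_1_integrable[of k] c by (intro lborel_integrable_real_affine) auto
  then show 1: "integrable lborel (\<lambda>s. \<bar>s\<bar> ^ k * gam t s)"
    unfolding eq using c by simp
  have "Imom k = \<bar>c\<bar> *\<^sub>R (LINT s|lborel. \<bar>0 + c * s\<bar> ^ k * gam 1 (0 + c * s))"
    unfolding Imom_def using c by (intro lborel_integral_real_affine) auto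
  also have "\<dots> = c ^ (k + 1) * (LINT s|lborel. \<bar>s\<bar> ^ k * gam t s)"
    unfolding eq using c by simp
  finally show "(LINT s|lborel. \<bar>s\<bar> ^ k * gam t s) = Imom k / sqrt t ^ (k + 1)"
    using c unfolding c_def[symmetric] by (simp add: field_simps)
qed

text \<open>By scaling, each factor \<open>\<bar>s\<bar>\<close> under the Gaussian gains t^(-1/2).
  The order in \<open>t\<close> of every Gaussian estimate below is read off from the power of
  \<open>\<bar>s\<bar>\<close> in its integrand.\<close>

lemma gauss_dominated:
  fixes g :: "real \<Rightarrow> 'b::{banach, second_countable_topology}"
  assumes t: "0 < t" and [measurable]: "g \<in> borel_measurable borel"
    and bound: "\<And>s. norm (g s) \<le> (c0 + c1 * \<bar>s\<bar> + c2 * s\<^sup>2 + c3 * \<bar>s\<bar> ^ 3) * gam t s"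
  shows "integrable lborel g"
    and "norm (LINT s|lborel. g s) \<le> c0 * Imom 0 / sqrt t + c1 * Imom 1 / t + c2 * Imom 2 / (t * sqrt t) + c3 * Imom 3 / t\<^sup>2"
proof -
  define h where "h s = c0 * (\<bar>s\<bar> ^ 0 * gam t s) + c1 * (\<bar>s\<bar> ^ 1 * gam t s) + c2 * (\<bar>s\<bar> ^ 2 * gam t s) + c3 * (\<bar>s\<bar> ^ 3 * gam t s)" for s
  have h: "integrable lborel h"
    unfolding h_def by (intro Bochner_Integration.integrable_add integrable_mult_right gam_moment t)
  have le: "norm (g s) \<le> h s" for s
    using bound[of s] by (simp add: h_def algebra_simps)
  show 1: "integrable lborel g"
    by (rule Bochner_Integration.integrable_bound[OF h]) (use le in \<open>auto intro: order_trans[OF _ abs_ge_self]\<close>)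
  have "norm (LINT s|lborel. g s) \<le> (LINT s|lborel. h s)"
    by (rule order_trans[OF integral_norm_bound]) (use le h 1 in \<open>auto intro!: integral_mono\<close>)
  also have "\<dots> = c0 * (Imom 0 / sqrt t ^ (0 + 1)) + c1 * (Imom 1 / sqrt t ^ (1 + 1)) + c2 * (Imom 2 / sqrt t ^ (2 + 1)) + c3 * (Imom 3 / sqrt t ^ (3 + 1))"
    unfolding h_def by (simp only: Bochner_Integration.integral_add Bochner_Integration.integrable_add integrable_mult_right gam_moment[OF t] integral_mult_right_zero)
  also have "\<dots> = c0 * Imom 0 / sqrt t + c1 * Imom 1 / t + c2 * Imom 2 / (t * sqrt t) + c3 * Imom 3 / t\<^sup>2"
  proof -
    have "sqrt t ^ (1 + 1) = t" "sqrt t ^ (2 + 1) = t * sqrt t" "sqrt t ^ (3 + 1) = t\<^sup>2"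
      using t by (simp_all add: power_numeral_reduce power2_eq_square mult.assoc[symmetric])
    then show ?thesis by simp
  qed
  finally show "norm (LINT s|lborel. g s) \<le> c0 * Imom 0 / sqrt t + c1 * Imom 1 / t + c2 * Imom 2 / (t * sqrt t) + c3 * Imom 3 / t\<^sup>2" .
qed

end

section \<open>Gaussian approximations of the walk\<close>

context diffusive_walk
begin

definition phi :: "real \<Rightarrow> real \<Rightarrow> real" where
  "phi t v = exp (- (v\<^sup>2 / (2 * s2 * t))) / sqrt (2 * pi * s2 * t)"

lemma phi_nonneg: "0 < t \<Longrightarrow> 0 \<le> phi t v"
  using s2_pos by (simp add: phi_def)

lemma trig_gam: "\<bar>sin u\<bar> * gam t s \<le> gam t s" "\<bar>cos u\<bar> * gam t s \<le> gam t s"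
  using gam_pos[of t s] by (auto intro!: mult_left_le_one_le)

lemma norm_inv_2pi: "cmod (of_real (1 / (2 * pi))) \<le> 1"
proof -
  have "1 / (2 * pi) \<le> 1" using pi_ge_two by (simp add: field_simps)
  then show ?thesis unfolding norm_of_real using pi_gt_zero by (subst abs_of_pos) auto
qed

lemma phi_even: "phi t (- v) = phi t v"
  by (simp add: phi_def)

text \<open>The substitution by the factor \<open>1 / sqrt (s2 * t)\<close> reduces the integral to
  the characteristic function of the standard normal law.\<close>

lemma gam_fourier:
  assumes t: "0 < t"
  shows "integrable lborel (\<lambda>s. iexp (s * v) * of_real (gam t s))"
    and "(LINT s|lborel. iexp (s * v) * of_real (gam t s)) = of_real (2 * pi * phi t v)"
proof -
  show 1: "integrable lborel (\<lambda>s. iexp (s * v) * complex_of_real (gam t s))"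
    by (rule gauss_dominated(1)[OF t, of _ 1 0 0 0]) (auto simp: norm_mult less_imp_le[OF gam_pos])
  define c where "c = 1 / sqrt (s2 * t)"
  have c: "0 < c" "c\<^sup>2 = 1 / (s2 * t)" using s2_pos t by (auto simp: c_def power_divide)
  have "(LINT s|lborel. iexp (s * v) * complex_of_real (gam t s))
      = \<bar>c\<bar> *\<^sub>R (LINT s|lborel. iexp ((0 + c * s) * v) * complex_of_real (gam t (0 + c * s)))"
    using c by (intro lborel_integral_real_affine) auto
  also have "(\<lambda>s. iexp ((0 + c * s) * v) * complex_of_real (gam t (0 + c * s)))
      = (\<lambda>s. of_real (sqrt (2 * pi)) * (std_normal_density s *\<^sub>R iexp ((c * v) * s)))"
  proof
    fix s
    have "s2 * (t * (c * s)\<^sup>2) = s\<^sup>2"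
      using c s2_pos t by (simp add: power_mult_distrib)
    then have "gam t (0 + c * s) = sqrt (2 * pi) * std_normal_density s"
      by (simp add: gam_def std_normal_density_def)
    then show "iexp ((0 + c * s) * v) * complex_of_real (gam t (0 + c * s))
      = of_real (sqrt (2 * pi)) * (std_normal_density s *\<^sub>R iexp ((c * v) * s))"
      by (simp add: scaleR_conv_of_real mult_ac)
  qed
  also have "(LINT s|lborel. of_real (sqrt (2 * pi)) * (std_normal_density s *\<^sub>R iexp ((c * v) * s)))
      = of_real (sqrt (2 * pi)) * (LINT s|lborel. std_normal_density s *\<^sub>R iexp ((c * v) * s))"
    by (rule integral_mult_right_zero)
  also have "(LINT s|lborel. std_normal_density s *\<^sub>R iexp ((c * v) * s)) = char std_normal_distribution (c * v)"
    unfolding char_def by (rule integral_density[symmetric]) (auto simp: normal_density_nonneg)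
  also have "\<dots> = of_real (exp (- (c * v)\<^sup>2 / 2))"
    by (simp add: char_std_normal_distribution)
  also have "\<bar>c\<bar> *\<^sub>R (of_real (sqrt (2 * pi)) * complex_of_real (exp (- (c * v)\<^sup>2 / 2))) = of_real (2 * pi * phi t v)"
  proof -
    have "(c * v)\<^sup>2 / 2 = v\<^sup>2 / (2 * s2 * t)" using c by (simp add: power_mult_distrib)
    moreover have "c * sqrt (2 * pi) = 2 * pi / sqrt (2 * pi * s2 * t)"
      using s2_pos t by (simp add: c_def real_sqrt_mult field_simps)
    ultimately have "c * (sqrt (2 * pi) * exp (- (c * v)\<^sup>2 / 2)) = 2 * pi * phi t v"
      by (simp add: phi_def mult.assoc[symmetric])
    then show ?thesis using c by (simp add: scaleR_conv_of_real flip: of_real_mult)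
  qed
  finally show "(LINT s|lborel. iexp (s * v) * of_real (gam t s)) = of_real (2 * pi * phi t v)" .
qed

lemma phi_le: "0 < t \<Longrightarrow> phi t v \<le> Imom 0 / sqrt t"
proof -
  assume t: "0 < t"
  have "cmod (of_real (2 * pi * phi t v)) \<le> 1 * Imom 0 / sqrt t + 0 * Imom 1 / t + 0 * Imom 2 / (t * sqrt t) + 0 * Imom 3 / t\<^sup>2"
    unfolding gam_fourier(2)[OF t, symmetric]
    by (rule gauss_dominated(2)[OF t]) (auto simp: norm_mult less_imp_le[OF gam_pos])
  then have "2 * pi * phi t v \<le> Imom 0 / sqrt t" unfolding norm_of_real using abs_ge_self[of "2 * pi * phi t v"] by simp
  moreover have "1 * phi t v \<le> 2 * pi * phi t v"
    using pi_ge_two phi_nonneg[OF t, of v] by (intro mult_right_mono) auto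
  ultimately show ?thesis by simp
qed

lemma phi_lipschitz: "0 < t \<Longrightarrow> \<bar>phi t v - phi t w\<bar> \<le> Imom 1 * \<bar>v - w\<bar> / t"
proof -
  assume t: "0 < t"
  have "cmod (LINT s|lborel. (iexp (s * v) - iexp (s * w)) * of_real (gam t s))
     \<le> 0 * Imom 0 / sqrt t + \<bar>v - w\<bar> * Imom 1 / t + 0 * Imom 2 / (t * sqrt t) + 0 * Imom 3 / t\<^sup>2"
  proof (rule gauss_dominated(2)[OF t])
    fix s
    have "iexp (s * v) - iexp (s * w) = iexp (s * w) * (iexp (s * (v - w)) - 1)"
      by (simp add: right_diff_distrib exp_add[symmetric] algebra_simps)
    then have "cmod (iexp (s * v) - iexp (s * w)) \<le> \<bar>s * (v - w)\<bar>"
      using iexp_approx_0[of "s * (v - w)"] by (simp only: norm_mult norm_exp_i_times mult_1_left)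
    then show "cmod ((iexp (s * v) - iexp (s * w)) * of_real (gam t s)) \<le> (0 + \<bar>v - w\<bar> * \<bar>s\<bar> + 0 * s\<^sup>2 + 0 * \<bar>s\<bar> ^ 3) * gam t s"
      using gam_pos[of t s] by (simp add: norm_mult abs_mult mult_right_mono mult.commute)
  qed measurable
  also have "(LINT s|lborel. (iexp (s * v) - iexp (s * w)) * of_real (gam t s)) = of_real (2 * pi * phi t v - 2 * pi * phi t w)"
    unfolding left_diff_distrib of_real_diff gam_fourier(2)[OF t, symmetric]
    by (rule Bochner_Integration.integral_diff) (rule gam_fourier(1)[OF t])+
  finally have "2 * pi * \<bar>phi t v - phi t w\<bar> \<le> Imom 1 * \<bar>v - w\<bar> / t"
    unfolding norm_of_real right_diff_distrib[symmetric] abs_mult by (simp add: mult.commute)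
  moreover have "1 * \<bar>phi t v - phi t w\<bar> \<le> 2 * pi * \<bar>phi t v - phi t w\<bar>"
    using pi_ge_two by (intro mult_right_mono) auto
  ultimately show ?thesis by simp
qed

text \<open>Uses \<open>exp (- w) \<le> 1 / w\<close>. The polynomial form is the Gaussian
  counterpart of the second moment estimate \<open>far_cell_bound\<close> for the walk, so that the
  two can be added.\<close>

lemma phi_tail: "\<exists>C>0. \<forall>t v. 0 < t \<longrightarrow> v \<noteq> 0 \<longrightarrow> phi t v \<le> C * sqrt t / v\<^sup>2"
proof -
  define C where "C = 2 * s2 / sqrt (2 * pi * s2)"
  have "phi t v \<le> C * sqrt t / v\<^sup>2" if t: "0 < t" and v: "v \<noteq> 0" for t v
  proof -
    define w where "w = v\<^sup>2 / (2 * s2 * t)"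
    have w: "0 < w" using s2_pos t v by (simp add: w_def)
    have "exp (- w) \<le> 1 / w"
    proof -
      have "w \<le> exp w" using exp_ge_add_one_self[of w] by linarith
      then show ?thesis using w by (simp add: exp_minus field_simps)
    qed
    then have "phi t v \<le> (1 / w) / sqrt (2 * pi * s2 * t)"
      unfolding phi_def w_def[symmetric] using s2_pos t by (intro divide_right_mono) auto
    also have "\<dots> = C * sqrt t / v\<^sup>2"
    proof -
      have "t = sqrt t * sqrt t" using t by simp
      then show ?thesis
        using s2_pos t v by (simp add: C_def w_def real_sqrt_mult field_simps)
    qed
    finally show ?thesis .
  qed
  moreover have "0 < C" using s2_pos by (simp add: C_def)
  ultimately show ?thesis by blast
qed

text \<open>The Gaussian density \<open>phi t y\<close> with state-dependent corrections of lower
  order, built by putting the approximate eigenfunction into the Fourier integral. The bare density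
  would ignore the drift of \<open>f\<close> from a given state, which vanishes only in the mean
  under \<open>nu\<close>.\<close>

definition U :: "real \<Rightarrow> 'x \<Rightarrow> real \<Rightarrow> complex" where
  "U t x y = of_real (1 / (2 * pi)) * (LINT s|lborel. iexp (s * y) * Gs s x * of_real (gam t s))"

lemma Gs_measurable [measurable]: "(\<lambda>s. Gs s x) \<in> borel_measurable borel"
  unfolding Gs_def by measurable

lemma U_integrable:
  assumes t: "0 < t"
  shows "integrable lborel (\<lambda>s. iexp (s * y) * Gs s x * of_real (gam t s))"
proof (rule gauss_dominated(1)[OF t, of _ 1 B B 0])
  fix s
  show "cmod (iexp (s * y) * Gs s x * of_real (gam t s)) \<le> (1 + B * \<bar>s\<bar> + B * s\<^sup>2 + 0 * \<bar>s\<bar> ^ 3) * gam t s"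
    using gam_pos[of t s] norm_Gs[of s x] by (simp add: norm_mult mult_right_mono)
qed measurable

lemma step_integral:
  fixes H :: "real \<Rightarrow> 'x \<Rightarrow> real \<Rightarrow> complex"
  assumes "\<And>x y. integrable lborel (\<lambda>s. H s x y)"
  shows "T (\<lambda>x y. LINT s|lborel. H s x y) x y = (LINT s|lborel. T (H s) x y)"
  unfolding step_def by (simp add: assms)

lemma step_mult_left: "T (\<lambda>x y. c * H x y) x y = c * T H x y" for c :: complex
  by (simp add: step_def sum_distrib_left mult_ac)

text \<open>On the Fourier side the defect of \<open>Gs\<close> is cubic in \<open>s\<close>, which
  becomes \<open>1 / t\<^sup>2\<close> after integration.\<close>

lemma U_step: "\<exists>C>0. \<forall>t x y. 0 < t \<longrightarrow> cmod (T (U t) x y - U (t + 1) x y) \<le> C / t\<^sup>2"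
proof -
  obtain C where C: "0 < C" "\<And>s x. cmod (chop P f s (Gs s) x - of_real (exp (- (s2 * s\<^sup>2 / 2))) * Gs s x) \<le> C * \<bar>s\<bar> ^ 3"
    using chop_Gs by blast
  have "cmod (T (U t) x y - U (t + 1) x y) \<le> (C * Imom 3 + 1) / t\<^sup>2" if t: "0 < t" for t x y
  proof -
    have meas [measurable]: "(\<lambda>s. chop P f s (Gs s) x) \<in> borel_measurable borel"
      unfolding chop_def by measurable
    have "T (U t) x y = of_real (1 / (2 * pi)) * T (\<lambda>x y. LINT s|lborel. iexp (s * y) * Gs s x * of_real (gam t s)) x y"
      unfolding U_def by (rule step_mult_left)
    also have "T (\<lambda>x y. LINT s|lborel. iexp (s * y) * Gs s x * of_real (gam t s)) x y
        = (LINT s|lborel. T (\<lambda>x y. iexp (s * y) * Gs s x * of_real (gam t s)) x y)"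
      by (rule step_integral) (rule U_integrable[OF t])
    also have "(\<lambda>s. T (\<lambda>x y. iexp (s * y) * Gs s x * of_real (gam t s)) x y)
        = (\<lambda>s. iexp (s * y) * chop P f s (Gs s) x * of_real (gam t s))"
    proof
      fix s
      show "T (\<lambda>x y. iexp (s * y) * Gs s x * of_real (gam t s)) x y = iexp (s * y) * chop P f s (Gs s) x * of_real (gam t s)"
        using step_mult_left[of "of_real (gam t s)" "\<lambda>x y. iexp (s * y) * Gs s x" x y] unfolding step_iexp
        by (simp only: mult.commute[of "of_real (gam t s)"])
    qed
    finally have 1: "T (U t) x y = of_real (1 / (2 * pi)) * (LINT s|lborel. iexp (s * y) * chop P f s (Gs s) x * of_real (gam t s))" .
    have int: "integrable lborel (\<lambda>s. iexp (s * y) * chop P f s (Gs s) x * of_real (gam t s))"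
    proof (rule gauss_dominated(1)[OF t, of _ 1 B B 0])
      fix s
      have "cmod (chop P f s (Gs s) x) \<le> 1 + B * \<bar>s\<bar> + B * s\<^sup>2" by (rule norm_chop_le) (rule norm_Gs)
      then show "cmod (iexp (s * y) * chop P f s (Gs s) x * of_real (gam t s)) \<le> (1 + B * \<bar>s\<bar> + B * s\<^sup>2 + 0 * \<bar>s\<bar> ^ 3) * gam t s"
        using gam_pos[of t s] by (simp add: norm_mult mult_right_mono)
    qed measurable
    define h where "h s = iexp (s * y) * (chop P f s (Gs s) x - of_real (exp (- (s2 * s\<^sup>2 / 2))) * Gs s x) * of_real (gam t s)" for s
    have "T (U t) x y - U (t + 1) x y = of_real (1 / (2 * pi)) * ((LINT s|lborel. iexp (s * y) * chop P f s (Gs s) x * of_real (gam t s))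
        - (LINT s|lborel. iexp (s * y) * Gs s x * of_real (gam (t + 1) s)))"
      unfolding 1 U_def by (simp only: right_diff_distrib)
    also have "(LINT s|lborel. iexp (s * y) * chop P f s (Gs s) x * of_real (gam t s)) - (LINT s|lborel. iexp (s * y) * Gs s x * of_real (gam (t + 1) s))
        = (LINT s|lborel. iexp (s * y) * chop P f s (Gs s) x * of_real (gam t s) - iexp (s * y) * Gs s x * of_real (gam (t + 1) s))"
      using int U_integrable[of "t + 1" y x] t by (intro Bochner_Integration.integral_diff[symmetric]) auto
    also have "\<dots> = (LINT s|lborel. h s)"
    proof (rule Bochner_Integration.integral_cong[OF refl])
      fix s
      have "gam (t + 1) s = gam t s * exp (- (s2 * s\<^sup>2 / 2))"
        unfolding gam_add by (simp add: gam_def)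
      then show "iexp (s * y) * chop P f s (Gs s) x * of_real (gam t s) - iexp (s * y) * Gs s x * of_real (gam (t + 1) s) = h s"
        by (simp add: h_def algebra_simps)
    qed
    finally have eq: "T (U t) x y - U (t + 1) x y = of_real (1 / (2 * pi)) * (LINT s|lborel. h s)" .
    have "cmod (LINT s|lborel. h s) \<le> 0 * Imom 0 / sqrt t + 0 * Imom 1 / t + 0 * Imom 2 / (t * sqrt t) + C * Imom 3 / t\<^sup>2"
    proof (rule gauss_dominated(2)[OF t])
      fix s show "cmod (h s) \<le> (0 + 0 * \<bar>s\<bar> + 0 * s\<^sup>2 + C * \<bar>s\<bar> ^ 3) * gam t s"
        unfolding h_def norm_mult using C(2)[of s x] gam_pos[of t s] by (auto intro!: mult_right_mono)
    qed (unfold h_def, measurable)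
    then have "cmod (LINT s|lborel. h s) \<le> C * Imom 3 / t\<^sup>2" by simp
    moreover note norm_inv_2pi
    ultimately have "cmod (T (U t) x y - U (t + 1) x y) \<le> 1 * (C * Imom 3 / t\<^sup>2)"
      unfolding eq norm_mult by (intro mult_mono) auto
    also have "\<dots> \<le> (C * Imom 3 + 1) / t\<^sup>2" by (simp add: divide_right_mono)
    finally show ?thesis .
  qed
  moreover have "0 < C * Imom 3 + 1" using C Imom_nonneg[of 3] by (simp add: add_nonneg_pos)
  ultimately show ?thesis by blast
qed

lemma U_phi: "\<exists>C>0. \<forall>t x y. 1 \<le> t \<longrightarrow> cmod (U t x y - of_real (phi t y)) \<le> C / t"
proof -
  define C where "C = B * Imom 1 + B * Imom 2 + 1"
  have "cmod (U t x y - of_real (phi t y)) \<le> C / t" if t: "1 \<le> t" for t x y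
  proof -
    have t0: "0 < t" using t by simp
    define h where "h s = iexp (s * y) * (Gs s x - 1) * of_real (gam t s)" for s
    have "U t x y - of_real (phi t y) = of_real (1 / (2 * pi)) * ((LINT s|lborel. iexp (s * y) * Gs s x * of_real (gam t s)) - of_real (2 * pi * phi t y))"
      unfolding U_def by (simp add: right_diff_distrib)
    also have "(LINT s|lborel. iexp (s * y) * Gs s x * of_real (gam t s)) - of_real (2 * pi * phi t y) = (LINT s|lborel. h s)"
      unfolding gam_fourier(2)[OF t0, symmetric] h_def
      unfolding Bochner_Integration.integral_diff[OF U_integrable[OF t0] gam_fourier(1)[OF t0], symmetric]
      by (rule Bochner_Integration.integral_cong) (auto simp: algebra_simps)
    finally have eq: "U t x y - of_real (phi t y) = of_real (1 / (2 * pi)) * (LINT s|lborel. h s)" .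
    have "cmod (LINT s|lborel. h s) \<le> 0 * Imom 0 / sqrt t + B * Imom 1 / t + B * Imom 2 / (t * sqrt t) + 0 * Imom 3 / t\<^sup>2"
    proof (rule gauss_dominated(2)[OF t0])
      fix s show "cmod (h s) \<le> (0 + B * \<bar>s\<bar> + B * s\<^sup>2 + 0 * \<bar>s\<bar> ^ 3) * gam t s"
        unfolding h_def norm_mult using norm_Gs_diff[of s x] gam_pos[of t s] by (auto intro!: mult_right_mono)
    qed (unfold h_def, measurable)
    also have "\<dots> \<le> B * Imom 1 / t + B * Imom 2 / (t * 1)"
    proof -
      have "B * Imom 2 / (t * sqrt t) \<le> B * Imom 2 / (t * 1)"
        using t B_ge_1 Imom_nonneg[of 2] by (intro divide_left_mono mult_left_mono mult_nonneg_nonneg mult_pos_pos) auto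
      then show ?thesis by simp
    qed
    also have "\<dots> \<le> C / t" using t by (simp add: C_def add_divide_distrib)
    finally have "cmod (LINT s|lborel. h s) \<le> C / t" .
    moreover note norm_inv_2pi
    ultimately have "cmod (U t x y - of_real (phi t y)) \<le> 1 * (C / t)"
      unfolding eq norm_mult by (intro mult_mono) auto
    then show ?thesis by simp
  qed
  moreover have "0 < C" using B_ge_1 Imom_nonneg[of 1] Imom_nonneg[of 2] by (simp add: C_def add_nonneg_pos)
  ultimately show ?thesis by blast
qed

text \<open>The slope at \<open>y = 0\<close> of the odd Gaussian
  \<open>phi t (y - z) - phi t (y + z)\<close>; equally, minus twice the derivative of
  \<open>phi t\<close> at \<open>z\<close>.\<close>

definition D :: "real \<Rightarrow> real \<Rightarrow> real" where
  "D t z = 2 * z / (s2 * t) * phi t z"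

text \<open>Integration by parts: the derivative of \<open>gam t s * sin (s * z)\<close> in
  \<open>s\<close> has integral 0, which expresses the sine integral through the known cosine
  integral.\<close>

lemma gam_sin_integral:
  assumes t: "0 < t"
  shows "(LINT s|lborel. s * sin (s * z) * gam t s) = pi * D t z"
proof -
  define F where "F s = gam t s * sin (s * z)" for s
  define F' where "F' s = z * (cos (s * z) * gam t s) - s2 * t * (s * sin (s * z) * gam t s)" for s
  have int1: "integrable lborel (\<lambda>s. cos (s * z) * gam t s)"
    by (rule gauss_dominated(1)[OF t, of _ 1 0 0 0]) (auto simp: abs_mult less_imp_le[OF gam_pos] trig_gam)
  have int2: "integrable lborel (\<lambda>s. s * sin (s * z) * gam t s)"
    by (rule gauss_dominated(1)[OF t, of _ 0 1 0 0])
      (auto simp: abs_mult less_imp_le[OF gam_pos] mult.assoc intro!: mult_left_mono trig_gam)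
  have cosint: "(LINT s|lborel. cos (s * z) * gam t s) = 2 * pi * phi t z"
  proof -
    have "(LINT s|lborel. cos (s * z) * gam t s) = (LINT s|lborel. Re (iexp (s * z) * of_real (gam t s)))"
      by (simp add: Re_exp)
    also have "\<dots> = Re (of_real (2 * pi * phi t z))"
      unfolding gam_fourier(2)[OF t, symmetric] by (rule integral_Re) (rule gam_fourier(1)[OF t])
    finally show ?thesis by simp
  qed
  have gam0: "(gam t \<longlongrightarrow> 0) at_infinity"
  proof -
    have "filterlim (\<lambda>s::real. s\<^sup>2) at_top at_infinity"
      using filterlim_pow_at_top[of 2 "norm :: real \<Rightarrow> real", OF _ filterlim_norm_at_top] by simp
    then have "filterlim (\<lambda>s. s2 / 2 * (t * s\<^sup>2)) at_top at_infinity"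
      using s2_pos t by (intro filterlim_tendsto_pos_mult_at_top[OF tendsto_const]) auto
    then show ?thesis
      unfolding gam_def by (intro filterlim_compose[OF exp_at_bot] filterlim_compose[OF filterlim_uminus_at_bot_at_top])
  qed
  have F0: "(F \<longlongrightarrow> 0) at_infinity"
    by (rule Lim_null_comparison[OF _ gam0])
      (auto simp: F_def abs_mult less_imp_le[OF gam_pos] intro!: always_eventually mult_left_le)
  have "(LBINT s=-\<infinity>..\<infinity>. F' s) = 0 - 0"
  proof (rule interval_integral_FTC_integrable)
    fix s
    show "(F has_vector_derivative F' s) (at s)"
      unfolding has_real_derivative_iff_has_vector_derivative[symmetric] F_def gam_def F'_def
      by (auto intro!: derivative_eq_intros simp: field_simps)
    show "isCont F' s"
      unfolding F'_def gam_def by (intro continuous_intros)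
  next
    show "set_integrable lborel (einterval (-\<infinity>) \<infinity>) F'"
      unfolding set_integrable_def F'_def using int1 int2 by simp
    show "((F \<circ> real_of_ereal) \<longlongrightarrow> 0) (at_right (-\<infinity>))" "((F \<circ> real_of_ereal) \<longlongrightarrow> 0) (at_left \<infinity>)"
      unfolding ereal_tendsto_simps using F0 by (auto intro: tendsto_mono[OF at_bot_le_at_infinity] tendsto_mono[OF at_top_le_at_infinity])
  qed simp
  then have "(LINT s|lborel. F' s) = 0"
    by (simp add: interval_lebesgue_integral_def set_lebesgue_integral_def)
  then have "z * (2 * pi * phi t z) - s2 * t * (LINT s|lborel. s * sin (s * z) * gam t s) = 0"
    unfolding F'_def using int1 int2 cosint by simp
  then show ?thesis using s2_pos t by (simp add: D_def field_simps)
qed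

lemma D_bound: "0 < t \<Longrightarrow> \<bar>D t z\<bar> \<le> Imom 1 / t"
proof -
  assume t: "0 < t"
  have "norm (LINT s|lborel. s * sin (s * z) * gam t s) \<le> 0 * Imom 0 / sqrt t + 1 * Imom 1 / t + 0 * Imom 2 / (t * sqrt t) + 0 * Imom 3 / t\<^sup>2"
    by (rule gauss_dominated(2)[OF t]) (auto simp: abs_mult less_imp_le[OF gam_pos] mult.assoc intro!: mult_left_mono trig_gam)
  then have "pi * \<bar>D t z\<bar> \<le> Imom 1 / t"
    unfolding gam_sin_integral[OF t] by (simp add: abs_mult)
  moreover have "1 * \<bar>D t z\<bar> \<le> pi * \<bar>D t z\<bar>" using pi_ge_two by (intro mult_right_mono) auto
  ultimately show ?thesis by simp
qed

lemma D_diff: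
  assumes t: "0 < t" and u: "0 \<le> u"
  shows "\<bar>D (t + u) z - D t z\<bar> \<le> s2 * Imom 3 * u / t\<^sup>2"
proof -
  have tu: "0 < t + u" using t u by simp
  have int: "integrable lborel (\<lambda>s. s * sin (s * z) * gam t s)" if "0 < t" for t
    by (rule gauss_dominated(1)[OF that, of _ 0 1 0 0])
      (auto simp: abs_mult less_imp_le[OF gam_pos] mult.assoc intro!: mult_left_mono trig_gam)
  have eq: "pi * (D (t + u) z - D t z) = (LINT s|lborel. s * sin (s * z) * gam (t + u) s - s * sin (s * z) * gam t s)"
    unfolding right_diff_distrib gam_sin_integral[OF t, symmetric] gam_sin_integral[OF tu, symmetric]
    by (rule Bochner_Integration.integral_diff[symmetric]) (use int t tu in auto)
  have "norm (LINT s|lborel. s * sin (s * z) * gam (t + u) s - s * sin (s * z) * gam t s) \<le> 0 * Imom 0 / sqrt t + 0 * Imom 1 / t + 0 * Imom 2 / (t * sqrt t) + (s2 * u) * Imom 3 / t\<^sup>2"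
  proof (rule gauss_dominated(2)[OF t])
    fix s
    define w where "w = s2 / 2 * (u * s\<^sup>2)"
    have w: "0 \<le> w" using s2_pos u by (simp add: w_def)
    have "s * sin (s * z) * gam (t + u) s - s * sin (s * z) * gam t s = (s * sin (s * z)) * ((gam u s - 1) * gam t s)"
      by (simp add: gam_add algebra_simps)
    also have "norm \<dots> = \<bar>s\<bar> * \<bar>sin (s * z)\<bar> * (\<bar>1 - exp (- w)\<bar> * gam t s)"
      using gam_pos[of t s] by (simp add: abs_mult gam_def[of u] w_def abs_minus_commute)
    also have "\<dots> \<le> \<bar>s\<bar> * 1 * (w * gam t s)"
      using exp_minus_approx(2)[OF w] gam_pos[of t s] by (intro mult_mono) auto
    also have "\<dots> = (s2 * u / 2) * \<bar>s\<bar> ^ 3 * gam t s"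
      by (simp add: w_def power3_eq_cube power2_eq_square mult_ac)
    also have "\<dots> \<le> (0 + 0 * \<bar>s\<bar> + 0 * s\<^sup>2 + (s2 * u) * \<bar>s\<bar> ^ 3) * gam t s"
      using s2_pos u gam_pos[of t s] by (auto intro!: mult_right_mono)
    finally show "norm (s * sin (s * z) * gam (t + u) s - s * sin (s * z) * gam t s) \<le> (0 + 0 * \<bar>s\<bar> + 0 * s\<^sup>2 + (s2 * u) * \<bar>s\<bar> ^ 3) * gam t s" .
  qed measurable
  then have "\<bar>pi * (D (t + u) z - D t z)\<bar> \<le> s2 * Imom 3 * u / t\<^sup>2"
    unfolding eq[symmetric] by (simp add: mult.commute mult.left_commute)
  then have "pi * \<bar>D (t + u) z - D t z\<bar> \<le> s2 * Imom 3 * u / t\<^sup>2"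
    by (simp add: abs_mult)
  moreover have "1 * \<bar>D (t + u) z - D t z\<bar> \<le> pi * \<bar>D (t + u) z - D t z\<bar>" using pi_ge_two by (intro mult_right_mono) auto
  ultimately show ?thesis by simp
qed

definition W :: "real \<Rightarrow> real \<Rightarrow> 'x \<Rightarrow> real \<Rightarrow> complex" where
  "W z t x y = U t x (y - z) - U t x (y + z)"

text \<open>In Fourier form \<open>W\<close> carries the odd factor \<open>sin (s * z)\<close>. The
  constant term of the other factor integrates to 0; its linear term is
  \<open>s * (y + r x)\<close>, so the corrector in \<open>Gs\<close> is what makes the martingale
  \<open>M\<close> appear. The remainder is quadratic in \<open>s\<close>, and
  \<open>\<bar>sin (s * z)\<bar> \<le> 1\<close> makes the bound uniform in
  \<open>z\<close>.\<close>

lemma W_expansion: "\<exists>C>0. \<forall>t z x y. 0 < t \<longrightarrow> cmod (W z t x y - of_real (D t z * M x y)) \<le> C * (1 + y\<^sup>2) / (t * sqrt t)"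
proof -
  define C where "C = 4 * B * Imom 2 + 1"
  have "cmod (W z t x y - of_real (D t z * M x y)) \<le> C * (1 + y\<^sup>2) / (t * sqrt t)" if t: "0 < t" for t z x y
  proof -
    define k where "k s = - 2 * \<i> * of_real (sin (s * z) * gam t s)" for s
    define h where "h s = k s * (iexp (s * y) * Gs s x - 1 - \<i> * of_real (s * M x y))" for s
    have int0: "integrable lborel (\<lambda>s. sin (s * z) * gam t s)"
      by (rule gauss_dominated(1)[OF t, of _ 1 0 0 0]) (auto simp: abs_mult less_imp_le[OF gam_pos] trig_gam)
    have int1: "integrable lborel (\<lambda>s. s * sin (s * z) * gam t s)"
      by (rule gauss_dominated(1)[OF t, of _ 0 1 0 0])
        (auto simp: abs_mult less_imp_le[OF gam_pos] mult.assoc intro!: mult_left_mono trig_gam)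
    have odd: "(LINT s|lborel. sin (s * z) * gam t s) = 0"
      using lborel_integral_real_affine[of "-1" "\<lambda>s. sin (s * z) * gam t s" 0] by (simp add: gam_def)
    have W1: "W z t x y = of_real (1 / (2 * pi)) * (LINT s|lborel. k s * (iexp (s * y) * Gs s x))"
    proof -
      have "(LINT s|lborel. iexp (s * (y - z)) * Gs s x * of_real (gam t s)) - (LINT s|lborel. iexp (s * (y + z)) * Gs s x * of_real (gam t s))
         = (LINT s|lborel. k s * (iexp (s * y) * Gs s x))"
      proof (subst Bochner_Integration.integral_diff[symmetric])
        show "(LINT s|lborel. iexp (s * (y - z)) * Gs s x * of_real (gam t s) - iexp (s * (y + z)) * Gs s x * of_real (gam t s))
          = (LINT s|lborel. k s * (iexp (s * y) * Gs s x))"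
        proof (rule Bochner_Integration.integral_cong[OF refl])
          fix s
          have "iexp (s * (y - z)) - iexp (s * (y + z)) = iexp (s * y) * (- 2 * \<i> * of_real (sin (s * z)))"
            unfolding cis_conv_exp[symmetric] by (simp add: complex_eq_iff algebra_simps sin_add cos_add sin_diff cos_diff)
          then show "iexp (s * (y - z)) * Gs s x * of_real (gam t s) - iexp (s * (y + z)) * Gs s x * of_real (gam t s) = k s * (iexp (s * y) * Gs s x)"
            by (simp only: left_diff_distrib[symmetric]) (simp add: k_def)
        qed
      qed (rule U_integrable[OF t])+
      then show ?thesis unfolding W_def U_def right_diff_distrib[symmetric] by (rule arg_cong)
    qed
    have k0: "integrable lborel k" "(LINT s|lborel. k s) = 0"
      unfolding k_def using int0 odd by (auto simp del: of_real_mult)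
    have k1eq: "k s * (\<i> * of_real (s * M x y)) = of_real (2 * M x y * (s * sin (s * z) * gam t s))" for s
      by (simp add: k_def complex_eq_iff)
    have k1: "integrable lborel (\<lambda>s. k s * (\<i> * of_real (s * M x y)))"
        "(LINT s|lborel. k s * (\<i> * of_real (s * M x y))) = of_real (2 * pi * (D t z * M x y))"
      unfolding k1eq using int1 gam_sin_integral[OF t, of z] by (auto simp del: of_real_mult)
    have kW: "integrable lborel (\<lambda>s. k s * (iexp (s * y) * Gs s x))"
    proof (rule gauss_dominated(1)[OF t, of _ 2 "2 * B" "2 * B" 0])
      fix s
      have "cmod (k s) \<le> 2 * gam t s"
        unfolding k_def using gam_pos[of t s] by (simp add: norm_mult abs_mult mult_left_le_one_le)
      then have "cmod (k s) * cmod (Gs s x) \<le> 2 * gam t s * (1 + B * \<bar>s\<bar> + B * s\<^sup>2)"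
        using norm_Gs[of s x] gam_pos[of t s] by (intro mult_mono) auto
      then show "cmod (k s * (iexp (s * y) * Gs s x)) \<le> (2 + 2 * B * \<bar>s\<bar> + 2 * B * s\<^sup>2 + 0 * \<bar>s\<bar> ^ 3) * gam t s"
        by (simp add: norm_mult algebra_simps)
    qed (unfold k_def, measurable)
    have "W z t x y - of_real (D t z * M x y) = of_real (1 / (2 * pi)) * ((LINT s|lborel. k s * (iexp (s * y) * Gs s x)) - (LINT s|lborel. k s) - (LINT s|lborel. k s * (\<i> * of_real (s * M x y))))"
      unfolding W1 k0 k1 by (simp add: right_diff_distrib)
    also have "(LINT s|lborel. k s * (iexp (s * y) * Gs s x)) - (LINT s|lborel. k s) - (LINT s|lborel. k s * (\<i> * of_real (s * M x y))) = (LINT s|lborel. h s)"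
      unfolding h_def right_diff_distrib using kW k0 k1 by simp
    finally have eq: "W z t x y - of_real (D t z * M x y) = of_real (1 / (2 * pi)) * (LINT s|lborel. h s)" .
    have "cmod (LINT s|lborel. h s) \<le> 0 * Imom 0 / sqrt t + 0 * Imom 1 / t + (4 * B * (1 + y\<^sup>2)) * Imom 2 / (t * sqrt t) + 0 * Imom 3 / t\<^sup>2"
    proof (rule gauss_dominated(2)[OF t])
      fix s
      have "iexp (s * y) * Gs s x - 1 - \<i> * of_real (s * M x y)
         = (iexp (s * y) - (1 + \<i> * of_real (s * y))) + \<i> * of_real (s * r x) * (iexp (s * y) - 1) - of_real (s\<^sup>2 * q x) * iexp (s * y)"
        by (simp add: Gs_def M_def algebra_simps)
      also have "cmod \<dots> \<le> cmod (iexp (s * y) - (1 + \<i> * of_real (s * y))) + cmod (\<i> * of_real (s * r x) * (iexp (s * y) - 1)) + cmod (of_real (s\<^sup>2 * q x) * iexp (s * y))"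
        by (rule order_trans[OF norm_triangle_ineq4]) (intro add_right_mono norm_triangle_ineq)
      also have "\<dots> \<le> (s * y)\<^sup>2 / 2 + (\<bar>s\<bar> * B) * \<bar>s * y\<bar> + s\<^sup>2 * B"
      proof (intro add_mono)
        show "cmod (iexp (s * y) - (1 + \<i> * of_real (s * y))) \<le> (s * y)\<^sup>2 / 2" by (rule iexp_approx_1)
        have "\<bar>s\<bar> * \<bar>r x\<bar> * cmod (iexp (s * y) - 1) \<le> (\<bar>s\<bar> * B) * \<bar>s * y\<bar>"
          using B_ge_1 by (intro mult_mono mult_left_mono B_bounds iexp_approx_0) auto
        then show "cmod (\<i> * of_real (s * r x) * (iexp (s * y) - 1)) \<le> (\<bar>s\<bar> * B) * \<bar>s * y\<bar>"
          by (simp only: norm_mult norm_of_real norm_ii mult_1_left abs_mult)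
        have "\<bar>s\<^sup>2\<bar> * \<bar>q x\<bar> \<le> s\<^sup>2 * B" using B_bounds(3)[of x] by (simp add: mult_left_mono)
        then show "cmod (of_real (s\<^sup>2 * q x) * iexp (s * y)) \<le> s\<^sup>2 * B"
          by (simp only: norm_mult norm_of_real norm_exp_i_times mult_1_right abs_mult)
      qed
      also have "\<dots> = s\<^sup>2 * (y\<^sup>2 / 2 + B * \<bar>y\<bar> + B)"
        by (simp add: power2_eq_square abs_mult algebra_simps)
      also have "\<dots> \<le> s\<^sup>2 * (2 * B * (1 + y\<^sup>2))"
      proof (rule mult_left_mono)
        have "0 \<le> (\<bar>y\<bar> - 1)\<^sup>2" by simp
        then have "\<bar>y\<bar> \<le> (1 + y\<^sup>2) / 2" by (simp add: power2_eq_square algebra_simps)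
        then have "B * \<bar>y\<bar> \<le> B * ((1 + y\<^sup>2) / 2)" using B_ge_1 by (intro mult_left_mono) auto
        also have "\<dots> = B / 2 + B * y\<^sup>2 / 2" by (simp add: field_simps)
        finally have "B * \<bar>y\<bar> \<le> B / 2 + B * y\<^sup>2 / 2" .
        moreover have "1 * y\<^sup>2 \<le> B * y\<^sup>2" using B_ge_1 by (intro mult_right_mono) auto
        moreover have "0 \<le> y\<^sup>2" by simp
        moreover have "2 * B * (1 + y\<^sup>2) = 2 * B + 2 * (B * y\<^sup>2)" by (simp add: algebra_simps)
        ultimately show "y\<^sup>2 / 2 + B * \<bar>y\<bar> + B \<le> 2 * B * (1 + y\<^sup>2)" using B_ge_1 by linarith
      qed simp
      finally have 1: "cmod (iexp (s * y) * Gs s x - 1 - \<i> * of_real (s * M x y)) \<le> s\<^sup>2 * (2 * B * (1 + y\<^sup>2))" .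
      have "cmod (k s) \<le> 2 * gam t s"
        unfolding k_def using gam_pos[of t s] by (simp add: norm_mult abs_mult mult_left_le_one_le)
      then have "cmod (h s) \<le> 2 * gam t s * (s\<^sup>2 * (2 * B * (1 + y\<^sup>2)))"
        unfolding h_def norm_mult using 1 gam_pos[of t s] by (intro mult_mono) auto
      then show "cmod (h s) \<le> (0 + 0 * \<bar>s\<bar> + (4 * B * (1 + y\<^sup>2)) * s\<^sup>2 + 0 * \<bar>s\<bar> ^ 3) * gam t s"
        by (simp add: algebra_simps)
    qed (unfold h_def k_def, measurable)
    also have "\<dots> \<le> C * (1 + y\<^sup>2) / (t * sqrt t)"
      using t by (auto simp: C_def algebra_simps intro!: divide_right_mono)
    finally have "cmod (LINT s|lborel. h s) \<le> C * (1 + y\<^sup>2) / (t * sqrt t)" .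
    moreover note norm_inv_2pi
    ultimately have "cmod (W z t x y - of_real (D t z * M x y)) \<le> 1 * (C * (1 + y\<^sup>2) / (t * sqrt t))"
      unfolding eq norm_mult by (intro mult_mono) auto
    then show ?thesis by simp
  qed
  moreover have "0 < C" using B_ge_1 Imom_nonneg[of 2] by (simp add: C_def add_nonneg_pos)
  ultimately show ?thesis by blast
qed

lemma inverse_powers_le:
  assumes "0 < n" "n / 2 \<le> (t::real)"
  shows "1 / t\<^sup>2 \<le> 4 / n\<^sup>2" "1 / (t * sqrt t) \<le> 4 / (n * sqrt n)"
proof -
  have t: "0 < t" using assms by simp
  have "(n / 2)\<^sup>2 \<le> t\<^sup>2" using assms by (intro power_mono) auto
  then have "1 / t\<^sup>2 \<le> 1 / (n / 2)\<^sup>2" using assms t by (intro divide_left_mono) auto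
  then show "1 / t\<^sup>2 \<le> 4 / n\<^sup>2" by (simp add: power_divide)
  have "sqrt (n / 4) \<le> sqrt t" using assms by simp
  moreover have "sqrt (n / 4) = sqrt n / 2" by (simp add: real_sqrt_divide)
  ultimately have "(n / 2) * (sqrt n / 2) \<le> t * sqrt t" using assms t by (intro mult_mono) auto
  then have "1 / (t * sqrt t) \<le> 1 / ((n / 2) * (sqrt n / 2))" using assms t by (intro divide_left_mono) auto
  then show "1 / (t * sqrt t) \<le> 4 / (n * sqrt n)" by simp
qed

lemma U_shift_step:
  assumes "\<And>x y. cmod (T (U t) x y - U (t + 1) x y) \<le> e"
  shows "cmod (T (\<lambda>x y. U t x (y + h)) x y - U (t + 1) x (y + h)) \<le> e"
  using assms[of x "y + h"] tpow_shift[of 1 P f "U t" h] by simp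

text \<open>The odd Gaussian \<open>W z\<close> vanishes to first order at the boundary, so the killed walk started from \<open>y\<close>
  only sees its slope \<open>D\<close> at the origin, multiplied by the harmonic function.\<close>

lemma kpow_W_asymp:
  "\<exists>C>0. \<forall>n z x y. 2 \<le> n \<longrightarrow> - B \<le> y \<longrightarrow>
     cmod ((Q ^^ (n div 2)) (W z (real (n - n div 2))) x y - of_real (D (real n) z * V x y))
        \<le> C * (1 + max y 0)\<^sup>2 / (real n * sqrt (real n))"
proof -
  obtain CU where CU: "0 < CU" "\<And>t x y. 0 < t \<Longrightarrow> cmod (T (U t) x y - U (t + 1) x y) \<le> CU / t\<^sup>2"
    using U_step by blast
  obtain CW where CW: "0 < CW" "\<And>t z x y. 0 < t \<Longrightarrow> cmod (W z t x y - of_real (D t z * M x y)) \<le> CW * (1 + y\<^sup>2) / (t * sqrt t)"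
    using W_expansion by blast
  obtain CS where CS: "0 < CS" "\<And>n x y. (\<Sum>j<n. surv j x y) \<le> CS * (1 + max y 0) * sqrt (real n)"
    using surv_sum_bound by blast
  obtain CT where CT: "0 < CT" "\<And>n x y. 0 < n \<Longrightarrow> surv n x y \<le> CT * (1 + max y 0) / sqrt (real n)"
    using surv_bound by blast
  define a1 where "a1 = 4 * CW * (1 + 4 * B\<^sup>2)"
  define a2 where "a2 = 12 * B * s2 * Imom 3"
  have a: "0 \<le> a1" "0 \<le> a2" using CW s2_pos B_ge_1 Imom_nonneg[of 3] by (auto simp: a1_def a2_def)
  define C where "C = 8 * CU * CS + a1 + a2 * CS + 2 * CW * B\<^sup>2 + 6 * B * Imom 1 * CT"
  have "cmod ((Q ^^ (n div 2)) (W z (real (n - n div 2))) x y - of_real (D (real n) z * V x y))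
        \<le> C * (1 + max y 0)\<^sup>2 / (real n * sqrt (real n))" if n: "2 \<le> n" and y: "- B \<le> y" for n z x y
  proof -
    define k where "k = n div 2"
    define m where "m = n - k"
    have mk: "m + k = n" "0 < k" "real n / 2 \<le> real m" "real n / 4 \<le> real k" "k \<le> n" using n by (auto simp: m_def k_def)
    have n0: "0 < real n" using n by simp
    define Y where "Y = 1 + max y 0"
    have Y1: "1 \<le> Y" by (simp add: Y_def)
    have Y: "1 \<le> Y" "Y \<le> Y\<^sup>2" using Y1 mult_left_mono[of 1 Y Y] by (auto simp: power2_eq_square)
    define N' where "N' = real n * sqrt (real n)"
    have N': "0 < N'" using n0 by (simp add: N'_def)
    \<comment> \<open>The slope is frozen at the final time \<open>n\<close>. Since \<open>M\<close>
      is invariant under the free move, the subtraction leaves the defect of \<open>W\<close>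
      unchanged, while it cancels the leading boundary values.\<close>
    define H where "H t = (\<lambda>x y. W z (real t) x y - of_real (D (real n) z * M x y))" for t :: nat
    define \<beta> where "\<beta> t = a1 / N' + a2 * (real n - real t) / (real n)\<^sup>2" for t :: nat
    have tel: "norm ((Q ^^ k) (H m) x y - H (m + k) x y)
      \<le> (8 * CU / (real n)\<^sup>2) * (\<Sum>j<k. surv j x y) + (\<Sum>j<k. \<beta> (m + k - Suc j) * (surv j x y - surv (Suc j) x y))"
    proof (rule kpow_telescope_bound[where B = B])
      fix t x y assume t: "m \<le> t"
      have t0: "real n / 2 \<le> real t" using mk(3) t by (meson of_nat_le_iff order_trans)
      then have t0: "real n / 2 \<le> real t" "0 < real t" using n0 by linarith+
      have TM: "T (\<lambda>x y. complex_of_real (D (real n) z * M x y)) x y = of_real (D (real n) z * M x y)"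
      proof -
        have "T (\<lambda>x y. D (real n) z * M x y) x y = D (real n) z * T M x y"
          using tpow_mult[of 1 P f "D (real n) z" M] by simp
        then show ?thesis unfolding step_of_real step_M by (simp only:)
      qed
      have TW: "T (W z t) x y = T (\<lambda>x y. U t x (y + - z)) x y - T (\<lambda>x y. U t x (y + z)) x y"
        unfolding W_def by (simp add: step_diff)
      have a: "cmod (T (\<lambda>x y. U t x (y + h)) x y - U (real t + 1) x (y + h)) \<le> CU / (real t)\<^sup>2" for h
        by (rule U_shift_step) (rule CU(2)[OF t0(2)])
      have "T (H t) x y - H (Suc t) x y = (T (\<lambda>x y. U t x (y + - z)) x y - U (real t + 1) x (y + - z)) - (T (\<lambda>x y. U t x (y + z)) x y - U (real t + 1) x (y + z))"
        unfolding H_def step_diff TM TW by (simp add: W_def add.commute)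
      then have "norm (T (H t) x y - H (Suc t) x y) \<le> CU / (real t)\<^sup>2 + CU / (real t)\<^sup>2"
        using norm_triangle_le_diff[OF add_mono[OF a[of "- z"] a[of z]]] by (simp only:)
      also have "\<dots> = 2 * CU * (1 / (real t)\<^sup>2)" by simp
      also have "\<dots> \<le> 2 * CU * (4 / (real n)\<^sup>2)"
        using inverse_powers_le(1)[OF n0 t0(1)] CU by (intro mult_left_mono) auto
      finally show "norm (T (H t) x y - H (Suc t) x y) \<le> 8 * CU / (real n)\<^sup>2" by simp
    next
      fix t x y assume t: "m \<le> t" "t < m + k" and y: "- 2 * B \<le> y" "y \<le> 0"
      have t0: "real n / 2 \<le> real t" using mk(3) t(1) by (meson of_nat_le_iff order_trans)
      then have t0: "real n / 2 \<le> real t" "0 < real t" "real t \<le> real n" using n0 t(2) mk(1) by simp_all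
      have y2: "y\<^sup>2 \<le> 4 * B\<^sup>2" using y power_mono[of "- y" "2 * B" 2] by (simp add: power_mult_distrib)
      have "norm (W z t x y - of_real (D t z * M x y)) \<le> CW * (1 + y\<^sup>2) * (1 / (t * sqrt t))"
        using CW(2)[OF t0(2), of z x y] by simp
      also have "\<dots> \<le> CW * (1 + 4 * B\<^sup>2) * (4 / N')"
        using inverse_powers_le(2)[OF n0 t0(1)] CW y2 t0 unfolding N'_def by (intro mult_mono) auto
      finally have 1: "norm (W z t x y - of_real (D t z * M x y)) \<le> a1 / N'" by (simp add: a1_def mult_ac)
      have M: "\<bar>M x y\<bar> \<le> 3 * B" using y B_bounds(2)[of x] by (simp add: M_def abs_le_iff)
      have "\<bar>D n z - D t z\<bar> \<le> s2 * Imom 3 * (real n - real t) * (1 / (real t)\<^sup>2)"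
        using D_diff[of "real t" "real n - real t" z] t0 by simp
      also have "\<dots> \<le> s2 * Imom 3 * (real n - real t) * (4 / (real n)\<^sup>2)"
        using inverse_powers_le(1)[OF n0 t0(1)] s2_pos Imom_nonneg[of 3] t0 by (intro mult_left_mono) auto
      finally have "\<bar>D n z - D t z\<bar> * \<bar>M x y\<bar> \<le> s2 * Imom 3 * (real n - real t) * (4 / (real n)\<^sup>2) * (3 * B)"
        using M B_ge_1 by (intro mult_mono) auto
      then have 2: "norm (complex_of_real ((D t z - D n z) * M x y)) \<le> a2 * (real n - real t) / (real n)\<^sup>2"
        unfolding norm_of_real abs_mult by (simp add: a2_def abs_minus_commute mult_ac)
      have "H t x y = (W z t x y - of_real (D t z * M x y)) + of_real ((D t z - D n z) * M x y)"
        by (simp add: H_def algebra_simps)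
      then show "norm (H t x y) \<le> \<beta> t"
        unfolding \<beta>_def using norm_triangle_mono[OF 1 2] by simp
    qed (use y B_bounds in auto)
    have s1: "(8 * CU / (real n)\<^sup>2) * (\<Sum>j<k. surv j x y) \<le> 8 * CU * CS * Y\<^sup>2 / N'"
    proof -
      have "(\<Sum>j<k. surv j x y) \<le> CS * Y * sqrt (real k)" unfolding Y_def by (rule CS)
      also have "\<dots> \<le> CS * Y\<^sup>2 * sqrt (real n)" using CS Y mk by (intro mult_mono) auto
      finally have "(8 * CU / (real n)\<^sup>2) * (\<Sum>j<k. surv j x y) \<le> (8 * CU / (real n)\<^sup>2) * (CS * Y\<^sup>2 * sqrt (real n))"
        using CU by (intro mult_left_mono) auto
      also have "\<dots> = 8 * CU * CS * Y\<^sup>2 / N'"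
        using n0 by (simp add: N'_def field_simps power2_eq_square) 
      finally show ?thesis .
    qed
    have s2: "(\<Sum>j<k. \<beta> (m + k - Suc j) * (surv j x y - surv (Suc j) x y)) \<le> (a1 + a2 * CS) * Y\<^sup>2 / N'"
    proof -
      have "(\<Sum>j<k. \<beta> (m + k - Suc j) * (surv j x y - surv (Suc j) x y))
         = (\<Sum>j<k. (a1 / N') * (surv j x y - surv (Suc j) x y) + (a2 / (real n)\<^sup>2) * (real (Suc j) * (surv j x y - surv (Suc j) x y)))"
      proof (rule sum.cong[OF refl])
        fix j assume "j \<in> {..<k}"
        then have eq: "real n - real (m + k - Suc j) = real (Suc j)" using mk by auto
        then show "\<beta> (m + k - Suc j) * (surv j x y - surv (Suc j) x y) = (a1 / N') * (surv j x y - surv (Suc j) x y) + (a2 / (real n)\<^sup>2) * (real (Suc j) * (surv j x y - surv (Suc j) x y))"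
          unfolding \<beta>_def eq by (simp only: distrib_right times_divide_eq_left mult.assoc)
      qed
      also have "\<dots> = (a1 / N') * (1 - surv k x y) + (a2 / (real n)\<^sup>2) * (\<Sum>j<k. real (Suc j) * (surv j x y - surv (Suc j) x y))"
        by (simp only: sum.distrib sum_distrib_left[symmetric] sum_surv_diff)
      \<comment> \<open>Abel summation: the mean of the exit time truncated to exits before
        \<open>k\<close> is at most a sum of survival probabilities, of order sqrt n. The growing
        part of \<open>\<beta>\<close> thus costs only n^(-3/2).\<close>
      also have "(\<Sum>j<k. real (Suc j) * (surv j x y - surv (Suc j) x y)) = (\<Sum>j<k. surv j x y) - real k * surv k x y"
        by (induction k) (simp_all add: algebra_simps)
      also have "(a1 / N') * (1 - surv k x y) + (a2 / (real n)\<^sup>2) * ((\<Sum>j<k. surv j x y) - real k * surv k x y)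
          \<le> (a1 / N') * Y\<^sup>2 + (a2 / (real n)\<^sup>2) * (CS * Y\<^sup>2 * sqrt (real n))"
      proof (intro add_mono mult_left_mono)
        show "1 - surv k x y \<le> Y\<^sup>2" using surv_nonneg[of k x y] Y by linarith
        have "(\<Sum>j<k. surv j x y) \<le> CS * Y * sqrt (real k)" unfolding Y_def by (rule CS)
        also have "\<dots> \<le> CS * Y\<^sup>2 * sqrt (real n)" using CS Y mk by (intro mult_mono) auto
        finally show "(\<Sum>j<k. surv j x y) - real k * surv k x y \<le> CS * Y\<^sup>2 * sqrt (real n)"
          using surv_nonneg[of k x y] by (simp add: add_increasing2 diff_le_eq)
      qed (use a N' in auto)
      also have "\<dots> = (a1 + a2 * CS) * Y\<^sup>2 / N'"
        using n0 by (simp add: N'_def field_simps power2_eq_square)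
      finally show ?thesis .
    qed
    have s3: "norm (H (m + k) x y) \<le> 2 * CW * B\<^sup>2 * Y\<^sup>2 / N'"
    proof -
      have "norm (H (m + k) x y) \<le> CW * (1 + y\<^sup>2) / N'"
        unfolding H_def mk(1) N'_def using CW(2)[OF n0] by simp
      also have "\<dots> \<le> CW * (2 * B\<^sup>2 * Y\<^sup>2) / N'"
      proof (intro divide_right_mono mult_left_mono)
        have "\<bar>y\<bar> \<le> B * Y"
        proof -
          have "1 * max y 0 \<le> B * max y 0" using B_ge_1 by (intro mult_right_mono) auto
          moreover have "\<bar>y\<bar> \<le> max y 0 + B" using y B_ge_1 by auto
          ultimately show ?thesis unfolding Y_def distrib_left by linarith
        qed
        then have "\<bar>y\<bar>\<^sup>2 \<le> (B * Y)\<^sup>2" by (intro power_mono) auto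
        moreover have "1 * 1 \<le> B\<^sup>2 * Y\<^sup>2" using B_ge_1 Y by (intro mult_mono) auto
        ultimately show "1 + y\<^sup>2 \<le> 2 * B\<^sup>2 * Y\<^sup>2" by (simp add: power_mult_distrib)
      qed (use CW N' in auto)
      finally show ?thesis by (simp add: mult_ac)
    qed
    have s4: "norm (complex_of_real (D n z * ((Q ^^ k) M x y - V x y))) \<le> 6 * B * Imom 1 * CT * Y\<^sup>2 / N'"
    proof -
      have "surv k x y \<le> CT * Y / sqrt (real k)" unfolding Y_def by (rule CT(2)[OF mk(2)])
      also have "\<dots> \<le> CT * Y\<^sup>2 / (sqrt (real n) / 2)"
      proof (intro frac_le mult_left_mono)
        have "sqrt (real n / 4) \<le> sqrt (real k)" using mk(4) by simp
        then show "sqrt (real n) / 2 \<le> sqrt (real k)" by (simp add: real_sqrt_divide)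
      qed (use CT Y n0 in auto)
      finally have "3 * B * surv k x y \<le> 3 * B * (CT * Y\<^sup>2 / (sqrt (real n) / 2))"
        using B_ge_1 by (intro mult_left_mono) auto
      then have "\<bar>(Q ^^ k) M x y - V x y\<bar> \<le> 3 * B * (CT * Y\<^sup>2 / (sqrt (real n) / 2))"
        using V_approx[OF y, of k x] by linarith
      then have "\<bar>D n z\<bar> * \<bar>(Q ^^ k) M x y - V x y\<bar> \<le> (Imom 1 / real n) * (3 * B * (CT * Y\<^sup>2 / (sqrt (real n) / 2)))"
        using D_bound[OF n0, of z] Imom_nonneg[of 1] n0 by (intro mult_mono) auto
      also have "\<dots> = 6 * B * Imom 1 * CT * Y\<^sup>2 / N'" by (simp add: N'_def)
      finally show ?thesis unfolding norm_of_real abs_mult .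
    qed
    have HQ: "(Q ^^ k) (H m) x y = (Q ^^ k) (W z (real m)) x y - of_real (D n z * (Q ^^ k) M x y)"
      unfolding H_def kpow_diff kpow_of_real kpow_mult by simp
    have eq: "(Q ^^ k) (W z (real m)) x y - of_real (D n z * V x y)
       = ((Q ^^ k) (H m) x y - H (m + k) x y) + H (m + k) x y + of_real (D n z * ((Q ^^ k) M x y - V x y))"
      unfolding HQ by (simp add: algebra_simps)
    have "norm ((Q ^^ k) (W z (real m)) x y - of_real (D n z * V x y)) \<le> (8 * CU * CS * Y\<^sup>2 / N' + (a1 + a2 * CS) * Y\<^sup>2 / N') + 2 * CW * B\<^sup>2 * Y\<^sup>2 / N' + 6 * B * Imom 1 * CT * Y\<^sup>2 / N'"
      unfolding eq using tel s1 s2 s3 s4 by (intro norm_triangle_le add_mono order_trans[OF tel]) auto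
    also have "\<dots> = C * Y\<^sup>2 / N'" by (simp add: C_def add_divide_distrib distrib_right)
    finally show ?thesis unfolding k_def m_def Y_def N'_def .
  qed
  moreover have "0 < C"
  proof -
    have "0 < CU * CS" "0 \<le> a2 * CS" "0 \<le> CW * B\<^sup>2" "0 \<le> B * Imom 1 * CT"
      using CU CS CW CT a B_ge_1 Imom_nonneg[of 1] by auto
    then show ?thesis using a unfolding C_def by (simp add: mult.assoc)
  qed
  ultimately show ?thesis by blast
qed

end

section \<open>Decay of the characteristic operator\<close>

text \<open>Equality case of the triangle inequality: after rotating the sum to the positive axis,
  the amounts by which the real parts fall short of the moduli are nonnegative and add up to
  0.\<close>

lemma sum_norm_eq_imp_aligned:
  fixes a :: "'a \<Rightarrow> complex"
  assumes "finite A" and eq: "cmod (\<Sum>v\<in>A. a v) = (\<Sum>v\<in>A. cmod (a v))"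
    and nz: "(\<Sum>v\<in>A. a v) \<noteq> 0" and v: "v \<in> A"
  shows "a v = of_real (cmod (a v)) * ((\<Sum>v\<in>A. a v) / of_real (cmod (\<Sum>v\<in>A. a v)))"
proof -
  define S where "S = (\<Sum>v\<in>A. a v)"
  define u where "u = S / of_real (cmod S)"
  have S: "S \<noteq> 0" using nz by (simp add: S_def)
  have u: "cmod u = 1" "u * cnj u = 1"
    using S by (auto simp: u_def norm_divide complex_norm_square[symmetric] power2_eq_square field_simps)
  have "S * cnj u = of_real (cmod S)"
    using S by (simp add: u_def complex_norm_square[symmetric] power2_eq_square)
  then have "Re (S * cnj u) = cmod S" by simp
  then have "(\<Sum>v\<in>A. Re (a v * cnj u)) = cmod S"
    by (simp only: S_def sum_distrib_right Re_sum)
  then have "(\<Sum>v\<in>A. cmod (a v) - Re (a v * cnj u)) = 0"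
    using eq by (simp add: S_def sum_subtractf)
  moreover have le: "Re (a v * cnj u) \<le> cmod (a v)" for v
    using complex_Re_le_cmod[of "a v * cnj u"] u by (simp add: norm_mult)
  ultimately have "cmod (a v) - Re (a v * cnj u) = 0"
    using v \<open>finite A\<close> by (subst (asm) sum_nonneg_eq_0_iff) auto
  then have "Re (a v * cnj u) = cmod (a v * cnj u)"
    using u by (simp add: norm_mult)
  then have "a v * cnj u = of_real (cmod (a v * cnj u))"
    by (metis complex_eq_iff complex_of_real_def complex.sel cmod_eq_Re norm_complex_def cmod_Re_le_iff Re_complex_of_real Im_complex_of_real cmod_power2 add_left_cancel add.right_neutral power_zero_numeral power_eq_0_iff zero_neq_numeral)
  then have "a v * (cnj u * u) = of_real (cmod (a v)) * u"
    using u by (simp add: norm_mult mult.assoc[symmetric])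
  then show ?thesis
    using u by (simp add: mult.commute u_def S_def)
qed

text \<open>Matrix entries of the n-th power of \<open>chop P f s\<close>: path probabilities from
  \<open>x\<close> to \<open>w\<close>, each carrying the phase of the accumulated
  \<open>f\<close>.\<close>

definition Ker :: "('x::finite \<Rightarrow> 'x \<Rightarrow> real) \<Rightarrow> ('x \<Rightarrow> real) \<Rightarrow> real \<Rightarrow> nat \<Rightarrow> 'x \<Rightarrow> 'x \<Rightarrow> complex" where
  "Ker P f s n x w = (chop P f s ^^ n) (\<lambda>v. if v = w then 1 else 0) x"

lemma chop_pow_Ker: "(chop P f s ^^ n) g x = (\<Sum>w\<in>UNIV. g w * Ker P f s n x w)"
proof (induction n arbitrary: x)
  case 0
  then show ?case by (simp add: Ker_def if_distrib[of "\<lambda>c. _ * c"] cong: if_cong)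
next
  case (Suc n)
  have "(chop P f s ^^ Suc n) g x = (\<Sum>x'\<in>UNIV. P x x' *\<^sub>R (iexp (s * f x') * (\<Sum>w\<in>UNIV. g w * Ker P f s n x' w)))"
    unfolding funpow.simps comp_def chop_def[of P f s "(chop P f s ^^ n) g"] Suc ..
  also have "\<dots> = (\<Sum>x'\<in>UNIV. \<Sum>w\<in>UNIV. g w * (P x x' *\<^sub>R (iexp (s * f x') * Ker P f s n x' w)))"
    by (simp add: sum_distrib_left scaleR_sum_right scaleR_conv_of_real mult_ac)
  also have "\<dots> = (\<Sum>w\<in>UNIV. \<Sum>x'\<in>UNIV. g w * (P x x' *\<^sub>R (iexp (s * f x') * Ker P f s n x' w)))"
    by (rule sum.swap)
  also have "\<dots> = (\<Sum>w\<in>UNIV. g w * Ker P f s (Suc n) x w)"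
    unfolding sum_distrib_left[symmetric] Ker_def funpow.simps comp_def chop_def[of P f s "(chop P f s ^^ n) _"] ..
  finally show ?case .
qed

lemma Ker_0: "Ker P f s 0 x w = (if x = w then 1 else 0)"
  by (simp add: Ker_def)

lemma Ker_Suc: "Ker P f s (Suc n) x w = (\<Sum>v\<in>UNIV. Ker P f s n x v * (P v w *\<^sub>R iexp (s * f w)))"
proof -
  have "Ker P f s (Suc n) x w = (chop P f s ^^ n) (chop P f s (\<lambda>v. if v = w then 1 else 0)) x"
    by (simp add: Ker_def funpow_swap1)
  also have "chop P f s (\<lambda>v. if v = w then 1 else 0) = (\<lambda>v. P v w *\<^sub>R iexp (s * f w))"
    by (simp add: chop_def fun_eq_iff if_distrib[of "\<lambda>c. _ * c"] if_distrib[of "\<lambda>c. _ *\<^sub>R c"] cong: if_cong)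
  finally show ?thesis by (simp add: chop_pow_Ker mult.commute)
qed

context markov_walk
begin

lemma Ker_le: "cmod (Ker P f s n x w) \<le> Ppow P n x w"
proof (induction n arbitrary: w)
  case (Suc n)
  have "cmod (Ker P f s (Suc n) x w) \<le> (\<Sum>v\<in>UNIV. cmod (Ker P f s n x v) * P v w)"
    unfolding Ker_Suc by (rule order_trans[OF norm_sum]) (simp add: norm_mult P_nonneg mult.commute)
  also have "\<dots> \<le> (\<Sum>v\<in>UNIV. Ppow P n x v * P v w)"
    by (intro sum_mono mult_right_mono Suc P_nonneg)
  finally show ?case by simp
qed (simp add: Ker_0)

definition row :: "real \<Rightarrow> nat \<Rightarrow> 'x \<Rightarrow> real" where
  "row s n x = (\<Sum>w\<in>UNIV. cmod (Ker P f s n x w))"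

lemma row_Suc_le: "row s (Suc n) x \<le> row s n x"
proof -
  have "row s (Suc n) x \<le> (\<Sum>w\<in>UNIV. \<Sum>v\<in>UNIV. cmod (Ker P f s n x v) * P v w)"
    unfolding row_def Ker_Suc
    by (intro sum_mono order_trans[OF norm_sum]) (simp add: norm_mult P_nonneg)
  also have "\<dots> = (\<Sum>v\<in>UNIV. \<Sum>w\<in>UNIV. cmod (Ker P f s n x v) * P v w)"
    by (rule sum.swap)
  also have "\<dots> = row s n x"
    by (simp add: sum_distrib_left[symmetric] P_sum row_def)
  finally show ?thesis .
qed

lemma row_antimono: "m \<le> n \<Longrightarrow> row s n x \<le> row s m x"
  by (rule lift_Suc_antimono_le[of "\<lambda>n. row s n x"]) (auto intro: row_Suc_le)

lemma chop_pow_le_row: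
  assumes "\<And>w. cmod (g w) \<le> c"
  shows "cmod ((chop P f s ^^ n) g x) \<le> c * row s n x"
proof -
  have "cmod ((chop P f s ^^ n) g x) \<le> (\<Sum>w\<in>UNIV. c * cmod (Ker P f s n x w))"
    unfolding chop_pow_Ker by (rule order_trans[OF norm_sum]) (auto simp: norm_mult intro!: sum_mono mult_right_mono assms)
  then show ?thesis by (simp add: row_def sum_distrib_left)
qed

text \<open>The induction applies the hypothesis to the function divided by \<open>q ^ j\<close>;
  hence the separate case \<open>q = 0\<close>.\<close>

lemma chop_pow_iterate:
  assumes q: "\<And>g x. (\<And>w. cmod (g w) \<le> 1) \<Longrightarrow> cmod ((chop P f s ^^ n) g x) \<le> q"
    and g: "\<And>w. cmod (g w) \<le> 1"
  shows "cmod ((chop P f s ^^ (j * n)) g x) \<le> q ^ j"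
proof (induction j arbitrary: x)
  case (Suc j)
  have q0: "0 \<le> q" using q[of g undefined] g norm_ge_zero order_trans by blast
  show ?case
  proof (cases "q = 0")
    case True
    have "cmod ((chop P f s ^^ (Suc j * n)) g x) \<le> 0"
    proof -
      have "(chop P f s ^^ (Suc j * n)) g x = (chop P f s ^^ n) ((chop P f s ^^ (j * n)) g) x"
        by (simp add: funpow_add)
      moreover have "cmod ((chop P f s ^^ (j * n)) g w) \<le> 1" for w
        using norm_chop_pow_le[OF g] .
      ultimately show ?thesis using q[of "(chop P f s ^^ (j * n)) g" x] True by simp
    qed
    then show ?thesis using True by simp
  next
    case False
    then have qp: "0 < q ^ j" using q0 by simp
    define h where "h w = of_real (1 / q ^ j) * (chop P f s ^^ (j * n)) g w" for w
    have h: "cmod (h w) \<le> 1" for w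
      unfolding h_def norm_mult norm_of_real using Suc[of w] qp q0 by (simp add: field_simps)
    have "(chop P f s ^^ n) h x = of_real (1 / q ^ j) * (chop P f s ^^ n) ((chop P f s ^^ (j * n)) g) x"
      unfolding h_def chop_pow_mult ..
    then have "cmod (of_real (1 / q ^ j) * (chop P f s ^^ (Suc j * n)) g x) \<le> q"
      using q[of h x] h by (simp add: funpow_add)
    then show ?thesis using qp unfolding norm_mult norm_of_real by (simp add: field_simps)
  qed
qed (simp add: g)

text \<open>The contraction is used \<open>t div n\<close> times, and the factor
  \<open>1 / q\<close> pays for the incomplete block.\<close>

lemma chop_pow_decay:
  assumes q: "\<And>g x. (\<And>w. cmod (g w) \<le> 1) \<Longrightarrow> cmod ((chop P f s ^^ n) g x) \<le> q"
    and g: "\<And>w. cmod (g w) \<le> 1" and q01: "0 < q" "q < 1" and n: "0 < n"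
  shows "cmod ((chop P f s ^^ t) g x) \<le> (1 / q) * exp (- (ln (1 / q) / real n * real t))"
proof -
  define L where "L = ln (1 / q)"
  have L: "0 < L" "exp (- L) = q" using q01 by (auto simp: L_def ln_div exp_minus)
  have "cmod ((chop P f s ^^ t) g x) = cmod ((chop P f s ^^ (t div n * n)) ((chop P f s ^^ (t mod n)) g) x)"
    by (metis comp_apply div_mult_mod_eq funpow_add)
  also have "\<dots> \<le> q ^ (t div n)"
  proof (rule chop_pow_iterate)
    show "cmod ((chop P f s ^^ n) h x) \<le> q" if "\<And>w. cmod (h w) \<le> 1" for h x
      using that by (rule q)
    show "cmod ((chop P f s ^^ (t mod n)) g w) \<le> 1" for w
      by (rule norm_chop_pow_le[OF g])
  qed
  also have "\<dots> = exp (- L * real (t div n))"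
    using exp_of_nat2_mult[of "- L" "t div n"] L(2) by (simp add: mult.commute)
  also have "\<dots> \<le> exp (- L * (real t / real n - 1))"
  proof -
    have "real t / real n - 1 \<le> real (t div n)"
    proof -
      have "real t = real n * real (t div n) + real (t mod n)"
        by (metis mult_div_mod_eq of_nat_add of_nat_mult)
      moreover have "real (t mod n) \<le> real n" using n by (simp add: less_imp_le)
      ultimately show ?thesis using n by (simp add: field_simps)
    qed
    then show ?thesis using L by simp
  qed
  also have "\<dots> = (1 / q) * exp (- (L / real n * real t))"
    unfolding L(2)[symmetric] by (simp add: exp_add[symmetric] exp_minus field_simps exp_diff)
  finally show ?thesis unfolding L_def .
qed

text \<open>The operators at \<open>s\<close> and \<open>s'\<close> are exchanged one factor at a
  time. None of them increases the sup norm, so the errors simply add.\<close>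

lemma chop_pow_continuous:
  assumes fB: "\<And>x. \<bar>f x\<bar> \<le> b" and g: "\<And>w. cmod (g w) \<le> 1"
  shows "cmod ((chop P f s ^^ n) g x - (chop P f s' ^^ n) g x) \<le> real n * b * \<bar>s - s'\<bar>"
proof (induction n arbitrary: x)
  case (Suc n)
  have one: "cmod (chop P f s h x - chop P f s' h x) \<le> b * \<bar>s - s'\<bar>" if h: "\<And>w. cmod (h w) \<le> 1" for h x
  proof -
    have "chop P f s h x - chop P f s' h x = (\<Sum>v\<in>UNIV. P x v *\<^sub>R ((iexp (s * f v) - iexp (s' * f v)) * h v))"
      unfolding chop_def by (simp add: sum_subtractf[symmetric] algebra_simps)
    then have "cmod (chop P f s h x - chop P f s' h x) \<le> (\<Sum>v\<in>UNIV. P x v * (cmod (iexp (s * f v) - iexp (s' * f v)) * cmod (h v)))"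
      using norm_sum[of "\<lambda>v. P x v *\<^sub>R ((iexp (s * f v) - iexp (s' * f v)) * h v)" UNIV] by (simp add: norm_mult P_nonneg)
    also have "\<dots> \<le> (\<Sum>v\<in>UNIV. P x v * (b * \<bar>s - s'\<bar>))"
    proof (intro sum_mono mult_left_mono P_nonneg)
      fix v
      have "iexp (s * f v) - iexp (s' * f v) = iexp (s' * f v) * (iexp ((s - s') * f v) - 1)"
        by (simp add: right_diff_distrib exp_add[symmetric] algebra_simps)
      then have "cmod (iexp (s * f v) - iexp (s' * f v)) \<le> \<bar>(s - s') * f v\<bar>"
        using iexp_approx_0[of "(s - s') * f v"] by (simp only: norm_mult norm_exp_i_times mult_1_left)
      also have "\<dots> \<le> \<bar>s - s'\<bar> * b" unfolding abs_mult by (intro mult_left_mono fB) auto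
      finally have "cmod (iexp (s * f v) - iexp (s' * f v)) * cmod (h v) \<le> (\<bar>s - s'\<bar> * b) * 1"
        using h[of v] by (intro mult_mono) (auto intro: order_trans[OF norm_ge_zero])
      then show "cmod (iexp (s * f v) - iexp (s' * f v)) * cmod (h v) \<le> b * \<bar>s - s'\<bar>" by (simp add: mult.commute)
    qed
    also have "\<dots> = b * \<bar>s - s'\<bar>" unfolding sum_distrib_right[symmetric] P_sum by simp
    finally show ?thesis .
  qed
  have eq: "(chop P f s ^^ Suc n) g x - (chop P f s' ^^ Suc n) g x
     = chop P f s (\<lambda>w. (chop P f s ^^ n) g w - (chop P f s' ^^ n) g w) x
      + (chop P f s ((chop P f s' ^^ n) g) x - chop P f s' ((chop P f s' ^^ n) g) x)"
    by (simp add: chop_diff)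
  have "cmod ((chop P f s ^^ Suc n) g x - (chop P f s' ^^ Suc n) g x) \<le> real n * b * \<bar>s - s'\<bar> + b * \<bar>s - s'\<bar>"
    unfolding eq by (intro norm_triangle_le add_mono norm_chop_le Suc one norm_chop_pow_le g)
  then show ?case by (simp add: algebra_simps)
qed simp

end

locale nonlattice_walk = diffusive_walk P f for P :: "'x::finite \<Rightarrow> 'x \<Rightarrow> real" and f :: "'x \<Rightarrow> real" +
  assumes H3: "H3 P f"
begin

text \<open>If no power of the operator were a strict contraction, the phases of \<open>Ker\<close> would be multiplicative along edges
  and rotate at constant speed, so all cycle sums would lie on a lattice, against (H3).\<close>

lemma row_less_1:
  assumes s: "s \<noteq> 0"
  shows "\<exists>n. \<forall>x. row s n x < 1"
proof (rule ccontr)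
  assume contra: "\<not> ?thesis"
  \<comment> \<open>Row sums decrease with \<open>n\<close>. If each state had its own good power,
    the largest of these finitely many exponents would serve all states at once.\<close>
  have "\<exists>x. \<forall>n. 1 \<le> row s n x"
  proof (rule ccontr)
    assume "\<not> (\<exists>x. \<forall>n. 1 \<le> row s n x)"
    then have "\<forall>x. \<exists>n. row s n x < 1" by (auto simp: not_le)
    then obtain h where h: "\<And>x. row s (h x) x < 1" by metis
    have "row s (Max (range h)) x < 1" for x
      using row_antimono[of "h x" "Max (range h)" s x] h[of x] by (simp add: order_le_less_trans)
    then show False using contra by blast
  qed
  then obtain x0 where x0: "\<And>n. 1 \<le> row s n x0" by blast
  \<comment> \<open>A row sum that never drops below 1 leaves no cancellation at all between paths
    from \<open>x0\<close> to the same end.\<close>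
  have mod: "cmod (Ker P f s n x0 w) = Ppow P n x0 w" for n w
  proof -
    have "(\<Sum>w\<in>UNIV. Ppow P n x0 w - cmod (Ker P f s n x0 w)) \<le> 0"
      using x0[of n] by (simp add: sum_subtractf Ppow_sum row_def)
    moreover have "Ppow P n x0 w - cmod (Ker P f s n x0 w) \<le> (\<Sum>w\<in>UNIV. Ppow P n x0 w - cmod (Ker P f s n x0 w))"
      by (rule member_le_sum) (auto simp: Ker_le)
    ultimately show ?thesis using Ker_le[of s n x0 w] by linarith
  qed
  obtain k \<delta> where k: "0 < k" "0 < \<delta>" "\<And>x w. \<delta> \<le> Ppow P k x w"
    using doeblin by blast
  have pos: "0 < Ppow P n x w" if "k \<le> n" for n x w
  proof -
    have "\<delta> \<le> (\<Sum>v\<in>UNIV. Ppow P (n - k) x v * Ppow P k v w)"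
      by (rule avg_bounds(1)[of _ _ _ 1]) (use Ppow_nonneg Ppow_sum k in \<open>auto intro: order_trans[OF Ker_le]\<close>,
         use Ppow_sum[of k] Ppow_nonneg member_le_sum[of w UNIV "Ppow P k _"] in fastforce)
    then show ?thesis using Ppow_add[of "n - k" k x w] that k by simp
  qed
  define \<alpha> where "\<alpha> n w = Ker P f s n x0 w / of_real (Ppow P n x0 w)" for n w
  have \<alpha>_norm: "cmod (\<alpha> n w) = 1" if "k \<le> n" for n w
    using pos[OF that, of x0 w] mod[of n w] by (simp add: \<alpha>_def norm_divide)
  have \<alpha>_nz: "\<alpha> n w \<noteq> 0" if "k \<le> n" for n w
    using \<alpha>_norm[OF that, of w] by auto
  \<comment> \<open>Equality in the triangle inequality aligns the contributions of all predecessors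
    of \<open>w\<close>, so the phase at \<open>w\<close> can be computed through any one of them.
    From time \<open>k\<close> on every state is charged and all phases are defined.\<close>
  have edge: "\<alpha> (Suc n) w = \<alpha> n v * iexp (s * f w)" if n: "k \<le> n" and e: "0 < P v w" for n v w
  proof -
    define a where "a v = Ker P f s n x0 v * (P v w *\<^sub>R iexp (s * f w))" for v
    have na: "cmod (a v) = Ppow P n x0 v * P v w" for v
      by (simp add: a_def norm_mult mod P_nonneg)
    have S: "(\<Sum>v\<in>UNIV. a v) = Ker P f s (Suc n) x0 w" by (simp add: a_def Ker_Suc)
    have Sn: "cmod (\<Sum>v\<in>UNIV. a v) = Ppow P (Suc n) x0 w" by (simp only: S mod)
    have p: "0 < Ppow P (Suc n) x0 w" using pos[of "Suc n"] n by (simp del: Ppow.simps)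
    have "a v = of_real (cmod (a v)) * ((\<Sum>v\<in>UNIV. a v) / of_real (cmod (\<Sum>v\<in>UNIV. a v)))"
    proof (rule sum_norm_eq_imp_aligned)
      show "cmod (\<Sum>v\<in>UNIV. a v) = (\<Sum>v\<in>UNIV. cmod (a v))" unfolding Sn na by simp
      show "(\<Sum>v\<in>UNIV. a v) \<noteq> 0" using Sn p by auto
    qed auto
    then have "Ker P f s n x0 v * (P v w *\<^sub>R iexp (s * f w)) = of_real (Ppow P n x0 v * P v w) * \<alpha> (Suc n) w"
      unfolding na S mod \<alpha>_def by (simp only: a_def)
    then show ?thesis
      using pos[OF n, of x0 v] e by (simp add: \<alpha>_def[of n] scaleR_conv_of_real field_simps)
  qed
  \<comment> \<open>Rotation of the phase at a fixed state during one unit of time. The factor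
    belonging to the edge cancels, so the rotation is carried along edges unchanged.\<close>
  define \<beta> where "\<beta> n w = \<alpha> (Suc n) w / \<alpha> n w" for n w
  have \<beta>_edge: "\<beta> (Suc n) w = \<beta> n v" if n: "k \<le> n" and e: "0 < P v w" for n v w
    unfolding \<beta>_def using edge[OF n e] edge[of "Suc n", OF _ e] n by simp
  have \<beta>_path: "\<beta> (n + j) w = \<beta> n v" if "k \<le> n" "0 < Ppow P j v w" for n j v w
    using that
  proof (induction j arbitrary: w)
    case 0
    then show ?case by (simp split: if_splits)
  next
    case (Suc j)
    have "\<exists>u. 0 < Ppow P j v u \<and> 0 < P u w"
    proof (rule ccontr)
      assume "\<not> ?thesis"
      then have "Ppow P j v u * P u w = 0" for u
        using Ppow_nonneg[of j v u] P_nonneg[of u w] by (metis less_eq_real_def mult_eq_0_iff)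
      then have "Ppow P (Suc j) v w = 0" unfolding Ppow.simps by (intro sum.neutral) auto
      then show False using Suc.prems(2) by linarith
    qed
    then obtain u where u: "0 < Ppow P j v u" "0 < P u w" by blast
    then show ?case using \<beta>_edge[of "n + j" u w] Suc.IH[of u] Suc.prems by simp
  qed
  \<comment> \<open>Any two states reach the state \<open>undefined\<close> in exactly
    \<open>k\<close> steps and hand it the same rotation.\<close>
  have \<beta>_const: "\<beta> n v = \<beta> n v'" if "k \<le> n" for n v v'
    using \<beta>_path[of n k v undefined] \<beta>_path[of n k v' undefined] pos[of k] that by simp
  obtain b where b: "b = \<beta> k undefined" by blast
  have \<beta>_b: "\<beta> n w = b" if "k \<le> n" for n w
    using that
  proof (induction n arbitrary: w rule: dec_induct)
    case base
    then show ?case using \<beta>_const[of k w undefined] b by simp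
  next
    case (step n)
    have "\<exists>v. 0 < P w v"
    proof (rule ccontr)
      assume "\<not> ?thesis"
      then have "P w v = 0" for v using P_nonneg[of w v] by (metis less_eq_real_def)
      then show False using P_sum[of w] by simp
    qed
    then obtain v where "0 < P w v" by blast
    then show ?case using \<beta>_edge[of n w v] \<beta>_const[of "Suc n" w v] step by simp
  qed
  have \<alpha>_b: "\<alpha> (k + j) w = \<alpha> k w * b ^ j" for j w
  proof (induction j)
    case (Suc j)
    have "\<alpha> (Suc (k + j)) w = \<alpha> (k + j) w * b"
      using \<beta>_b[of "k + j" w] \<alpha>_nz[of "k + j" w] by (simp add: \<beta>_def field_simps)
    then show ?case using Suc by simp
  qed simp
  have "cmod b = 1" using b \<alpha>_norm[of k] \<alpha>_norm[of "Suc k"] by (simp add: \<beta>_def norm_divide)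
  then obtain th where th: "b = iexp th" by (metis cis_conv_exp rcis_cmod_Arg rcis_def mult_1_left of_real_1)
  \<comment> \<open>Around a cycle of \<open>n + 1\<close> states the phase is multiplied by
    \<open>b ^ (n + 1)\<close> and also by \<open>iexp\<close> of \<open>s\<close> times the cycle
    sum. The sum thus equals \<open>(n + 1) * th / s\<close> modulo \<open>2 * pi / s\<close>, which
    dictates the two parameters.\<close>
  from H3[unfolded H3_def, rule_format, of "th / s" "2 * pi / s"]
  obtain n :: nat and xs :: "'x list" where xs: "length xs = n + 1"
    "(\<Prod>i<n. P (xs ! i) (xs ! (i+1))) * P (xs ! n) (xs ! 0) > 0"
    "(\<Sum>i\<le>n. f (xs ! i)) - real (n+1) * (th / s) \<notin> {(2 * pi / s) * of_int k | k. True}"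
    by (elim exE conjE)
  have epos: "P (xs ! i) (xs ! (i+1)) > 0" if "i < n" for i
  proof (rule ccontr)
    assume "\<not> ?thesis"
    then have "P (xs ! i) (xs ! (i+1)) = 0" using P_nonneg[of "xs ! i" "xs ! (i+1)"] by linarith
    then have "(\<Prod>i<n. P (xs ! i) (xs ! (i+1))) = 0" using that by (auto intro!: prod_zero)
    then show False using xs(2) by (simp only: mult_zero_left less_irrefl)
  qed
  have elast: "P (xs ! n) (xs ! 0) > 0"
    using xs(2) P_nonneg[of "xs ! n" "xs ! 0"] by (cases "P (xs ! n) (xs ! 0) = 0") auto
  have walk: "\<alpha> (k + j) (xs ! j) * iexp (s * f (xs ! 0)) = \<alpha> k (xs ! 0) * iexp (s * (\<Sum>i\<le>j. f (xs ! i)))" if "j \<le> n" for j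
    using that
  proof (induction j)
    case (Suc j)
    have "\<alpha> (k + Suc j) (xs ! Suc j) = \<alpha> (k + j) (xs ! j) * iexp (s * f (xs ! Suc j))"
      using edge[of "k + j" "xs ! j" "xs ! Suc j"] epos[of j] Suc.prems by simp
    then show ?case using Suc by (simp add: exp_add algebra_simps)
  qed simp
  have "\<alpha> k (xs ! 0) * b ^ Suc n = \<alpha> (k + Suc n) (xs ! 0)" by (rule \<alpha>_b[symmetric])
  also have "\<dots> = \<alpha> (k + n) (xs ! n) * iexp (s * f (xs ! 0))"
    using edge[of "k + n" "xs ! n" "xs ! 0"] elast by simp
  also have "\<dots> = \<alpha> k (xs ! 0) * iexp (s * (\<Sum>i\<le>n. f (xs ! i)))" using walk[of n] by simp
  finally have "b ^ Suc n = iexp (s * (\<Sum>i\<le>n. f (xs ! i)))" using \<alpha>_nz[of k "xs ! 0"] by simp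
  moreover have "b ^ Suc n = iexp (real (Suc n) * th)"
    unfolding th exp_of_nat_mult[symmetric] by (simp add: mult_ac)
  ultimately have "exp (\<i> * of_real (s * (\<Sum>i\<le>n. f (xs ! i)))) = exp (\<i> * of_real (real (Suc n) * th))" by simp
  then obtain m :: int where "\<i> * of_real (s * (\<Sum>i\<le>n. f (xs ! i))) = \<i> * of_real (real (Suc n) * th) + of_real (of_int (2 * m) * pi) * \<i>"
    unfolding exp_eq by blast
  then have "Im (\<i> * of_real (s * (\<Sum>i\<le>n. f (xs ! i)))) = Im (\<i> * of_real (real (Suc n) * th) + of_real (of_int (2 * m) * pi) * \<i>)"
    by (rule arg_cong)
  then have "s * (\<Sum>i\<le>n. f (xs ! i)) = real (Suc n) * th + 2 * of_int m * pi" by simp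
  then have "(\<Sum>i\<le>n. f (xs ! i)) - real (n+1) * (th / s) = (2 * pi / s) * of_int m"
    using s by (simp add: field_simps)
  then show False using xs(3) by blast
qed

end

section \<open>Central limit theorem and decay for the twisted operators, with explicit
  errors\<close>

context diffusive_walk
begin

text \<open>Each application adds an error of order \<open>\<bar>s\<bar> ^ 3\<close>; later
  applications do not enlarge it, so the errors grow linearly in \<open>j\<close>.\<close>

lemma chop_pow_eigen:
  "\<exists>C>0. \<forall>s j x. cmod ((chop P f s ^^ j) (Gs s) x - of_real (gam (real j) s) * Gs s x) \<le> C * (real j * \<bar>s\<bar> ^ 3)"
proof -
  obtain C where C: "0 < C" "\<And>s x. cmod (chop P f s (Gs s) x - of_real (exp (- (s2 * s\<^sup>2 / 2))) * Gs s x) \<le> C * \<bar>s\<bar> ^ 3"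
    using chop_Gs by blast
  have "cmod ((chop P f s ^^ j) (Gs s) x - of_real (gam (real j) s) * Gs s x) \<le> C * (real j * \<bar>s\<bar> ^ 3)" for s j x
  proof (induction j arbitrary: x)
    case 0
    then show ?case by (simp add: gam_def)
  next
    case (Suc j)
    have g: "gam (real (Suc j)) s = gam (real j) s * exp (- (s2 * s\<^sup>2 / 2))"
      using gam_add[of "real j" 1 s] by (simp add: gam_def add.commute)
    have eq: "(chop P f s ^^ Suc j) (Gs s) x - of_real (gam (real (Suc j)) s) * Gs s x
      = chop P f s (\<lambda>w. (chop P f s ^^ j) (Gs s) w - of_real (gam (real j) s) * Gs s w) x
       + of_real (gam (real j) s) * (chop P f s (Gs s) x - of_real (exp (- (s2 * s\<^sup>2 / 2))) * Gs s x)"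
      unfolding g chop_diff chop_mult by (simp add: algebra_simps)
    have "gam (real j) s \<le> 1" using s2_pos by (simp add: gam_def)
    then have "cmod (of_real (gam (real j) s) * (chop P f s (Gs s) x - of_real (exp (- (s2 * s\<^sup>2 / 2))) * Gs s x)) \<le> 1 * (C * \<bar>s\<bar> ^ 3)"
      unfolding norm_mult norm_of_real using C(2)[of s x] gam_pos[of "real j" s] by (intro mult_mono) auto
    then have "cmod ((chop P f s ^^ Suc j) (Gs s) x - of_real (gam (real (Suc j)) s) * Gs s x) \<le> C * (real j * \<bar>s\<bar> ^ 3) + 1 * (C * \<bar>s\<bar> ^ 3)"
      unfolding eq by (intro norm_triangle_le add_mono norm_chop_le Suc) auto
    then show ?case by (simp add: algebra_simps)
  qed
  then show ?thesis using C by blast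
qed

lemma Ker_at_0: "Ker P f 0 n x w = of_real (Ppow P n x w)"
proof (induction n arbitrary: w)
  case (Suc n)
  then show ?case by (simp add: Ker_Suc scaleR_conv_of_real)
qed (simp add: Ker_0)

definition nuc :: "('x \<Rightarrow> complex) \<Rightarrow> complex" where
  "nuc g = (\<Sum>w\<in>UNIV. g w * of_real (nu w))"

lemma norm_nuc_le:
  assumes "\<And>w. cmod (g w) \<le> 1"
  shows "cmod (nuc g) \<le> 1"
proof -
  have "cmod (nuc g) \<le> (\<Sum>w\<in>UNIV. 1 * nu w)"
    unfolding nuc_def by (rule order_trans[OF norm_sum])
      (auto simp: norm_mult nu_nonneg intro!: sum_mono mult_left_le_one_le assms)
  then show ?thesis by (simp add: nu_sum)
qed

text \<open>The \<open>l\<close> steps applied first are compared with frequency 0, where the chain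
  forgets its start and turns \<open>g\<close> into the constant \<open>nuc g\<close> up to
  \<open>\<rho> ^ l\<close>. The remaining \<open>j\<close> steps act on a constant, which is close
  to the approximate eigenfunction \<open>Gs s\<close>.\<close>

lemma chop_clt:
  "\<exists>C \<rho>. 0 < C \<and> 0 < \<rho> \<and> \<rho> < 1 \<and> (\<forall>s j l g x. \<bar>s\<bar> \<le> 1 \<longrightarrow> (\<forall>w. cmod (g w) \<le> 1) \<longrightarrow>
     cmod ((chop P f s ^^ (j + l)) g x - nuc g * of_real (gam (real j) s)) \<le> C * (real j * \<bar>s\<bar> ^ 3 + real (l + 1) * \<bar>s\<bar> + \<rho> ^ l))"
proof -
  obtain C1 where C1: "0 < C1" "\<And>s j x. cmod ((chop P f s ^^ j) (Gs s) x - of_real (gam (real j) s) * Gs s x) \<le> C1 * (real j * \<bar>s\<bar> ^ 3)"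
    using chop_pow_eigen by blast
  obtain C2 \<rho> where C2: "0 < C2" "0 < \<rho>" "\<rho> < 1" "\<And>n x w. \<bar>Ppow P n x w - nu w\<bar> \<le> C2 * \<rho> ^ n"
    using nu_props(3) by blast
  define N where "N = real CARD('x)"
  define C where "C = C1 + 4 * B + N * C2"
  have "cmod ((chop P f s ^^ (j + l)) g x - nuc g * of_real (gam (real j) s)) \<le> C * (real j * \<bar>s\<bar> ^ 3 + real (l + 1) * \<bar>s\<bar> + \<rho> ^ l)"
    if s: "\<bar>s\<bar> \<le> 1" and g: "\<And>w. cmod (g w) \<le> 1" for s j l g x
  proof -
    define h where "h = (chop P f s ^^ l) g"
    have h: "cmod (h w - nuc g) \<le> real l * B * \<bar>s\<bar> + N * C2 * \<rho> ^ l" for w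
    proof -
      have "(chop P f 0 ^^ l) g w - nuc g = (\<Sum>v\<in>UNIV. g v * of_real (Ppow P l w v - nu v))"
        unfolding chop_pow_Ker Ker_at_0 nuc_def by (simp add: sum_subtractf right_diff_distrib)
      then have "cmod ((chop P f 0 ^^ l) g w - nuc g) \<le> (\<Sum>v\<in>UNIV. cmod (g v) * \<bar>Ppow P l w v - nu v\<bar>)"
        using norm_sum[of "\<lambda>v. g v * of_real (Ppow P l w v - nu v)" UNIV] by (simp only: norm_mult norm_of_real)
      also have "\<dots> \<le> (\<Sum>v\<in>(UNIV::'x set). 1 * (C2 * \<rho> ^ l))"
        by (intro sum_mono mult_mono g C2) auto
      finally have 1: "cmod ((chop P f 0 ^^ l) g w - nuc g) \<le> N * C2 * \<rho> ^ l" by (simp add: N_def)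
      have 2: "cmod (h w - (chop P f 0 ^^ l) g w) \<le> real l * B * \<bar>s\<bar>"
        unfolding h_def using chop_pow_continuous[where b = B and g = g and s = s and n = l and x = w and s' = 0] B_bounds g by simp
      show ?thesis using norm_triangle_mono[OF 2 1] by simp
    qed
    have G1: "cmod (Gs s w - 1) \<le> 2 * B * \<bar>s\<bar>" for w
    proof -
      have "\<bar>s\<bar> * \<bar>s\<bar> \<le> \<bar>s\<bar> * 1" using s by (intro mult_left_mono) auto
      then have "B * s\<^sup>2 \<le> B * \<bar>s\<bar>" using B_ge_1 by (intro mult_left_mono) (auto simp: power2_eq_square)
      then show ?thesis using norm_Gs_diff[of s w] by linarith
    qed
    have gam1: "gam (real j) s \<le> 1" using s2_pos by (simp add: gam_def)
    have one: "cmod ((chop P f s ^^ j) (\<lambda>w. 1) x - of_real (gam (real j) s)) \<le> 4 * B * \<bar>s\<bar> + C1 * (real j * \<bar>s\<bar> ^ 3)"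
    proof -
      have eq: "(chop P f s ^^ j) (\<lambda>w. 1) x - of_real (gam (real j) s)
        = ((chop P f s ^^ j) (Gs s) x - of_real (gam (real j) s) * Gs s x) + of_real (gam (real j) s) * (Gs s x - 1) - (chop P f s ^^ j) (\<lambda>w. Gs s w - 1) x"
        unfolding chop_pow_diff by (simp add: algebra_simps)
      have a: "cmod ((chop P f s ^^ j) (\<lambda>w. Gs s w - 1) x) \<le> 2 * B * \<bar>s\<bar>"
        by (rule norm_chop_pow_le) (rule G1)
      have "cmod (of_real (gam (real j) s) * (Gs s x - 1)) \<le> 1 * (2 * B * \<bar>s\<bar>)"
        unfolding norm_mult norm_of_real using gam1 gam_pos[of "real j" s] G1[of x] by (intro mult_mono) auto
      then show ?thesis
        unfolding eq using norm_triangle_ineq4[of "((chop P f s ^^ j) (Gs s) x - of_real (gam (real j) s) * Gs s x) + of_real (gam (real j) s) * (Gs s x - 1)" "(chop P f s ^^ j) (\<lambda>w. Gs s w - 1) x"]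
          norm_triangle_ineq[of "(chop P f s ^^ j) (Gs s) x - of_real (gam (real j) s) * Gs s x" "of_real (gam (real j) s) * (Gs s x - 1)"] a C1(2)[of j s x] by linarith
    qed
    have eq: "(chop P f s ^^ (j + l)) g x - nuc g * of_real (gam (real j) s)
       = (chop P f s ^^ j) (\<lambda>w. h w - nuc g) x + nuc g * ((chop P f s ^^ j) (\<lambda>w. 1) x - of_real (gam (real j) s))"
      using chop_pow_mult[where n = j and P = P and f = f and s = s and c = "nuc g" and g = "\<lambda>w. 1"] unfolding chop_pow_diff by (simp add: h_def funpow_add algebra_simps)
    have a: "cmod ((chop P f s ^^ j) (\<lambda>w. h w - nuc g) x) \<le> real l * B * \<bar>s\<bar> + N * C2 * \<rho> ^ l"
      by (rule norm_chop_pow_le) (rule h)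
    have b: "cmod (nuc g * ((chop P f s ^^ j) (\<lambda>w. 1) x - of_real (gam (real j) s))) \<le> 1 * (4 * B * \<bar>s\<bar> + C1 * (real j * \<bar>s\<bar> ^ 3))"
      unfolding norm_mult using norm_nuc_le[OF g] one by (intro mult_mono) auto
    have "cmod ((chop P f s ^^ (j + l)) g x - nuc g * of_real (gam (real j) s))
       \<le> (real l * B * \<bar>s\<bar> + N * C2 * \<rho> ^ l) + 1 * (4 * B * \<bar>s\<bar> + C1 * (real j * \<bar>s\<bar> ^ 3))"
      unfolding eq by (rule norm_triangle_mono[OF a b])
    also have "\<dots> \<le> C1 * (real j * \<bar>s\<bar> ^ 3) + 4 * B * (real (l + 1) * \<bar>s\<bar>) + N * C2 * \<rho> ^ l"
    proof -
      have "0 \<le> B * (real l * \<bar>s\<bar>)" using B_ge_1 by simp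
      then show ?thesis by (simp add: algebra_simps)
    qed
    also have "\<dots> \<le> C * (real j * \<bar>s\<bar> ^ 3) + C * (real (l + 1) * \<bar>s\<bar>) + C * \<rho> ^ l"
    proof (intro add_mono mult_right_mono)
      have "0 \<le> N * C2" using C2 by (simp add: N_def)
      then show "C1 \<le> C" "4 * B \<le> C" "N * C2 \<le> C" using C1(1) B_ge_1 by (auto simp: C_def)
    qed (use C2 in auto)
    finally show ?thesis by (simp add: distrib_left)
  qed
  moreover have "0 < C" using C1(1) B_ge_1 C2(1) by (simp add: C_def N_def add_pos_nonneg)
  ultimately show ?thesis using C2 by blast
qed

text \<open>About \<open>1 / s\<^sup>2\<close> steps bring the Gaussian factor below
  \<open>e1\<close>, a fixed number less than 1, so a block of that length contracts by a factor
  independent of \<open>s\<close>. Iterating blocks gives decay at a rate proportional to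
  \<open>s\<^sup>2\<close>.\<close>

lemma decay_small:
  "\<exists>s0>0. \<exists>C>0. \<exists>c>0. \<forall>s t g x. \<bar>s\<bar> \<le> s0 \<longrightarrow> (\<forall>w. cmod (g w) \<le> 1) \<longrightarrow> cmod ((chop P f s ^^ t) g x) \<le> C * exp (- (c * s\<^sup>2 * real t))"
proof -
  obtain C \<rho> where C: "0 < C" "0 < \<rho>" "\<rho> < 1" and clt: "\<And>s j l g x. \<bar>s\<bar> \<le> 1 \<Longrightarrow> (\<And>w. cmod (g w) \<le> 1) \<Longrightarrow>
     cmod ((chop P f s ^^ (j + l)) g x - nuc g * of_real (gam (real j) s)) \<le> C * (real j * \<bar>s\<bar> ^ 3 + real (l + 1) * \<bar>s\<bar> + \<rho> ^ l)"
    using chop_clt by blast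
  define e1 where "e1 = exp (- (s2 / 2))"
  have e1: "0 < e1" "e1 < 1" using s2_pos by (auto simp: e1_def)
  define q where "q = (1 + e1) / 2"
  have q: "0 < q" "q < 1" using e1 by (auto simp: q_def)
  have "(\<lambda>l. C * \<rho> ^ l) \<longlonglongrightarrow> 0" using C by (auto intro!: tendsto_eq_intros LIMSEQ_power_zero)
  then have "eventually (\<lambda>l. C * \<rho> ^ l < (1 - e1) / 4) sequentially"
    using e1 by (intro order_tendstoD(2)) auto
  \<comment> \<open>The relaxation time \<open>l\<close> is fixed before the frequency range
    \<open>s0\<close>, because the error term \<open>real (l + 1) * \<bar>s\<bar>\<close> has to be
    made small afterwards. Each of the two errors gets a quarter of the gap \<open>1 - e1\<close>,
    which leaves the factor \<open>q\<close>.\<close>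
  then obtain l where l: "C * \<rho> ^ l < (1 - e1) / 4" by (auto simp: eventually_sequentially)
  define s0 where "s0 = min 1 ((1 - e1) / (4 * C * real (l + 3)))"
  have s0: "0 < s0" "s0 \<le> 1" "C * (real (l + 3) * s0) \<le> (1 - e1) / 4"
  proof -
    show "0 < s0" "s0 \<le> 1" using e1 C by (auto simp: s0_def)
    define l3 where "l3 = real (l + 3)"
    have l3: "0 < l3" by (simp add: l3_def)
    have "C * (l3 * s0) \<le> C * (l3 * ((1 - e1) / (4 * C * l3)))"
      using C l3 by (intro mult_left_mono) (auto simp: s0_def l3_def)
    also have "\<dots> = (1 - e1) / 4" using C l3 by simp
    finally show "C * (real (l + 3) * s0) \<le> (1 - e1) / 4" by (simp only: l3_def)
  qed
  define c where "c = ln (1 / q) / real (l + 2)"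
  have c: "0 < c" using q by (simp add: c_def)
  have "cmod ((chop P f s ^^ t) g x) \<le> (1 / q) * exp (- (c * s\<^sup>2 * real t))"
    if s: "\<bar>s\<bar> \<le> s0" and g: "\<And>w. cmod (g w) \<le> 1" for s t g x
  proof (cases "s = 0")
    case True
    have "cmod ((chop P f s ^^ t) g x) \<le> 1" by (rule norm_chop_pow_le) (rule g)
    also have "1 \<le> 1 / q" using q by simp
    finally show ?thesis using True by simp
  next
    case False
    have s1: "\<bar>s\<bar> \<le> 1" "s\<^sup>2 \<le> 1" using s s0 by (auto simp: abs_square_le_1)
    have ssq: "0 < s\<^sup>2" using False by simp
    \<comment> \<open>The least integer with \<open>1 \<le> real j * s\<^sup>2\<close>; as
      \<open>s\<^sup>2 \<le> 1\<close> this product is also at most 2, which keeps the block length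
      below \<open>(l + 2) / s\<^sup>2\<close>.\<close>
    define j where "j = nat \<lceil>1 / s\<^sup>2\<rceil>"
    have "0 \<le> 1 / s\<^sup>2" by simp
    then have j1: "1 / s\<^sup>2 \<le> real j" "real j \<le> 1 / s\<^sup>2 + 1" unfolding j_def by linarith+
    have j: "1 \<le> real j * s\<^sup>2" "real j * s\<^sup>2 \<le> 2"
    proof -
      show "1 \<le> real j * s\<^sup>2" using j1(1) ssq by (simp add: field_simps)
      have "real j * s\<^sup>2 \<le> (1 / s\<^sup>2 + 1) * s\<^sup>2" using j1(2) ssq by (intro mult_right_mono) auto
      also have "\<dots> = 1 + s\<^sup>2" using ssq by (simp add: field_simps)
      finally show "real j * s\<^sup>2 \<le> 2" using s1 by simp
    qed
    have contr: "cmod ((chop P f s ^^ (j + l)) g x) \<le> q" if g: "\<And>w. cmod (g w) \<le> 1" for g x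
    proof -
      have "gam (real j) s \<le> e1"
        unfolding gam_def e1_def using j(1) s2_pos mult_left_mono[OF j(1), of "s2 / 2"] by simp
      then have "cmod (nuc g * of_real (gam (real j) s)) \<le> 1 * e1"
        unfolding norm_mult norm_of_real using norm_nuc_le[OF g] gam_pos[of "real j" s] by (intro mult_mono) auto
      moreover have "C * (real j * \<bar>s\<bar> ^ 3 + real (l + 1) * \<bar>s\<bar> + \<rho> ^ l) \<le> (1 - e1) / 4 + (1 - e1) / 4"
      proof -
        have "real j * \<bar>s\<bar> ^ 3 = real j * s\<^sup>2 * \<bar>s\<bar>" by (simp add: power3_eq_cube power2_eq_square)
        also have "\<dots> \<le> 2 * \<bar>s\<bar>" using j by (intro mult_right_mono) auto
        finally have "real j * \<bar>s\<bar> ^ 3 + real (l + 1) * \<bar>s\<bar> \<le> real (l + 3) * \<bar>s\<bar>" by (simp add: algebra_simps)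
        also have "\<dots> \<le> real (l + 3) * s0" using s by (intro mult_left_mono) auto
        finally have "C * (real j * \<bar>s\<bar> ^ 3 + real (l + 1) * \<bar>s\<bar>) \<le> C * (real (l + 3) * s0)"
          using C by (intro mult_left_mono) auto
        then show ?thesis unfolding distrib_left[of C _ "\<rho> ^ l"] using s0(3) l by linarith
      qed
      moreover have "cmod ((chop P f s ^^ (j + l)) g x) \<le> cmod ((chop P f s ^^ (j + l)) g x - nuc g * of_real (gam (real j) s)) + cmod (nuc g * of_real (gam (real j) s))"
        using norm_triangle_ineq[of "(chop P f s ^^ (j + l)) g x - nuc g * of_real (gam (real j) s)" "nuc g * of_real (gam (real j) s)"] by simp
      moreover have "cmod ((chop P f s ^^ (j + l)) g x - nuc g * of_real (gam (real j) s)) \<le> C * (real j * \<bar>s\<bar> ^ 3 + real (l + 1) * \<bar>s\<bar> + \<rho> ^ l)"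
        by (rule clt[OF s1(1)]) (rule g)
      ultimately have "cmod ((chop P f s ^^ (j + l)) g x) \<le> e1 + ((1 - e1) / 4 + (1 - e1) / 4)" by linarith
      then show ?thesis by (simp add: q_def field_simps)
    qed
    have jl: "0 < j + l" using j(1) ssq by (cases j) auto
    have "cmod ((chop P f s ^^ t) g x) \<le> (1 / q) * exp (- (ln (1 / q) / real (j + l) * real t))"
      by (rule chop_pow_decay[OF _ g q jl]) (rule contr, blast)
    also have "\<dots> \<le> (1 / q) * exp (- (c * s\<^sup>2 * real t))"
    proof -
      have "real l * s\<^sup>2 \<le> real l * 1" using s1 by (intro mult_left_mono) auto
      then have "real (j + l) * s\<^sup>2 \<le> real (l + 2)" using j(2) by (simp add: algebra_simps)
      moreover define Jr Lr where "Jr = real (j + l)" and "Lr = real (l + 2)"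
      moreover have "0 < Jr" unfolding Jr_def of_nat_0_less_iff by (rule jl)
      moreover have "0 < Lr" by (simp add: Lr_def)
      ultimately have "s\<^sup>2 / Lr \<le> 1 / Jr" by (simp add: field_simps)
      then have "s\<^sup>2 / real (l + 2) \<le> 1 / real (j + l)" by (simp only: Jr_def Lr_def)
      then have "ln (1 / q) * (s\<^sup>2 / real (l + 2)) \<le> ln (1 / q) * (1 / real (j + l))"
        using q by (intro mult_left_mono) auto
      then have "c * s\<^sup>2 \<le> ln (1 / q) / real (j + l)" by (simp add: c_def)
      then have "c * s\<^sup>2 * real t \<le> ln (1 / q) / real (j + l) * real t" by (intro mult_right_mono) auto
      then show ?thesis using q by (intro mult_left_mono) auto
    qed
    finally show ?thesis .
  qed
  then show ?thesis using s0(1) q c by (intro exI[of _ s0] conjI exI[of _ "1 / q"] exI[of _ c]) auto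
qed

end

context nonlattice_walk
begin

text \<open>Strict contraction of one power at \<open>s0\<close> persists nearby by continuity. The
  exponent is written with \<open>s\<^sup>2\<close>, bounded by \<open>A\<close> in the
  neighbourhood, only to match \<open>decay_small\<close>.\<close>

lemma decay_local:
  assumes "s0 \<noteq> 0"
  shows "\<exists>d>0. \<exists>C>0. \<exists>c>0. \<forall>s t g x. \<bar>s - s0\<bar> < d \<longrightarrow> (\<forall>w. cmod (g w) \<le> 1) \<longrightarrow> cmod ((chop P f s ^^ t) g x) \<le> C * exp (- (c * s\<^sup>2 * real t))"
proof -
  obtain n where n: "\<And>x. row s0 n x < 1" using row_less_1[OF assms] by blast
  have n0: "0 < n"
  proof (rule ccontr)
    assume "\<not> 0 < n"
    then have n_0: "n = 0" by simp
    have "row s0 n undefined = 1"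
      unfolding n_0 row_def Ker_0 by (simp add: if_distrib[of cmod] cong: if_cong)
    then show False using n[of undefined] by simp
  qed
  define q0 where "q0 = Max (range (row s0 n))"
  have q0: "row s0 n x \<le> q0" for x unfolding q0_def by (rule Max_ge) auto
  have "q0 \<in> range (row s0 n)" unfolding q0_def by (rule Max_in) auto
  then have q01: "q0 < 1" using n by auto
  have "0 \<le> row s0 n undefined" by (simp add: row_def sum_nonneg)
  then have q00: "0 \<le> q0" using q0[of undefined] by linarith
  define q where "q = (1 + q0) / 2"
  have q: "0 < q" "q < 1" using q01 q00 by (auto simp: q_def)
  define d where "d = (1 - q0) / (2 * real n * B)"
  have d: "0 < d" using q01 n0 B_ge_1 by (simp add: d_def)
  define A where "A = (\<bar>s0\<bar> + d)\<^sup>2"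
  have A: "0 < A" using d by (simp add: A_def add_nonneg_pos)
  define c where "c = ln (1 / q) / real n / A"
  have c: "0 < c" using q n0 A by (simp add: c_def)
  have "cmod ((chop P f s ^^ t) g x) \<le> (1 / q) * exp (- (c * s\<^sup>2 * real t))"
    if s: "\<bar>s - s0\<bar> < d" and g: "\<And>w. cmod (g w) \<le> 1" for s t g x
  proof -
    have contr: "cmod ((chop P f s ^^ n) g x) \<le> q" if g: "\<And>w. cmod (g w) \<le> 1" for g x
    proof -
      have "cmod ((chop P f s ^^ n) g x - (chop P f s0 ^^ n) g x) \<le> real n * B * \<bar>s - s0\<bar>"
        by (rule chop_pow_continuous) (auto intro: B_bounds g)
      also have "\<dots> \<le> real n * B * d" using s B_ge_1 by (intro mult_left_mono) auto
      also have "\<dots> = (1 - q0) / 2" using n0 B_ge_1 by (simp add: d_def)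
      finally have 1: "cmod ((chop P f s ^^ n) g x - (chop P f s0 ^^ n) g x) \<le> (1 - q0) / 2" .
      have 2: "cmod ((chop P f s0 ^^ n) g x) \<le> q0"
        using chop_pow_le_row[where g = g and c = 1 and s = s0 and n = n and x = x] g q0[of x] by simp
      show ?thesis using norm_triangle_mono[OF 1 2] by (simp add: q_def field_simps)
    qed
    have "cmod ((chop P f s ^^ t) g x) \<le> (1 / q) * exp (- (ln (1 / q) / real n * real t))"
      by (rule chop_pow_decay[OF _ g q n0]) (rule contr, blast)
    also have "\<dots> \<le> (1 / q) * exp (- (c * s\<^sup>2 * real t))"
    proof -
      have "\<bar>s\<bar> \<le> \<bar>s0\<bar> + d" using s by linarith
      then have "\<bar>s\<bar>\<^sup>2 \<le> A" unfolding A_def by (intro power_mono) auto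
      then have "c * s\<^sup>2 \<le> c * A" using c by (intro mult_left_mono) auto
      also have "c * A = ln (1 / q) / real n" using A by (simp add: c_def)
      finally have "c * s\<^sup>2 * real t \<le> ln (1 / q) / real n * real t" by (intro mult_right_mono) auto
      then show ?thesis using q by (intro mult_left_mono) auto
    qed
    finally show ?thesis .
  qed
  then show ?thesis using d q c by (intro exI[of _ d] conjI exI[of _ "1 / q"] exI[of _ c]) auto
qed

text \<open>Compactness of the frequency interval, in the form of Bolzano bisection: the bound
  passes to unions of adjacent intervals and holds near every point, by \<open>decay_small\<close>
  at 0 and \<open>decay_local\<close> elsewhere.\<close>

lemma decay_uniform:
  assumes "0 \<le> K'"
  shows "\<exists>C>0. \<exists>c>0. \<forall>s t g x. \<bar>s\<bar> \<le> K' \<longrightarrow> (\<forall>w. cmod (g w) \<le> 1) \<longrightarrow> cmod ((chop P f s ^^ t) g x) \<le> C * exp (- (c * s\<^sup>2 * real t))"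
proof -
  define R where "R a b \<longleftrightarrow> (\<exists>C>0. \<exists>c>0. \<forall>s t g x. a \<le> s \<longrightarrow> s \<le> b \<longrightarrow> (\<forall>w. cmod (g w) \<le> 1) \<longrightarrow> cmod ((chop P f s ^^ t) g x) \<le> C * exp (- (c * s\<^sup>2 * real t)))" for a b
  have "- K' \<le> K'" using assms by simp
  then have "R (- K') K'"
  proof (induction rule: Bolzano)
    case (trans a b e)
    obtain C1 c1 where 1: "0 < C1" "0 < c1" "\<And>s t g x. a \<le> s \<Longrightarrow> s \<le> b \<Longrightarrow> (\<And>w. cmod (g w) \<le> 1) \<Longrightarrow> cmod ((chop P f s ^^ t) g x) \<le> C1 * exp (- (c1 * s\<^sup>2 * real t))"
      using trans(1) unfolding R_def by blast
    obtain C2 c2 where 2: "0 < C2" "0 < c2" "\<And>s t g x. b \<le> s \<Longrightarrow> s \<le> e \<Longrightarrow> (\<And>w. cmod (g w) \<le> 1) \<Longrightarrow> cmod ((chop P f s ^^ t) g x) \<le> C2 * exp (- (c2 * s\<^sup>2 * real t))"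
      using trans(2) unfolding R_def by blast
    define C where "C = max C1 C2"
    define c where "c = min c1 c2"
    have le: "C' * exp (- (c' * s\<^sup>2 * real t)) \<le> C * exp (- (c * s\<^sup>2 * real t))" if "0 < C'" "C' \<le> C" "c \<le> c'" for C' c' s t
      using that by (intro mult_mono) (auto intro!: mult_right_mono)
    have "cmod ((chop P f s ^^ t) g x) \<le> C * exp (- (c * s\<^sup>2 * real t))" if "a \<le> s" "s \<le> e" "\<And>w. cmod (g w) \<le> 1" for s t g x
    proof (cases "s \<le> b")
      case True
      have "cmod ((chop P f s ^^ t) g x) \<le> C1 * exp (- (c1 * s\<^sup>2 * real t))"
        by (rule 1(3)[OF that(1) True]) (rule that(3))
      also have "\<dots> \<le> C * exp (- (c * s\<^sup>2 * real t))" by (rule le[OF 1(1)]) (auto simp: C_def c_def)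
      finally show ?thesis .
    next
      case False
      then have "b \<le> s" by simp
      have "cmod ((chop P f s ^^ t) g x) \<le> C2 * exp (- (c2 * s\<^sup>2 * real t))"
        by (rule 2(3)[OF \<open>b \<le> s\<close> that(2)]) (rule that(3))
      also have "\<dots> \<le> C * exp (- (c * s\<^sup>2 * real t))" by (rule le[OF 2(1)]) (auto simp: C_def c_def)
      finally show ?thesis .
    qed
    moreover have "0 < C" "0 < c" using 1 2 by (auto simp: C_def c_def)
    ultimately show ?case unfolding R_def by blast
  next
    case (local x)
    show ?case
    proof (cases "x = 0")
      case True
      obtain s0 C c where D: "0 < s0" "0 < C" "0 < c" "\<And>s t g x. \<bar>s\<bar> \<le> s0 \<Longrightarrow> (\<forall>w. cmod (g w) \<le> 1) \<Longrightarrow> cmod ((chop P f s ^^ t) g x) \<le> C * exp (- (c * s\<^sup>2 * real t))"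
        using decay_small by blast
      have "R a b" if "a \<le> x \<and> x \<le> b \<and> b - a < s0" for a b
      proof -
        have "\<bar>s\<bar> \<le> s0" if "a \<le> s" "s \<le> b" for s using that \<open>a \<le> x \<and> x \<le> b \<and> b - a < s0\<close> True by auto
        then show ?thesis unfolding R_def using D by blast
      qed
      then show ?thesis using D(1) by blast
    next
      case False
      obtain s0 C c where D: "0 < s0" "0 < C" "0 < c" "\<And>s t g x'. \<bar>s - x\<bar> < s0 \<Longrightarrow> (\<forall>w. cmod (g w) \<le> 1) \<Longrightarrow> cmod ((chop P f s ^^ t) g x') \<le> C * exp (- (c * s\<^sup>2 * real t))"
        using decay_local[OF False] by blast
      have "R a b" if "a \<le> x \<and> x \<le> b \<and> b - a < s0" for a b
      proof -
        have "\<bar>s - x\<bar> < s0" if "a \<le> s" "s \<le> b" for s using that \<open>a \<le> x \<and> x \<le> b \<and> b - a < s0\<close> by auto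
        then show ?thesis unfolding R_def using D by blast
      qed
      then show ?thesis using D(1) by blast
    qed
  qed
  then obtain C c where Cc: "0 < C" "0 < c" "\<And>s t g x. - K' \<le> s \<Longrightarrow> s \<le> K' \<Longrightarrow> (\<forall>w. cmod (g w) \<le> 1) \<Longrightarrow> cmod ((chop P f s ^^ t) g x) \<le> C * exp (- (c * s\<^sup>2 * real t))"
    unfolding R_def by blast
  show ?thesis
  proof (rule exI[of _ C], rule conjI[OF Cc(1)], rule exI[of _ c], rule conjI[OF Cc(2)], intro allI impI)
    fix s :: real and t :: nat and g :: "'x \<Rightarrow> complex" and x assume "\<bar>s\<bar> \<le> K'" "\<forall>w. cmod (g w) \<le> 1"
    then show "cmod ((chop P f s ^^ t) g x) \<le> C * exp (- (c * s\<^sup>2 * real t))"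
      by (intro Cc(3)) auto
  qed
qed

end

section \<open>The Fejer kernel\<close>

text \<open>The unnormalised Fejer kernel \<open>(1 - cos x) / x\<^sup>2\<close>; written with
  \<open>sinc\<close> it is continuous at 0 without a case distinction.\<close>

definition jker :: "real \<Rightarrow> real" where "jker x = (sinc (x / 2))\<^sup>2 / 2"

text \<open>The odd primitive of \<open>jker\<close>, found by integrating by parts into the sine
  integral.\<close>

definition Jker :: "real \<Rightarrow> real" where "Jker x = Si x - x * jker x"

lemma jker_nonneg: "0 \<le> jker x" by (simp add: jker_def)

lemma jker_eq: "x \<noteq> 0 \<Longrightarrow> jker x = (1 - cos x) / x\<^sup>2"
  using cos_double_sin[of "x / 2"] by (simp add: jker_def power_divide field_simps)

lemma jker_ge: "0 < A \<Longrightarrow> x\<^sup>2 \<le> A \<Longrightarrow> (1 - cos x) / A \<le> jker x"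
  by (cases "x = 0") (auto simp: jker_eq jker_nonneg intro!: divide_left_mono)

lemma jker_le: "x \<noteq> 0 \<Longrightarrow> jker x \<le> 2 / x\<^sup>2"
  unfolding jker_eq using cos_ge_minus_one[of x] by (intro divide_right_mono) auto

lemma jker_le_half: "jker x \<le> 1 / 2"
proof -
  have "\<bar>sinc (x / 2)\<bar> \<le> 1"
    using abs_sin_x_le_abs_x[of "x / 2"] by (auto simp: field_simps)
  then have "(sinc (x / 2))\<^sup>2 \<le> 1" by (simp add: abs_square_le_1)
  then show ?thesis by (simp add: jker_def)
qed

lemma jker_even: "jker (- x) = jker x"
  by (simp add: jker_def)

lemma isCont_jker: "isCont jker x"
  unfolding jker_def by (intro continuous_intros isCont_o2[OF _ isCont_sinc]) auto

lemma DERIV_Jker: "(Jker has_real_derivative jker x) (at x)"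
proof (cases "x = 0")
  case True
  have "((\<lambda>x. x * jker x) has_real_derivative jker 0) (at 0)"
    unfolding DERIV_def
  proof (rule Lim_transform_eventually)
    show "(jker \<longlongrightarrow> jker 0) (at 0)" using isCont_jker[of 0] by (simp add: isCont_def)
    show "eventually (\<lambda>h. jker h = ((0 + h) * jker (0 + h) - 0 * jker 0) / h) (at 0)"
      by (simp add: eventually_at_filter)
  qed
  then have "((\<lambda>x. Si x - x * jker x) has_real_derivative (sinc 0 - jker 0)) (at 0)"
    by (intro derivative_intros DERIV_Si)
  then show ?thesis using True by (simp add: Jker_def[abs_def] jker_def)
next
  case False
  have "((\<lambda>x. Si x - (1 - cos x) / x) has_real_derivative (sinc x - (sin x * x - (1 - cos x)) / (x * x))) (at x)"
    using False by (auto intro!: derivative_eq_intros DERIV_Si)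
  also have "sinc x - (sin x * x - (1 - cos x)) / (x * x) = jker x"
    using False by (simp add: jker_eq field_simps power2_eq_square)
  finally show ?thesis
  proof (rule DERIV_cong_ev[THEN iffD1, rotated 3])
    have "eventually (\<lambda>y. y \<noteq> 0) (nhds x)" using False by (rule t1_space_nhds)
    then show "eventually (\<lambda>y. Si y - (1 - cos y) / y = Jker y) (nhds x)"
      by eventually_elim (simp add: Jker_def jker_eq power2_eq_square)
  qed auto
qed

lemma Jker_mono: "x \<le> y \<Longrightarrow> Jker x \<le> Jker y"
  by (rule DERIV_nonneg_imp_nondecreasing) (use DERIV_Jker jker_nonneg in blast)+

lemma Jker_at_top: "(Jker \<longlongrightarrow> pi / 2) at_top"
proof -
  have "((\<lambda>x. x * jker x) \<longlongrightarrow> 0) at_top"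
  proof (rule Lim_null_comparison)
    show "eventually (\<lambda>x. norm (x * jker x) \<le> 2 / x) at_top"
      using eventually_gt_at_top[of 0]
    proof eventually_elim
      case (elim x)
      have "x * jker x \<le> x * (2 / x\<^sup>2)" using elim jker_le[of x] by (intro mult_left_mono) auto
      then show ?case using elim jker_nonneg[of x] by (simp add: power2_eq_square)
    qed
    show "((\<lambda>x::real. 2 / x) \<longlongrightarrow> 0) at_top"
      by (intro tendsto_divide_0[OF tendsto_const] filterlim_at_top_imp_at_infinity filterlim_ident)
  qed
  from tendsto_diff[OF Si_at_top this] show ?thesis by (simp add: Jker_def[abs_def])
qed

lemma Jker_le: "Jker x \<le> pi / 2"
proof (rule tendsto_lowerbound[OF Jker_at_top])
  show "eventually (\<lambda>y. Jker x \<le> Jker y) at_top"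
    by (rule eventually_mono[OF eventually_ge_at_top[of x]]) (rule Jker_mono)
qed simp

text \<open>Because \<open>jker v \<le> 2 / v\<^sup>2\<close>, the function
  \<open>Jker y + 2 / y\<close> decreases on the positive axis to the limit pi / 2.\<close>

lemma Jker_ge: "0 < x \<Longrightarrow> pi / 2 - 2 / x \<le> Jker x"
proof -
  assume x: "0 < x"
  have lim: "((\<lambda>y. Jker y + 2 / y) \<longlongrightarrow> pi / 2 + 0) at_top"
    by (intro tendsto_add Jker_at_top tendsto_divide_0[OF tendsto_const] filterlim_at_top_imp_at_infinity filterlim_ident)
  have "pi / 2 + 0 \<le> Jker x + 2 / x"
  proof (rule tendsto_upperbound[OF lim])
    show "eventually (\<lambda>y. Jker y + 2 / y \<le> Jker x + 2 / x) at_top"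
      using eventually_ge_at_top[of x]
    proof eventually_elim
      case (elim y)
      show ?case
      proof (rule DERIV_nonpos_imp_nonincreasing[OF elim])
        fix v assume v: "x \<le> v" "v \<le> y"
        have "((\<lambda>y. Jker y + 2 / y) has_real_derivative (jker v - 2 / v\<^sup>2)) (at v)"
          using v x by (auto intro!: derivative_eq_intros DERIV_Jker simp: power2_eq_square)
        moreover have "jker v - 2 / v\<^sup>2 \<le> 0" using jker_le[of v] v x by simp
        ultimately show "\<exists>y. ((\<lambda>y. Jker y + 2 / y) has_real_derivative y) (at v) \<and> y \<le> 0" by blast
      qed
    qed
  qed simp
  then show ?thesis by simp
qed

lemma Jker_odd: "Jker (- x) = - Jker x"
proof -
  have "Si (- x) = - Si x" by (cases "0 \<le> x") (use Si_neg[of x] Si_neg[of "- x"] in auto)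
  then show ?thesis by (simp add: Jker_def jker_even)
qed

definition tri :: "real \<Rightarrow> real \<Rightarrow> real" where "tri L s = max 0 (1 - \<bar>s\<bar> / L)"

text \<open>Approximate identity with Fourier transform \<open>tri L\<close>: frequencies beyond
  \<open>L\<close> do not occur, and the heavy tail of order \<open>1 / v\<^sup>2\<close> is the
  price.\<close>

definition fej :: "real \<Rightarrow> real \<Rightarrow> real" where "fej L v = L / pi * jker (L * v)"

lemma tri_measurable [measurable]: "tri L \<in> borel_measurable borel"
  unfolding tri_def by measurable

lemma tri_bounds: "0 < L \<Longrightarrow> 0 \<le> tri L s" "0 < L \<Longrightarrow> tri L s \<le> 1" "0 < L \<Longrightarrow> tri L s \<noteq> 0 \<Longrightarrow> \<bar>s\<bar> \<le> L"
    "0 < L \<Longrightarrow> 1 - tri L s \<le> \<bar>s\<bar> / L"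
  by (auto simp: tri_def max_def field_simps split: if_splits)

lemma tri_integrable: "0 < L \<Longrightarrow> integrable lborel (tri L)"
proof -
  assume L: "0 < L"
  have "integrable lborel (indicator {- L..L} :: real \<Rightarrow> real)"
    by (rule integrable_real_indicator) (auto simp: emeasure_lborel_Icc_eq)
  then show ?thesis
  proof (rule Bochner_Integration.integrable_bound)
    have "norm (tri L s) \<le> norm (indicator {- L..L} s :: real)" for s
    proof (cases "tri L s = 0")
      case False
      then have "s \<in> {- L..L}" using tri_bounds(3)[OF L False] by (auto simp: abs_le_iff)
      then show ?thesis using tri_bounds(1,2)[OF L, of s] by simp
    qed simp
    then show "AE s in lborel. norm (tri L s) \<le> norm (indicator {- L..L} s :: real)" by simp
  qed measurable
qed

text \<open>Explicit primitives on the two linear pieces; they divide by \<open>v\<close>, so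
  \<open>v = 0\<close> is treated apart.\<close>

lemma tri_fourier:
  assumes L: "0 < L"
  shows "(LINT s|lborel. cos (s * v) * tri L s) = 2 * pi * fej L v"
proof (cases "v = 0")
  case True
  define F1 where "F1 s = s - s\<^sup>2 / (2 * L)" for s
  define F2 where "F2 s = s + s\<^sup>2 / (2 * L)" for s
  have 1: "(LINT s|lborel. (1 - s / L) * indicator {0..L} s) = F1 L - F1 0"
    using L by (intro integral_FTC_Icc_real) (auto intro!: derivative_eq_intros continuous_intros simp: F1_def)
  have 2: "(LINT s|lborel. (1 + s / L) * indicator {- L..0} s) = F2 0 - F2 (- L)"
    using L by (intro integral_FTC_Icc_real) (auto intro!: derivative_eq_intros continuous_intros simp: F2_def)
  have i1: "integrable lborel (\<lambda>s. (1 - s / L) * indicator {0..L} s)"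
    by (intro borel_integrable_atLeastAtMost) (use L in \<open>auto intro!: continuous_intros\<close>)
  have i2: "integrable lborel (\<lambda>s. (1 + s / L) * indicator {- L..0} s)"
    by (intro borel_integrable_atLeastAtMost) (use L in \<open>auto intro!: continuous_intros\<close>)
  have "(LINT s|lborel. cos (s * v) * tri L s) = (LINT s|lborel. (1 - s / L) * indicator {0..L} s + (1 + s / L) * indicator {- L..0} s)"
  proof (rule integral_cong_AE)
    show "AE s in lborel. cos (s * v) * tri L s = (1 - s / L) * indicator {0..L} s + (1 + s / L) * indicator {- L..0} s"
      using AE_lborel_singleton[of 0]
      by eventually_elim (use L True in \<open>auto simp: tri_def indicator_def field_simps max_def\<close>)
  qed auto
  also have "\<dots> = (F1 L - F1 0) + (F2 0 - F2 (- L))"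
    using i1 i2 1 2 by simp
  also have "\<dots> = L" using L by (simp add: F1_def F2_def power2_eq_square)
  finally show ?thesis using True by (simp add: fej_def jker_def)
next
  case v: False
  define F1 where "F1 s = (1 - s / L) * sin (s * v) / v - cos (s * v) / (L * v\<^sup>2)" for s
  define F2 where "F2 s = (1 + s / L) * sin (s * v) / v + cos (s * v) / (L * v\<^sup>2)" for s
  have 1: "(LINT s|lborel. ((1 - s / L) * cos (s * v)) * indicator {0..L} s) = F1 L - F1 0"
  proof (rule integral_FTC_Icc_real)
    fix s show "(F1 has_real_derivative ((1 - s / L) * cos (s * v))) (at s)"
      unfolding F1_def using L v by (auto intro!: derivative_eq_intros simp: field_simps power2_eq_square)
  qed (use L in \<open>auto intro!: continuous_intros\<close>)
  have 2: "(LINT s|lborel. ((1 + s / L) * cos (s * v)) * indicator {- L..0} s) = F2 0 - F2 (- L)"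
  proof (rule integral_FTC_Icc_real)
    fix s show "(F2 has_real_derivative ((1 + s / L) * cos (s * v))) (at s)"
      unfolding F2_def using L v by (auto intro!: derivative_eq_intros simp: field_simps power2_eq_square)
  qed (use L in \<open>auto intro!: continuous_intros\<close>)
  have i1: "integrable lborel (\<lambda>s. ((1 - s / L) * cos (s * v)) * indicator {0..L} s)"
    by (intro borel_integrable_atLeastAtMost) (use L in \<open>auto intro!: continuous_intros\<close>)
  have i2: "integrable lborel (\<lambda>s. ((1 + s / L) * cos (s * v)) * indicator {- L..0} s)"
    by (intro borel_integrable_atLeastAtMost) (use L in \<open>auto intro!: continuous_intros\<close>)
  have "(LINT s|lborel. cos (s * v) * tri L s) = (LINT s|lborel. ((1 - s / L) * cos (s * v)) * indicator {0..L} s + ((1 + s / L) * cos (s * v)) * indicator {- L..0} s)"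
  proof (rule integral_cong_AE)
    show "AE s in lborel. cos (s * v) * tri L s = ((1 - s / L) * cos (s * v)) * indicator {0..L} s + ((1 + s / L) * cos (s * v)) * indicator {- L..0} s"
      using AE_lborel_singleton[of 0]
      by eventually_elim (use L in \<open>auto simp: tri_def indicator_def field_simps max_def\<close>)
  qed auto
  also have "\<dots> = (F1 L - F1 0) + (F2 0 - F2 (- L))"
    using i1 i2 1 2 by simp
  also have "\<dots> = 2 * (1 - cos (L * v)) / (L * v\<^sup>2)" using L v by (simp add: F1_def F2_def field_simps)
  also have "\<dots> = 2 * pi * fej L v"
    using L v by (simp add: fej_def jker_eq field_simps power2_eq_square)
  finally show ?thesis .
qed

lemma fej_nonneg: "0 < L \<Longrightarrow> 0 \<le> fej L v"
  by (simp add: fej_def jker_nonneg)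

section \<open>The smoothed law of the free walk in Fourier space\<close>

context nonlattice_walk
begin

definition ind :: "'x \<Rightarrow> 'x \<Rightarrow> real" where "ind w x = (if x = w then 1 else 0)"

lemma ind_bounds: "0 \<le> ind w x" "ind w x \<le> 1" "cmod (of_real (ind w x)) \<le> 1"
  by (auto simp: ind_def)

lemma nuc_ind: "nuc (\<lambda>x. of_real (ind w x)) = of_real (nu w)"
  unfolding nuc_def of_real_mult[symmetric] of_real_sum[symmetric]
  by (simp add: ind_def if_distrib[of "\<lambda>c. c * _"] cong: if_cong)

lemma chop_pow_measurable [measurable]:
  assumes [measurable]: "h \<in> borel_measurable borel"
  shows "(\<lambda>u. (chop P f (h u) ^^ n) g x) \<in> borel_measurable borel"
proof (induction n arbitrary: x)
  case (Suc n)
  have [measurable]: "(\<lambda>u. (chop P f (h u) ^^ n) g x) \<in> borel_measurable borel" for x by (rule Suc)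
  show ?case unfolding funpow.simps comp_def chop_def[of P f _ "(chop P f _ ^^ n) g"] by measurable
qed simp

text \<open>The Fejer kernel is a superposition of waves, and the walk acts on each wave through
  \<open>chop\<close>; linearity moves the transition operator under the integral.\<close>

lemma tpow_fej:
  assumes L: "0 < L"
  shows "(T ^^ t) (\<lambda>x y. ind w x * fej L (y - z)) x y
    = Re (of_real (1 / (2 * pi)) * (LINT s|lborel. iexp (s * (y - z)) * of_real (tri L s) * (chop P f s ^^ t) (\<lambda>x. of_real (ind w x)) x))"
proof -
  have int: "integrable lborel (\<lambda>s. iexp (s * v) * of_real (tri L s) * h s)"
    if [measurable]: "h \<in> borel_measurable borel" and h: "\<And>s. cmod (h s) \<le> 1" for v and h :: "real \<Rightarrow> complex"
    by (rule Bochner_Integration.integrable_bound[OF tri_integrable[OF L]])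
      (use tri_bounds[OF L] h in \<open>auto simp: norm_mult intro!: AE_I2 mult_right_le_one_le\<close>)
  show ?thesis
  proof (induction t arbitrary: x y)
    case 0
    have "fej L (y - z) = Re (of_real (1 / (2 * pi)) * (LINT s|lborel. iexp (s * (y - z)) * of_real (tri L s)))"
    proof -
      have "integrable lborel (\<lambda>s. iexp (s * (y - z)) * complex_of_real (tri L s))"
        using int[of "\<lambda>_. 1" "y - z"] by simp
      then have "Re (LINT s|lborel. iexp (s * (y - z)) * of_real (tri L s)) = (LINT s|lborel. Re (iexp (s * (y - z)) * of_real (tri L s)))"
        by (rule integral_Re[symmetric])
      also have "\<dots> = (LINT s|lborel. cos (s * (y - z)) * tri L s)"
        by (simp add: Re_exp)
      also have "\<dots> = 2 * pi * fej L (y - z)" by (rule tri_fourier[OF L])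
      finally show ?thesis by (simp only: Re_complex_of_real times_complex.sel Im_complex_of_real) simp
    qed
    then show ?case by (cases "x = w") (simp_all add: ind_def)
  next
    case (Suc t)
    define g :: "'x \<Rightarrow> complex" where "g = (\<lambda>x. of_real (ind w x))"
    have gb: "cmod ((chop P f s ^^ n) g x) \<le> 1" for s n x
      by (rule norm_chop_pow_le) (simp add: g_def ind_def)
    have "(T ^^ Suc t) (\<lambda>x y. ind w x * fej L (y - z)) x y
      = (\<Sum>x'\<in>UNIV. P x x' * Re (of_real (1 / (2 * pi)) * (LINT s|lborel. iexp (s * (y + f x' - z)) * of_real (tri L s) * (chop P f s ^^ t) g x')))"
      unfolding funpow.simps comp_def step_def[of P f "(T ^^ t) _"] Suc g_def by simp
    also have "\<dots> = Re (of_real (1 / (2 * pi)) * (\<Sum>x'\<in>UNIV. LINT s|lborel. of_real (P x x') * (iexp (s * (y + f x' - z)) * of_real (tri L s) * (chop P f s ^^ t) g x')))"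
      unfolding sum_distrib_left Re_sum
      by (rule sum.cong[OF refl]) (simp del: of_real_divide of_real_mult)
    also have "(\<Sum>x'\<in>UNIV. LINT s|lborel. of_real (P x x') * (iexp (s * (y + f x' - z)) * of_real (tri L s) * (chop P f s ^^ t) g x'))
      = (LINT s|lborel. (\<Sum>x'\<in>UNIV. of_real (P x x') * (iexp (s * (y + f x' - z)) * of_real (tri L s) * (chop P f s ^^ t) g x')))"
      by (rule Bochner_Integration.integral_sum[symmetric]) (intro integrable_mult_right int chop_pow_measurable gb, simp)
    also have "\<dots> = (LINT s|lborel. iexp (s * (y - z)) * of_real (tri L s) * (chop P f s ^^ Suc t) g x)"
    proof (rule Bochner_Integration.integral_cong[OF refl])
      fix s
      have e: "iexp (s * (y + f x' - z)) = iexp (s * (y - z)) * iexp (s * f x')" for x'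
        by (simp add: exp_add[symmetric] algebra_simps)
      show "(\<Sum>x'\<in>UNIV. of_real (P x x') * (iexp (s * (y + f x' - z)) * of_real (tri L s) * (chop P f s ^^ t) g x')) = iexp (s * (y - z)) * of_real (tri L s) * (chop P f s ^^ Suc t) g x"
        unfolding funpow.simps comp_def chop_def[of P f s "(chop P f s ^^ t) g"] sum_distrib_left e
        by (rule sum.cong[OF refl]) (simp only: scaleR_conv_of_real mult_ac)
    qed
    finally show ?case unfolding g_def .
  qed
qed

text \<open>In \<open>chop_clt\<close> with \<open>s = u / sqrt t\<close>, \<open>l\<close> is fixed
  first to make \<open>\<rho> ^ l\<close> small; for this \<open>l\<close> every other error
  vanishes as \<open>t\<close> grows, and \<open>gam (t - l) s\<close> tends to
  \<open>gam 1 u\<close>.\<close>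

lemma scaled_char_tendsto:
  "(\<lambda>t. (chop P f (u / sqrt (real t)) ^^ t) (\<lambda>x. of_real (ind w x)) x) \<longlonglongrightarrow> of_real (nu w * gam 1 u)"
proof -
  define g :: "'x \<Rightarrow> complex" where "g = (\<lambda>x. of_real (ind w x))"
  have g: "cmod (g v) \<le> 1" for v by (simp add: g_def ind_def)
  obtain C \<rho> where C: "0 < C" "0 < \<rho>" "\<rho> < 1" and clt: "\<And>s j l g x. \<bar>s\<bar> \<le> 1 \<Longrightarrow> (\<And>w. cmod (g w) \<le> 1) \<Longrightarrow>
     cmod ((chop P f s ^^ (j + l)) g x - nuc g * of_real (gam (real j) s)) \<le> C * (real j * \<bar>s\<bar> ^ 3 + real (l + 1) * \<bar>s\<bar> + \<rho> ^ l)"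
    using chop_clt by blast
  have inv0: "(\<lambda>t. 1 / sqrt (real t)) \<longlonglongrightarrow> 0"
    by (intro tendsto_divide_0[OF tendsto_const] filterlim_at_top_imp_at_infinity filterlim_compose[OF sqrt_at_top] filterlim_real_sequentially)
  have inv1: "(\<lambda>t. 1 / real t) \<longlonglongrightarrow> 0" by (rule lim_1_over_n)
  show ?thesis
    unfolding g_def[symmetric]
  proof (rule LIMSEQ_I)
    fix e :: real assume e: "0 < e"
    have "(\<lambda>l. C * \<rho> ^ l) \<longlonglongrightarrow> 0" using C by (auto intro!: tendsto_eq_intros LIMSEQ_power_zero)
    then have "eventually (\<lambda>l. C * \<rho> ^ l < e / 2) sequentially" using e by (intro order_tendstoD(2)) auto
    then obtain l where l: "C * \<rho> ^ l < e / 2" by (auto simp: eventually_sequentially)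
    define b where "b t = C * (\<bar>u\<bar> ^ 3 * (1 / sqrt (real t)) + real (l + 1) * \<bar>u\<bar> * (1 / sqrt (real t)) + \<rho> ^ l)
        + \<bar>nu w * exp (- (s2 / 2 * (u\<^sup>2 * (1 - real l * (1 / real t))))) - nu w * gam 1 u\<bar>" for t :: nat
    have "b \<longlonglongrightarrow> C * (\<bar>u\<bar> ^ 3 * 0 + real (l + 1) * \<bar>u\<bar> * 0 + \<rho> ^ l) + \<bar>nu w * exp (- (s2 / 2 * (u\<^sup>2 * (1 - real l * 0)))) - nu w * gam 1 u\<bar>"
      unfolding b_def by (intro tendsto_intros inv0 inv1)
    then have blim: "b \<longlonglongrightarrow> C * \<rho> ^ l" by (simp add: gam_def)
    have "eventually (\<lambda>t. b t < e / 2 + e / 2) sequentially"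
      by (rule order_tendstoD(2)[OF blim]) (use l e in linarith)
    moreover have "(\<lambda>t. \<bar>u\<bar> * (1 / sqrt (real t))) \<longlonglongrightarrow> \<bar>u\<bar> * 0" by (intro tendsto_intros inv0)
    then have "eventually (\<lambda>t. \<bar>u\<bar> * (1 / sqrt (real t)) < 1) sequentially" by (intro order_tendstoD(2)) auto
    ultimately have "eventually (\<lambda>t. norm ((chop P f (u / sqrt (real t)) ^^ t) g x - of_real (nu w * gam 1 u)) < e) sequentially"
      using eventually_ge_at_top[of "l + 1"]
    proof eventually_elim
      case (elim t)
      define s where "s = u / sqrt (real t)"
      define j where "j = t - l"
      have t: "0 < real t" "t = j + l" "real j \<le> real t" "real j = real t - real l" using elim by (auto simp: j_def)
      have as: "\<bar>s\<bar> = \<bar>u\<bar> * (1 / sqrt (real t))" by (simp add: s_def)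
      have s1: "\<bar>s\<bar> \<le> 1" using elim as by simp
      have "cmod ((chop P f s ^^ (j + l)) g x - nuc g * of_real (gam (real j) s)) \<le> C * (real j * \<bar>s\<bar> ^ 3 + real (l + 1) * \<bar>s\<bar> + \<rho> ^ l)"
        by (rule clt[OF s1]) (rule g)
      moreover have "real j * \<bar>s\<bar> ^ 3 \<le> \<bar>u\<bar> ^ 3 * (1 / sqrt (real t))"
      proof -
        have 1: "real j * \<bar>s\<bar> ^ 3 \<le> real t * \<bar>s\<bar> ^ 3" using t(3) by (intro mult_right_mono) auto
        have "\<bar>s\<bar> ^ 3 = \<bar>u\<bar> ^ 3 * (1 / sqrt (real t)) / real t"
          using t(1) by (simp add: s_def power_divide power3_eq_cube)
        then have "real t * \<bar>s\<bar> ^ 3 = \<bar>u\<bar> ^ 3 * (1 / sqrt (real t))" using t(1) by simp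
        then show ?thesis using 1 by linarith
      qed
      then have "C * (real j * \<bar>s\<bar> ^ 3 + real (l + 1) * \<bar>s\<bar> + \<rho> ^ l) \<le> C * (\<bar>u\<bar> ^ 3 * (1 / sqrt (real t)) + real (l + 1) * \<bar>u\<bar> * (1 / sqrt (real t)) + \<rho> ^ l)"
        using C as by (intro mult_left_mono) auto
      moreover have gj: "gam (real j) s = exp (- (s2 / 2 * (u\<^sup>2 * (1 - real l * (1 / real t)))))"
        using t(1) unfolding gam_def t(4) by (simp add: s_def power_divide field_simps)
      have "cmod (nuc g * of_real (gam (real j) s) - of_real (nu w * gam 1 u)) = \<bar>nu w * exp (- (s2 / 2 * (u\<^sup>2 * (1 - real l * (1 / real t))))) - nu w * gam 1 u\<bar>"
        unfolding g_def nuc_ind gj of_real_mult[symmetric] of_real_diff[symmetric] norm_of_real ..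
      moreover have "cmod ((chop P f s ^^ (j + l)) g x - of_real (nu w * gam 1 u)) \<le> cmod ((chop P f s ^^ (j + l)) g x - nuc g * of_real (gam (real j) s)) + cmod (nuc g * of_real (gam (real j) s) - of_real (nu w * gam 1 u))"
        using norm_triangle_ineq[of "(chop P f s ^^ (j + l)) g x - nuc g * of_real (gam (real j) s)" "nuc g * of_real (gam (real j) s) - of_real (nu w * gam 1 u)"] by simp
      ultimately have "cmod ((chop P f s ^^ (j + l)) g x - of_real (nu w * gam 1 u)) \<le> b t"
        unfolding b_def by linarith
      then show ?case using elim(1) unfolding s_def t(2)[symmetric] by linarith
    qed
    then show "\<exists>no. \<forall>t\<ge>no. norm ((chop P f (u / sqrt (real t)) ^^ t) g x - of_real (nu w * gam 1 u)) < e"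
      by (simp add: eventually_sequentially)
  qed
qed

text \<open>Dominated convergence. The cutoff \<open>tri\<close> confines the true frequency
  \<open>u / sqrt t\<close> to a compact set, where \<open>decay_uniform\<close> provides the
  Gaussian majorant \<open>C * exp (- (c * u\<^sup>2))\<close> independent of
  \<open>t\<close>.\<close>

lemma scaled_char_integral_tendsto:
  assumes L: "0 < L"
  shows "(\<lambda>t. LINT u|lborel. tri L (u / sqrt (real t)) * cmod ((chop P f (u / sqrt (real t)) ^^ t) (\<lambda>x. of_real (ind w x)) x - of_real (nu w * gam 1 u))) \<longlonglongrightarrow> 0"
proof -
  define g :: "'x \<Rightarrow> complex" where "g = (\<lambda>x. of_real (ind w x))"
  have g: "\<forall>v. cmod (g v) \<le> 1" by (simp add: g_def ind_def)
  obtain C c where Cc: "0 < C" "0 < c" "\<And>s t g x. \<bar>s\<bar> \<le> L \<Longrightarrow> (\<forall>w. cmod (g w) \<le> 1) \<Longrightarrow> cmod ((chop P f s ^^ t) g x) \<le> C * exp (- (c * s\<^sup>2 * real t))"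
    using decay_uniform[of L] L by (metis less_imp_le)
  have int0: "integrable lborel (\<lambda>u. exp (- (c * u\<^sup>2)) :: real)"
  proof -
    have "integrable lborel (\<lambda>u. \<bar>u\<bar> ^ 0 * gam (2 * c / s2) u)"
      by (rule gam_moment(1)) (use Cc s2_pos in simp)
    then show ?thesis using s2_pos by (simp add: gam_def)
  qed
  have int1: "integrable lborel (gam 1)" using gam_1_integrable[of 0] by simp
  have bound: "norm (tri L (u / sqrt (real t)) * cmod ((chop P f (u / sqrt (real t)) ^^ t) g x - of_real (nu w * gam 1 u))) \<le> C * exp (- (c * u\<^sup>2)) + nu w * gam 1 u"
    if t: "0 < t" for t u
  proof -
    define s where "s = u / sqrt (real t)"
    show ?thesis
      unfolding s_def[symmetric]
    proof (cases "tri L s = 0")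
      case True
      have "0 \<le> C * exp (- (c * u\<^sup>2))" "0 \<le> nu w * gam 1 u" using Cc nu_nonneg[of w] gam_pos[of 1 u] by auto
      then show "norm (tri L s * cmod ((chop P f s ^^ t) g x - of_real (nu w * gam 1 u))) \<le> C * exp (- (c * u\<^sup>2)) + nu w * gam 1 u"
        using True by simp
    next
      case False
      then have s: "\<bar>s\<bar> \<le> L" using tri_bounds(3)[OF L] by auto
      have "s\<^sup>2 * real t = u\<^sup>2" using t by (simp add: s_def power_divide)
      then have 1: "cmod ((chop P f s ^^ t) g x) \<le> C * exp (- (c * u\<^sup>2))"
        using Cc(3)[OF s g, of t x] by (simp add: mult.assoc)
      have 2: "cmod (of_real (nu w * gam 1 u)) \<le> nu w * gam 1 u"
        unfolding norm_of_real using nu_nonneg[of w] gam_pos[of 1 u] by simp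
      have 3: "cmod ((chop P f s ^^ t) g x - of_real (nu w * gam 1 u)) \<le> C * exp (- (c * u\<^sup>2)) + nu w * gam 1 u"
        using norm_triangle_le_diff[OF add_mono[OF 1 2]] .
      have "tri L s * cmod ((chop P f s ^^ t) g x - of_real (nu w * gam 1 u)) \<le> 1 * cmod ((chop P f s ^^ t) g x - of_real (nu w * gam 1 u))"
        using tri_bounds[OF L] by (intro mult_right_mono) auto
      then show "norm (tri L s * cmod ((chop P f s ^^ t) g x - of_real (nu w * gam 1 u))) \<le> C * exp (- (c * u\<^sup>2)) + nu w * gam 1 u"
        using 3 tri_bounds(1)[OF L, of s] by simp
    qed
  qed
  have lim: "(\<lambda>t. tri L (u / sqrt (real t)) * cmod ((chop P f (u / sqrt (real t)) ^^ t) g x - of_real (nu w * gam 1 u))) \<longlonglongrightarrow> 0" for u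
  proof -
    have lim: "(\<lambda>t. cmod ((chop P f (u / sqrt (real t)) ^^ t) g x - of_real (nu w * gam 1 u))) \<longlonglongrightarrow> 0"
      using scaled_char_tendsto[of u w x] unfolding g_def by (intro tendsto_norm_zero LIM_zero)
    show ?thesis
      by (rule Lim_null_comparison[OF _ lim])
        (use tri_bounds[OF L] in \<open>auto simp: abs_mult intro!: always_eventually mult_left_le_one_le\<close>)
  qed
  \<comment> \<open>The index is shifted to \<open>Suc t\<close> because the majorant is established
    only for positive times.\<close>
  have "(\<lambda>t. LINT u|lborel. tri L (u / sqrt (real (Suc t))) * cmod ((chop P f (u / sqrt (real (Suc t))) ^^ Suc t) g x - of_real (nu w * gam 1 u)))
      \<longlonglongrightarrow> (LINT u|(lborel :: real measure). 0)"
  proof (rule integral_dominated_convergence[where w = "\<lambda>u. C * exp (- (c * u\<^sup>2)) + nu w * gam 1 u"])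
    show "integrable lborel (\<lambda>u. C * exp (- (c * u\<^sup>2)) + nu w * gam 1 u)"
      using int0 int1 by (intro Bochner_Integration.integrable_add integrable_mult_right) auto
    show "AE u in lborel. (\<lambda>t. tri L (u / sqrt (real (Suc t))) * cmod ((chop P f (u / sqrt (real (Suc t))) ^^ Suc t) g x - of_real (nu w * gam 1 u))) \<longlonglongrightarrow> 0"
      by (intro AE_I2 LIMSEQ_Suc[OF lim])
    show "AE u in lborel. norm (tri L (u / sqrt (real (Suc t))) * cmod ((chop P f (u / sqrt (real (Suc t))) ^^ Suc t) g x - of_real (nu w * gam 1 u))) \<le> C * exp (- (c * u\<^sup>2)) + nu w * gam 1 u" for t
      by (intro AE_I2 bound) simp
  qed measurable
  note lim_Suc = this[unfolded Bochner_Integration.integral_zero]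
  show ?thesis
    unfolding g_def[symmetric] by (rule LIMSEQ_imp_Suc, rule lim_Suc)
qed

end

section \<open>Local limit theorem\<close>

text \<open>The indicator of the interval from \<open>\<alpha>\<close> to \<open>\<beta>\<close>
  convolved with \<open>fej L\<close>, in closed form through the primitive of the kernel.\<close>

definition smooth_ind :: "real \<Rightarrow> real \<Rightarrow> real \<Rightarrow> real \<Rightarrow> real" where
  "smooth_ind L \<alpha> \<beta> v = (Jker (L * (v - \<alpha>)) - Jker (L * (v - \<beta>))) / pi"

lemma smooth_ind_bounds:
  assumes "0 < L" "\<alpha> \<le> \<beta>"
  shows "0 \<le> smooth_ind L \<alpha> \<beta> v" "smooth_ind L \<alpha> \<beta> v \<le> 1"
proof -
  have "L * (v - \<beta>) \<le> L * (v - \<alpha>)" using assms by (intro mult_left_mono) auto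
  then show "0 \<le> smooth_ind L \<alpha> \<beta> v"
    unfolding smooth_ind_def using Jker_mono by (simp add: pi_ge_zero)
  have "- Jker (L * (v - \<beta>)) \<le> pi / 2" using Jker_le[of "- (L * (v - \<beta>))"] by (simp add: Jker_odd)
  then have "Jker (L * (v - \<alpha>)) - Jker (L * (v - \<beta>)) \<le> pi" using Jker_le[of "L * (v - \<alpha>)"] by simp
  then show "smooth_ind L \<alpha> \<beta> v \<le> 1" unfolding smooth_ind_def by simp
qed

lemma smooth_ind_inside:
  assumes "0 < L" "0 < \<eta>" "\<alpha> + \<eta> \<le> v" "v \<le> \<beta> - \<eta>"
  shows "1 - 4 / (pi * \<eta>) / L \<le> smooth_ind L \<alpha> \<beta> v"
proof -
  have Le: "0 < L * \<eta>" using assms by simp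
  have "pi / 2 - 2 / (L * \<eta>) \<le> Jker (L * \<eta>)" by (rule Jker_ge[OF Le])
  moreover have "Jker (L * \<eta>) \<le> Jker (L * (v - \<alpha>))" using assms by (intro Jker_mono mult_left_mono) auto
  moreover have "Jker (L * \<eta>) \<le> Jker (L * (\<beta> - v))" using assms by (intro Jker_mono mult_left_mono) auto
  moreover have "Jker (L * (v - \<beta>)) = - Jker (L * (\<beta> - v))"
    using Jker_odd[of "L * (\<beta> - v)"] by (simp add: algebra_simps)
  ultimately have "pi - 4 / (L * \<eta>) \<le> Jker (L * (v - \<alpha>)) - Jker (L * (v - \<beta>))" by linarith
  then have "(pi - 4 / (L * \<eta>)) / pi \<le> smooth_ind L \<alpha> \<beta> v"
    unfolding smooth_ind_def by (intro divide_right_mono) auto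
  then show ?thesis by (simp add: diff_divide_distrib mult_ac)
qed

text \<open>The mean value theorem evaluates the kernel at a point whose distance from 0 is at least
  \<open>L * d\<close>, where its quadratic decay applies.\<close>

lemma smooth_ind_outside:
  assumes "0 < L" "\<alpha> < \<beta>" "0 < d" "v \<le> \<alpha> - d \<or> \<beta> + d \<le> v"
  shows "smooth_ind L \<alpha> \<beta> v \<le> 2 * (\<beta> - \<alpha>) / (pi * L * d\<^sup>2)"
proof -
  have lt: "L * (v - \<beta>) < L * (v - \<alpha>)" using assms by (intro mult_strict_left_mono) auto
  obtain \<xi> where \<xi>: "L * (v - \<beta>) < \<xi>" "\<xi> < L * (v - \<alpha>)"
    "Jker (L * (v - \<alpha>)) - Jker (L * (v - \<beta>)) = (L * (v - \<alpha>) - L * (v - \<beta>)) * jker \<xi>"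
    using MVT2[OF lt, of Jker jker] DERIV_Jker by blast
  have far: "L * d \<le> \<bar>\<xi>\<bar>"
  proof (cases "v \<le> \<alpha> - d")
    case True
    then have "L * (v - \<alpha>) \<le> L * (- d)" using assms by (intro mult_left_mono) auto
    then show ?thesis using \<xi> by simp
  next
    case False
    then have "\<beta> + d \<le> v" using assms by simp
    then have "L * d \<le> L * (v - \<beta>)" using assms by (intro mult_left_mono) auto
    then show ?thesis using \<xi> by simp
  qed
  have Ld: "0 < L * d" using assms by simp
  then have \<xi>0: "\<xi> \<noteq> 0" using far by auto
  have "(L * d)\<^sup>2 \<le> \<bar>\<xi>\<bar>\<^sup>2" using far Ld by (intro power_mono) auto
  then have "2 / \<xi>\<^sup>2 \<le> 2 / (L * d)\<^sup>2" using Ld \<xi>0 by (intro divide_left_mono mult_pos_pos) auto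
  then have "jker \<xi> \<le> 2 / (L * d)\<^sup>2" using jker_le[OF \<xi>0] by linarith
  then have "(L * (\<beta> - \<alpha>)) * jker \<xi> \<le> (L * (\<beta> - \<alpha>)) * (2 / (L * d)\<^sup>2)"
    using assms by (intro mult_left_mono) auto
  then have "smooth_ind L \<alpha> \<beta> v \<le> (L * (\<beta> - \<alpha>)) * (2 / (L * d)\<^sup>2) / pi"
    unfolding smooth_ind_def \<xi>(3) by (intro divide_right_mono) (auto simp: algebra_simps)
  also have "\<dots> = 2 * (\<beta> - \<alpha>) / (pi * L * d\<^sup>2)"
    using assms by (simp add: field_simps power2_eq_square)
  finally show ?thesis .
qed

text \<open>Smoothing the slightly enlarged or shrunk interval dominates or undercuts the indicator
  up to the Fejer tails, which decay like a Cauchy density. \<open>A\<close> depends on the margin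
  \<open>\<eta>\<close> but not on \<open>L\<close>, so the tail term can be made small afterwards
  by a large \<open>L\<close>.\<close>

lemma indicator_sandwich:
  assumes a: "0 < a" and \<eta>: "0 < \<eta>" "2 * \<eta> < a"
  shows "\<exists>A>0. \<forall>L>0. \<forall>z v. indicator {z..z + a} v \<le> smooth_ind L (z - \<eta>) (z + a + \<eta>) v + A / L / (1 + (v - z)\<^sup>2)
      \<and> smooth_ind L (z + \<eta>) (z + a - \<eta>) v - A / L / (1 + (v - z)\<^sup>2) \<le> (indicator {z..z + a} v :: real)"
proof -
  define A1 where "A1 = 4 / (pi * \<eta>) * (1 + a\<^sup>2)"
  define A2 where "A2 = 2 * a / pi * (1 / \<eta>\<^sup>2 + (1 + a / \<eta>)\<^sup>2)"
  have A: "0 < A1" "0 < A2" using a \<eta> by (auto simp: A1_def A2_def intro!: mult_pos_pos add_pos_pos add_pos_nonneg divide_pos_pos)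
  define A where "A = A1 + A2"
  have D: "0 < 1 + (v - z)\<^sup>2" for v z :: real by (simp add: add_pos_nonneg)
  have "indicator {z..z + a} v \<le> smooth_ind L (z - \<eta>) (z + a + \<eta>) v + A / L / (1 + (v - z)\<^sup>2)" if L: "0 < L" for L z v
  proof (cases "v \<in> {z..z + a}")
    case True
    have "(v - z)\<^sup>2 \<le> a\<^sup>2" using True by (intro power_mono) auto
    then have "4 / (pi * \<eta>) * (1 + (v - z)\<^sup>2) \<le> A1" unfolding A1_def using \<eta> by (intro mult_left_mono) auto
    then have "4 / (pi * \<eta>) \<le> A / (1 + (v - z)\<^sup>2)" using D[of v z] A by (simp add: A_def pos_le_divide_eq)
    then have "4 / (pi * \<eta>) / L \<le> A / (1 + (v - z)\<^sup>2) / L" using L by (intro divide_right_mono) auto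
    then have "4 / (pi * \<eta>) / L \<le> A / L / (1 + (v - z)\<^sup>2)" by (simp add: mult.commute)
    moreover have "1 - 4 / (pi * \<eta>) / L \<le> smooth_ind L (z - \<eta>) (z + a + \<eta>) v"
      using True by (intro smooth_ind_inside L \<eta>) auto
    ultimately show ?thesis using True by simp
  next
    case False
    have "0 \<le> smooth_ind L (z - \<eta>) (z + a + \<eta>) v" using a \<eta> L by (intro smooth_ind_bounds) auto
    moreover have "0 \<le> A / L / (1 + (v - z)\<^sup>2)" using A L D[of v z] by (auto simp: A_def intro!: divide_nonneg_nonneg less_imp_le)
    ultimately show ?thesis using False by simp
  qed
  moreover have "smooth_ind L (z + \<eta>) (z + a - \<eta>) v - A / L / (1 + (v - z)\<^sup>2) \<le> indicator {z..z + a} v" if L: "0 < L" for L z v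
  proof (cases "v \<in> {z..z + a}")
    case True
    have "smooth_ind L (z + \<eta>) (z + a - \<eta>) v \<le> 1" using a \<eta> L by (intro smooth_ind_bounds) auto
    moreover have "0 \<le> A / L / (1 + (v - z)\<^sup>2)" using A L D[of v z] by (auto simp: A_def intro!: divide_nonneg_nonneg less_imp_le)
    ultimately show ?thesis using True by simp
  next
    case False
    define d where "d = (if v < z then z + \<eta> - v else v - (z + a - \<eta>))"
    have d: "\<eta> \<le> d" "\<bar>v - z\<bar> \<le> d + a" "v \<le> (z + \<eta>) - d \<or> (z + a - \<eta>) + d \<le> v"
      using False \<eta> a by (auto simp: d_def)
    have d0: "0 < d" using d \<eta> by simp
    have "smooth_ind L (z + \<eta>) (z + a - \<eta>) v \<le> 2 * ((z + a - \<eta>) - (z + \<eta>)) / (pi * L * d\<^sup>2)"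
      using d d0 \<eta> L by (intro smooth_ind_outside) auto
    also have "\<dots> \<le> 2 * a / (pi * L * d\<^sup>2)"
      using L d0 \<eta> by (intro divide_right_mono) auto
    also have "\<dots> \<le> A / L / (1 + (v - z)\<^sup>2)"
    proof -
      have "\<bar>v - z\<bar>\<^sup>2 \<le> (d + a)\<^sup>2" using d by (intro power_mono) auto
      then have "(1 + (v - z)\<^sup>2) / d\<^sup>2 \<le> (1 + (d + a)\<^sup>2) / d\<^sup>2" using d0 by (intro divide_right_mono) auto
      also have "\<dots> = 1 / d\<^sup>2 + (1 + a / d)\<^sup>2" using d0 by (simp add: field_simps power2_eq_square)
      also have "\<dots> \<le> 1 / \<eta>\<^sup>2 + (1 + a / \<eta>)\<^sup>2"
        using d \<eta> a d0 by (intro add_mono divide_left_mono power_mono mult_pos_pos) auto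
      finally have "2 * a / pi * ((1 + (v - z)\<^sup>2) / d\<^sup>2) \<le> A2"
        unfolding A2_def using a by (intro mult_left_mono) auto
      then have "2 * a / (pi * d\<^sup>2) * (1 + (v - z)\<^sup>2) \<le> A" using A by (simp add: A_def)
      then have "2 * a / (pi * d\<^sup>2) \<le> A / (1 + (v - z)\<^sup>2)" using D[of v z] by (simp add: pos_le_divide_eq)
      then have "2 * a / (pi * d\<^sup>2) / L \<le> A / (1 + (v - z)\<^sup>2) / L" using L by (intro divide_right_mono) auto
      then show ?thesis by (simp add: mult_ac)
    qed
    finally show ?thesis using False by simp
  qed
  ultimately show ?thesis using A by (intro exI[of _ A]) (auto simp: A_def)
qed

context nonlattice_walk
begin

text \<open>Both sides are Fourier integrals in which \<open>y\<close> and \<open>z\<close> enter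
  only through a phase of modulus 1; taking norms inside makes the bound uniform in them. There
  remain the integral from \<open>scaled_char_integral_tendsto\<close>, rescaled by 1 / sqrt t, and
  the cost of \<open>tri\<close> against the Gaussian, of order \<open>1 / (L * t)\<close>.\<close>

lemma fejer_llt:
  assumes L: "0 < L" and \<kappa>: "0 < \<kappa>"
  shows "\<exists>N. \<forall>t\<ge>N. \<forall>x w y z. \<bar>(T ^^ t) (\<lambda>x y. ind w x * fej L (y - z)) x y - nu w * phi (real t) (y - z)\<bar> \<le> \<kappa> / sqrt (real t)"
proof -
  define E where "E t x w = (LINT u|lborel. tri L (u / sqrt (real t)) * cmod ((chop P f (u / sqrt (real t)) ^^ t) (\<lambda>x. of_real (ind w x)) x - of_real (nu w * gam 1 u)))" for t x w
  have "eventually (\<lambda>t. E t x w < \<kappa> / 2) sequentially" for x w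
    using scaled_char_integral_tendsto[OF L, of w x] \<kappa> unfolding E_def by (intro order_tendstoD(2)) auto
  then have "eventually (\<lambda>t. \<forall>x\<in>UNIV. \<forall>w\<in>UNIV. E t x w < \<kappa> / 2) sequentially"
    by (intro eventually_ball_finite ballI) simp_all
  moreover have "(\<lambda>t. Imom 1 / L * (1 / sqrt (real t))) \<longlonglongrightarrow> Imom 1 / L * 0"
    by (intro tendsto_intros tendsto_divide_0[OF tendsto_const] filterlim_at_top_imp_at_infinity filterlim_compose[OF sqrt_at_top] filterlim_real_sequentially)
  then have "eventually (\<lambda>t. Imom 1 / L * (1 / sqrt (real t)) < \<kappa> / 2) sequentially"
    using \<kappa> by (intro order_tendstoD(2)) auto
  ultimately have ev: "eventually (\<lambda>t. (\<forall>x\<in>UNIV. \<forall>w\<in>UNIV. E t x w < \<kappa> / 2) \<and> Imom 1 / L * (1 / sqrt (real t)) < \<kappa> / 2 \<and> 0 < t) sequentially"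
    using eventually_gt_at_top[of 0] by eventually_elim auto
  have main: "\<bar>(T ^^ t) (\<lambda>x y. ind w x * fej L (y - z)) x y - nu w * phi (real t) (y - z)\<bar> \<le> \<kappa> / sqrt (real t)"
    if t: "(\<forall>x\<in>UNIV. \<forall>w\<in>UNIV. E t x w < \<kappa> / 2) \<and> Imom 1 / L * (1 / sqrt (real t)) < \<kappa> / 2 \<and> 0 < t" for t x w y z
  proof -
    have t0: "0 < real t" using t by simp
    define v where "v = y - z"
    define ch where "ch s = (chop P f s ^^ t) (\<lambda>x. of_real (ind w x)) x" for s
    have [measurable]: "ch \<in> borel_measurable borel" unfolding ch_def by (rule chop_pow_measurable) simp
    have ch1: "cmod (ch s) \<le> 1" for s unfolding ch_def by (rule norm_chop_pow_le) (rule ind_bounds)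
    have i1: "integrable lborel (\<lambda>s. iexp (s * v) * of_real (tri L s) * ch s)"
      by (rule Bochner_Integration.integrable_bound[OF tri_integrable[OF L]])
        (use tri_bounds[OF L] ch1 in \<open>auto simp: norm_mult intro!: AE_I2 mult_right_le_one_le\<close>)
    have i2: "integrable lborel (\<lambda>s. of_real (nu w) * (iexp (s * v) * complex_of_real (gam (real t) s)))"
      by (intro integrable_mult_right gam_fourier t0)
    have ig: "integrable lborel (\<lambda>s. \<bar>s\<bar> ^ k * gam (real t) s)" for k by (rule gam_moment(1)[OF t0])
    have i3: "integrable lborel (\<lambda>s. tri L s * cmod (ch s - of_real (nu w * gam (real t) s)))"
    proof (rule Bochner_Integration.integrable_bound)
      show "integrable lborel (\<lambda>s. tri L s + nu w * (\<bar>s\<bar> ^ 0 * gam (real t) s))"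
        by (intro Bochner_Integration.integrable_add integrable_mult_right ig tri_integrable L)
      show "AE s in lborel. norm (tri L s * cmod (ch s - of_real (nu w * gam (real t) s))) \<le> norm (tri L s + nu w * (\<bar>s\<bar> ^ 0 * gam (real t) s))"
      proof (rule AE_I2)
        fix s
        have 2: "cmod (of_real (nu w * gam (real t) s)) \<le> nu w * gam (real t) s"
          unfolding norm_of_real using nu_nonneg[of w] gam_pos[of "real t" s] by simp
        have "tri L s * cmod (ch s - of_real (nu w * gam (real t) s)) \<le> tri L s * (1 + nu w * gam (real t) s)"
          using norm_triangle_le_diff[OF add_mono[OF ch1[of s] 2]] tri_bounds[OF L] by (intro mult_left_mono) auto
        also have "\<dots> \<le> tri L s + 1 * (nu w * gam (real t) s)"
          unfolding distrib_left using tri_bounds[OF L] nu_nonneg[of w] gam_pos[of "real t" s] by (intro add_mono mult_right_mono) auto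
        finally show "norm (tri L s * cmod (ch s - of_real (nu w * gam (real t) s))) \<le> norm (tri L s + nu w * (\<bar>s\<bar> ^ 0 * gam (real t) s))"
          using tri_bounds[OF L] by simp
      qed
    qed measurable
    have "nu w * phi (real t) v = Re (of_real (1 / (2 * pi)) * (LINT s|lborel. of_real (nu w) * (iexp (s * v) * of_real (gam (real t) s))))"
      unfolding integral_mult_right_zero gam_fourier(2)[OF t0] by simp
    then have eq: "(T ^^ t) (\<lambda>x y. ind w x * fej L (y - z)) x y - nu w * phi (real t) v
      = Re (of_real (1 / (2 * pi)) * (LINT s|lborel. iexp (s * v) * of_real (tri L s) * ch s - of_real (nu w) * (iexp (s * v) * of_real (gam (real t) s))))"
      unfolding tpow_fej[OF L] v_def[symmetric] ch_def[symmetric] Bochner_Integration.integral_diff[OF i1 i2] right_diff_distrib by simp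
    have "\<bar>(T ^^ t) (\<lambda>x y. ind w x * fej L (y - z)) x y - nu w * phi (real t) v\<bar>
      \<le> cmod (LINT s|lborel. iexp (s * v) * of_real (tri L s) * ch s - of_real (nu w) * (iexp (s * v) * of_real (gam (real t) s)))"
      unfolding eq
    proof (rule order_trans[OF abs_Re_le_cmod])
      show "cmod (of_real (1 / (2 * pi)) * (LINT s|lborel. iexp (s * v) * of_real (tri L s) * ch s - of_real (nu w) * (iexp (s * v) * of_real (gam (real t) s))))
        \<le> cmod (LINT s|lborel. iexp (s * v) * of_real (tri L s) * ch s - of_real (nu w) * (iexp (s * v) * of_real (gam (real t) s)))"
        unfolding norm_mult[of "of_real (1 / (2 * pi))"] by (rule mult_left_le_one_le) (use norm_inv_2pi in auto)
    qed
    also have "\<dots> \<le> (LINT s|lborel. tri L s * cmod (ch s - of_real (nu w * gam (real t) s)) + 1 / L * (\<bar>s\<bar> ^ 1 * gam (real t) s))"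
    proof (rule order_trans[OF integral_norm_bound], rule integral_mono)
      show "integrable lborel (\<lambda>s. cmod (iexp (s * v) * of_real (tri L s) * ch s - of_real (nu w) * (iexp (s * v) * of_real (gam (real t) s))))"
        using i1 i2 by (intro integrable_norm Bochner_Integration.integrable_diff)
      show "integrable lborel (\<lambda>s. tri L s * cmod (ch s - of_real (nu w * gam (real t) s)) + 1 / L * (\<bar>s\<bar> ^ 1 * gam (real t) s))"
        by (intro Bochner_Integration.integrable_add integrable_mult_right ig i3)
      fix s
      have e: "iexp (s * v) * of_real (tri L s) * ch s - of_real (nu w) * (iexp (s * v) * of_real (gam (real t) s))
        = iexp (s * v) * (of_real (tri L s) * (ch s - of_real (nu w * gam (real t) s)) - of_real ((1 - tri L s) * (nu w * gam (real t) s)))"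
        by (simp add: algebra_simps)
      have nu1: "nu w \<le> 1" using member_le_sum[of w UNIV nu] nu_nonneg nu_sum by simp
      have "(1 - tri L s) * (nu w * gam (real t) s) \<le> (\<bar>s\<bar> / L) * (1 * gam (real t) s)"
        using tri_bounds(4)[OF L, of s] nu1 gam_pos[of "real t" s] nu_nonneg[of w] L by (intro mult_mono) auto
      moreover have "0 \<le> (1 - tri L s) * (nu w * gam (real t) s)"
        using tri_bounds(2)[OF L, of s] gam_pos[of "real t" s] nu_nonneg[of w] by auto
      ultimately have b: "cmod (of_real ((1 - tri L s) * (nu w * gam (real t) s))) \<le> 1 / L * (\<bar>s\<bar> ^ 1 * gam (real t) s)"
        unfolding norm_of_real by simp
      have a: "cmod (of_real (tri L s) * (ch s - of_real (nu w * gam (real t) s))) \<le> tri L s * cmod (ch s - of_real (nu w * gam (real t) s))"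
        unfolding norm_mult norm_of_real using tri_bounds(1)[OF L, of s] by simp
      show "cmod (iexp (s * v) * of_real (tri L s) * ch s - of_real (nu w) * (iexp (s * v) * of_real (gam (real t) s)))
        \<le> tri L s * cmod (ch s - of_real (nu w * gam (real t) s)) + 1 / L * (\<bar>s\<bar> ^ 1 * gam (real t) s)"
        unfolding e norm_mult[of "iexp _"] norm_exp_i_times mult_1_left by (rule norm_triangle_le_diff[OF add_mono[OF a b]])
    qed
    also have "\<dots> = (LINT s|lborel. tri L s * cmod (ch s - of_real (nu w * gam (real t) s))) + 1 / L * (Imom 1 / sqrt (real t) ^ (1 + 1))"
      unfolding Bochner_Integration.integral_add[OF i3 integrable_mult_right[OF ig]] integral_mult_right_zero gam_moment(2)[OF t0] ..
    also have "(LINT s|lborel. tri L s * cmod (ch s - of_real (nu w * gam (real t) s))) = E t x w / sqrt (real t)"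
    proof -
      define c where "c = 1 / sqrt (real t)"
      have c: "0 < c" using t0 by (simp add: c_def)
      have "(LINT s|lborel. tri L s * cmod (ch s - of_real (nu w * gam (real t) s)))
        = \<bar>c\<bar> *\<^sub>R (LINT s|lborel. tri L (0 + c * s) * cmod (ch (0 + c * s) - of_real (nu w * gam (real t) (0 + c * s))))"
        using c by (intro lborel_integral_real_affine) auto
      also have "(LINT s|lborel. tri L (0 + c * s) * cmod (ch (0 + c * s) - of_real (nu w * gam (real t) (0 + c * s)))) = E t x w"
        unfolding E_def
      proof (rule Bochner_Integration.integral_cong[OF refl])
        fix s
        have "gam (real t) (0 + c * s) = gam 1 s" using t0 by (simp add: gam_def c_def power_divide)
        moreover have "0 + c * s = s / sqrt (real t)" by (simp add: c_def)
        ultimately show "tri L (0 + c * s) * cmod (ch (0 + c * s) - of_real (nu w * gam (real t) (0 + c * s)))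
          = tri L (s / sqrt (real t)) * cmod ((chop P f (s / sqrt (real t)) ^^ t) (\<lambda>x. of_real (ind w x)) x - of_real (nu w * gam 1 s))"
          by (simp only: ch_def)
      qed
      finally show ?thesis using c by (simp add: c_def)
    qed
    also have "E t x w / sqrt (real t) + 1 / L * (Imom 1 / sqrt (real t) ^ (1 + 1)) = (E t x w + Imom 1 / L * (1 / sqrt (real t))) / sqrt (real t)"
    proof -
      have "e / s + 1 / L * (i / (s * s)) = (e + i / L * (1 / s)) / s" for e s i :: real
        by (simp add: add_divide_distrib)
      then show ?thesis by (simp only: power_add power_one_right)
    qed
    also have "\<dots> \<le> \<kappa> / sqrt (real t)"
    proof (rule divide_right_mono)
      have "E t x w < \<kappa> / 2" "Imom 1 / L * (1 / sqrt (real t)) < \<kappa> / 2" using t by auto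
      then show "E t x w + Imom 1 / L * (1 / sqrt (real t)) \<le> \<kappa>" by linarith
    qed simp
    finally show ?thesis unfolding v_def .
  qed
  from ev obtain N where "\<And>t. t \<ge> N \<Longrightarrow> (\<forall>x\<in>UNIV. \<forall>w\<in>UNIV. E t x w < \<kappa> / 2) \<and> Imom 1 / L * (1 / sqrt (real t)) < \<kappa> / 2 \<and> 0 < t"
    unfolding eventually_sequentially by blast
  then show ?thesis using main by blast
qed

text \<open>Large times follow from the local theorem and the maximum of the Gaussian density.
  Before \<open>N\<close> the value is at most 1, which \<open>sqrt (real N)\<close> in the constant
  covers.\<close>

lemma fej_bound: "\<exists>C>0. \<forall>t x w y z. 0 < t \<longrightarrow> (T ^^ t) (\<lambda>x y. ind w x * fej 1 (y - z)) x y \<le> C / sqrt (real t)"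
proof -
  obtain N where N: "\<And>t x w y z. t \<ge> N \<Longrightarrow> \<bar>(T ^^ t) (\<lambda>x y. ind w x * fej 1 (y - z)) x y - nu w * phi (real t) (y - z)\<bar> \<le> 1 / sqrt (real t)"
    using fejer_llt[OF zero_less_one zero_less_one] by blast
  define C where "C = Imom 0 + 1 + sqrt (real N)"
  have "(T ^^ t) (\<lambda>x y. ind w x * fej 1 (y - z)) x y \<le> C / sqrt (real t)" if t: "0 < t" for t x w y z
  proof (cases "N \<le> t")
    case True
    have nu1: "nu w \<le> 1" using member_le_sum[of w UNIV nu] nu_nonneg nu_sum by simp
    have "nu w * phi (real t) (y - z) \<le> 1 * (Imom 0 / sqrt (real t))"
      using nu1 nu_nonneg[of w] phi_le[of "real t" "y - z"] phi_nonneg[of "real t" "y - z"] t by (intro mult_mono) auto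
    moreover have "\<bar>(T ^^ t) (\<lambda>x y. ind w x * fej 1 (y - z)) x y - nu w * phi (real t) (y - z)\<bar> \<le> 1 / sqrt (real t)"
      by (rule N[OF True])
    ultimately have "(T ^^ t) (\<lambda>x y. ind w x * fej 1 (y - z)) x y \<le> Imom 0 / sqrt (real t) + 1 / sqrt (real t)"
      by linarith
    also have "\<dots> \<le> C / sqrt (real t)"
      unfolding add_divide_distrib[symmetric] by (intro divide_right_mono) (auto simp: C_def)
    finally show ?thesis .
  next
    case False
    have "(T ^^ t) (\<lambda>x y. ind w x * fej 1 (y - z)) x y \<le> (T ^^ t) (\<lambda>x y. 1) x y"
    proof (rule tpow_mono)
      fix x y
      have "fej 1 (y - z) \<le> 1"
        using jker_le_half[of "y - z"] pi_ge_two by (simp add: fej_def divide_simps)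
      then have "ind w x * fej 1 (y - z) \<le> 1 * 1" using ind_bounds fej_nonneg[of 1] by (intro mult_mono) auto
      then show "ind w x * fej 1 (y - z) \<le> 1" by simp
    qed
    also have "\<dots> = 1" by (simp add: tpow_const)
    also have "1 \<le> sqrt (real N) / sqrt (real t)" using False t by simp
    also have "\<dots> \<le> C / sqrt (real t)" using Imom_nonneg[of 0] by (intro divide_right_mono) (auto simp: C_def)
    finally show ?thesis .
  qed
  moreover have "0 < C" using Imom_nonneg[of 0] by (simp add: C_def add_pos_nonneg)
  ultimately show ?thesis by blast
qed

text \<open>Passes from the Fejer kernel to a majorant without zeros, which can dominate both the
  tails of the sandwich and indicators of intervals.\<close>

lemma cauchy_bound: "\<exists>C>0. \<forall>t x w y z. 0 < t \<longrightarrow> (T ^^ t) (\<lambda>x y. ind w x * (1 / (1 + (y - z)\<^sup>2))) x y \<le> C / sqrt (real t)"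
proof -
  obtain C where C: "0 < C" "\<And>t x w y z. 0 < t \<Longrightarrow> (T ^^ t) (\<lambda>x y. ind w x * fej 1 (y - z)) x y \<le> C / sqrt (real t)"
    using fej_bound by blast
  \<comment> \<open>The shift by \<open>pi\<close> fills the zeros of the kernel:
    \<open>1 - cos v\<close> and \<open>1 - cos (v + pi)\<close> add up to 2. \<open>A\<close>
    bounds both squared arguments, so \<open>jker_ge\<close> applies to each term.\<close>
  have pt: "1 / (1 + v\<^sup>2) \<le> pi ^ 3 * (fej 1 v + fej 1 (v + pi))" for v
  proof -
    define S where "S = v\<^sup>2 + pi\<^sup>2"
    have S: "0 < S" unfolding S_def by (simp add: add_nonneg_pos)
    define A where "A = 2 * S"
    have A: "0 < A" using S by (simp add: A_def)
    have "0 \<le> (v - pi)\<^sup>2" by simp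
    then have "(v + pi)\<^sup>2 \<le> A" by (simp add: A_def S_def power2_eq_square algebra_simps)
    then have "(1 - cos (v + pi)) / A \<le> jker (v + pi)" using A by (intro jker_ge) auto
    moreover have "(1 - cos v) / A \<le> jker v" using A by (intro jker_ge) (auto simp: A_def S_def)
    ultimately have "(1 - cos v) / A + (1 - cos (v + pi)) / A \<le> jker v + jker (v + pi)" by linarith
    moreover have "(1 - cos v) / A + (1 - cos (v + pi)) / A = 1 / S"
      using S unfolding A_def by (simp add: add_divide_distrib[symmetric])
    moreover have "1 / (pi\<^sup>2 * (1 + v\<^sup>2)) \<le> 1 / S"
    proof (rule divide_left_mono)
      have "1 * 1 \<le> pi * pi" using pi_ge_two by (intro mult_mono) auto
      then have "1 * v\<^sup>2 \<le> pi\<^sup>2 * v\<^sup>2" by (intro mult_right_mono) (auto simp: power2_eq_square)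
      then show "S \<le> pi\<^sup>2 * (1 + v\<^sup>2)" by (simp add: S_def algebra_simps)
      show "0 < pi\<^sup>2 * (1 + v\<^sup>2) * S" using S by (intro mult_pos_pos add_pos_nonneg) auto
    qed simp
    ultimately have "1 / (pi\<^sup>2 * (1 + v\<^sup>2)) \<le> jker v + jker (v + pi)" by linarith
    then have "pi\<^sup>2 * (1 / (pi\<^sup>2 * (1 + v\<^sup>2))) \<le> pi\<^sup>2 * (jker v + jker (v + pi))" by (intro mult_left_mono) auto
    moreover have "pi\<^sup>2 * (1 / (pi\<^sup>2 * (1 + v\<^sup>2))) = 1 / (1 + v\<^sup>2)" by simp
    moreover have "pi\<^sup>2 * (jker v + jker (v + pi)) = pi ^ 3 * (fej 1 v + fej 1 (v + pi))"
      by (simp add: fej_def power2_eq_square power3_eq_cube field_simps)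
    ultimately show ?thesis by linarith
  qed
  have "(T ^^ t) (\<lambda>x y. ind w x * (1 / (1 + (y - z)\<^sup>2))) x y \<le> 2 * pi ^ 3 * C / sqrt (real t)" if t: "0 < t" for t x w y z
  proof -
    have "(T ^^ t) (\<lambda>x y. ind w x * (1 / (1 + (y - z)\<^sup>2))) x y \<le> (T ^^ t) (\<lambda>x y. pi ^ 3 * (ind w x * fej 1 (y - z) + ind w x * fej 1 (y - (z - pi)))) x y"
    proof (rule tpow_mono)
      fix x y
      have "ind w x * (1 / (1 + (y - z)\<^sup>2)) \<le> ind w x * (pi ^ 3 * (fej 1 (y - z) + fej 1 (y - z + pi)))"
        by (intro mult_left_mono pt ind_bounds)
      then show "ind w x * (1 / (1 + (y - z)\<^sup>2)) \<le> pi ^ 3 * (ind w x * fej 1 (y - z) + ind w x * fej 1 (y - (z - pi)))"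
        by (simp add: algebra_simps)
    qed
    also have "\<dots> = pi ^ 3 * ((T ^^ t) (\<lambda>x y. ind w x * fej 1 (y - z)) x y + (T ^^ t) (\<lambda>x y. ind w x * fej 1 (y - (z - pi))) x y)"
      unfolding tpow_mult tpow_add ..
    also have "\<dots> \<le> pi ^ 3 * (C / sqrt (real t) + C / sqrt (real t))"
      by (intro mult_left_mono add_mono C t) auto
    also have "\<dots> = 2 * pi ^ 3 * C / sqrt (real t)" by (simp add: field_simps)
    finally show ?thesis .
  qed
  moreover have "0 < 2 * pi ^ 3 * C" using C by simp
  ultimately show ?thesis by blast
qed

text \<open>Mean value theorem in the endpoint of the interval, applied after the transition
  operator. It replaces an exchange of integral and expectation; the intermediate point
  \<open>\<xi>\<close> is harmless because \<open>fejer_llt\<close> is uniform in its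
  position.\<close>

lemma tpow_smooth_ind:
  assumes "0 < L" "\<alpha> < \<beta>"
  shows "\<exists>\<xi>. \<alpha> < \<xi> \<and> \<xi> < \<beta> \<and> (T ^^ t) (\<lambda>x y. ind w x * smooth_ind L \<alpha> \<beta> y) x y = (\<beta> - \<alpha>) * (T ^^ t) (\<lambda>x y. ind w x * fej L (y - \<xi>)) x y"
proof -
  define \<Phi> where "\<Phi> u = (T ^^ t) (\<lambda>x y. ind w x * (- Jker (L * (y - u)) / pi)) x y" for u
  have der: "((\<lambda>u. (T ^^ t) (\<lambda>x y. ind w x * (- Jker (L * (y - u)) / pi)) x y) has_real_derivative (T ^^ t) (\<lambda>x y. ind w x * fej L (y - u)) x y) (at u)" for t x y u
  proof (induction t arbitrary: x y)
    case 0
    have "((\<lambda>u. Jker (L * (y - u))) has_real_derivative jker (L * (y - u)) * (L * (0 - 1))) (at u)"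
      by (rule DERIV_chain2[OF DERIV_Jker]) (auto intro!: derivative_eq_intros)
    then have "((\<lambda>u. ind w x * (- Jker (L * (y - u)) / pi)) has_real_derivative ind w x * (- (jker (L * (y - u)) * (L * (0 - 1))) / pi)) (at u)"
      by (intro DERIV_cmult DERIV_cdivide DERIV_minus)
    then show ?case by (simp add: fej_def mult_ac)
  next
    case (Suc t)
    have "((\<lambda>u. \<Sum>x'\<in>UNIV. P x x' * (T ^^ t) (\<lambda>x y. ind w x * (- Jker (L * (y - u)) / pi)) x' (y + f x')) has_real_derivative
        (\<Sum>x'\<in>UNIV. P x x' * (T ^^ t) (\<lambda>x y. ind w x * fej L (y - u)) x' (y + f x'))) (at u)"
      by (intro DERIV_sum DERIV_cmult Suc)
    then show ?case unfolding funpow.simps comp_def step_def[of P f "(T ^^ t) _"] real_scaleR_def .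
  qed
  obtain \<xi> where \<xi>: "\<alpha> < \<xi>" "\<xi> < \<beta>" "\<Phi> \<beta> - \<Phi> \<alpha> = (\<beta> - \<alpha>) * (T ^^ t) (\<lambda>x y. ind w x * fej L (y - \<xi>)) x y"
    using MVT2[OF assms(2), of \<Phi> "\<lambda>u. (T ^^ t) (\<lambda>x y. ind w x * fej L (y - u)) x y"] der unfolding \<Phi>_def by blast
  have "\<Phi> \<beta> - \<Phi> \<alpha> = (T ^^ t) (\<lambda>x y. ind w x * (- Jker (L * (y - \<beta>)) / pi) - ind w x * (- Jker (L * (y - \<alpha>)) / pi)) x y"
    unfolding \<Phi>_def tpow_diff ..
  also have "(\<lambda>x y. ind w x * (- Jker (L * (y - \<beta>)) / pi) - ind w x * (- Jker (L * (y - \<alpha>)) / pi)) = (\<lambda>x y. ind w x * smooth_ind L \<alpha> \<beta> y)"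
    by (auto simp: fun_eq_iff smooth_ind_def ind_def diff_divide_distrib)
  finally show ?thesis using \<xi> by metis
qed

definition cell :: "'x \<Rightarrow> real \<Rightarrow> real \<Rightarrow> 'x \<Rightarrow> real \<Rightarrow> real" where
  "cell w a z x y = ind w x * indicator {z..z + a} y"

lemma cell_bounds: "0 \<le> cell w a z x y" "cell w a z x y \<le> 1"
  by (auto simp: cell_def ind_def indicator_def)

theorem llt:
  assumes a: "0 < a" and \<kappa>: "0 < \<kappa>"
  shows "\<exists>N. \<forall>t\<ge>N. \<forall>x w y z. \<bar>(T ^^ t) (cell w a z) x y - a * nu w * phi (real t) (y - z)\<bar> \<le> \<kappa> / sqrt (real t)"
proof -
  obtain CR where CR: "0 < CR" "\<And>t x w y z. 0 < t \<Longrightarrow> (T ^^ t) (\<lambda>x y. ind w x * (1 / (1 + (y - z)\<^sup>2))) x y \<le> CR / sqrt (real t)"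
    using cauchy_bound by blast
  have I0: "0 \<le> Imom 0" "0 \<le> Imom 1" by (rule Imom_nonneg)+
  define J where "J = Imom 0 + 1"
  have J: "0 < J" "Imom 0 \<le> J" using I0 by (auto simp: J_def)
  \<comment> \<open>The margin fixes the error from a wrong interval length. The tail constant
    \<open>A\<close> depends on this margin, then \<open>L\<close> makes the tail a quarter of
    \<open>\<kappa>\<close>, and the time threshold comes last.\<close>
  define \<eta> where "\<eta> = min (a / 4) (\<kappa> / (8 * J))"
  have \<eta>: "0 < \<eta>" "2 * \<eta> < a" "2 * \<eta> * Imom 0 \<le> \<kappa> / 4"
  proof -
    show "0 < \<eta>" "2 * \<eta> < a" using a \<kappa> J by (auto simp: \<eta>_def)
    have "\<eta> * Imom 0 \<le> (\<kappa> / (8 * J)) * J"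
      using I0 \<kappa> a J by (intro mult_mono) (auto simp: \<eta>_def)
    also have "\<dots> = \<kappa> / 8" using J by simp
    finally show "2 * \<eta> * Imom 0 \<le> \<kappa> / 4" by simp
  qed
  obtain A where A: "0 < A" "\<And>L z v. 0 < L \<Longrightarrow> indicator {z..z + a} v \<le> smooth_ind L (z - \<eta>) (z + a + \<eta>) v + A / L / (1 + (v - z)\<^sup>2)"
      "\<And>L z v. 0 < L \<Longrightarrow> smooth_ind L (z + \<eta>) (z + a - \<eta>) v - A / L / (1 + (v - z)\<^sup>2) \<le> indicator {z..z + a} v"
    using indicator_sandwich[OF a \<eta>(1,2)] by blast
  define L where "L = 4 * A * CR / \<kappa>"
  have L: "0 < L" "A / L * CR = \<kappa> / 4" using A CR \<kappa> by (auto simp: L_def)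
  obtain N1 where N1: "\<And>t x w y z. t \<ge> N1 \<Longrightarrow> \<bar>(T ^^ t) (\<lambda>x y. ind w x * fej L (y - z)) x y - nu w * phi (real t) (y - z)\<bar> \<le> (\<kappa> / (8 * a)) / sqrt (real t)"
  proof -
    have "0 < \<kappa> / (8 * a)" using a \<kappa> by simp
    from fejer_llt[OF L(1) this] show ?thesis using that by blast
  qed
  define c where "c = 4 * a * a * Imom 1"
  have "(\<lambda>t. c * (1 / sqrt (real t))) \<longlonglongrightarrow> c * 0"
    by (intro tendsto_intros tendsto_divide_0[OF tendsto_const] filterlim_at_top_imp_at_infinity filterlim_compose[OF sqrt_at_top] filterlim_real_sequentially)
  then have "eventually (\<lambda>t. c * (1 / sqrt (real t)) < \<kappa> / 4) sequentially"
    using \<kappa> by (intro order_tendstoD(2)) auto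
  then obtain N2 where N2: "\<And>t. t \<ge> N2 \<Longrightarrow> c * (1 / sqrt (real t)) < \<kappa> / 4" by (auto simp: eventually_sequentially)
  \<comment> \<open>Three quarters of the allowance: the error of \<open>fejer_llt\<close> for an
    interval of length at most \<open>2 * a\<close>, the displacement of the Gaussian from
    \<open>\<xi>\<close> to \<open>z\<close>, and the replacement of the length by \<open>a\<close>.
    The last quarter pays for the Cauchy tails.\<close>
  have sm: "\<bar>(T ^^ t) (\<lambda>x y. ind w x * smooth_ind L \<alpha> \<beta> y) x y - a * nu w * phi (real t) (y - z)\<bar> \<le> (3 * \<kappa> / 4) / sqrt (real t)"
    if t: "t \<ge> N1" "t \<ge> N2" "0 < t" and ab: "\<alpha> < \<beta>" "\<bar>\<beta> - \<alpha> - a\<bar> \<le> 2 * \<eta>" "z - a \<le> \<alpha>" "\<beta> \<le> z + 2 * a" for t x w y z \<alpha> \<beta>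
  proof -
    have t0: "0 < real t" using t by simp
    define st where "st = sqrt (real t)"
    have st: "0 < st" "st * st = real t" using t0 by (auto simp: st_def)
    obtain \<xi> where \<xi>: "\<alpha> < \<xi>" "\<xi> < \<beta>" "(T ^^ t) (\<lambda>x y. ind w x * smooth_ind L \<alpha> \<beta> y) x y = (\<beta> - \<alpha>) * (T ^^ t) (\<lambda>x y. ind w x * fej L (y - \<xi>)) x y"
      using tpow_smooth_ind[OF L(1) ab(1)] by blast
    define X where "X = (T ^^ t) (\<lambda>x y. ind w x * fej L (y - \<xi>)) x y"
    define b where "b = \<beta> - \<alpha>"
    have b: "0 < b" "b \<le> 2 * a" "\<bar>b - a\<bar> \<le> 2 * \<eta>" using ab \<eta> by (auto simp: b_def)
    have nu1: "0 \<le> nu w" "nu w \<le> 1" using member_le_sum[of w UNIV nu] nu_nonneg nu_sum by auto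
    have 1: "\<bar>X - nu w * phi (real t) (y - \<xi>)\<bar> \<le> (\<kappa> / (8 * a)) / st" unfolding X_def st_def by (rule N1[OF t(1)])
    have "\<bar>b * X - b * (nu w * phi (real t) (y - \<xi>))\<bar> = b * \<bar>X - nu w * phi (real t) (y - \<xi>)\<bar>"
      using b by (simp add: right_diff_distrib[symmetric] abs_mult)
    also have "\<dots> \<le> (2 * a) * ((\<kappa> / (8 * a)) / st)" using b 1 \<kappa> a st by (intro mult_mono) auto
    also have "\<dots> = \<kappa> / 4 / st" using a by simp
    finally have 2: "\<bar>b * X - b * (nu w * phi (real t) (y - \<xi>))\<bar> \<le> \<kappa> / 4 / st" .
    have "\<bar>phi (real t) (y - \<xi>) - phi (real t) (y - z)\<bar> \<le> Imom 1 * \<bar>(y - \<xi>) - (y - z)\<bar> / real t" by (rule phi_lipschitz[OF t0])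
    also have "\<dots> \<le> Imom 1 * (2 * a) / real t" using \<xi> ab I0 a t0 by (intro divide_right_mono mult_left_mono) auto
    finally have zz: "nu w * \<bar>phi (real t) (y - \<xi>) - phi (real t) (y - z)\<bar> \<le> 1 * (Imom 1 * (2 * a) / real t)"
      using nu1 by (intro mult_mono) auto
    have "b * (nu w * \<bar>phi (real t) (y - \<xi>) - phi (real t) (y - z)\<bar>) \<le> (2 * a) * (1 * (Imom 1 * (2 * a) / real t))"
      by (rule mult_mono[OF b(2) zz]) (use a nu1 in auto)
    also have "\<dots> = c * (1 / st) / st" using st by (simp add: c_def st(2)[symmetric])
    also have "\<dots> \<le> \<kappa> / 4 / st" using N2[OF t(2)] st unfolding st_def[symmetric] by (intro divide_right_mono) auto
    finally have "b * (nu w * \<bar>phi (real t) (y - \<xi>) - phi (real t) (y - z)\<bar>) \<le> \<kappa> / 4 / st" .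
    then have 3: "\<bar>b * (nu w * phi (real t) (y - \<xi>)) - b * (nu w * phi (real t) (y - z))\<bar> \<le> \<kappa> / 4 / st"
      using b nu1 by (simp add: right_diff_distrib[symmetric] abs_mult)
    have "\<bar>b - a\<bar> * (nu w * phi (real t) (y - z)) \<le> (2 * \<eta>) * (1 * (Imom 0 / st))"
      using b nu1 \<eta> phi_le[OF t0, of "y - z"] phi_nonneg[OF t0, of "y - z"] unfolding st_def[symmetric] by (intro mult_mono) auto
    also have "\<dots> = (2 * \<eta> * Imom 0) / st" by simp
    also have "\<dots> \<le> \<kappa> / 4 / st" by (rule divide_right_mono[OF \<eta>(3)]) (use st in auto)
    finally have 4: "\<bar>b * (nu w * phi (real t) (y - z)) - a * (nu w * phi (real t) (y - z))\<bar> \<le> \<kappa> / 4 / st"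
      using nu1 phi_nonneg[OF t0, of "y - z"] by (simp add: left_diff_distrib[symmetric] abs_mult)
    have "\<bar>b * X - a * (nu w * phi (real t) (y - z))\<bar> \<le> \<kappa> / 4 / st + \<kappa> / 4 / st + \<kappa> / 4 / st"
      using 2 3 4 by linarith
    then show ?thesis unfolding \<xi>(3) b_def[symmetric] X_def[symmetric] st_def[symmetric] by (simp add: mult.assoc)
  qed
  have cau: "(T ^^ t) (\<lambda>x y. A / L * (ind w x * (1 / (1 + (y - z)\<^sup>2)))) x y \<le> \<kappa> / 4 / sqrt (real t)" if "0 < t" for t x w y z
  proof -
    have "A / L * (T ^^ t) (\<lambda>x y. ind w x * (1 / (1 + (y - z)\<^sup>2))) x y \<le> A / L * (CR / sqrt (real t))"
      using A L by (intro mult_left_mono CR that) auto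
    also have "\<dots> = \<kappa> / 4 / sqrt (real t)" by (simp only: times_divide_eq_right L(2))
    finally show ?thesis unfolding tpow_mult .
  qed
  have "\<bar>(T ^^ t) (cell w a z) x y - a * nu w * phi (real t) (y - z)\<bar> \<le> \<kappa> / sqrt (real t)"
    if t: "t \<ge> max (Suc 0) (max N1 N2)" for t x w y z
  proof -
    have t': "t \<ge> N1" "t \<ge> N2" "0 < t" using t by auto
    have "(T ^^ t) (cell w a z) x y \<le> (T ^^ t) (\<lambda>x y. ind w x * smooth_ind L (z - \<eta>) (z + a + \<eta>) y + A / L * (ind w x * (1 / (1 + (y - z)\<^sup>2)))) x y"
    proof (rule tpow_mono)
      fix x y
      have "ind w x * indicator {z..z + a} y \<le> ind w x * (smooth_ind L (z - \<eta>) (z + a + \<eta>) y + A / L / (1 + (y - z)\<^sup>2))"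
        by (intro mult_left_mono A(2) L ind_bounds)
      then show "cell w a z x y \<le> ind w x * smooth_ind L (z - \<eta>) (z + a + \<eta>) y + A / L * (ind w x * (1 / (1 + (y - z)\<^sup>2)))"
        by (simp add: cell_def algebra_simps)
    qed
    also have "\<dots> \<le> (T ^^ t) (\<lambda>x y. ind w x * smooth_ind L (z - \<eta>) (z + a + \<eta>) y) x y + \<kappa> / 4 / sqrt (real t)"
      unfolding tpow_add by (intro add_left_mono cau[OF t'(3)])
    finally have up: "(T ^^ t) (cell w a z) x y \<le> (T ^^ t) (\<lambda>x y. ind w x * smooth_ind L (z - \<eta>) (z + a + \<eta>) y) x y + \<kappa> / 4 / sqrt (real t)" .
    have "(T ^^ t) (\<lambda>x y. ind w x * smooth_ind L (z + \<eta>) (z + a - \<eta>) y - A / L * (ind w x * (1 / (1 + (y - z)\<^sup>2)))) x y \<le> (T ^^ t) (cell w a z) x y"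
    proof (rule tpow_mono)
      fix x y
      have "ind w x * (smooth_ind L (z + \<eta>) (z + a - \<eta>) y - A / L / (1 + (y - z)\<^sup>2)) \<le> ind w x * indicator {z..z + a} y"
        by (intro mult_left_mono A(3) L ind_bounds)
      then show "ind w x * smooth_ind L (z + \<eta>) (z + a - \<eta>) y - A / L * (ind w x * (1 / (1 + (y - z)\<^sup>2))) \<le> cell w a z x y"
        by (simp add: cell_def algebra_simps)
    qed
    moreover have "(T ^^ t) (\<lambda>x y. A / L * (ind w x * (1 / (1 + (y - z)\<^sup>2)))) x y \<le> \<kappa> / 4 / sqrt (real t)"
      by (rule cau[OF t'(3)])
    ultimately have lo: "(T ^^ t) (\<lambda>x y. ind w x * smooth_ind L (z + \<eta>) (z + a - \<eta>) y) x y - \<kappa> / 4 / sqrt (real t) \<le> (T ^^ t) (cell w a z) x y"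
      unfolding tpow_diff by linarith
    have s1: "\<bar>(T ^^ t) (\<lambda>x y. ind w x * smooth_ind L (z - \<eta>) (z + a + \<eta>) y) x y - a * nu w * phi (real t) (y - z)\<bar> \<le> (3 * \<kappa> / 4) / sqrt (real t)"
      using a \<eta> by (intro sm t') auto
    have s2: "\<bar>(T ^^ t) (\<lambda>x y. ind w x * smooth_ind L (z + \<eta>) (z + a - \<eta>) y) x y - a * nu w * phi (real t) (y - z)\<bar> \<le> (3 * \<kappa> / 4) / sqrt (real t)"
      using a \<eta> by (intro sm t') auto
    have "\<kappa> / sqrt (real t) = (3 * \<kappa> / 4) / sqrt (real t) + \<kappa> / 4 / sqrt (real t)" by (simp add: field_simps)
    then show ?thesis using up lo s1 s2 by linarith
  qed
  then show ?thesis by blast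
qed

end

section \<open>Time reversal\<close>

context ergodic_chain
begin

text \<open>The chain reversed in time under its stationary law.\<close>

definition dualP :: "'x \<Rightarrow> 'x \<Rightarrow> real" where "dualP x x' = nu x' * P x' x / nu x"

lemma dualP_nonneg: "0 \<le> dualP x x'"
  using nu_nonneg P_nonneg by (simp add: dualP_def)

lemma nu_dualP: "nu x * dualP x x' = nu x' * P x' x"
  using nu_props(2)[of x] by (simp add: dualP_def)

lemma stochastic_dual: "stochastic dualP"
  unfolding stochastic_def
proof (intro conjI allI)
  fix x
  have "(\<Sum>x'\<in>UNIV. dualP x x') = (\<Sum>x'\<in>UNIV. nu x' * P x' x) / nu x"
    by (simp add: dualP_def sum_divide_distrib)
  then show "(\<Sum>x'\<in>UNIV. dualP x x') = 1" using nu_props(2)[of x] by (simp add: nu_inv)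
qed (rule dualP_nonneg)

lemma Ppow_dual: "Ppow dualP n x x' = nu x' * Ppow P n x' x / nu x"
proof (induction n arbitrary: x')
  case 0
  then show ?case using nu_props(2)[of x] by (cases "x = x'") auto
next
  case (Suc n)
  have "Ppow dualP (Suc n) x x' = (\<Sum>w\<in>UNIV. nu x' / nu x * (P x' w * Ppow P n w x))"
    unfolding Ppow.simps Suc
  proof (rule sum.cong[OF refl])
    fix w
    show "nu w * Ppow P n w x / nu x * dualP w x' = nu x' / nu x * (P x' w * Ppow P n w x)"
      using nu_props(2)[of w] by (simp add: dualP_def)
  qed
  also have "\<dots> = nu x' * Ppow P (Suc n) x' x / nu x"
    using Ppow_add[of "Suc 0" n x' x] by (simp add: sum_distrib_left sum_divide_distrib Ppow_1 del: Ppow.simps)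
  finally show ?case .
qed

lemma H1_dual: "H1 dualP"
proof -
  obtain k \<delta> where k: "0 < k" "0 < \<delta>" "\<delta> \<le> 1" "\<And>x w. \<delta> \<le> Ppow P k x w"
    using doeblin by blast
  have pos: "0 < Ppow dualP k x x'" for x x'
    unfolding Ppow_dual using nu_props(2) k(2) k(4)[of x' x] by (auto intro!: divide_pos_pos mult_pos_pos)
  have "0 < Papply dualP k g x" if g: "\<forall>x. g x \<ge> 0" "\<exists>x. g x \<noteq> 0" for g x
  proof -
    obtain v where v: "g v \<noteq> 0" using g by blast
    show ?thesis unfolding Papply_def
      by (rule sum_pos2[of _ v]) (use v g pos in \<open>auto intro!: mult_pos_pos mult_nonneg_nonneg less_imp_le[OF pos] simp: less_le\<close>)
  qed
  then show ?thesis unfolding H1_def using k(1) by (intro exI[of _ k]) auto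
qed

lemma ergodic_dual: "ergodic_chain dualP"
  by unfold_locales (rule stochastic_dual, rule H1_dual)

lemma nu_dual: "inv_nu dualP = nu"
proof -
  have "invariant_prob dualP nu"
    unfolding invariant_prob_def
  proof (intro conjI allI)
    fix x'
    have "(\<Sum>x\<in>UNIV. nu x * dualP x x') = nu x' * (\<Sum>x\<in>UNIV. P x' x)"
      by (simp add: nu_dualP sum_distrib_left)
    then show "(\<Sum>x\<in>UNIV. nu x * dualP x x') = nu x'" by (simp add: P_sum)
  qed (use nu_nonneg nu_sum in auto)
  from ergodic_chain.nu_unique[OF ergodic_dual this] show ?thesis
    by (simp add: ergodic_chain.nu_def[OF ergodic_dual])
qed

lemma nu_int_dual: "nu_int dualP g = nu_int P g"
  by (simp add: nu_int_def nu_dual nu_def)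

end

context diffusive_walk
begin

text \<open>Stationary covariances of \<open>f\<close> at a given time distance are unchanged by
  reversal and by the sign of \<open>f\<close>.\<close>

lemma sigma2_dual: "sigma2 dualP (\<lambda>x. - f x) = sigma2 P f"
proof -
  have "nu_int dualP (\<lambda>x. - f x * Papply dualP n (\<lambda>x. - f x) x) = nu_int P (\<lambda>x. f x * Papply P n f x)" for n
  proof -
    have "nu_int dualP (\<lambda>x. - f x * Papply dualP n (\<lambda>x. - f x) x) = (\<Sum>x\<in>UNIV. \<Sum>x'\<in>UNIV. f x * f x' * (nu x' * Ppow P n x' x))"
      unfolding nu_int_dual nu_int_eq
    proof (rule sum.cong[OF refl])
      fix x
      have "- f x * Papply dualP n (\<lambda>x. - f x) x * nu x = (\<Sum>x'\<in>UNIV. f x * f x' * (Ppow dualP n x x' * nu x))"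
        unfolding Papply_def sum_distrib_left sum_distrib_right by (rule sum.cong) auto
      also have "\<dots> = (\<Sum>x'\<in>UNIV. f x * f x' * (nu x' * Ppow P n x' x))"
        using nu_props(2)[of x] by (simp add: Ppow_dual)
      finally show "- f x * Papply dualP n (\<lambda>x. - f x) x * nu x = (\<Sum>x'\<in>UNIV. f x * f x' * (nu x' * Ppow P n x' x))" .
    qed
    also have "\<dots> = (\<Sum>x'\<in>UNIV. \<Sum>x\<in>UNIV. f x * f x' * (nu x' * Ppow P n x' x))" by (rule sum.swap)
    also have "\<dots> = nu_int P (\<lambda>x. f x * Papply P n f x)"
      unfolding nu_int_eq Papply_def sum_distrib_left sum_distrib_right by (intro sum.cong) auto
    finally show ?thesis .
  qed
  then show ?thesis unfolding sigma2_def by (simp add: nu_int_dual)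
qed

text \<open>Makes the survival and moment bounds of \<open>diffusive_walk\<close> available for the
  reversed walk. Read backwards, increments are subtracted, hence the sign of
  \<open>f\<close>.\<close>

lemma dual_walk: "diffusive_walk dualP (\<lambda>x. - f x)"
proof -
  have "nu_int P (\<lambda>x. - f x) = - nu_int P f" by (simp add: nu_int_def sum_negf)
  then have "H2 dualP (\<lambda>x. - f x)" using H2 by (simp add: H2_def nu_int_dual)
  then show ?thesis
    by unfold_locales (auto intro: stochastic_dual H1_dual simp: sigma2_dual s2_pos)
qed

text \<open>\<open>N\<close> grows by exactly \<open>s2 / 2\<close> per step in mean and dominates
  \<open>y\<^sup>2 / 4\<close> up to a constant.\<close>

lemma tpow_square: "\<exists>C>0. \<forall>t x y z. (T ^^ t) (\<lambda>x v. (v - z)\<^sup>2) x y \<le> C * (1 + real t + (y - z)\<^sup>2)"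
proof -
  have TN: "(T ^^ t) N x y = N x y + real t * (s2 / 2)" for t x y
  proof (induction t arbitrary: x y)
    case (Suc t)
    have "(T ^^ t) N = (\<lambda>x y. N x y + real t * (s2 / 2))" by (intro ext) (rule Suc)
    then have "(T ^^ Suc t) N x y = T (\<lambda>x y. N x y + real t * (s2 / 2)) x y" by simp
    also have "\<dots> = N x y + s2 / 2 + real t * (s2 / 2)"
      unfolding step_add step_const step_N ..
    finally show ?case by (simp add: algebra_simps)
  qed simp
  define C where "C = 8 + 16 * B\<^sup>2 + 2 * s2"
  have "(T ^^ t) (\<lambda>x v. (v - z)\<^sup>2) x y \<le> C * (1 + real t + (y - z)\<^sup>2)" for t x y z
  proof -
    have "(T ^^ t) (\<lambda>x v. (v - z)\<^sup>2) x y = (T ^^ t) (\<lambda>x v. v\<^sup>2) x (y - z)"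
      using tpow_shift[of t P f "\<lambda>x v. v\<^sup>2" "- z"] by (simp add: fun_eq_iff)
    also have "\<dots> \<le> (T ^^ t) (\<lambda>x v. 4 * N x v + 8 * B\<^sup>2) x (y - z)"
    proof (rule tpow_mono)
      fix x v show "v\<^sup>2 \<le> 4 * N x v + 8 * B\<^sup>2" using N_ge[of v x] by simp
    qed
    also have "\<dots> = 4 * (N x (y - z) + real t * (s2 / 2)) + 8 * B\<^sup>2"
      unfolding tpow_add tpow_mult tpow_const TN ..
    also have "\<dots> \<le> 4 * (2 * (y - z)\<^sup>2 + 2 * B\<^sup>2 + real t * (s2 / 2)) + 8 * B\<^sup>2"
    proof -
      have "0 \<le> (\<bar>y - z\<bar> - B)\<^sup>2" by simp
      then have "(\<bar>y - z\<bar> + B)\<^sup>2 \<le> 2 * (y - z)\<^sup>2 + 2 * B\<^sup>2" by (simp add: power2_eq_square algebra_simps)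
      then show ?thesis using N_le[of x "y - z"] by simp
    qed
    also have "\<dots> = 8 * (y - z)\<^sup>2 + 16 * B\<^sup>2 * 1 + 2 * s2 * real t" by simp
    also have "\<dots> \<le> C * (y - z)\<^sup>2 + C * 1 + C * real t"
      using s2_pos by (intro add_mono mult_right_mono) (auto simp: C_def)
    finally show ?thesis by (simp add: algebra_simps)
  qed
  moreover have "0 < C" using s2_pos by (simp add: C_def add_pos_nonneg)
  ultimately show ?thesis by blast
qed

section \<open>Adjoints of the transition operators with respect to \<open>nu\<close> times Lebesgue
  measure\<close>

definition TE :: "(real \<Rightarrow> real) \<Rightarrow> ('x \<Rightarrow> real \<Rightarrow> real) \<Rightarrow> 'x \<Rightarrow> real \<Rightarrow> real" where
  "TE e G x y = (\<Sum>x'\<in>UNIV. P x x' * (e (y + f x') * G x' (y + f x')))"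

text \<open>Undoing a move that arrived at \<open>x\<close> subtracts \<open>f x\<close>. The
  displacement thus belongs to the state where the reversed move starts, whereas \<open>step\<close>
  adds the value at the arrival state; comparisons with the reversed walk are therefore shifted by
  one move.\<close>

definition dTE :: "(real \<Rightarrow> real) \<Rightarrow> ('x \<Rightarrow> real \<Rightarrow> real) \<Rightarrow> 'x \<Rightarrow> real \<Rightarrow> real" where
  "dTE e H x y = e y * (\<Sum>x'\<in>UNIV. dualP x x' * H x' (y - f x))"

lemma T_TE: "T G = TE (\<lambda>_. 1) G"
  by (simp add: step_def TE_def fun_eq_iff)

lemma Q_TE: "Q G = TE (indicator {0<..}) G"
  by (auto simp: kstep_def step_def TE_def fun_eq_iff intro!: sum.cong)

lemma TE_measurable:
  assumes [measurable]: "e \<in> borel_measurable borel" "\<And>x. G x \<in> borel_measurable borel"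
  shows "TE e G x \<in> borel_measurable borel" "dTE e G x \<in> borel_measurable borel"
  unfolding TE_def dTE_def by measurable

lemma TE_nonneg:
  assumes "\<And>y. 0 \<le> e y" "\<And>x y. 0 \<le> G x y"
  shows "0 \<le> TE e G x y" "0 \<le> dTE e G x y"
  unfolding TE_def dTE_def by (intro sum_nonneg mult_nonneg_nonneg assms P_nonneg dualP_nonneg)+

lemma TE_pow_props:
  assumes e: "e \<in> borel_measurable borel" "\<And>y. 0 \<le> e y"
    and G: "\<And>x. G x \<in> borel_measurable borel" "\<And>x y. 0 \<le> G x y"
  shows "(TE e ^^ n) G x \<in> borel_measurable borel" "0 \<le> (TE e ^^ n) G x y"
    "(dTE e ^^ n) G x \<in> borel_measurable borel" "0 \<le> (dTE e ^^ n) G x y"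
proof -
  show "(TE e ^^ n) G x \<in> borel_measurable borel" "(dTE e ^^ n) G x \<in> borel_measurable borel"
    by (induction n arbitrary: x) (auto intro: TE_measurable e G)
  show "0 \<le> (TE e ^^ n) G x y" "0 \<le> (dTE e ^^ n) G x y"
    by (induction n arbitrary: x y) (auto intro: TE_nonneg e G)
qed

text \<open>Detailed balance between \<open>P\<close> and \<open>dualP\<close>, together with the
  translation \<open>y \<mapsto> y - f x'\<close>, under which Lebesgue measure is
  invariant.\<close>

lemma TE_dual:
  assumes [measurable]: "e \<in> borel_measurable borel" "\<And>x. G x \<in> borel_measurable borel" "\<And>x. H x \<in> borel_measurable borel"
    and nn: "\<And>y. 0 \<le> e y" "\<And>x y. 0 \<le> G x y" "\<And>x y. 0 \<le> H x y"
  shows "(\<Sum>x\<in>UNIV. \<integral>\<^sup>+y. ennreal (nu x * H x y * TE e G x y) \<partial>lborel) = (\<Sum>x\<in>UNIV. \<integral>\<^sup>+y. ennreal (nu x * dTE e H x y * G x y) \<partial>lborel)"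
proof -
  have "(\<integral>\<^sup>+y. ennreal (nu x * H x y * TE e G x y) \<partial>lborel)
      = (\<Sum>x'\<in>UNIV. \<integral>\<^sup>+y. ennreal (nu x' * dualP x' x * (H x (y - f x') * (e y * G x' y))) \<partial>lborel)" for x
  proof -
    have "(\<integral>\<^sup>+y. ennreal (nu x * H x y * TE e G x y) \<partial>lborel)
      = (\<integral>\<^sup>+y. (\<Sum>x'\<in>UNIV. ennreal (nu x' * dualP x' x * (H x y * (e (y + f x') * G x' (y + f x'))))) \<partial>lborel)"
    proof (rule nn_integral_cong)
      fix y
      have "nu x * H x y * TE e G x y = (\<Sum>x'\<in>UNIV. nu x' * dualP x' x * (H x y * (e (y + f x') * G x' (y + f x'))))"
        unfolding TE_def sum_distrib_left nu_dualP by (intro sum.cong) auto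
      then show "ennreal (nu x * H x y * TE e G x y) = (\<Sum>x'\<in>UNIV. ennreal (nu x' * dualP x' x * (H x y * (e (y + f x') * G x' (y + f x')))))"
        using nn nu_nonneg dualP_nonneg by (subst sum_ennreal) (auto intro!: mult_nonneg_nonneg)
    qed
    also have "\<dots> = (\<Sum>x'\<in>UNIV. \<integral>\<^sup>+y. ennreal (nu x' * dualP x' x * (H x y * (e (y + f x') * G x' (y + f x')))) \<partial>lborel)"
      by (rule nn_integral_sum) measurable
    also have "\<dots> = (\<Sum>x'\<in>UNIV. \<integral>\<^sup>+y. ennreal (nu x' * dualP x' x * (H x (y - f x') * (e y * G x' y))) \<partial>lborel)"
    proof (rule sum.cong[OF refl])
      fix x'
      show "(\<integral>\<^sup>+y. ennreal (nu x' * dualP x' x * (H x y * (e (y + f x') * G x' (y + f x')))) \<partial>lborel)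
        = (\<integral>\<^sup>+y. ennreal (nu x' * dualP x' x * (H x (y - f x') * (e y * G x' y))) \<partial>lborel)"
        using nn_integral_real_affine[of "\<lambda>y. ennreal (nu x' * dualP x' x * (H x (y - f x') * (e y * G x' y)))" 1 "f x'"]
        by (simp add: add.commute)
    qed
    finally show ?thesis .
  qed
  then have "(\<Sum>x\<in>UNIV. \<integral>\<^sup>+y. ennreal (nu x * H x y * TE e G x y) \<partial>lborel)
      = (\<Sum>x\<in>UNIV. \<Sum>x'\<in>UNIV. \<integral>\<^sup>+y. ennreal (nu x' * dualP x' x * (H x (y - f x') * (e y * G x' y))) \<partial>lborel)"
    by (rule sum.cong[OF refl])
  also have "\<dots> = (\<Sum>x'\<in>UNIV. \<Sum>x\<in>UNIV. \<integral>\<^sup>+y. ennreal (nu x' * dualP x' x * (H x (y - f x') * (e y * G x' y))) \<partial>lborel)"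
    by (rule sum.swap)
  also have "\<dots> = (\<Sum>x'\<in>UNIV. \<integral>\<^sup>+y. ennreal (nu x' * dTE e H x' y * G x' y) \<partial>lborel)"
  proof (rule sum.cong[OF refl])
    fix x'
    have "(\<Sum>x\<in>UNIV. \<integral>\<^sup>+y. ennreal (nu x' * dualP x' x * (H x (y - f x') * (e y * G x' y))) \<partial>lborel)
      = (\<integral>\<^sup>+y. (\<Sum>x\<in>UNIV. ennreal (nu x' * dualP x' x * (H x (y - f x') * (e y * G x' y)))) \<partial>lborel)"
      by (rule nn_integral_sum[symmetric]) measurable
    also have "\<dots> = (\<integral>\<^sup>+y. ennreal (nu x' * dTE e H x' y * G x' y) \<partial>lborel)"
    proof (rule nn_integral_cong)
      fix y
      have "nu x' * dTE e H x' y * G x' y = (\<Sum>x\<in>UNIV. nu x' * dualP x' x * (H x (y - f x') * (e y * G x' y)))"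
        unfolding dTE_def sum_distrib_left sum_distrib_right by (intro sum.cong) auto
      then show "(\<Sum>x\<in>UNIV. ennreal (nu x' * dualP x' x * (H x (y - f x') * (e y * G x' y)))) = ennreal (nu x' * dTE e H x' y * G x' y)"
        using nn nu_nonneg dualP_nonneg by (subst sum_ennreal) (auto intro!: mult_nonneg_nonneg)
    qed
    finally show "(\<Sum>x\<in>UNIV. \<integral>\<^sup>+y. ennreal (nu x' * dualP x' x * (H x (y - f x') * (e y * G x' y))) \<partial>lborel)
      = (\<integral>\<^sup>+y. ennreal (nu x' * dTE e H x' y * G x' y) \<partial>lborel)" .
  qed
  finally show ?thesis .
qed

lemma TE_pow_dual:
  assumes e: "e \<in> borel_measurable borel" "\<And>y. 0 \<le> e y"
    and G: "\<And>x. G x \<in> borel_measurable borel" "\<And>x y. 0 \<le> G x y"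
    and H: "\<And>x. H x \<in> borel_measurable borel" "\<And>x y. 0 \<le> H x y"
  shows "(\<Sum>x\<in>UNIV. \<integral>\<^sup>+y. ennreal (nu x * H x y * (TE e ^^ n) G x y) \<partial>lborel) = (\<Sum>x\<in>UNIV. \<integral>\<^sup>+y. ennreal (nu x * (dTE e ^^ n) H x y * G x y) \<partial>lborel)"
  using H
proof (induction n arbitrary: H)
  case (Suc n)
  have "(\<Sum>x\<in>UNIV. \<integral>\<^sup>+y. ennreal (nu x * H x y * (TE e ^^ Suc n) G x y) \<partial>lborel) = (\<Sum>x\<in>UNIV. \<integral>\<^sup>+y. ennreal (nu x * dTE e H x y * (TE e ^^ n) G x y) \<partial>lborel)"
    unfolding funpow.simps comp_def
    by (rule TE_dual) (auto intro: e Suc.prems TE_pow_props G)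
  also have "\<dots> = (\<Sum>x\<in>UNIV. \<integral>\<^sup>+y. ennreal (nu x * (dTE e ^^ n) (dTE e H) x y * G x y) \<partial>lborel)"
    by (rule Suc.IH) (auto intro: TE_measurable TE_nonneg e Suc.prems)
  finally show ?case by (simp add: funpow_swap1)
qed simp

text \<open>The first two of the \<open>n + 2\<close> positivity conditions are those at
  \<open>y\<close> and at \<open>y - f x\<close>. The remaining \<open>n\<close> are the killing
  conditions of the reversed walk started at \<open>y - f x\<close>. The induction carries the
  indicator of the second condition along.\<close>

lemma dTE_killed_le: "(dTE (indicator {0<..}) ^^ (n + 2)) (\<lambda>_ _. 1) x y \<le> (kstep dualP (\<lambda>x. - f x) ^^ n) (\<lambda>_ _. 1) x (y - f x)"
proof -
  interpret dual: diffusive_walk dualP "\<lambda>x. - f x" by (rule dual_walk)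
  define c where "c n = (dTE (indicator {0<..}) ^^ n) (\<lambda>_ _. 1 :: real)" for n
  have c_Suc: "c (Suc n) x y = indicator {0<..} y * (\<Sum>x'\<in>UNIV. dualP x x' * c n x' (y - f x))" for n x y
    by (simp add: c_def dTE_def)
  have c0: "c 0 x y = 1" for x y by (simp add: c_def)
  have dsum: "(\<Sum>x'\<in>UNIV. dualP x x') = 1" for x by (rule dual.P_sum)
  have c_nonneg: "0 \<le> c n x y" for n x y unfolding c_def by (rule TE_pow_props(4)) auto
  have "c (n + 2) x y \<le> indicator {0<..} (y - f x) * (kstep dualP (\<lambda>x. - f x) ^^ n) (\<lambda>_ _. 1) x (y - f x)" for n
  proof (induction n arbitrary: x y)
    case 0
    have "c 1 x y = indicator {0<..} y" for x y
      using c_Suc[of 0 x y] by (simp add: c0 dsum)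
    then have "c 2 x y = indicator {0<..} y * (\<Sum>x'\<in>UNIV. dualP x x' * indicator {0<..} (y - f x))"
      using c_Suc[of 1 x y] by (simp add: numeral_2_eq_2)
    also have "\<dots> = indicator {0<..} y * indicator {0<..} (y - f x)"
      unfolding sum_distrib_right[symmetric] dsum by simp
    finally show ?case by (auto simp: indicator_def numeral_2_eq_2)
  next
    case (Suc n)
    define R where "R = (kstep dualP (\<lambda>x. - f x) ^^ n) (\<lambda>_ _. 1 :: real)"
    have R0: "0 \<le> R x y" for x y unfolding R_def by (rule dual.kpow_nonneg) simp
    have "c (Suc n + 2) x y = indicator {0<..} y * (\<Sum>x'\<in>UNIV. dualP x x' * c (n + 2) x' (y - f x))"
      using c_Suc[of "n + 2" x y] by simp
    also have "\<dots> \<le> 1 * (\<Sum>x'\<in>UNIV. dualP x x' * (indicator {0<..} (y - f x) * (indicator {0<..} (y - f x - f x') * R x' (y - f x - f x'))))"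
    proof (intro mult_mono sum_mono mult_left_mono dualP_nonneg)
      fix x'
      have "c (n + 2) x' (y - f x) = indicator {0<..} (y - f x) * c (n + 2) x' (y - f x)"
        using c_Suc[of "Suc n" x' "y - f x"] by (simp add: indicator_def)
      also have "\<dots> \<le> indicator {0<..} (y - f x) * (indicator {0<..} (y - f x - f x') * R x' (y - f x - f x'))"
        using Suc.IH[of x' "y - f x"] by (intro mult_left_mono) (auto simp: R_def)
      finally show "c (n + 2) x' (y - f x) \<le> indicator {0<..} (y - f x) * (indicator {0<..} (y - f x - f x') * R x' (y - f x - f x'))" .
    next
      show "0 \<le> (\<Sum>x'\<in>UNIV. dualP x x' * c (n + 2) x' (y - f x))"
        by (intro sum_nonneg mult_nonneg_nonneg dualP_nonneg c_nonneg)
    qed (auto simp: indicator_def intro!: c_nonneg)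
    also have "\<dots> = indicator {0<..} (y - f x) * (\<Sum>x'\<in>UNIV. dualP x x' * (indicator {0<..} (y - f x - f x') * R x' (y - f x - f x')))"
      unfolding sum_distrib_left by (simp add: mult_ac)
    also have "(\<Sum>x'\<in>UNIV. dualP x x' * (indicator {0<..} (y - f x - f x') * R x' (y - f x - f x'))) = kstep dualP (\<lambda>x. - f x) R x (y - f x)"
      by (auto simp: kstep_def step_def indicator_def intro!: sum.cong)
    finally show ?case by (simp add: R_def)
  qed
  from this[of n] have "c (n + 2) x y \<le> indicator {0<..} (y - f x) * (kstep dualP (\<lambda>x. - f x) ^^ n) (\<lambda>_ _. 1) x (y - f x)" .
  also have "\<dots> \<le> 1 * (kstep dualP (\<lambda>x. - f x) ^^ n) (\<lambda>_ _. 1) x (y - f x)"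
    by (intro mult_right_mono dual.kpow_nonneg) (auto simp: indicator_def)
  finally show ?thesis unfolding c_def by simp
qed

text \<open>When the function does not depend on the state, the last reversed move averages out and
  only its displacement is kept; this accounts for the shift by one move.\<close>

lemma dTE_free_eq: "(dTE (\<lambda>_. 1) ^^ Suc n) (\<lambda>_. h) x y = (step dualP (\<lambda>x. - f x) ^^ n) (\<lambda>_. h) x (y - f x)"
proof -
  interpret dual: diffusive_walk dualP "\<lambda>x. - f x" by (rule dual_walk)
  show ?thesis
  proof (induction n arbitrary: x y)
    case 0
    then show ?case by (simp add: dTE_def sum_distrib_right[symmetric] dual.P_sum)
  next
    case (Suc n)
    have "(dTE (\<lambda>_. 1) ^^ Suc (Suc n)) (\<lambda>_. h) x y = dTE (\<lambda>_. 1) ((dTE (\<lambda>_. 1) ^^ Suc n) (\<lambda>_. h)) x y" by simp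
    also have "\<dots> = (\<Sum>x'\<in>UNIV. dualP x x' * (step dualP (\<lambda>x. - f x) ^^ n) (\<lambda>_. h) x' (y - f x - f x'))"
      unfolding dTE_def[of _ "(dTE _ ^^ Suc n) _"] Suc by simp
    also have "\<dots> = (step dualP (\<lambda>x. - f x) ^^ Suc n) (\<lambda>_. h) x (y - f x)"
      by (simp add: step_def[of _ _ "(step _ _ ^^ n) _"])
    finally show ?case .
  qed
qed

text \<open>A higher start survives along every path along which the lower one does.\<close>

lemma kpow_shift_mono:
  fixes G H :: "'x \<Rightarrow> real \<Rightarrow> real"
  assumes "0 \<le> h" "\<And>x y. G x y \<le> H x (y + h)" "\<And>x y. 0 \<le> H x y"
  shows "(Q ^^ n) G x y \<le> (Q ^^ n) H x (y + h)"
proof (induction n arbitrary: x y)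
  case (Suc n)
  have nn: "0 \<le> (Q ^^ n) H x y" for x y by (rule kpow_nonneg) (rule assms)
  show ?case
    unfolding funpow.simps comp_def kstep_def[of _ _ "(Q ^^ n) _"] step_def
  proof (intro sum_mono, unfold real_scaleR_def, intro mult_left_mono P_nonneg)
    fix x'
    show "(if 0 < y + f x' then (Q ^^ n) G x' (y + f x') else 0) \<le> (if 0 < y + h + f x' then (Q ^^ n) H x' (y + h + f x') else 0)"
      using Suc[of x' "y + f x'"] nn[of x' "y + h + f x'"] assms(1) by (auto simp: add_ac)
  qed
qed (use assms in simp)

end

context nonlattice_walk
begin

lemma cell_measurable [measurable]: "cell w a z x \<in> borel_measurable borel"
  unfolding cell_def by measurable

lemma local_bound:
  assumes a: "0 < a"
  shows "\<exists>C>0. \<forall>t x w y z. 0 < t \<longrightarrow> (T ^^ t) (cell w a z) x y \<le> C / sqrt (real t)"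
proof -
  obtain C where C: "0 < C" "\<And>t x w y z. 0 < t \<Longrightarrow> (T ^^ t) (\<lambda>x y. ind w x * (1 / (1 + (y - z)\<^sup>2))) x y \<le> C / sqrt (real t)"
    using cauchy_bound by blast
  have "(T ^^ t) (cell w a z) x y \<le> (1 + a\<^sup>2) * C / sqrt (real t)" if t: "0 < t" for t x w y z
  proof -
    have "(T ^^ t) (cell w a z) x y \<le> (T ^^ t) (\<lambda>x y. (1 + a\<^sup>2) * (ind w x * (1 / (1 + (y - z)\<^sup>2)))) x y"
    proof (rule tpow_mono)
      fix x y
      have pos: "0 < 1 + (y - z)\<^sup>2" by (simp add: add_pos_nonneg)
      have "indicator {z..z + a} y \<le> (1 + a\<^sup>2) * (1 / (1 + (y - z)\<^sup>2))"
      proof (cases "y \<in> {z..z + a}")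
        case True
        then have "(y - z)\<^sup>2 \<le> a\<^sup>2" by (intro power_mono) auto
        then show ?thesis using True pos by simp
      next
        case False
        then show ?thesis using pos by simp
      qed
      then have "ind w x * indicator {z..z + a} y \<le> ind w x * ((1 + a\<^sup>2) * (1 / (1 + (y - z)\<^sup>2)))"
        by (intro mult_left_mono ind_bounds)
      then show "cell w a z x y \<le> (1 + a\<^sup>2) * (ind w x * (1 / (1 + (y - z)\<^sup>2)))"
        by (simp only: cell_def mult.left_commute)
    qed
    also have "\<dots> \<le> (1 + a\<^sup>2) * (C / sqrt (real t))"
      unfolding tpow_mult by (intro mult_left_mono C t) auto
    finally show ?thesis by simp
  qed
  moreover have "0 < (1 + a\<^sup>2) * C" using C by (simp add: add_pos_nonneg)
  ultimately show ?thesis by blast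
qed

text \<open>The local bound lets one replace the law of the position at time \<open>t\<close> by \<open>t\<^sup>-\<^sup>1\<^sup>/\<^sup>2\<close> times Lebesgue measure.\<close>

lemma tpow_le_integral:
  "\<exists>C>0. \<forall>t x y g h. 0 < t \<longrightarrow> (\<forall>x y. 0 \<le> g x y) \<longrightarrow> (\<forall>x y. 0 \<le> h x y) \<longrightarrow> (\<forall>x. h x \<in> borel_measurable borel)
     \<longrightarrow> (\<forall>x y v. y \<le> v \<longrightarrow> v \<le> y + 1 \<longrightarrow> g x y \<le> h x v)
     \<longrightarrow> ennreal ((T ^^ t) g x y) \<le> ennreal (C / sqrt (real t)) * (\<Sum>x'\<in>UNIV. \<integral>\<^sup>+v. ennreal (nu x' * h x' v) \<partial>lborel)"
proof -
  obtain C1 where C1: "0 < C1" "\<And>t x w y z. 0 < t \<Longrightarrow> (T ^^ t) (cell w 1 z) x y \<le> C1 / sqrt (real t)"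
    using local_bound[of 1] by auto
  \<comment> \<open>The local bound holds for each end state separately; dividing by the smallest
    weight of \<open>nu\<close> inserts \<open>nu\<close> into the integral, as the duality
    requires.\<close>
  define m where "m = Min (range nu)"
  have "m \<in> range nu" unfolding m_def by (rule Min_in) auto
  then have m0: "0 < m" using nu_props(2) by auto
  have m: "m \<le> nu x" for x unfolding m_def by (rule Min_le) auto
  define C where "C = C1 / m"
  have key: "ennreal ((T ^^ t) g x y) \<le> ennreal (C / sqrt (real t)) * (\<Sum>x'\<in>UNIV. \<integral>\<^sup>+v. ennreal (nu x' * h x' v) \<partial>lborel)"
    if t: "0 < t" and g: "\<And>x y. 0 \<le> g x y" and h: "\<And>x y. 0 \<le> h x y" and [measurable]: "\<And>x. h x \<in> borel_measurable borel"
      and gh: "\<And>x y v. y \<le> v \<Longrightarrow> v \<le> y + 1 \<Longrightarrow> g x y \<le> h x v" for t x y g h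
  proof -
    define p where "p xs = pathprob P x xs" for xs
    define X where "X xs = (x # xs) ! t" for xs
    define Y where "Y xs = y + Ssum f xs t" for xs
    have p: "0 \<le> p xs" for xs unfolding p_def pathprob_def by (intro prod_nonneg) (auto intro: P_nonneg)
    have Tg: "(T ^^ t) G x y = (\<Sum>xs\<in>paths t. p xs * G (X xs) (Y xs))" for G :: "'x \<Rightarrow> real \<Rightarrow> real"
      unfolding expect_free[symmetric] expect_n_def p_def X_def Y_def ..
    have "ennreal ((T ^^ t) g x y) = (\<Sum>xs\<in>paths t. ennreal (p xs * g (X xs) (Y xs)))"
      unfolding Tg using p g by (intro sum_ennreal[symmetric]) auto
    also have "\<dots> \<le> (\<Sum>xs\<in>paths t. \<integral>\<^sup>+v. ennreal (p xs * (indicator {Y xs..Y xs + 1} v * h (X xs) v)) \<partial>lborel)"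
    proof (rule sum_mono)
      fix xs
      have "ennreal (p xs * g (X xs) (Y xs)) = (\<integral>\<^sup>+v. ennreal (p xs * g (X xs) (Y xs)) * indicator {Y xs..Y xs + 1} v \<partial>lborel)"
        by (simp add: nn_integral_cmult_indicator)
      also have "\<dots> \<le> (\<integral>\<^sup>+v. ennreal (p xs * (indicator {Y xs..Y xs + 1} v * h (X xs) v)) \<partial>lborel)"
        by (intro nn_integral_mono) (auto simp: indicator_def intro!: ennreal_leI mult_left_mono p gh)
      finally show "ennreal (p xs * g (X xs) (Y xs)) \<le> (\<integral>\<^sup>+v. ennreal (p xs * (indicator {Y xs..Y xs + 1} v * h (X xs) v)) \<partial>lborel)" .
    qed
    also have "\<dots> = (\<integral>\<^sup>+v. (\<Sum>xs\<in>paths t. ennreal (p xs * (indicator {Y xs..Y xs + 1} v * h (X xs) v))) \<partial>lborel)"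
      by (rule nn_integral_sum[symmetric]) measurable
    also have "\<dots> \<le> (\<integral>\<^sup>+v. (\<Sum>x'\<in>UNIV. ennreal (C / sqrt (real t)) * ennreal (nu x' * h x' v)) \<partial>lborel)"
    proof (rule nn_integral_mono)
      fix v
      \<comment> \<open>For fixed \<open>v\<close>, the condition that \<open>v\<close> lies in the
        unit interval to the right of the end point says that the end point lies in the unit cell
        ending at \<open>v\<close>. The sum over paths becomes a local probability.\<close>
      have "(\<Sum>xs\<in>paths t. p xs * (indicator {Y xs..Y xs + 1} v * h (X xs) v)) = (\<Sum>x'\<in>UNIV. h x' v * (T ^^ t) (cell x' 1 (v - 1)) x y)"
      proof -
        have "(\<Sum>x'\<in>UNIV. h x' v * (T ^^ t) (cell x' 1 (v - 1)) x y) = (\<Sum>x'\<in>UNIV. \<Sum>xs\<in>paths t. h x' v * (p xs * cell x' 1 (v - 1) (X xs) (Y xs)))"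
          unfolding Tg sum_distrib_left ..
        also have "\<dots> = (\<Sum>xs\<in>paths t. \<Sum>x'\<in>UNIV. h x' v * (p xs * cell x' 1 (v - 1) (X xs) (Y xs)))"
          by (rule sum.swap)
        also have "\<dots> = (\<Sum>xs\<in>paths t. p xs * (indicator {Y xs..Y xs + 1} v * h (X xs) v))"
        proof (rule sum.cong[OF refl])
          fix xs
          have "(\<Sum>x'\<in>UNIV. h x' v * (p xs * cell x' 1 (v - 1) (X xs) (Y xs))) = (\<Sum>x'\<in>UNIV. if X xs = x' then h x' v * (p xs * indicator {v - 1..v - 1 + 1} (Y xs)) else 0)"
            by (rule sum.cong) (auto simp: cell_def ind_def)
          also have "\<dots> = h (X xs) v * (p xs * indicator {v - 1..v - 1 + 1} (Y xs))" by simp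
          also have "\<dots> = p xs * (indicator {Y xs..Y xs + 1} v * h (X xs) v)" by (auto simp: indicator_def)
          finally show "(\<Sum>x'\<in>UNIV. h x' v * (p xs * cell x' 1 (v - 1) (X xs) (Y xs))) = p xs * (indicator {Y xs..Y xs + 1} v * h (X xs) v)" .
        qed
        finally show ?thesis ..
      qed
      also have "\<dots> \<le> (\<Sum>x'\<in>UNIV. (C / sqrt (real t)) * (nu x' * h x' v))"
      proof (rule sum_mono)
        fix x'
        have "h x' v * (T ^^ t) (cell x' 1 (v - 1)) x y \<le> h x' v * (C1 / sqrt (real t))"
          by (intro mult_left_mono C1 t h)
        also have "\<dots> \<le> h x' v * ((C / sqrt (real t)) * nu x')"
        proof (intro mult_left_mono h)
          have "C1 / sqrt (real t) = (C / sqrt (real t)) * m" using m0 by (simp add: C_def)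
          also have "\<dots> \<le> (C / sqrt (real t)) * nu x'" using C1 m0 by (intro mult_left_mono m) (auto simp: C_def)
          finally show "C1 / sqrt (real t) \<le> (C / sqrt (real t)) * nu x'" .
        qed
        finally show "h x' v * (T ^^ t) (cell x' 1 (v - 1)) x y \<le> (C / sqrt (real t)) * (nu x' * h x' v)" by (simp only: mult_ac)
      qed
      finally have "ennreal (\<Sum>xs\<in>paths t. p xs * (indicator {Y xs..Y xs + 1} v * h (X xs) v)) \<le> ennreal (\<Sum>x'\<in>UNIV. (C / sqrt (real t)) * (nu x' * h x' v))"
        by (rule ennreal_leI)
      also have "ennreal (\<Sum>x'\<in>UNIV. (C / sqrt (real t)) * (nu x' * h x' v)) = (\<Sum>x'\<in>UNIV. ennreal (C / sqrt (real t)) * ennreal (nu x' * h x' v))"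
        using C1 m0 h nu_nonneg by (subst sum_ennreal[symmetric]) (auto simp: C_def ennreal_mult[symmetric] intro!: mult_nonneg_nonneg sum.cong)
      also have "ennreal (\<Sum>xs\<in>paths t. p xs * (indicator {Y xs..Y xs + 1} v * h (X xs) v)) = (\<Sum>xs\<in>paths t. ennreal (p xs * (indicator {Y xs..Y xs + 1} v * h (X xs) v)))"
        using p h by (intro sum_ennreal[symmetric]) (auto intro!: mult_nonneg_nonneg)
      finally show "(\<Sum>xs\<in>paths t. ennreal (p xs * (indicator {Y xs..Y xs + 1} v * h (X xs) v))) \<le> (\<Sum>x'\<in>UNIV. ennreal (C / sqrt (real t)) * ennreal (nu x' * h x' v))" .
    qed
    also have "\<dots> = (\<Sum>x'\<in>UNIV. \<integral>\<^sup>+v. ennreal (C / sqrt (real t)) * ennreal (nu x' * h x' v) \<partial>lborel)"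
      by (rule nn_integral_sum) measurable
    also have "\<dots> = ennreal (C / sqrt (real t)) * (\<Sum>x'\<in>UNIV. \<integral>\<^sup>+v. ennreal (nu x' * h x' v) \<partial>lborel)"
      unfolding sum_distrib_left by (intro sum.cong[OF refl] nn_integral_cmult) measurable
    finally show ?thesis .
  qed
  have "0 < C" using C1 m0 by (simp add: C_def)
  show ?thesis
  proof (rule exI[of _ C], rule conjI[OF \<open>0 < C\<close>], intro allI impI)
    fix t :: nat and x :: 'x and y :: real and g h :: "'x \<Rightarrow> real \<Rightarrow> real"
    assume "0 < t" "\<forall>x y. 0 \<le> g x y" "\<forall>x y. 0 \<le> h x y" "\<forall>x. h x \<in> borel_measurable borel"
      "\<forall>x y v. y \<le> v \<longrightarrow> v \<le> y + 1 \<longrightarrow> g x y \<le> h x v"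
    then show "ennreal ((T ^^ t) g x y) \<le> ennreal (C / sqrt (real t)) * (\<Sum>x'\<in>UNIV. \<integral>\<^sup>+v. ennreal (nu x' * h x' v) \<partial>lborel)"
      by (intro key) auto
  qed
qed

lemma sum_cell_integral_le:
  assumes c: "0 \<le> c" and a: "0 < a" and le: "\<And>u. z \<le> u \<Longrightarrow> u \<le> z + a \<Longrightarrow> R w u \<le> c"
    and R: "\<And>x u. 0 \<le> R x u"
  shows "(\<Sum>x\<in>UNIV. \<integral>\<^sup>+u. ennreal (nu x * R x u * cell w a z x u) \<partial>lborel) \<le> ennreal (c * a)"
proof -
  have nu1: "nu w \<le> 1" using member_le_sum[of w UNIV nu] nu_nonneg nu_sum by simp
  have each: "(\<integral>\<^sup>+u. ennreal (nu x * R x u * cell w a z x u) \<partial>lborel) \<le> (if x = w then ennreal (c * a) else 0)" for x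
  proof (cases "x = w")
    case True
    have "(\<integral>\<^sup>+u. ennreal (nu x * R x u * cell w a z x u) \<partial>lborel) \<le> (\<integral>\<^sup>+u. ennreal c * indicator {z..z + a} u \<partial>lborel)"
    proof (rule nn_integral_mono)
      fix u
      show "ennreal (nu x * R x u * cell w a z x u) \<le> ennreal c * indicator {z..z + a} u"
      proof (cases "u \<in> {z..z + a}")
        case u: True
        have "nu x * R x u * cell w a z x u \<le> 1 * c * 1"
          using True u nu1 nu_nonneg c R le cell_bounds by (intro mult_mono) auto
        then show ?thesis using u by (simp add: ennreal_leI)
      next
        case False
        then show ?thesis by (simp add: cell_def)
      qed
    qed
    also have "\<dots> = ennreal (c * a)"
      using a c by (simp add: nn_integral_cmult_indicator ennreal_mult)
    finally show ?thesis using True by simp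
  next
    case False
    then show ?thesis by (simp add: cell_def ind_def)
  qed
  have "(\<Sum>x\<in>UNIV. \<integral>\<^sup>+u. ennreal (nu x * R x u * cell w a z x u) \<partial>lborel) \<le> (\<Sum>x\<in>UNIV. if x = w then ennreal (c * a) else 0)"
    by (rule sum_mono) (rule each)
  then show ?thesis by simp
qed

text \<open>In the first half of the time killing is ignored and the law is replaced by 1 / sqrt m
  times Lebesgue measure. Integrated against that measure, the second half becomes, by duality, the
  survival of the reversed walk started near \<open>z\<close>, of order \<open>(1 + z)\<close> /
  sqrt m.\<close>

lemma killed_cell_bound:
  assumes a: "0 < a"
  shows "\<exists>C>0. \<forall>m x w y z. 6 \<le> m \<longrightarrow> 0 \<le> z \<longrightarrow> (Q ^^ m) (cell w a z) x y \<le> C * (1 + z) / real m"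
proof -
  obtain C1 where C1: "0 < C1" and smooth: "\<And>t x y g h. 0 < t \<Longrightarrow> (\<forall>x y. 0 \<le> g x y) \<Longrightarrow> (\<forall>x y. 0 \<le> h x y) \<Longrightarrow> (\<forall>x. h x \<in> borel_measurable borel)
     \<Longrightarrow> (\<forall>x y v. y \<le> v \<longrightarrow> v \<le> y + 1 \<longrightarrow> g x y \<le> h x v)
     \<Longrightarrow> ennreal ((T ^^ t) g x y) \<le> ennreal (C1 / sqrt (real t)) * (\<Sum>x'\<in>UNIV. \<integral>\<^sup>+v. ennreal (nu x' * h x' v) \<partial>lborel)"
    using tpow_le_integral by blast
  obtain C2 where C2: "0 < C2" "\<And>n x y. 0 < n \<Longrightarrow> (kstep dualP (\<lambda>x. - f x) ^^ n) (\<lambda>_ _. 1) x y \<le> C2 * (1 + max y 0) / sqrt (real n)"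
    using diffusive_walk.surv_bound[OF dual_walk] unfolding markov_walk.surv_def[OF markov_walk.intro[OF stochastic_dual]] by blast
  define e :: "real \<Rightarrow> real" where "e = indicator {0<..}"
  have e: "e \<in> borel_measurable borel" "\<And>y. 0 \<le> e y" by (auto simp: e_def)
  have QTE: "(Q ^^ n) G = (TE e ^^ n) G" for n and G :: "'x \<Rightarrow> real \<Rightarrow> real"
    by (induction n) (simp_all add: Q_TE e_def)
  define A where "A = a + 1"
  define C where "C = 18 * C1 * C2 * (A + B + 1) * A"
  have AB: "0 < A" "0 < A + B + 1" using a B_ge_1 by (auto simp: A_def)
  have "(Q ^^ m) (cell w a z) x y \<le> C * (1 + z) / real m" if m: "6 \<le> m" and z: "0 \<le> z" for m x w y z
  proof -
    define m1 where "m1 = m div 2"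
    define m2 where "m2 = m - m1"
    \<comment> \<open>The reversed walk loses two steps in \<open>dTE_killed_le\<close>;
      \<open>6 \<le> m\<close> keeps \<open>n\<close> positive and at least
      \<open>m / 9\<close>.\<close>
    define n where "n = m2 - 2"
    have mm: "m = m1 + m2" "0 < m1" "m2 = n + 2" "0 < n" "real m / 9 \<le> real m1" "real m / 9 \<le> real n"
      using m by (auto simp: m1_def m2_def n_def)
    have m0: "0 < real m" using m by simp
    have lower: "sqrt (real m) / 3 \<le> sqrt (real k)" if "real m / 9 \<le> real k" for k
      using real_sqrt_le_mono[OF that] by (simp add: real_sqrt_divide)
    have "(Q ^^ m) (cell w a z) x y \<le> (T ^^ m1) ((Q ^^ m2) (cell w a z)) x y"
      unfolding mm(1) funpow_add comp_def by (rule kpow_le_tpow) (intro kpow_nonneg cell_bounds)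
    then have "ennreal ((Q ^^ m) (cell w a z) x y) \<le> ennreal ((T ^^ m1) ((Q ^^ m2) (cell w a z)) x y)"
      by (rule ennreal_leI)
    also have "\<dots> \<le> ennreal (C1 / sqrt (real m1)) * (\<Sum>x'\<in>UNIV. \<integral>\<^sup>+v. ennreal (nu x' * (Q ^^ m2) (cell w A z) x' v) \<partial>lborel)"
    proof (rule smooth[OF mm(2)]; (intro allI impI)?)
      show "0 \<le> (Q ^^ m2) (cell w a z) x y" "0 \<le> (Q ^^ m2) (cell w A z) x y" for x y
        by (intro kpow_nonneg cell_bounds)+
      show "(Q ^^ m2) (cell w A z) x \<in> borel_measurable borel" for x
        unfolding QTE by (rule TE_pow_props(1)[OF e]) (auto intro: cell_bounds)
      show "(Q ^^ m2) (cell w a z) x y \<le> (Q ^^ m2) (cell w A z) x v" if v: "y \<le> v" "v \<le> y + 1" for x y v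
      proof -
        have "(Q ^^ m2) (cell w a z) x y \<le> (Q ^^ m2) (cell w A z) x (y + (v - y))"
        proof (rule kpow_shift_mono)
          fix x y'
          show "cell w a z x y' \<le> cell w A z x (y' + (v - y))"
            using v by (auto simp: cell_def ind_def indicator_def A_def)
        qed (use v cell_bounds in auto)
        then show ?thesis by simp
      qed
    qed
    also have "(\<Sum>x'\<in>UNIV. \<integral>\<^sup>+v. ennreal (nu x' * (Q ^^ m2) (cell w A z) x' v) \<partial>lborel)
        = (\<Sum>x'\<in>UNIV. \<integral>\<^sup>+v. ennreal (nu x' * (dTE e ^^ m2) (\<lambda>_ _. 1) x' v * cell w A z x' v) \<partial>lborel)"
      using TE_pow_dual[OF e, of "cell w A z" "\<lambda>_ _. 1" m2] cell_bounds unfolding QTE by simp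
    also have "\<dots> \<le> ennreal (C2 * (1 + z + A + B) / sqrt (real n) * A)"
    proof (rule sum_cell_integral_le)
      show "0 \<le> (dTE e ^^ m2) (\<lambda>_ _. 1) x u" for x u by (rule TE_pow_props(4)[OF e]) auto
      fix u assume u: "z \<le> u" "u \<le> z + A"
      have "(dTE e ^^ m2) (\<lambda>_ _. 1) w u \<le> (kstep dualP (\<lambda>x. - f x) ^^ n) (\<lambda>_ _. 1) w (u - f w)"
        unfolding e_def mm(3) by (rule dTE_killed_le)
      also have "\<dots> \<le> C2 * (1 + max (u - f w) 0) / sqrt (real n)" by (rule C2(2)[OF mm(4)])
      also have "\<dots> \<le> C2 * (1 + z + A + B) / sqrt (real n)"
        using C2 u z B_bounds(1)[of w] AB B_ge_1 by (intro divide_right_mono mult_left_mono) (auto simp: abs_le_iff)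
      finally show "(dTE e ^^ m2) (\<lambda>_ _. 1) w u \<le> C2 * (1 + z + A + B) / sqrt (real n)" .
    qed (use AB C2 z B_ge_1 in auto)
    finally have "ennreal ((Q ^^ m) (cell w a z) x y) \<le> ennreal (C1 / sqrt (real m1)) * ennreal (C2 * (1 + z + A + B) / sqrt (real n) * A)"
      by (simp add: mult_left_mono)
    also have "\<dots> = ennreal (C1 / sqrt (real m1) * (C2 * (1 + z + A + B) / sqrt (real n) * A))"
      using C1 C2 AB z B_ge_1 by (intro ennreal_mult[symmetric]) auto
    finally have "(Q ^^ m) (cell w a z) x y \<le> C1 / sqrt (real m1) * (C2 * (1 + z + A + B) / sqrt (real n) * A)"
      using C1 C2 AB z B_ge_1 by (subst (asm) ennreal_le_iff) auto
    also have "\<dots> \<le> C1 / (sqrt (real m) / 3) * (C2 * ((1 + z) * (A + B + 1)) / (sqrt (real m) / 3) * A)"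
    proof (intro mult_mono frac_le lower mm)
      have "0 \<le> z * (A + B)" using z AB B_ge_1 by (intro mult_nonneg_nonneg) auto
      then show "1 + z + A + B \<le> (1 + z) * (A + B + 1)" by (simp add: algebra_simps)
    qed (use C1 C2 AB z m0 B_ge_1 in \<open>auto intro!: mult_nonneg_nonneg divide_nonneg_nonneg\<close>)
    also have "\<dots> = 9 * C1 * C2 * (A + B + 1) * A * (1 + z) / real m"
      using m0 by (simp add: field_simps)
    also have "\<dots> \<le> C * (1 + z) / real m"
      using C1 C2 AB z m0 by (intro divide_right_mono mult_right_mono) (auto simp: C_def)
    finally show ?thesis .
  qed
  moreover have "0 < C" using C1 C2 AB by (simp add: C_def)
  ultimately show ?thesis by blast
qed

text \<open>To reach the cell, the walk must cover half the distance in one of the two halves of the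
  time. A second moment bound gives this a factor of order \<open>t / (z - y)\<^sup>2\<close>, and
  the local bound for the other half gives 1 / sqrt t.\<close>

lemma far_cell_bound:
  assumes a: "0 < a"
  shows "\<exists>C>0. \<forall>t x w y z. 0 < t \<longrightarrow> 4 \<le> \<bar>z - y\<bar> \<longrightarrow> (T ^^ t) (cell w a z) x y \<le> C * sqrt (real t) / (z - y)\<^sup>2"
proof -
  obtain C1 where C1: "0 < C1" and smooth: "\<And>t x y g h. 0 < t \<Longrightarrow> (\<forall>x y. 0 \<le> g x y) \<Longrightarrow> (\<forall>x y. 0 \<le> h x y) \<Longrightarrow> (\<forall>x. h x \<in> borel_measurable borel)
     \<Longrightarrow> (\<forall>x y v. y \<le> v \<longrightarrow> v \<le> y + 1 \<longrightarrow> g x y \<le> h x v)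
     \<Longrightarrow> ennreal ((T ^^ t) g x y) \<le> ennreal (C1 / sqrt (real t)) * (\<Sum>x'\<in>UNIV. \<integral>\<^sup>+v. ennreal (nu x' * h x' v) \<partial>lborel)"
    using tpow_le_integral by blast
  obtain C2 where C2: "0 < C2" "\<And>t x y z. (T ^^ t) (\<lambda>x v. (v - z)\<^sup>2) x y \<le> C2 * (1 + real t + (y - z)\<^sup>2)"
    using tpow_square by blast
  obtain C3 where C3: "0 < C3" "\<And>t x y z. (step dualP (\<lambda>x. - f x) ^^ t) (\<lambda>x v. (v - z)\<^sup>2) x y \<le> C3 * (1 + real t + (y - z)\<^sup>2)"
    using diffusive_walk.tpow_square[OF dual_walk] by blast
  obtain C4 where C4: "0 < C4" "\<And>t x w y z. 0 < t \<Longrightarrow> (T ^^ t) (cell w a z) x y \<le> C4 / sqrt (real t)"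
    using local_bound[OF a] by blast
  define A where "A = a + 1"
  have A: "0 < A" using a by (simp add: A_def)
  define E where "E = 1 + (A + B)\<^sup>2"
  have E: "1 \<le> E" by (simp add: E_def)
  define one :: "real \<Rightarrow> real" where "one = (\<lambda>_. 1)"
  have one: "one \<in> borel_measurable borel" "\<And>y. 0 \<le> one y" by (auto simp: one_def)
  have TTE: "(T ^^ n) G = (TE one ^^ n) G" for n and G :: "'x \<Rightarrow> real \<Rightarrow> real"
    by (induction n) (simp_all add: T_TE one_def)
  define K1 where "K1 = 16 * C4 * C2"
  define K2 where "K2 = 64 * C1 * C3 * E * A"
  define C where "C = K1 + K2 + (A + B)\<^sup>2"
  have K: "0 < K1" "0 < K2" using C1 C2 C3 C4 E A by (auto simp: K1_def K2_def)
  have main: "(T ^^ t) (cell w a z) x y \<le> (K1 + K2) * sqrt (real t) / (z - y)\<^sup>2" if t: "2 \<le> t" and far: "4 \<le> \<bar>z - y\<bar>" for t x w y z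
  proof -
    \<comment> \<open>Half the distance. As \<open>2 \<le> D'\<close>, the loss of 1 in
      \<open>h\<close>, where the end point is moved by up to 1, keeps at least
      \<open>D' / 2\<close>.\<close>
    define D' where "D' = \<bar>z - y\<bar> / 2"
    have D': "2 \<le> D'" "D'\<^sup>2 = (z - y)\<^sup>2 / 4" using far by (auto simp: D'_def power_divide)
    define t1 where "t1 = t div 2"
    define t2 where "t2 = t - t1"
    have tt: "t = t1 + t2" "0 < t1" "0 < t2" "real t / 4 \<le> real t1" "real t / 4 \<le> real t2" "1 + real t1 \<le> 2 * real t"
      "1 + real t2 \<le> 2 * real t"
      using t by (auto simp: t1_def t2_def)
    have t0: "0 < real t" using t by simp
    have lower: "sqrt (real t) / 2 \<le> sqrt (real k)" if "real t / 4 \<le> real k" for k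
      using real_sqrt_le_mono[OF that] by (simp add: real_sqrt_divide)
    define F where "F = (T ^^ t2) (cell w a z)"
    define F' where "F' = (T ^^ t2) (cell w A z)"
    have Fn: "0 \<le> F x y" "0 \<le> F' x y" for x y unfolding F_def F'_def by (intro tpow_nonneg cell_bounds)+
    have Fle: "F x y \<le> C4 / sqrt (real t2)" for x y unfolding F_def by (rule C4(2)[OF tt(3)])
    define g where "g = (\<lambda>x' y'. if D' \<le> \<bar>y' - z\<bar> then F x' y' else 0)"
    \<comment> \<open>The event of a large displacement in the second half is replaced by its
      Chebyshev weight. By duality this weight becomes a second moment of the reversed walk started
      in the cell.\<close>
    define h where "h = (\<lambda>x' v. (v - z)\<^sup>2 / (D' - 1)\<^sup>2 * F' x' v)"
    have "(T ^^ t) (cell w a z) x y = (T ^^ t1) F x y" unfolding tt(1) F_def funpow_add comp_def ..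
    also have "\<dots> \<le> (T ^^ t1) (\<lambda>x' y'. C4 / sqrt (real t2) / D'\<^sup>2 * (y' - y)\<^sup>2 + g x' y') x y"
    proof (rule tpow_mono)
      fix x' y'
      have nn: "0 \<le> C4 / sqrt (real t2) / D'\<^sup>2 * (y' - y)\<^sup>2" "0 \<le> g x' y'" using C4 Fn by (auto simp: g_def)
      show "F x' y' \<le> C4 / sqrt (real t2) / D'\<^sup>2 * (y' - y)\<^sup>2 + g x' y'"
      proof (cases "D' \<le> \<bar>y' - y\<bar>")
        case True
        then have "D'\<^sup>2 \<le> \<bar>y' - y\<bar>\<^sup>2" using D' by (intro power_mono) auto
        then have "1 \<le> (y' - y)\<^sup>2 / D'\<^sup>2" using D' by (simp add: pos_le_divide_eq)
        then have "C4 / sqrt (real t2) * 1 \<le> C4 / sqrt (real t2) * ((y' - y)\<^sup>2 / D'\<^sup>2)" using C4 by (intro mult_left_mono) auto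
        then show ?thesis using Fle[of x' y'] nn by simp
      next
        case False
        moreover have "2 * D' = \<bar>z - y\<bar>" by (simp add: D'_def)
        ultimately have "D' \<le> \<bar>y' - z\<bar>" by linarith
        then show ?thesis using nn by (simp add: g_def)
      qed
    qed
    also have "\<dots> = C4 / sqrt (real t2) / D'\<^sup>2 * (T ^^ t1) (\<lambda>x' y'. (y' - y)\<^sup>2) x y + (T ^^ t1) g x y"
      unfolding tpow_add tpow_mult ..
    also have "\<dots> \<le> K1 * sqrt (real t) / (z - y)\<^sup>2 + K2 * sqrt (real t) / (z - y)\<^sup>2"
    proof (rule add_mono)
      have "C4 / sqrt (real t2) / D'\<^sup>2 * (T ^^ t1) (\<lambda>x' y'. (y' - y)\<^sup>2) x y \<le> C4 / (sqrt (real t) / 2) / D'\<^sup>2 * (C2 * (2 * real t))"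
      proof (rule mult_mono)
        show "C4 / sqrt (real t2) / D'\<^sup>2 \<le> C4 / (sqrt (real t) / 2) / D'\<^sup>2"
          using C4 t0 tt by (intro divide_right_mono divide_left_mono lower) (auto intro!: mult_pos_pos)
        have "(T ^^ t1) (\<lambda>x' y'. (y' - y)\<^sup>2) x y \<le> C2 * (1 + real t1 + (y - y)\<^sup>2)" by (rule C2)
        also have "\<dots> \<le> C2 * (2 * real t)" using C2 tt(6) by (intro mult_left_mono) auto
        finally show "(T ^^ t1) (\<lambda>x' y'. (y' - y)\<^sup>2) x y \<le> C2 * (2 * real t)" .
        show "0 \<le> (T ^^ t1) (\<lambda>x' y'. (y' - y)\<^sup>2) x y" by (intro tpow_nonneg) auto
      qed (use C4 in auto)
      also have "\<dots> = K1 * (real t / sqrt (real t)) / (z - y)\<^sup>2" unfolding D'(2) by (simp add: K1_def)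
      also have "real t / sqrt (real t) = sqrt (real t)" using t0 by (simp add: real_div_sqrt)
      finally show "C4 / sqrt (real t2) / D'\<^sup>2 * (T ^^ t1) (\<lambda>x' y'. (y' - y)\<^sup>2) x y \<le> K1 * sqrt (real t) / (z - y)\<^sup>2" .
    next
      have hm: "(\<lambda>v. (v - z)\<^sup>2 / (D' - 1)\<^sup>2) \<in> borel_measurable borel" by measurable
      have F'm: "F' x \<in> borel_measurable borel" for x
        unfolding F'_def TTE by (rule TE_pow_props(1)[OF one]) (auto intro: cell_bounds)
      have "ennreal ((T ^^ t1) g x y) \<le> ennreal (C1 / sqrt (real t1)) * (\<Sum>x'\<in>UNIV. \<integral>\<^sup>+v. ennreal (nu x' * h x' v) \<partial>lborel)"
      proof (rule smooth[OF tt(2)]; (intro allI impI)?)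
        show "0 \<le> g x y" "0 \<le> h x y" for x y using Fn by (auto simp: g_def h_def)
        show "h x \<in> borel_measurable borel" for x unfolding h_def using F'm[of x] by measurable
        show "g x y \<le> h x v" if v: "y \<le> v" "v \<le> y + 1" for x y v
        proof (cases "D' \<le> \<bar>y - z\<bar>")
          case True
          have "D' - 1 \<le> \<bar>v - z\<bar>" using True v by linarith
          then have "(D' - 1)\<^sup>2 \<le> \<bar>v - z\<bar>\<^sup>2" using D' by (intro power_mono) auto
          then have ge1: "1 \<le> (v - z)\<^sup>2 / (D' - 1)\<^sup>2" using D' by (simp add: pos_le_divide_eq)
          have "F x y \<le> F' x v"
          proof -
            have "F x y \<le> (T ^^ t2) (\<lambda>x y'. cell w A z x (y' + (v - y))) x y"
              unfolding F_def
            proof (rule tpow_mono)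
              fix x y'
              show "cell w a z x y' \<le> cell w A z x (y' + (v - y))"
                using v by (auto simp: cell_def ind_def indicator_def A_def)
            qed
            then show ?thesis unfolding tpow_shift F'_def by simp
          qed
          also have "\<dots> \<le> (v - z)\<^sup>2 / (D' - 1)\<^sup>2 * F' x v" using mult_right_mono[OF ge1 Fn(2)[of x v]] by simp
          finally show ?thesis using True by (simp add: g_def h_def)
        next
          case False
          then show ?thesis using Fn by (simp add: g_def h_def)
        qed
      qed
      also have "(\<Sum>x'\<in>UNIV. \<integral>\<^sup>+v. ennreal (nu x' * h x' v) \<partial>lborel)
        = (\<Sum>x'\<in>UNIV. \<integral>\<^sup>+v. ennreal (nu x' * (dTE one ^^ t2) (\<lambda>_ v. (v - z)\<^sup>2 / (D' - 1)\<^sup>2) x' v * cell w A z x' v) \<partial>lborel)"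
        using TE_pow_dual[OF one, of "cell w A z" "\<lambda>_ v. (v - z)\<^sup>2 / (D' - 1)\<^sup>2" t2] cell_bounds hm
        unfolding h_def F'_def TTE by (simp add: mult.assoc)
      also have "\<dots> \<le> ennreal (C3 * (2 * real t * E) / (D' - 1)\<^sup>2 * A)"
      proof (rule sum_cell_integral_le)
        show "0 \<le> (dTE one ^^ t2) (\<lambda>_ v. (v - z)\<^sup>2 / (D' - 1)\<^sup>2) x u" for x u
          by (rule TE_pow_props(4)[OF one]) auto
        fix u assume u: "z \<le> u" "u \<le> z + A"
        obtain k where k: "t2 = Suc k" using tt(3) by (cases t2) auto
        have "(dTE one ^^ t2) (\<lambda>_ v. (v - z)\<^sup>2 / (D' - 1)\<^sup>2) w u = (step dualP (\<lambda>x. - f x) ^^ k) (\<lambda>_ v. (v - z)\<^sup>2 / (D' - 1)\<^sup>2) w (u - f w)"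
          unfolding one_def k by (rule dTE_free_eq)
        also have "\<dots> = 1 / (D' - 1)\<^sup>2 * (step dualP (\<lambda>x. - f x) ^^ k) (\<lambda>_ v. (v - z)\<^sup>2) w (u - f w)"
          using tpow_mult[where n = k and P = dualP and f = "\<lambda>x. - f x" and c = "1 / (D' - 1)\<^sup>2" and G = "\<lambda>_ v. (v - z)\<^sup>2"]
          by (simp add: fun_eq_iff)
        also have "\<dots> \<le> 1 / (D' - 1)\<^sup>2 * (C3 * (2 * real t * E))"
        proof (rule mult_left_mono)
          have "(step dualP (\<lambda>x. - f x) ^^ k) (\<lambda>_ v. (v - z)\<^sup>2) w (u - f w) \<le> C3 * (1 + real k + (u - f w - z)\<^sup>2)" by (rule C3)
          also have "\<dots> \<le> C3 * (2 * real t * E)"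
          proof (rule mult_left_mono)
            have "\<bar>u - f w - z\<bar> \<le> A + B" using u B_bounds(1)[of w] by (simp add: abs_le_iff)
            then have "\<bar>u - f w - z\<bar>\<^sup>2 \<le> (A + B)\<^sup>2" by (intro power_mono) auto
            moreover have "real k \<le> 2 * real t - 2" using tt(7) k by simp
            moreover have "(2 * real t) * 1 + 1 * (A + B)\<^sup>2 \<le> (2 * real t) * 1 + (2 * real t) * (A + B)\<^sup>2"
              using t by (intro add_mono mult_right_mono) auto
            ultimately show "1 + real k + (u - f w - z)\<^sup>2 \<le> 2 * real t * E" by (simp add: E_def algebra_simps)
          qed (use C3 in simp)
          finally show "(step dualP (\<lambda>x. - f x) ^^ k) (\<lambda>_ v. (v - z)\<^sup>2) w (u - f w) \<le> C3 * (2 * real t * E)" .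
        qed simp
        finally show "(dTE one ^^ t2) (\<lambda>_ v. (v - z)\<^sup>2 / (D' - 1)\<^sup>2) w u \<le> C3 * (2 * real t * E) / (D' - 1)\<^sup>2" by simp
      qed (use A C3 E in auto)
      finally have "ennreal ((T ^^ t1) g x y) \<le> ennreal (C1 / sqrt (real t1)) * ennreal (C3 * (2 * real t * E) / (D' - 1)\<^sup>2 * A)"
        by (simp add: mult_left_mono)
      also have "\<dots> = ennreal (C1 / sqrt (real t1) * (C3 * (2 * real t * E) / (D' - 1)\<^sup>2 * A))"
        using C1 C3 A E by (intro ennreal_mult[symmetric]) auto
      finally have "(T ^^ t1) g x y \<le> C1 / sqrt (real t1) * (C3 * (2 * real t * E) / (D' - 1)\<^sup>2 * A)"
        using C1 C3 A E by (subst (asm) ennreal_le_iff) auto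
      also have "\<dots> \<le> C1 / (sqrt (real t) / 2) * (C3 * (2 * real t * E) / (D' / 2)\<^sup>2 * A)"
      proof (intro mult_mono divide_left_mono lower tt power_mono)
        show "D' / 2 \<le> D' - 1" using D' by simp
      qed (use C1 C3 A E D' t0 tt in \<open>auto intro!: mult_pos_pos mult_nonneg_nonneg divide_nonneg_nonneg\<close>)
      also have "\<dots> = K2 * (real t / sqrt (real t)) / (z - y)\<^sup>2"
        unfolding power_divide D'(2) by (simp add: K2_def)
      also have "real t / sqrt (real t) = sqrt (real t)" using t0 by (simp add: real_div_sqrt)
      finally show "(T ^^ t1) g x y \<le> K2 * sqrt (real t) / (z - y)\<^sup>2" .
    qed
    finally show ?thesis by (simp add: add_divide_distrib distrib_right)
  qed
  have "(T ^^ t) (cell w a z) x y \<le> C * sqrt (real t) / (z - y)\<^sup>2" if t: "0 < t" and far: "4 \<le> \<bar>z - y\<bar>" for t x w y z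
  proof (cases "2 \<le> t")
    case True
    have "(T ^^ t) (cell w a z) x y \<le> (K1 + K2) * sqrt (real t) / (z - y)\<^sup>2" by (rule main[OF True far])
    also have "\<dots> \<le> C * sqrt (real t) / (z - y)\<^sup>2"
      by (intro divide_right_mono mult_right_mono) (auto simp: C_def)
    finally show ?thesis .
  next
    case False
    then have t1: "t = 1" using t by simp
    have zy: "0 < (z - y)\<^sup>2" using far by auto
    have "T (cell w a z) x y \<le> T (\<lambda>_ _. (A + B)\<^sup>2 / (z - y)\<^sup>2) x y"
    proof (rule step_mono)
      fix x'
      show "cell w a z x' (y + f x') \<le> (A + B)\<^sup>2 / (z - y)\<^sup>2"
      proof (cases "y + f x' \<in> {z..z + a}")
        case True
        then have "\<bar>z - y\<bar> \<le> A + B" using B_bounds(1)[of x'] a by (auto simp: A_def abs_le_iff)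
        then have "\<bar>z - y\<bar>\<^sup>2 \<le> (A + B)\<^sup>2" by (intro power_mono) auto
        then have "1 \<le> (A + B)\<^sup>2 / (z - y)\<^sup>2" using zy by (simp add: pos_le_divide_eq)
        then show ?thesis using cell_bounds(2)[of w a z x' "y + f x'"] by linarith
      next
        case False
        then show ?thesis by (simp add: cell_def)
      qed
    qed
    also have "\<dots> = (A + B)\<^sup>2 / (z - y)\<^sup>2" by (simp add: step_const)
    also have "\<dots> \<le> C / (z - y)\<^sup>2" using K by (intro divide_right_mono) (auto simp: C_def)
    finally show ?thesis using t1 by simp
  qed
  moreover have "0 < C" using K by (simp add: C_def add_pos_nonneg)
  ultimately show ?thesis by blast
qed

end

section \<open>The conditioned local limit theorem\<close>

context nonlattice_walk
begin

lemma norm_kpow_pos_le: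
  fixes G :: "'x \<Rightarrow> real \<Rightarrow> 'b::real_normed_vector"
  assumes "\<And>x y. 0 < y \<Longrightarrow> norm (G x y) \<le> c" and "0 < k"
  shows "norm ((Q ^^ k) G x y) \<le> c * surv k x y"
proof -
  have "norm ((Q ^^ k) G x y) \<le> (Q ^^ k) (\<lambda>x y. norm (G x y)) x y" by (rule norm_kpow)
  also have "\<dots> \<le> (Q ^^ k) (\<lambda>_ _. c) x y" by (rule kpow_mono_pos) (use assms in auto)
  finally show ?thesis by (simp add: kpow_const)
qed

lemma nu_le_1: "nu w \<le> 1"
  using member_le_sum[of w UNIV nu] nu_nonneg nu_sum by simp

text \<open>Reflection principle: \<open>a \<nu>(w) U t (y + z) - F\<^sub>t(y)\<close>, with \<open>F\<^sub>t\<close> the free density at \<open>z\<close>, almost vanishes at \<open>y = 0\<close> and solves the free evolution.\<close>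

lemma killed_cell_far:
  assumes a: "0 < a" and \<kappa>: "0 < \<kappa>" and \<eta>: "0 < \<eta>"
  shows "\<exists>N. \<forall>m\<ge>N. \<forall>x w y z. 0 < y \<longrightarrow> \<eta> * sqrt (real m) \<le> z \<longrightarrow>
    \<bar>(Q ^^ m) (cell w a z) x y - a * nu w * (phi (real m) (y - z) - phi (real m) (y + z))\<bar> \<le> \<kappa> / sqrt (real m)"
proof -
  obtain CU where CU: "0 < CU" "\<And>t x y. 0 < t \<Longrightarrow> cmod (T (U t) x y - U (t + 1) x y) \<le> CU / t\<^sup>2"
    using U_step by blast
  obtain CP where CP: "0 < CP" "\<And>t x y. 1 \<le> t \<Longrightarrow> cmod (U t x y - of_real (phi t y)) \<le> CP / t"
    using U_phi by blast
  obtain CT where CT: "0 < CT" "\<And>t v. 0 < t \<Longrightarrow> v \<noteq> 0 \<Longrightarrow> phi t v \<le> CT * sqrt t / v\<^sup>2"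
    using phi_tail by blast
  obtain CF where CF: "0 < CF" "\<And>t x w y z. 0 < t \<Longrightarrow> 4 \<le> \<bar>z - y\<bar> \<Longrightarrow> (T ^^ t) (cell w a z) x y \<le> CF * sqrt (real t) / (z - y)\<^sup>2"
    using far_cell_bound[OF a] by blast
  define S where "S = CF + a * CT"
  have S: "0 < S" using CF CT a by (simp add: S_def add_pos_pos)
  \<comment> \<open>\<open>\<theta>\<close> bounds sqrt (t0 / m) for the initial time
    \<open>t0\<close> chosen below. It is small enough that up to \<open>t0\<close> neither the walk
    nor the Gaussian crosses a distance \<open>\<eta> * sqrt m\<close> with density above
    \<open>\<kappa> / 4\<close> over sqrt m.\<close>
  define \<theta> where "\<theta> = min (1 / 2) (\<kappa> * \<eta>\<^sup>2 / (4 * S))"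
  have \<theta>: "0 < \<theta>" "\<theta> \<le> 1 / 2" "S * \<theta> / \<eta>\<^sup>2 \<le> \<kappa> / 4"
  proof -
    show "0 < \<theta>" "\<theta> \<le> 1 / 2" using \<kappa> \<eta> S by (auto simp: \<theta>_def)
    have "S * \<theta> \<le> S * (\<kappa> * \<eta>\<^sup>2 / (4 * S))" using S by (intro mult_left_mono) (auto simp: \<theta>_def)
    also have "\<dots> = \<kappa> / 4 * \<eta>\<^sup>2" using S by simp
    finally show "S * \<theta> / \<eta>\<^sup>2 \<le> \<kappa> / 4" using \<eta> by (simp add: pos_divide_le_eq)
  qed
  define \<delta> where "\<delta> = \<theta>\<^sup>2 / 2"
  have \<delta>: "0 < \<delta>" "\<delta> \<le> 1 / 4" "sqrt (2 * \<delta>) = \<theta>"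
  proof -
    show "0 < \<delta>" "sqrt (2 * \<delta>) = \<theta>" using \<theta> by (auto simp: \<delta>_def)
    have "\<theta>\<^sup>2 \<le> (1 / 2)\<^sup>2" using \<theta> by (intro power_mono) auto
    then show "\<delta> \<le> 1 / 4" by (simp add: \<delta>_def power_divide)
  qed
  define sd where "sd = sqrt \<delta>"
  have sd: "0 < sd" using \<delta> by (simp add: sd_def)
  \<comment> \<open>The local theorem is used from time \<open>t0 \<ge> \<delta> * m\<close> on,
    where its error is larger by the factor \<open>1 / sd\<close> than at time \<open>m\<close>; the
    summand 1 accounts for its use at time \<open>m\<close> itself.\<close>
  define \<kappa>1 where "\<kappa>1 = \<kappa> / (4 * (1 / sd + 1))"
  have \<kappa>1: "0 < \<kappa>1" "\<kappa>1 * (1 / sd + 1) = \<kappa> / 4"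
  proof -
    define e where "e = 1 / sd + 1"
    have e: "0 < e" using sd by (simp add: e_def add_pos_pos)
    have eq: "\<kappa>1 = \<kappa> / (4 * e)" by (simp only: \<kappa>1_def e_def)
    show "0 < \<kappa>1" using \<kappa> e by (simp add: eq)
    have "\<kappa>1 * e = \<kappa> / 4" using e by (simp add: eq)
    then show "\<kappa>1 * (1 / sd + 1) = \<kappa> / 4" by (simp only: e_def)
  qed
  obtain N1 where N1: "\<And>t x w y z. t \<ge> N1 \<Longrightarrow> \<bar>(T ^^ t) (cell w a z) x y - a * nu w * phi (real t) (y - z)\<bar> \<le> \<kappa>1 / sqrt (real t)"
    using llt[OF a \<kappa>1(1)] by blast
  define c where "c = a * CU / \<delta>\<^sup>2 + (2 * a * CP + 4 * a * B * Imom 1) / \<delta> + a * CP"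
  have "eventually (\<lambda>m. 2 * c / \<kappa> \<le> sqrt (real m)) sequentially"
    using filterlim_compose[OF sqrt_at_top filterlim_real_sequentially] by (simp add: filterlim_at_top)
  moreover have "eventually (\<lambda>m. 4 / \<eta> \<le> sqrt (real m)) sequentially"
    using filterlim_compose[OF sqrt_at_top filterlim_real_sequentially] by (simp add: filterlim_at_top)
  moreover have "eventually (\<lambda>m. (real N1 + 1) / \<delta> \<le> real m) sequentially"
    using filterlim_real_sequentially by (simp add: filterlim_at_top)
  ultimately have "eventually (\<lambda>m. 2 * c / \<kappa> \<le> sqrt (real m) \<and> 4 / \<eta> \<le> sqrt (real m) \<and> (real N1 + 1) / \<delta> \<le> real m) sequentially"
    by eventually_elim auto
  then obtain N where N: "\<And>m. m \<ge> N \<Longrightarrow> 2 * c / \<kappa> \<le> sqrt (real m) \<and> 4 / \<eta> \<le> sqrt (real m) \<and> (real N1 + 1) / \<delta> \<le> real m"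
    by (auto simp: eventually_sequentially)
  have "\<bar>(Q ^^ m) (cell w a z) x y - a * nu w * (phi (real m) (y - z) - phi (real m) (y + z))\<bar> \<le> \<kappa> / sqrt (real m)"
    if m: "m \<ge> N" and y: "0 < y" and z: "\<eta> * sqrt (real m) \<le> z" for m x w y z
  proof -
    define sm where "sm = sqrt (real m)"
    have big: "2 * c / \<kappa> \<le> sm" "4 / \<eta> \<le> sm" "real N1 + 1 \<le> \<delta> * real m"
      using N[OF m] \<delta> by (auto simp: sm_def pos_divide_le_eq mult.commute)
    have dm: "1 \<le> \<delta> * real m" using big(3) by simp
    have m0: "0 < real m" using dm \<delta> by (cases m) auto
    have sm: "0 < sm" "sm * sm = real m" using m0 by (auto simp: sm_def)
    have z4: "4 \<le> z" "\<eta> * sm \<le> z" using z big(2) \<eta> by (auto simp: sm_def field_simps)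
    have z0: "0 < z" using z4 by simp
    define t0 where "t0 = nat \<lceil>\<delta> * real m\<rceil>"
    have t0: "\<delta> * real m \<le> real t0" "real t0 \<le> \<delta> * real m + 1" unfolding t0_def using dm by linarith+
    have t0': "real t0 \<le> 2 * \<delta> * real m" "0 < t0" "1 \<le> real t0" "N1 \<le> t0" "real t0 \<le> real m"
    proof -
      show "real t0 \<le> 2 * \<delta> * real m" using t0 dm by linarith
      show "0 < t0" "1 \<le> real t0" "N1 \<le> t0" using t0 dm big(3) by linarith+
      have "\<delta> * real m \<le> 1 / 4 * real m" using \<delta> m0 by (intro mult_right_mono) auto
      then show "real t0 \<le> real m" using \<open>real t0 \<le> 2 * \<delta> * real m\<close> m0 by linarith
    qed
    define k where "k = m - t0"
    have mk: "m = t0 + k" using t0'(5) by (simp add: k_def)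
    define F where "F t = (T ^^ t) (cell w a z)" for t
    define h where "h = \<theta> / \<eta>\<^sup>2 / sm"
    have ratio: "sqrt (real t) / z\<^sup>2 \<le> h" if t: "t \<le> t0" for t
    proof -
      have "real t \<le> real t0" using t by simp
      then have "real t \<le> 2 * \<delta> * real m" using t0'(1) by linarith
      then have "sqrt (real t) \<le> sqrt (2 * \<delta> * real m)" by (rule real_sqrt_le_mono)
      also have "\<dots> = \<theta> * sm" using \<delta>(3) by (simp add: real_sqrt_mult sm_def)
      finally have 1: "sqrt (real t) \<le> \<theta> * sm" .
      have "(\<eta> * sm)\<^sup>2 \<le> z\<^sup>2" using z4 \<eta> sm by (intro power_mono) auto
      then have "sqrt (real t) / z\<^sup>2 \<le> (\<theta> * sm) / (\<eta> * sm)\<^sup>2" using 1 \<theta> sm \<eta> by (intro frac_le) auto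
      also have "\<dots> = h" using sm(1) \<eta> by (simp add: h_def power2_eq_square field_simps)
      finally show ?thesis .
    qed
    have h0: "0 \<le> h" using \<theta> sm by (simp add: h_def)
    \<comment> \<open>Initial stage, where the local theorem says nothing. The free density solves
      the free evolution exactly, so only its boundary values enter, and
      \<open>far_cell_bound\<close> makes them small because the cell lies far from the
      boundary.\<close>
    have step1: "\<bar>(Q ^^ t0) (cell w a z) x y - F t0 x y\<bar> \<le> CF * h" if y: "- B \<le> y" for x y
    proof -
      have "norm ((Q ^^ t0) (F 0) x y - F (0 + t0) x y) \<le> 0 * (\<Sum>j<t0. surv j x y) + (\<Sum>j<t0. (CF * h) * (surv j x y - surv (Suc j) x y))"
      proof (rule kpow_telescope_bound[where B = B])
        fix t x y
        show "norm (T (F t) x y - F (Suc t) x y) \<le> 0" by (simp add: F_def)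
      next
        fix t x y assume t: "t < 0 + t0" and y: "y \<le> (0::real)"
        show "norm (F t x y) \<le> CF * h"
        proof (cases "t = 0")
          case True
          have "cell w a z x y = 0" using y z0 by (simp add: cell_def indicator_def)
          then show ?thesis using True CF h0 by (simp add: F_def)
        next
          case False
          have far: "4 \<le> \<bar>z - y\<bar>" "z\<^sup>2 \<le> (z - y)\<^sup>2" using y z4 z0 by (auto intro!: power_mono)
          have "F t x y \<le> CF * sqrt (real t) / (z - y)\<^sup>2" unfolding F_def using False far by (intro CF(2)) auto
          also have "\<dots> \<le> CF * sqrt (real t) / z\<^sup>2" using far z0 CF by (intro divide_left_mono mult_pos_pos) auto
          also have "\<dots> = CF * (sqrt (real t) / z\<^sup>2)" by simp
          also have "\<dots> \<le> CF * h" using ratio[of t] t CF by (intro mult_left_mono) auto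
          finally show ?thesis unfolding F_def using tpow_nonneg[of "cell w a z" t x y] cell_bounds by simp
        qed
      qed (use y B_bounds in auto)
      also have "\<dots> = CF * h * (1 - surv t0 x y)"
        unfolding sum_distrib_left[symmetric] sum_surv_diff by simp
      also have "\<dots> \<le> CF * h * 1" using CF h0 surv_nonneg[of t0 x y] by (intro mult_left_mono) auto
      finally show ?thesis by (simp add: F_def)
    qed
    \<comment> \<open>Near \<open>y = 0\<close> the free density at \<open>z\<close> and its mirror
      image nearly agree because \<open>phi\<close> is even. \<open>H\<close> is thus an almost free
      solution that almost vanishes on the exit strip from time \<open>t0\<close> on.\<close>
    define H where "H t = (\<lambda>x y. of_real (a * nu w) * U (real t) x (y + z) - of_real (F t x y))" for t :: nat
    have anu: "0 \<le> a * nu w" "a * nu w \<le> a" using a nu_nonneg[of w] nu_le_1[of w] by auto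
    have Uphi: "cmod (of_real (a * nu w) * U (real t) x v - of_real (a * nu w * phi (real t) v)) \<le> a * CP / real t" if "1 \<le> t" for t x v
    proof -
      have "cmod (of_real (a * nu w) * U (real t) x v - of_real (a * nu w * phi (real t) v)) = (a * nu w) * cmod (U (real t) x v - of_real (phi (real t) v))"
      proof -
        have e: "of_real (a * nu w) * U (real t) x v - of_real (a * nu w * phi (real t) v) = of_real (a * nu w) * (U (real t) x v - of_real (phi (real t) v))"
          by (simp add: algebra_simps)
        show ?thesis unfolding e norm_mult norm_of_real abs_of_nonneg[OF anu(1)] ..
      qed
      also have "\<dots> \<le> a * (CP / real t)" using anu a CP(2)[of "real t" x v] that by (intro mult_mono) auto
      finally show ?thesis by simp
    qed
    define \<beta> where "\<beta> = (a * CP + 4 * a * B * Imom 1) / real t0 + \<kappa>1 / sqrt (real t0)"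
    have \<beta>0: "0 \<le> \<beta>" using a CP B_ge_1 Imom_nonneg[of 1] \<kappa>1 t0' by (auto simp: \<beta>_def intro!: add_nonneg_nonneg divide_nonneg_nonneg mult_nonneg_nonneg)
    have tele: "cmod ((Q ^^ k) (H t0) x y - H (t0 + k) x y) \<le> a * CU / (real t0)\<^sup>2 * real m + \<beta>"
    proof -
      have "norm ((Q ^^ k) (H t0) x y - H (t0 + k) x y) \<le> (a * CU / (real t0)\<^sup>2) * (\<Sum>j<k. surv j x y) + (\<Sum>j<k. \<beta> * (surv j x y - surv (Suc j) x y))"
      proof (rule kpow_telescope_bound[where B = B])
        fix t x y assume t: "t0 \<le> t"
        have tp: "0 < real t" using t t0' by simp
        have "cmod (T (\<lambda>x y. U (real t) x (y + z)) x y - U (real t + 1) x (y + z)) \<le> CU / (real t)\<^sup>2"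
          by (rule U_shift_step) (rule CU(2)[OF tp])
        also have "\<dots> \<le> CU / (real t0)\<^sup>2" using CU t t0' by (intro divide_left_mono power_mono mult_pos_pos) auto
        finally have 1: "cmod (T (\<lambda>x y. U (real t) x (y + z)) x y - U (real t + 1) x (y + z)) \<le> CU / (real t0)\<^sup>2" .
        have TF: "T (\<lambda>x y. complex_of_real (F t x y)) x y = of_real (F (Suc t) x y)"
          unfolding step_of_real by (simp add: F_def)
        have eq: "T (H t) x y - H (Suc t) x y = of_real (a * nu w) * (T (\<lambda>x y. U (real t) x (y + z)) x y - U (real t + 1) x (y + z))"
          unfolding H_def step_diff step_mult_left TF by (simp add: algebra_simps)
        have "norm (T (H t) x y - H (Suc t) x y) \<le> a * (CU / (real t0)\<^sup>2)"
          unfolding eq norm_mult norm_of_real using anu 1 a by (intro mult_mono) auto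
        then show "norm (T (H t) x y - H (Suc t) x y) \<le> a * CU / (real t0)\<^sup>2" by simp
      next
        fix t x y assume t: "t0 \<le> t" and yy: "- 2 * B \<le> y" "y \<le> 0"
        have tp: "0 < real t" "1 \<le> t" "N1 \<le> t" using t t0' by auto
        have 1: "cmod (of_real (a * nu w) * U (real t) x (y + z) - of_real (a * nu w * phi (real t) (y + z))) \<le> a * CP / real t0"
          by (rule order_trans[OF Uphi[OF tp(2)]]) (use a CP t t0' in \<open>auto intro!: divide_left_mono mult_pos_pos\<close>)
        have "\<bar>phi (real t) (y + z) - phi (real t) (z - y)\<bar> \<le> Imom 1 * \<bar>(y + z) - (z - y)\<bar> / real t" by (rule phi_lipschitz[OF tp(1)])
        also have "\<dots> \<le> Imom 1 * (4 * B) / real t0"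
          using yy Imom_nonneg[of 1] t t0' B_ge_1 by (intro frac_le mult_left_mono mult_nonneg_nonneg) auto
        finally have "(a * nu w) * \<bar>phi (real t) (y + z) - phi (real t) (z - y)\<bar> \<le> a * (Imom 1 * (4 * B) / real t0)"
          using anu a by (intro mult_mono) auto
        then have 2: "\<bar>a * nu w * phi (real t) (y + z) - a * nu w * phi (real t) (y - z)\<bar> \<le> 4 * a * B * Imom 1 / real t0"
        proof -
          assume le: "(a * nu w) * \<bar>phi (real t) (y + z) - phi (real t) (z - y)\<bar> \<le> a * (Imom 1 * (4 * B) / real t0)"
          have ev: "phi (real t) (z - y) = phi (real t) (y - z)" using phi_even[of "real t" "z - y"] by simp
          have e: "a * nu w * phi (real t) (y + z) - a * nu w * phi (real t) (y - z) = (a * nu w) * (phi (real t) (y + z) - phi (real t) (z - y))"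
            unfolding ev by (simp add: algebra_simps)
          show ?thesis using le unfolding e abs_mult[of "a * nu w"] abs_of_nonneg[OF anu(1)] by (simp add: mult_ac)
        qed
        have "\<bar>F t x y - a * nu w * phi (real t) (y - z)\<bar> \<le> \<kappa>1 / sqrt (real t)" unfolding F_def by (rule N1[OF tp(3)])
        also have "\<dots> \<le> \<kappa>1 / sqrt (real t0)" using \<kappa>1 t t0' by (intro divide_left_mono mult_pos_pos) auto
        finally have 3: "\<bar>a * nu w * phi (real t) (y + z) - F t x y\<bar> \<le> 4 * a * B * Imom 1 / real t0 + \<kappa>1 / sqrt (real t0)"
          using 2 by linarith
        have eq: "H t x y = (of_real (a * nu w) * U (real t) x (y + z) - of_real (a * nu w * phi (real t) (y + z))) + of_real (a * nu w * phi (real t) (y + z) - F t x y)"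
          unfolding H_def of_real_diff by simp
        have 4: "cmod (of_real (a * nu w * phi (real t) (y + z) - F t x y)) \<le> 4 * a * B * Imom 1 / real t0 + \<kappa>1 / sqrt (real t0)"
          unfolding norm_of_real by (rule 3)
        have "norm (H t x y) \<le> a * CP / real t0 + (4 * a * B * Imom 1 / real t0 + \<kappa>1 / sqrt (real t0))"
          unfolding eq by (rule norm_triangle_mono[OF 1 4])
        then show "norm (H t x y) \<le> \<beta>" by (simp add: \<beta>_def add_divide_distrib)
      qed (use y B_ge_1 B_bounds in auto)
      also have "(\<Sum>j<k. \<beta> * (surv j x y - surv (Suc j) x y)) = \<beta> * (1 - surv k x y)"
        unfolding sum_distrib_left[symmetric] sum_surv_diff ..
      also have "(a * CU / (real t0)\<^sup>2) * (\<Sum>j<k. surv j x y) + \<beta> * (1 - surv k x y) \<le> (a * CU / (real t0)\<^sup>2) * real m + \<beta> * 1"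
      proof (intro add_mono mult_left_mono)
        have "(\<Sum>j<k. surv j x y) \<le> (\<Sum>j<k. 1)" by (intro sum_mono surv_le_1)
        then show "(\<Sum>j<k. surv j x y) \<le> real m" using mk by simp
        show "1 - surv k x y \<le> 1" using surv_nonneg by simp
      qed (use a CU \<beta>0 in auto)
      finally show ?thesis by simp
    qed
    have Qm: "(Q ^^ m) (cell w a z) x y = (Q ^^ k) ((Q ^^ t0) (cell w a z)) x y"
      unfolding mk by (metis add.commute comp_apply funpow_add)
    have d1: "\<bar>(Q ^^ m) (cell w a z) x y - (Q ^^ k) (F t0) x y\<bar> \<le> CF * h"
    proof -
      have "norm ((Q ^^ k) (\<lambda>x y. (Q ^^ t0) (cell w a z) x y - F t0 x y) x y) \<le> (Q ^^ k) (\<lambda>_ _. CF * h) x y"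
        by (rule norm_kpow_le[of "- B"]) (use B_ge_1 y step1 in auto)
      also have "\<dots> = CF * h * surv k x y" by (rule kpow_const)
      also have "\<dots> \<le> CF * h * 1" using CF h0 by (intro mult_left_mono surv_le_1) auto
      finally show ?thesis unfolding Qm kpow_diff by simp
    qed
    \<comment> \<open>On \<open>y \<ge> 0\<close> the mirror Gaussian is evaluated at distance at
      least \<open>z\<close> from its centre, and at time \<open>t0\<close> its spread is still
      small compared with \<open>z\<close>.\<close>
    have d2: "cmod ((Q ^^ k) (\<lambda>x y. of_real (a * nu w) * U (real t0) x (y + z)) x y) \<le> a * CT * h + a * CP / real t0"
    proof -
      have "norm ((Q ^^ k) (\<lambda>x y. of_real (a * nu w) * U (real t0) x (y + z)) x y) \<le> (Q ^^ k) (\<lambda>_ _. a * CT * h + a * CP / real t0) x y"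
      proof (rule norm_kpow_le[of 0])
        fix x y assume y: "(0::real) \<le> y"
        have t0r: "0 < real t0" using t0' by simp
        have "phi (real t0) (y + z) \<le> CT * sqrt (real t0) / (y + z)\<^sup>2" using y z0 t0r by (intro CT(2)) auto
        also have "\<dots> \<le> CT * sqrt (real t0) / z\<^sup>2" using y z0 CT by (intro divide_left_mono power_mono mult_pos_pos) auto
        also have "\<dots> = CT * (sqrt (real t0) / z\<^sup>2)" by simp
        also have "\<dots> \<le> CT * h" using ratio[of t0] CT by (intro mult_left_mono) auto
        finally have "a * nu w * phi (real t0) (y + z) \<le> a * (CT * h)"
          using anu a phi_nonneg[OF t0r, of "y + z"] by (intro mult_mono) auto
        then have 1: "cmod (of_real (a * nu w * phi (real t0) (y + z))) \<le> a * CT * h"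
          unfolding norm_of_real using anu(1) phi_nonneg[OF t0r, of "y + z"] by simp
        have "1 \<le> t0" using t0' by simp
        from norm_triangle_mono[OF 1 Uphi[OF this, of x "y + z"]]
        show "norm (of_real (a * nu w) * U (real t0) x (y + z)) \<le> a * CT * h + a * CP / real t0" by simp
      qed (use y in auto)
      also have "\<dots> = (a * CT * h + a * CP / real t0) * surv k x y" by (rule kpow_const)
      also have "\<dots> \<le> (a * CT * h + a * CP / real t0) * 1"
        using a CT CP h0 t0' by (intro mult_left_mono surv_le_1) (auto intro!: add_nonneg_nonneg)
      finally show ?thesis by simp
    qed
    have QH: "(Q ^^ k) (H t0) x y = (Q ^^ k) (\<lambda>x y. of_real (a * nu w) * U (real t0) x (y + z)) x y - of_real ((Q ^^ k) (F t0) x y)"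
      unfolding H_def kpow_diff kpow_of_real ..
    have N1m: "\<bar>F m x y - a * nu w * phi (real m) (y - z)\<bar> \<le> \<kappa>1 / sm"
      unfolding F_def sm_def by (rule N1) (use t0' in linarith)
    have m1: "1 \<le> m" using m0 by (cases m) auto
    define R where "R = a * nu w * (phi (real m) (y - z) - phi (real m) (y + z))"
    \<comment> \<open>After \<open>t0\<close> the killed density is the mirror term minus
      \<open>H\<close>. The killed mirror term is negligible by \<open>d2\<close>, and
      \<open>H\<close> survives unchanged up to time \<open>m\<close>, where it is the mirror image
      minus the free density.\<close>
    have eq: "complex_of_real ((Q ^^ m) (cell w a z) x y - R)
      = of_real ((Q ^^ m) (cell w a z) x y - (Q ^^ k) (F t0) x y) + (Q ^^ k) (\<lambda>x y. of_real (a * nu w) * U (real t0) x (y + z)) x y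
        - ((Q ^^ k) (H t0) x y - H (t0 + k) x y) - (of_real (a * nu w) * U (real m) x (y + z) - of_real (a * nu w * phi (real m) (y + z)))
        + of_real (F m x y - a * nu w * phi (real m) (y - z))"
      unfolding QH mk[symmetric] H_def[of m] R_def by (simp add: algebra_simps)
    have "\<bar>(Q ^^ m) (cell w a z) x y - R\<bar> = cmod (complex_of_real ((Q ^^ m) (cell w a z) x y - R))" by (simp only: norm_of_real)
    also have "\<dots> \<le> CF * h + (a * CT * h + a * CP / real t0) + (a * CU / (real t0)\<^sup>2 * real m + \<beta>) + a * CP / real m + \<kappa>1 / sm"
      unfolding eq
    proof (intro norm_triangle_mono)
      have n1: "cmod (of_real ((Q ^^ m) (cell w a z) x y - (Q ^^ k) (F t0) x y)) \<le> CF * h" unfolding norm_of_real by (rule d1)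
      show "cmod (of_real ((Q ^^ m) (cell w a z) x y - (Q ^^ k) (F t0) x y) + (Q ^^ k) (\<lambda>x y. of_real (a * nu w) * U (real t0) x (y + z)) x y
        - ((Q ^^ k) (H t0) x y - H (t0 + k) x y) - (of_real (a * nu w) * U (real m) x (y + z) - of_real (a * nu w * phi (real m) (y + z))))
        \<le> CF * h + (a * CT * h + a * CP / real t0) + (a * CU / (real t0)\<^sup>2 * real m + \<beta>) + a * CP / real m"
        by (intro norm_triangle_le_diff add_mono order_trans[OF norm_triangle_ineq4] order_trans[OF norm_triangle_ineq] n1 d2 tele Uphi m1)
      show "cmod (of_real (F m x y - a * nu w * phi (real m) (y - z))) \<le> \<kappa>1 / sm" unfolding norm_of_real by (rule N1m)
    qed
    also have "\<dots> \<le> (\<kappa> / 4 + \<kappa> / 4 + \<kappa> / 2) / sm"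
    proof -
      have e1: "CF * h + a * CT * h \<le> \<kappa> / 4 / sm"
      proof -
        have "CF * h + a * CT * h = S * \<theta> / \<eta>\<^sup>2 / sm" by (simp add: S_def h_def algebra_simps add_divide_distrib)
        also have "\<dots> \<le> \<kappa> / 4 / sm" by (rule divide_right_mono[OF \<theta>(3)]) (use sm in auto)
        finally show ?thesis .
      qed
      have t0inv: "1 / real t0 \<le> 1 / (\<delta> * real m)" using t0 dm t0' \<delta> m0 by (intro divide_left_mono mult_pos_pos) auto
      have "sqrt (\<delta> * real m) \<le> sqrt (real t0)" using t0 by simp
      then have sd_t0: "sd * sm \<le> sqrt (real t0)" by (simp add: real_sqrt_mult sd_def sm_def)
      have e2: "\<kappa>1 / sqrt (real t0) + \<kappa>1 / sm \<le> \<kappa> / 4 / sm"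
      proof -
        have "\<kappa>1 / sqrt (real t0) \<le> \<kappa>1 / (sd * sm)" using sd_t0 \<kappa>1 sd sm t0' by (intro divide_left_mono mult_pos_pos) auto
        moreover have "\<kappa>1 / (sd * sm) + \<kappa>1 / sm = \<kappa>1 * (1 / sd + 1) / sm" using sd sm by (simp add: field_simps)
        ultimately show ?thesis unfolding \<kappa>1(2) by linarith
      qed
      have e3: "a * CU / (real t0)\<^sup>2 * real m + (2 * a * CP + 4 * a * B * Imom 1) / real t0 + a * CP / real m \<le> \<kappa> / 2 / sm"
      proof -
        have "a * CU / (real t0)\<^sup>2 * real m \<le> a * CU / \<delta>\<^sup>2 / real m"
        proof -
          have "a * CU / (real t0)\<^sup>2 \<le> a * CU / (\<delta> * real m)\<^sup>2"
            using t0 dm t0' \<delta> m0 a CU by (intro divide_left_mono power_mono mult_pos_pos) auto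
          then have "a * CU / (real t0)\<^sup>2 * real m \<le> a * CU / (\<delta> * real m)\<^sup>2 * real m" using m0 by (intro mult_right_mono) auto
          also have "\<dots> = a * CU / \<delta>\<^sup>2 / real m" using m0 by (simp add: power2_eq_square)
          finally show ?thesis .
        qed
        moreover have "(2 * a * CP + 4 * a * B * Imom 1) * (1 / real t0) \<le> (2 * a * CP + 4 * a * B * Imom 1) * (1 / (\<delta> * real m))"
          using t0inv a CP B_ge_1 Imom_nonneg[of 1] by (intro mult_left_mono) auto
        then have "(2 * a * CP + 4 * a * B * Imom 1) / real t0 \<le> (2 * a * CP + 4 * a * B * Imom 1) / \<delta> / real m" by simp
        ultimately have "a * CU / (real t0)\<^sup>2 * real m + (2 * a * CP + 4 * a * B * Imom 1) / real t0 + a * CP / real m \<le> c / real m"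
          unfolding c_def add_divide_distrib by linarith
        also have "c / real m = c / sm / sm" using sm(2) by simp
        also have "\<dots> \<le> \<kappa> / 2 / sm"
        proof (rule divide_right_mono)
          show "c / sm \<le> \<kappa> / 2" using big(1) sm \<kappa> by (simp add: field_simps)
        qed (use sm in auto)
        finally show ?thesis .
      qed
      have b: "\<beta> = a * CP / real t0 + 4 * a * B * Imom 1 / real t0 + \<kappa>1 / sqrt (real t0)"
        unfolding \<beta>_def add_divide_distrib ..
      have e3': "a * CU / (real t0)\<^sup>2 * real m + 2 * (a * CP / real t0) + 4 * a * B * Imom 1 / real t0 + a * CP / real m \<le> \<kappa> / 2 / sm"
        using e3 by (simp add: add_divide_distrib)
      have sum: "(\<kappa> / 4 + \<kappa> / 4 + \<kappa> / 2) / sm = \<kappa> / 4 / sm + \<kappa> / 4 / sm + \<kappa> / 2 / sm"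
        unfolding add_divide_distrib ..
      have "A1 + (A2 + A3) + (A4 + (A3 + A5 + A6)) + A7 + A8 \<le> k1 + k2 + k3"
        if "A1 + A2 \<le> k1" "A6 + A8 \<le> k2" "A4 + 2 * A3 + A5 + A7 \<le> k3" for A1 A2 A3 A4 A5 A6 A7 A8 k1 k2 k3 :: real
        using that by linarith
      from this[OF e1 e2 e3'] show ?thesis unfolding sum b .
    qed
    also have "\<dots> = \<kappa> / sm" by simp
    finally show ?thesis unfolding R_def sm_def .
  qed
  then show ?thesis by blast
qed

text \<open>The constants account for the rounding of \<open>n div 2\<close>; the worst case is
  \<open>n = 3\<close>.\<close>

lemma halves_ge:
  assumes "2 \<le> n"
  shows "0 < n div 2" "n - n div 2 + n div 2 = n" "real n \<le> 4 * real (n div 2)" "real n \<le> 2 * real (n - n div 2)"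
    "sqrt (real n) \<le> 2 * sqrt (real (n div 2))" "real n \<le> 3 * (sqrt (real (n - n div 2)) * sqrt (real (n div 2)))"
proof -
  show "0 < n div 2" "n - n div 2 + n div 2 = n" using assms by linarith+
  have k: "n \<le> 3 * (n div 2)" "n \<le> 2 * (n - n div 2)" using assms by linarith+
  then show 1: "real n \<le> 4 * real (n div 2)" and "real n \<le> 2 * real (n - n div 2)" by linarith+
  have "sqrt (real n) \<le> sqrt (4 * real (n div 2))" using 1 by (rule real_sqrt_le_mono)
  then show "sqrt (real n) \<le> 2 * sqrt (real (n div 2))" by (simp add: real_sqrt_mult)
  have "real n * real n \<le> (3 * real (n - n div 2)) * (3 * real (n div 2))"
    by (intro mult_mono) (use k in linarith)+
  then have "sqrt (real n * real n) \<le> sqrt (9 * (real (n - n div 2) * real (n div 2)))"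
    by (intro real_sqrt_le_mono) (simp add: mult_ac del: of_nat_diff)
  moreover have "sqrt (9 * v) = 3 * sqrt v" for v :: real
    using real_sqrt_mult[of "3 * 3" v] by (simp only: real_sqrt_abs2) simp
  ultimately show "real n \<le> 3 * (sqrt (real (n - n div 2)) * sqrt (real (n div 2)))" by (simp add: real_sqrt_mult)
qed

lemma kpow_halves: "2 \<le> n \<Longrightarrow> (Q ^^ n) G = (Q ^^ (n div 2)) ((Q ^^ (n - n div 2)) G)"
proof -
  assume "2 \<le> n"
  then have "n = n div 2 + (n - n div 2)" by linarith
  then have "(Q ^^ n) G = (Q ^^ (n div 2 + (n - n div 2))) G" by (rule arg_cong)
  then show ?thesis unfolding funpow_add comp_apply .
qed

text \<open>Survive the first half, then apply the free local bound to the second. This holds for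
  all \<open>z\<close> and all \<open>n \<ge> 2\<close> and serves where the limit theorem gives
  nothing.\<close>

lemma killed_cell_apriori:
  assumes a: "0 < a"
  shows "\<exists>C>0. \<forall>n x w y z. 2 \<le> n \<longrightarrow> (Q ^^ n) (cell w a z) x y \<le> C * (1 + max y 0) / real n"
proof -
  obtain Cs where Cs: "0 < Cs" "\<And>n x y. 0 < n \<Longrightarrow> surv n x y \<le> Cs * (1 + max y 0) / sqrt (real n)"
    using surv_bound by blast
  obtain Cl where Cl: "0 < Cl" "\<And>t x w y z. 0 < t \<Longrightarrow> (T ^^ t) (cell w a z) x y \<le> Cl / sqrt (real t)"
    using local_bound[OF a] by blast
  have "(Q ^^ n) (cell w a z) x y \<le> 3 * Cl * Cs * (1 + max y 0) / real n" if n: "2 \<le> n" for n x w y z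
  proof -
    define k where "k = n div 2"
    define m where "m = n - n div 2"
    note h = halves_ge[OF n, folded k_def m_def]
    have m0: "0 < m" using h(4) n by (cases m) auto
    have Y: "0 < 1 + max y 0" by linarith
    have "(Q ^^ n) (cell w a z) x y = (Q ^^ k) ((Q ^^ m) (cell w a z)) x y" unfolding k_def m_def kpow_halves[OF n] ..
    also have "\<dots> \<le> (Q ^^ k) (\<lambda>_ _. Cl / sqrt (real m)) x y"
    proof (rule kpow_mono)
      fix x y
      show "(Q ^^ m) (cell w a z) x y \<le> Cl / sqrt (real m)"
        by (rule order_trans[OF kpow_le_tpow Cl(2)[OF m0]]) (rule cell_bounds)
    qed
    also have "\<dots> = Cl / sqrt (real m) * surv k x y" by (rule kpow_const)
    also have "\<dots> \<le> Cl / sqrt (real m) * (Cs * (1 + max y 0) / sqrt (real k))"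
      using Cl Cs(2)[OF h(1)] by (intro mult_left_mono) auto
    also have "\<dots> = 3 * Cl * Cs * (1 + max y 0) / (3 * (sqrt (real m) * sqrt (real k)))" by simp
    also have "\<dots> \<le> 3 * Cl * Cs * (1 + max y 0) / real n"
      using h(6) n Cl Cs Y m0 h(1) by (intro divide_left_mono mult_nonneg_nonneg mult_pos_pos) auto
    finally show ?thesis .
  qed
  then show ?thesis using Cl(1) Cs(1) by (intro exI[of _ "3 * Cl * Cs"]) auto
qed

lemma D_le_near:
  assumes "0 < n" "0 \<le> z"
  shows "\<bar>D n z\<bar> \<le> 2 * Imom 0 / s2 * (z / sqrt n) / n"
proof -
  have "\<bar>D n z\<bar> = 2 * z / (s2 * n) * phi n z"
    unfolding D_def using assms s2_pos phi_nonneg[of n z] by (subst abs_of_nonneg) auto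
  also have "\<dots> \<le> 2 * z / (s2 * n) * (Imom 0 / sqrt n)"
    using assms s2_pos phi_le[of n z] by (intro mult_left_mono) auto
  finally show ?thesis by (simp add: mult_ac)
qed

text \<open>The order of the quantifiers matters: \<open>C\<close> is chosen before
  \<open>\<kappa>\<close>, and \<open>N\<close> does not depend on \<open>x\<close>,
  \<open>w\<close>, \<open>y\<close>, \<open>z\<close>. Only then can \<open>\<kappa>\<close> be
  tied to \<open>\<epsilon>\<close> with a constant independent of it.\<close>

theorem conditioned_llt:
  assumes a: "0 < a"
  shows "\<exists>C>0. \<forall>\<kappa>>0. \<exists>N. \<forall>n\<ge>N. \<forall>x w y z. - B \<le> y \<longrightarrow> 0 \<le> z \<longrightarrow>
    \<bar>(Q ^^ n) (cell w a z) x y - a * nu w * (D (real n) z * V x y)\<bar>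
      \<le> (\<kappa> * (1 + max y 0) + C * (1 + max y 0)\<^sup>2 / sqrt (real n)) / real n"
proof -
  obtain Cs where Cs: "0 < Cs" "\<And>n x y. 0 < n \<Longrightarrow> surv n x y \<le> Cs * (1 + max y 0) / sqrt (real n)"
    using surv_bound by blast
  obtain Ck where Ck: "0 < Ck" "\<And>m x w y z. 6 \<le> m \<Longrightarrow> 0 \<le> z \<Longrightarrow> (Q ^^ m) (cell w a z) x y \<le> Ck * (1 + z) / real m"
    using killed_cell_bound[OF a] by blast
  obtain CP where CP: "0 < CP" "\<And>t x y. 1 \<le> t \<Longrightarrow> cmod (U t x y - of_real (phi t y)) \<le> CP / t"
    using U_phi by blast
  obtain CW where CW: "0 < CW" "\<And>n z x y. 2 \<le> n \<Longrightarrow> - B \<le> y \<Longrightarrow> cmod ((Q ^^ (n div 2)) (W z (real (n - n div 2))) x y - of_real (D (real n) z * V x y))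
      \<le> CW * (1 + max y 0)\<^sup>2 / (real n * sqrt (real n))"
    using kpow_W_asymp by blast
  define C where "C = 4 * Ck * Cs + 8 * a * CP * Cs + a * CW"
  have C: "0 < C" "4 * Ck * Cs \<le> C" "8 * a * CP * Cs + a * CW \<le> C" using Ck CW Cs CP a by (auto simp: C_def add_pos_pos)
  define c1 where "c1 = 4 * Ck * Cs + 10 * a * B * Imom 0 / s2"
  have c1: "0 < c1" unfolding c1_def using Ck Cs a B_ge_1 Imom_nonneg[of 0] s2_pos by (intro add_pos_nonneg) auto
  have main: "\<exists>N. \<forall>n\<ge>N. \<forall>x w y z. - B \<le> y \<longrightarrow> 0 \<le> z \<longrightarrow>
    \<bar>(Q ^^ n) (cell w a z) x y - a * nu w * (D (real n) z * V x y)\<bar>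
      \<le> (\<kappa> * (1 + max y 0) + C * (1 + max y 0)\<^sup>2 / sqrt (real n)) / real n" if \<kappa>: "0 < \<kappa>" for \<kappa>
  proof -
    \<comment> \<open>Below \<open>\<eta> * sqrt n\<close> the killed density and the main term are
      each linear in \<open>z / sqrt n\<close>; \<open>c1\<close> adds their coefficients.\<close>
    define \<eta> where "\<eta> = \<kappa> / c1"
    have \<eta>: "0 < \<eta>" "c1 * \<eta> = \<kappa>" using \<kappa> c1 by (auto simp: \<eta>_def)
    \<comment> \<open>The error of the second half is multiplied by survival in the first;
      \<open>Cs\<close> comes from the survival bound and 3 from \<open>halves_ge\<close>.\<close>
    define \<kappa>' where "\<kappa>' = \<kappa> / (3 * Cs)"
    have \<kappa>': "0 < \<kappa>'" "3 * \<kappa>' * Cs = \<kappa>" using \<kappa> Cs by (auto simp: \<kappa>'_def)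
    obtain N' where N': "\<And>m x w y z. m \<ge> N' \<Longrightarrow> 0 < y \<Longrightarrow> \<eta> * sqrt (real m) \<le> z \<Longrightarrow>
        \<bar>(Q ^^ m) (cell w a z) x y - a * nu w * (phi (real m) (y - z) - phi (real m) (y + z))\<bar> \<le> \<kappa>' / sqrt (real m)"
      using killed_cell_far[OF a \<kappa>'(1) \<eta>(1)] by blast
    have "\<bar>(Q ^^ n) (cell w a z) x y - a * nu w * (D (real n) z * V x y)\<bar>
      \<le> (\<kappa> * (1 + max y 0) + C * (1 + max y 0)\<^sup>2 / sqrt (real n)) / real n"
      if n: "n \<ge> 12 + 2 * N'" and y: "- B \<le> y" and z: "0 \<le> z" for n x w y z
    proof -
      define Y where "Y = 1 + max y 0"
      have Y: "1 \<le> Y" "Y \<le> Y\<^sup>2"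
      proof -
        show Y1: "1 \<le> Y" by (simp add: Y_def)
        show "Y \<le> Y\<^sup>2" using mult_right_mono[OF Y1, of Y] Y1 by (simp add: power2_eq_square)
      qed
      have n2: "2 \<le> n" using n by simp
      define k where "k = n div 2"
      define m where "m = n - n div 2"
      define sn where "sn = sqrt (real n)"
      have sn: "0 < sn" using n2 by (simp add: sn_def)
      have rn: "0 < real n" using n2 by simp
      note h = halves_ge[OF n2, folded k_def m_def sn_def]
      have m6: "6 \<le> m" "N' \<le> m" "m \<le> n" using n by (auto simp: m_def)
      have rm: "0 < real m" "0 < real k" using m6 h(1) by auto
      have anu: "0 \<le> a * nu w" "a * nu w \<le> a" using a nu_nonneg[of w] nu_le_1[of w] by auto
      have sk: "surv k x y \<le> Cs * Y / sqrt (real k)" unfolding Y_def by (rule Cs(2)[OF h(1)])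
      have sk': "surv k x y / real m \<le> 4 * Cs * Y / sn / real n"
      proof -
        have "surv k x y / real m \<le> (Cs * Y / sqrt (real k)) / real m" using sk rm by (intro divide_right_mono) auto
        also have "\<dots> = 4 * Cs * Y / ((2 * sqrt (real k)) * (2 * real m))" by simp
        also have "\<dots> \<le> 4 * Cs * Y / (sn * real n)"
          using h(4,5) sn rn Cs Y rm by (intro divide_left_mono mult_mono mult_pos_pos mult_nonneg_nonneg) auto
        finally show ?thesis by simp
      qed
      have split: "(Q ^^ n) (cell w a z) x y = (Q ^^ k) ((Q ^^ m) (cell w a z)) x y" unfolding k_def m_def kpow_halves[OF n2] ..
      have "\<bar>(Q ^^ n) (cell w a z) x y - a * nu w * (D (real n) z * V x y)\<bar> \<le> (\<kappa> * Y + C * Y\<^sup>2 / sn) / real n"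
      proof (cases "z < \<eta> * sn")
        case True
        have "(Q ^^ n) (cell w a z) x y \<le> (Q ^^ k) (\<lambda>_ _. Ck * (1 + z) / real m) x y"
          unfolding split by (rule kpow_mono) (rule Ck(2)[OF m6(1) z])
        also have "\<dots> = Ck * (1 + z) * (surv k x y / real m)" by (simp add: kpow_const)
        also have "\<dots> \<le> Ck * (1 + z) * (4 * Cs * Y / sn / real n)" using sk' Ck z by (intro mult_left_mono) auto
        also have "\<dots> = 4 * Ck * Cs * Y / sn / real n + 4 * Ck * Cs * Y * (z / sn) / real n" by (simp add: algebra_simps add_divide_distrib)
        also have "\<dots> \<le> C * Y\<^sup>2 / sn / real n + 4 * Ck * Cs * Y * (z / sn) / real n"
          using C Y sn rn Ck Cs by (intro add_right_mono divide_right_mono mult_mono) auto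
        finally have 1: "(Q ^^ n) (cell w a z) x y \<le> C * Y\<^sup>2 / sn / real n + 4 * Ck * Cs * Y * (z / sn) / real n" .
        have 0: "0 \<le> (Q ^^ n) (cell w a z) x y" by (rule kpow_nonneg) (rule cell_bounds)
        have "\<bar>a * nu w * (D (real n) z * V x y)\<bar> = (a * nu w) * (\<bar>D (real n) z\<bar> * \<bar>V x y\<bar>)"
          unfolding abs_mult[of "a * nu w"] abs_of_nonneg[OF anu(1)] abs_mult[of "D (real n) z"] ..
        also have "\<dots> \<le> a * ((2 * Imom 0 / s2 * (z / sn) / real n) * (5 * B * Y))"
          using anu a D_le_near[OF rn z] V_bound[OF y, of x] unfolding sn_def Y_def by (intro mult_mono mult_nonneg_nonneg) auto
        also have "\<dots> = 10 * a * B * Imom 0 / s2 * Y * (z / sn) / real n" by (simp add: mult_ac)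
        finally have 2: "\<bar>a * nu w * (D (real n) z * V x y)\<bar> \<le> 10 * a * B * Imom 0 / s2 * Y * (z / sn) / real n" .
        have "c1 * Y * (z / sn) / real n = 4 * Ck * Cs * Y * (z / sn) / real n + 10 * a * B * Imom 0 / s2 * Y * (z / sn) / real n"
          unfolding c1_def distrib_right add_divide_distrib ..
        with 0 1 2 have "\<bar>(Q ^^ n) (cell w a z) x y - a * nu w * (D (real n) z * V x y)\<bar> \<le> C * Y\<^sup>2 / sn / real n + c1 * Y * (z / sn) / real n"
          by linarith
        also have "c1 * Y * (z / sn) / real n \<le> c1 * Y * \<eta> / real n"
          using True sn c1 Y rn by (intro divide_right_mono mult_left_mono) (auto simp: pos_divide_le_eq)
        also have "c1 * Y * \<eta> = \<kappa> * Y" using \<eta>(2) by (simp add: mult_ac)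
        finally show ?thesis by (simp add: add_divide_distrib)
      next
        case False
        have zm: "\<eta> * sqrt (real m) \<le> z"
        proof -
          have "\<eta> * sqrt (real m) \<le> \<eta> * sn" using m6(3) \<eta> by (intro mult_left_mono) (auto simp: sn_def)
          then show ?thesis using False by linarith
        qed
        \<comment> \<open>The part of the second half that is not described by the odd Gaussian. It
          is bounded uniformly on positive heights, so surviving the first half contributes the
          missing factor 1 / sqrt n.\<close>
        define G where "G = (\<lambda>x y. complex_of_real ((Q ^^ m) (cell w a z) x y) - (a * nu w) *\<^sub>R W z (real m) x y)"
        have Gb: "cmod (G x y) \<le> \<kappa>' / sqrt (real m) + 2 * a * CP / real m" if y: "0 < y" for x y
        proof -
          define p where "p = a * nu w * (phi (real m) (y - z) - phi (real m) (y + z))"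
          have m1: "1 \<le> real m" using m6 by simp
          have eq: "G x y = of_real ((Q ^^ m) (cell w a z) x y - p) - (a * nu w) *\<^sub>R ((U (real m) x (y - z) - of_real (phi (real m) (y - z))) - (U (real m) x (y + z) - of_real (phi (real m) (y + z))))"
            unfolding G_def p_def W_def scaleR_conv_of_real by (simp add: algebra_simps)
          have n1: "cmod (of_real ((Q ^^ m) (cell w a z) x y - p)) \<le> \<kappa>' / sqrt (real m)"
            unfolding norm_of_real p_def by (rule N'[OF m6(2) y zm])
          have "cmod ((U (real m) x (y - z) - of_real (phi (real m) (y - z))) - (U (real m) x (y + z) - of_real (phi (real m) (y + z)))) \<le> CP / real m + CP / real m"
            by (rule order_trans[OF norm_triangle_ineq4 add_mono[OF CP(2)[OF m1] CP(2)[OF m1]]])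
          then have n2: "cmod ((a * nu w) *\<^sub>R ((U (real m) x (y - z) - of_real (phi (real m) (y - z))) - (U (real m) x (y + z) - of_real (phi (real m) (y + z))))) \<le> a * (CP / real m + CP / real m)"
            unfolding norm_scaleR abs_of_nonneg[OF anu(1)] using anu a by (intro mult_mono) auto
          have "cmod (G x y) \<le> \<kappa>' / sqrt (real m) + a * (CP / real m + CP / real m)"
            unfolding eq by (rule order_trans[OF norm_triangle_ineq4 add_mono[OF n1 n2]])
          also have "a * (CP / real m + CP / real m) = 2 * a * CP / real m" by (simp add: field_simps)
          finally show ?thesis .
        qed
        have QG: "(Q ^^ k) G x y = of_real ((Q ^^ n) (cell w a z) x y) - (a * nu w) *\<^sub>R (Q ^^ k) (W z (real m)) x y"
          unfolding G_def kpow_diff kpow_of_real kpow_scaleR split ..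
        have "cmod ((Q ^^ k) G x y) \<le> (\<kappa>' / sqrt (real m) + 2 * a * CP / real m) * surv k x y"
          by (rule norm_kpow_pos_le[OF Gb h(1)])
        also have "\<dots> = \<kappa>' / sqrt (real m) * surv k x y + 2 * a * CP * (surv k x y / real m)"
          by (simp add: algebra_simps)
        also have "\<dots> \<le> \<kappa> * Y / real n + 8 * a * CP * Cs * Y\<^sup>2 / sn / real n"
        proof (rule add_mono)
          have "\<kappa>' / sqrt (real m) * surv k x y \<le> \<kappa>' / sqrt (real m) * (Cs * Y / sqrt (real k))" using sk \<kappa>' by (intro mult_left_mono) auto
          also have "\<dots> = \<kappa> * Y / (3 * (sqrt (real m) * sqrt (real k)))" unfolding \<kappa>'(2)[symmetric] by simp
          also have "\<dots> \<le> \<kappa> * Y / real n" using h(6) rn rm \<kappa> Y by (intro divide_left_mono mult_pos_pos) auto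
          finally show "\<kappa>' / sqrt (real m) * surv k x y \<le> \<kappa> * Y / real n" .
          have "2 * a * CP * (surv k x y / real m) \<le> 2 * a * CP * (4 * Cs * Y / sn / real n)" using sk' a CP by (intro mult_left_mono) auto
          also have "\<dots> = 8 * a * CP * Cs * Y / sn / real n" by simp
          also have "\<dots> \<le> 8 * a * CP * Cs * Y\<^sup>2 / sn / real n" using Y sn rn a CP Cs by (intro divide_right_mono mult_left_mono) auto
          finally show "2 * a * CP * (surv k x y / real m) \<le> 8 * a * CP * Cs * Y\<^sup>2 / sn / real n" .
        qed
        finally have 1: "cmod ((Q ^^ k) G x y) \<le> \<kappa> * Y / real n + 8 * a * CP * Cs * Y\<^sup>2 / sn / real n" .
        have "cmod ((Q ^^ k) (W z (real m)) x y - of_real (D (real n) z * V x y)) \<le> CW * Y\<^sup>2 / (real n * sn)"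
          unfolding k_def m_def Y_def sn_def by (rule CW(2)[OF n2 y])
        then have 2: "cmod ((a * nu w) *\<^sub>R ((Q ^^ k) (W z (real m)) x y - of_real (D (real n) z * V x y))) \<le> a * (CW * Y\<^sup>2 / (real n * sn))"
          unfolding norm_scaleR abs_of_nonneg[OF anu(1)] using anu a by (intro mult_mono) auto
        have eq: "complex_of_real ((Q ^^ n) (cell w a z) x y - a * nu w * (D (real n) z * V x y))
            = (Q ^^ k) G x y + (a * nu w) *\<^sub>R ((Q ^^ k) (W z (real m)) x y - of_real (D (real n) z * V x y))"
          unfolding QG scaleR_conv_of_real by (simp add: algebra_simps)
        have "\<bar>(Q ^^ n) (cell w a z) x y - a * nu w * (D (real n) z * V x y)\<bar>
            = cmod (complex_of_real ((Q ^^ n) (cell w a z) x y - a * nu w * (D (real n) z * V x y)))" by (simp only: norm_of_real)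
        also have "\<dots> \<le> (\<kappa> * Y / real n + 8 * a * CP * Cs * Y\<^sup>2 / sn / real n) + a * (CW * Y\<^sup>2 / (real n * sn))"
          unfolding eq by (rule norm_triangle_mono[OF 1 2])
        also have "\<dots> = \<kappa> * Y / real n + (8 * a * CP * Cs + a * CW) * Y\<^sup>2 / sn / real n"
          by (simp add: algebra_simps add_divide_distrib)
        also have "\<dots> \<le> \<kappa> * Y / real n + C * Y\<^sup>2 / sn / real n"
          using C sn rn by (intro add_left_mono divide_right_mono mult_right_mono) auto
        finally show ?thesis by (simp add: add_divide_distrib)
      qed
      then show ?thesis by (simp only: Y_def sn_def)
    qed
    then show ?thesis by blast
  qed
  show ?thesis
    by (rule exI[of _ C], rule conjI[OF C(1)], intro allI impI, rule main)
qed

section \<open>Survival asymptotics and the identification of \<open>Vfun\<close> with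
  \<open>V\<close>\<close>

lemma kpow_has_integral:
  fixes G :: "real \<Rightarrow> 'x \<Rightarrow> real \<Rightarrow> real"
  assumes "\<And>x y. ((\<lambda>z. G z x y) has_integral I x y) S"
  shows "((\<lambda>z. (Q ^^ n) (G z) x y) has_integral (Q ^^ n) I x y) S"
proof (induction n arbitrary: x y)
  case 0
  then show ?case using assms by simp
next
  case (Suc n)
  have "((\<lambda>z. P x x' *\<^sub>R (if 0 < y + f x' then (Q ^^ n) (G z) x' (y + f x') else 0))
      has_integral P x x' *\<^sub>R (if 0 < y + f x' then (Q ^^ n) I x' (y + f x') else 0)) S" for x'
    by (rule has_integral_cmul) (use Suc in auto)
  then have "((\<lambda>z. \<Sum>x'\<in>UNIV. P x x' *\<^sub>R (if 0 < y + f x' then (Q ^^ n) (G z) x' (y + f x') else 0))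
      has_integral (\<Sum>x'\<in>UNIV. P x x' *\<^sub>R (if 0 < y + f x' then (Q ^^ n) I x' (y + f x') else 0))) S"
    by (intro has_integral_sum) auto
  then show ?case by (simp only: funpow.simps comp_apply kstep_def[of P f "(Q ^^ n) _"] step_def)
qed

text \<open>The Lebesgue measure of those \<open>z\<close> between 0 and \<open>L\<close> whose unit
  interval starting at \<open>z\<close> contains \<open>v\<close>.\<close>

definition window :: "real \<Rightarrow> real \<Rightarrow> real" where
  "window L v = max 0 (min L v - max 0 (v - 1))"

lemma has_integral_window:
  assumes L: "0 \<le> L"
  shows "((\<lambda>z. indicator {z..z + 1} v) has_integral window L v) {0..L}"
proof -
  define S where "S = {max 0 (v - 1)..min L v}"
  have "((\<lambda>_. 1::real) has_integral window L v) S"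
  proof (cases "max 0 (v - 1) \<le> min L v")
    case True
    then show ?thesis using has_integral_const_real[of "1::real" "max 0 (v - 1)" "min L v"]
      by (simp add: S_def window_def)
  next
    case False
    then have "S = {}" unfolding S_def by simp
    moreover have "window L v = 0" unfolding window_def using False by linarith
    ultimately show ?thesis by simp
  qed
  then have "((\<lambda>z. if z \<in> S then 1::real else 0) has_integral window L v) {0..L}"
    by (subst has_integral_restrict) (auto simp: S_def)
  then show ?thesis
    by (rule has_integral_eq[rotated]) (auto simp: S_def indicator_def)
qed

text \<open>The window equals 1 between 1 and \<open>L\<close>. Lower heights are covered by one
  unit cell, and higher ones by the first moment weight \<open>v / L\<close>.\<close>

lemma window_bounds:
  assumes L: "0 < L" and v: "0 < v"
  shows "window L v \<le> 1" "1 \<le> window L v + indicator {0..0 + 1} v + 1 / L * v"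
proof -
  show "window L v \<le> 1" by (simp add: window_def)
  show "1 \<le> window L v + indicator {0..0 + 1} v + 1 / L * v"
  proof (cases "v \<le> L")
    case True
    then show ?thesis using L v by (auto simp: window_def indicator_def)
  next
    case False
    then have "1 \<le> 1 / L * v" using L by (simp add: field_simps)
    then show ?thesis by (auto simp: window_def indicator_def)
  qed
qed

lemma has_integral_D:
  assumes t: "0 < t" and L: "0 \<le> L"
  shows "(D t has_integral 2 * (phi t 0 - phi t L)) {0..L}"
proof -
  have "((\<lambda>z. - 2 * phi t z) has_vector_derivative D t z) (at z within {0..L})" for z
  proof -
    define c where "c = 2 * s2 * t"
    have "c \<noteq> 0" using t s2_pos by (simp add: c_def)
    then have "((\<lambda>z. exp (- (z\<^sup>2 / c))) has_real_derivative exp (- (z\<^sup>2 / c)) * - (2 * z / c)) (at z within {0..L})"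
      by (auto intro!: derivative_eq_intros simp: power2_eq_square)
    from DERIV_cmult[OF DERIV_cdivide[OF this], of "- 2" "sqrt (2 * pi * s2 * t)"]
    have "((\<lambda>z. - 2 * (exp (- (z\<^sup>2 / c)) / sqrt (2 * pi * s2 * t))) has_real_derivative
        - 2 * (exp (- (z\<^sup>2 / c)) * - (2 * z / c) / sqrt (2 * pi * s2 * t))) (at z within {0..L})" .
    also have "- 2 * (exp (- (z\<^sup>2 / c)) * - (2 * z / c) / sqrt (2 * pi * s2 * t)) = D t z"
      by (simp add: c_def D_def phi_def)
    finally show ?thesis by (simp add: phi_def c_def has_real_derivative_iff_has_vector_derivative)
  qed
  from fundamental_theorem_of_calculus[OF L this]
  show ?thesis by (simp add: algebra_simps)
qed

lemma window_llt:
  assumes y: "- B \<le> y" and \<kappa>: "0 < \<kappa>"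
  shows "\<exists>N. \<forall>n\<ge>N. \<forall>z\<ge>0. \<bar>(Q ^^ n) (\<lambda>_. indicator {z..z + 1}) x y - D (real n) z * V x y\<bar> \<le> \<kappa> / real n"
proof -
  define Y where "Y = 1 + max y 0"
  have Y: "0 < Y" by (simp add: Y_def add_pos_nonneg)
  define Kc where "Kc = real (CARD('x))"
  have Kc: "0 < Kc" by (simp add: Kc_def)
  have "0 < \<kappa> / (2 * Kc * Y)" using \<kappa> Kc Y by simp
  obtain C where C: "0 < C" "\<forall>\<kappa>>0. \<exists>N. \<forall>n\<ge>N. \<forall>x w y z. - B \<le> y \<longrightarrow> 0 \<le> z \<longrightarrow>
    \<bar>(Q ^^ n) (cell w 1 z) x y - 1 * nu w * (D (real n) z * V x y)\<bar>
      \<le> (\<kappa> * (1 + max y 0) + C * (1 + max y 0)\<^sup>2 / sqrt (real n)) / real n"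
    by (rule exE[OF conditioned_llt[OF zero_less_one]], erule conjE, rule that, assumption, assumption)
  obtain N1 where N1: "\<forall>n\<ge>N1. \<forall>x w y z. - B \<le> y \<longrightarrow> 0 \<le> z \<longrightarrow>
    \<bar>(Q ^^ n) (cell w 1 z) x y - 1 * nu w * (D (real n) z * V x y)\<bar>
      \<le> (\<kappa> / (2 * Kc * Y) * (1 + max y 0) + C * (1 + max y 0)\<^sup>2 / sqrt (real n)) / real n"
    by (rule exE[OF C(2)[rule_format, OF \<open>0 < \<kappa> / (2 * Kc * Y)\<close>]], rule that, assumption)
  have "eventually (\<lambda>n. 2 * Kc * C * Y\<^sup>2 / \<kappa> \<le> sqrt (real n)) sequentially"
    using filterlim_compose[OF sqrt_at_top filterlim_real_sequentially] by (simp add: filterlim_at_top)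
  then obtain N2 where N2: "\<And>n. n \<ge> N2 \<Longrightarrow> 2 * Kc * C * Y\<^sup>2 / \<kappa> \<le> sqrt (real n)" by (auto simp: eventually_sequentially)
  have "\<bar>(Q ^^ n) (\<lambda>_. indicator {z..z + 1}) x y - D (real n) z * V x y\<bar> \<le> \<kappa> / real n"
    if n: "n \<ge> max N1 (max N2 1)" and z: "0 \<le> z" for n z
  proof -
    have rn: "0 < real n" "0 < sqrt (real n)" using n by auto
    have fsum: "(\<lambda>_. indicator {z..z + 1}) = (\<lambda>x v. \<Sum>w\<in>UNIV. cell w 1 z x v)"
      by (simp add: fun_eq_iff cell_def ind_def if_distrib[of "\<lambda>c. c * _"] cong: if_cong)
    have eq: "(Q ^^ n) (\<lambda>_. indicator {z..z + 1}) x y - D (real n) z * V x y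
       = (\<Sum>w\<in>UNIV. (Q ^^ n) (cell w 1 z) x y - 1 * nu w * (D (real n) z * V x y))"
      unfolding fsum kpow_sum[OF finite] sum_subtractf sum_distrib_right[symmetric] mult_1 nu_sum by simp
    have "\<bar>(Q ^^ n) (\<lambda>_. indicator {z..z + 1}) x y - D (real n) z * V x y\<bar>
       \<le> (\<Sum>w\<in>UNIV. \<bar>(Q ^^ n) (cell w 1 z) x y - 1 * nu w * (D (real n) z * V x y)\<bar>)" unfolding eq by (rule sum_abs)
    also have "\<dots> \<le> (\<Sum>w\<in>(UNIV::'x set). (\<kappa> / (2 * Kc * Y) * Y + C * Y\<^sup>2 / sqrt (real n)) / real n)"
    proof (rule sum_mono)
      fix w
      have "N1 \<le> n" using n by simp
      from N1[rule_format, OF this y z, of w x]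
      show "\<bar>(Q ^^ n) (cell w 1 z) x y - 1 * nu w * (D (real n) z * V x y)\<bar> \<le> (\<kappa> / (2 * Kc * Y) * Y + C * Y\<^sup>2 / sqrt (real n)) / real n"
        by (simp only: Y_def)
    qed
    also have "\<dots> = Kc * (\<kappa> / (2 * Kc * Y) * Y + C * Y\<^sup>2 / sqrt (real n)) / real n" by (simp add: Kc_def)
    also have "\<dots> = (\<kappa> / 2 + Kc * C * Y\<^sup>2 / sqrt (real n)) / real n" using Y Kc by (simp add: distrib_left)
    also have "\<dots> \<le> (\<kappa> / 2 + \<kappa> / 2) / real n"
    proof (intro divide_right_mono add_left_mono)
      have "2 * Kc * C * Y\<^sup>2 \<le> sqrt (real n) * \<kappa>" using N2[of n] n \<kappa> by (simp add: pos_divide_le_eq)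
      then show "Kc * C * Y\<^sup>2 / sqrt (real n) \<le> \<kappa> / 2" using rn by (simp add: pos_divide_le_eq mult_ac)
    qed (use rn in auto)
    finally show ?thesis by simp
  qed
  then show ?thesis by blast
qed

text \<open>The mean height on survival stays bounded in \<open>n\<close> because it differs from
  the killed mean of \<open>M\<close> by a bounded amount. By Markov's inequality this controls the
  surviving mass above \<open>L\<close>.\<close>

lemma kpow_height_bounded:
  assumes y: "- B \<le> y"
  shows "(Q ^^ n) (\<lambda>_ v. v) x y \<le> V x y + 4 * B"
proof -
  have "(Q ^^ n) (\<lambda>_ v. v) x y \<le> (Q ^^ n) (\<lambda>x v. M x v + B) x y"
  proof (rule kpow_mono)
    fix x v show "v \<le> M x v + B" using B_bounds(2)[of x] by (simp add: M_def abs_le_iff)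
  qed
  also have "\<dots> = (Q ^^ n) M x y + B * surv n x y" unfolding kpow_add kpow_const ..
  also have "\<dots> \<le> (V x y + 3 * B * 1) + B * 1"
  proof (intro add_mono mult_left_mono surv_le_1)
    have "3 * B * surv n x y \<le> 3 * B * 1" using B_ge_1 by (intro mult_left_mono surv_le_1) auto
    then show "(Q ^^ n) M x y \<le> V x y + 3 * B * 1" using V_approx[OF y, of n x] by linarith
  qed (use B_ge_1 in auto)
  finally show ?thesis by simp
qed

text \<open>The local theorem is integrated over \<open>z\<close> from 0 to
  \<open>A * sqrt n\<close>. The four errors are, in order: the local error over that range, the
  lowest unit cell (where \<open>D\<close> vanishes), the mass above the range, and the part of the
  Gaussian integral cut off.\<close>

lemma surv_window_estimate:
  assumes y: "- B \<le> y" and n: "0 < n" and A: "0 < A" and \<kappa>: "0 < \<kappa>"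
    and llt: "\<And>z. 0 \<le> z \<Longrightarrow> \<bar>(Q ^^ n) (\<lambda>_. indicator {z..z + 1}) x y - D (real n) z * V x y\<bar> \<le> \<kappa> / real n"
  shows "\<bar>sqrt (real n) * surv n x y - 2 / sqrt (2 * pi * s2) * V x y\<bar>
    \<le> \<kappa> * A + \<kappa> + (\<bar>V x y\<bar> + 4 * B) / A + 2 / sqrt (2 * pi * s2) * \<bar>V x y\<bar> * exp (- (A\<^sup>2 / (2 * s2)))"
proof -
  define sn where "sn = sqrt (real n)"
  have rn: "0 < real n" "1 \<le> real n" using n by auto
  have sn: "0 < sn" "sn * sn = real n" "1 \<le> sn" using rn by (auto simp: sn_def)
  define L where "L = A * sn"
  have L: "0 < L" "0 \<le> L" using A sn by (auto simp: L_def)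
  define p :: "real \<Rightarrow> real" where "p z = (Q ^^ n) (\<lambda>_. indicator {z..z + 1}) x y" for z
  define w where "w = (Q ^^ n) (\<lambda>_. window L) x y"
  have intp: "(p has_integral w) {0..L}"
    unfolding p_def w_def by (rule kpow_has_integral) (rule has_integral_window[OF L(2)])
  have "((\<lambda>z. p z - D (real n) z * V x y) has_integral w - 2 * (phi (real n) 0 - phi (real n) L) * V x y) {0..L}"
    by (intro has_integral_diff intp has_integral_mult_left has_integral_D rn L)
  then have "norm (w - 2 * (phi (real n) 0 - phi (real n) L) * V x y) \<le> \<kappa> / real n * measure lborel {0..L}"
    by (rule has_integral_bound_real[of _ "{}", rotated 2]) (use llt rn \<kappa> in \<open>auto simp: p_def\<close>)
  then have "\<bar>w - 2 * (phi (real n) 0 - phi (real n) L) * V x y\<bar> \<le> \<kappa> / real n * L" using L by simp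
  then have "sn * \<bar>w - 2 * (phi (real n) 0 - phi (real n) L) * V x y\<bar> \<le> sn * (\<kappa> / real n * L)"
    using sn by (intro mult_left_mono) auto
  also have "sn * (\<kappa> / real n * L) = \<kappa> * A"
    unfolding sn(2)[symmetric] L_def using sn(1) by simp
  finally have wb: "\<bar>sn * w - sn * (2 * (phi (real n) 0 - phi (real n) L) * V x y)\<bar> \<le> \<kappa> * A"
    using sn(1) by (simp only: right_diff_distrib[symmetric] abs_mult abs_of_pos)
  define e where "e = exp (- (A\<^sup>2 / (2 * s2)))"
  define c0 where "c0 = 2 / sqrt (2 * pi * s2)"
  have c0: "0 < c0" using s2_pos by (simp add: c0_def)
  have "phi (real n) L = e / sqrt (2 * pi * s2) / sn"
  proof -
    have "L\<^sup>2 / (2 * s2 * real n) = A\<^sup>2 / (2 * s2)"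
      unfolding L_def sn(2)[symmetric] using sn(1) by (simp add: power2_eq_square)
    then show ?thesis by (simp add: phi_def e_def real_sqrt_mult sn_def)
  qed
  moreover have "phi (real n) 0 = 1 / sqrt (2 * pi * s2) / sn" by (simp add: phi_def real_sqrt_mult sn_def)
  ultimately have ph: "sn * phi (real n) L = e / sqrt (2 * pi * s2)" "sn * phi (real n) 0 = 1 / sqrt (2 * pi * s2)"
    using sn(1) by auto
  have "sn * (2 * (phi (real n) 0 - phi (real n) L) * V x y) = 2 * (sn * phi (real n) 0 - sn * phi (real n) L) * V x y"
    by (simp add: algebra_simps)
  also have "\<dots> = c0 * V x y - c0 * V x y * e" unfolding ph c0_def by (simp add: diff_divide_distrib algebra_simps)
  finally have "sn * (2 * (phi (real n) 0 - phi (real n) L) * V x y) = c0 * V x y - c0 * V x y * e" .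
  with wb have wb: "\<bar>sn * w - (c0 * V x y - c0 * V x y * e)\<bar> \<le> \<kappa> * A" by simp
  have low: "w \<le> surv n x y"
  proof -
    have "w \<le> (Q ^^ n) (\<lambda>_ _. 1) x y" unfolding w_def by (rule kpow_mono_pos) (use window_bounds L n in auto)
    then show ?thesis by (simp add: kpow_const)
  qed
  have p0: "p 0 \<le> \<kappa> / real n"
    using llt[of 0] by (simp add: p_def D_def abs_le_iff)
  have "surv n x y = (Q ^^ n) (\<lambda>_ _. 1) x y" by (simp add: kpow_const)
  also have "\<dots> \<le> (Q ^^ n) (\<lambda>_ v. window L v + indicator {0..0 + 1} v + 1 / L * v) x y"
    by (rule kpow_mono_pos) (use window_bounds L n in auto)
  also have "\<dots> = w + p 0 + 1 / L * (Q ^^ n) (\<lambda>_ v. v) x y"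
    unfolding kpow_add kpow_mult p_def w_def ..
  also have "\<dots> \<le> w + \<kappa> / real n + 1 / L * (\<bar>V x y\<bar> + 4 * B)"
  proof (intro add_mono p0 mult_left_mono order_refl)
    show "(Q ^^ n) (\<lambda>_ v. v) x y \<le> \<bar>V x y\<bar> + 4 * B" using kpow_height_bounded[OF y, of n x] by linarith
  qed (use L in auto)
  finally have "sn * surv n x y \<le> sn * (w + \<kappa> / real n + 1 / L * (\<bar>V x y\<bar> + 4 * B))" using sn by (intro mult_left_mono) auto
  also have "\<dots> = sn * w + \<kappa> / sn + (\<bar>V x y\<bar> + 4 * B) / A"
    unfolding L_def sn(2)[symmetric] distrib_left[of sn] using sn(1) by simp
  also have "\<dots> \<le> sn * w + \<kappa> / 1 + (\<bar>V x y\<bar> + 4 * B) / A"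
    using sn \<kappa> by (intro add_right_mono add_left_mono divide_left_mono) auto
  finally have up: "sn * surv n x y \<le> sn * w + \<kappa> + (\<bar>V x y\<bar> + 4 * B) / A" by simp
  have low': "sn * w \<le> sn * surv n x y" using low sn by (intro mult_left_mono) auto
  have nn: "0 \<le> (\<bar>V x y\<bar> + 4 * B) / A" using A B_ge_1 by (intro divide_nonneg_nonneg) auto
  have "\<bar>c0 * V x y * e\<bar> = c0 * \<bar>V x y\<bar> * e" using c0 by (simp add: abs_mult e_def)
  then have "\<bar>sn * surv n x y - c0 * V x y\<bar> \<le> \<kappa> * A + \<kappa> + (\<bar>V x y\<bar> + 4 * B) / A + c0 * \<bar>V x y\<bar> * e"
    using up low' wb nn \<kappa> by linarith
  then show ?thesis by (simp only: sn_def c0_def e_def)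
qed

text \<open>\<open>A\<close> is chosen first to make the two tail terms small, then
  \<open>\<kappa>\<close> for this \<open>A\<close>. No uniformity in the starting point is needed,
  since only a limit at fixed \<open>x\<close> and \<open>y\<close> enters
  \<open>Vfun\<close>.\<close>

theorem surv_asymp:
  assumes y: "- B \<le> y"
  shows "(\<lambda>n. sqrt (real n) * surv n x y) \<longlonglongrightarrow> 2 / sqrt (2 * pi * s2) * V x y"
proof (rule LIMSEQ_I)
  fix \<epsilon> :: real assume \<epsilon>: "0 < \<epsilon>"
  define R where "R A = (\<bar>V x y\<bar> + 4 * B) / A + 2 / sqrt (2 * pi * s2) * \<bar>V x y\<bar> * exp (- (A\<^sup>2 / (2 * s2)))" for A
  have "(R \<longlongrightarrow> 0 + 2 / sqrt (2 * pi * s2) * \<bar>V x y\<bar> * 0) at_top"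
    unfolding R_def
  proof (intro tendsto_add tendsto_mult tendsto_const)
    show "((\<lambda>A. (\<bar>V x y\<bar> + 4 * B) / A) \<longlongrightarrow> 0) at_top"
      by (intro tendsto_divide_0[OF tendsto_const] filterlim_at_top_imp_at_infinity filterlim_ident)
    have "filterlim (\<lambda>A. 1 / (2 * s2) * A\<^sup>2) at_top at_top"
      using s2_pos by (intro filterlim_tendsto_pos_mult_at_top[OF tendsto_const] filterlim_pow_at_top filterlim_ident) auto
    then have "filterlim (\<lambda>A. - (A\<^sup>2 / (2 * s2))) at_bot at_top" by (simp add: filterlim_uminus_at_bot)
    then show "((\<lambda>A. exp (- (A\<^sup>2 / (2 * s2)))) \<longlongrightarrow> 0) at_top"
      by (rule filterlim_compose[OF exp_at_bot])
  qed
  then have "eventually (\<lambda>A. R A < \<epsilon> / 2) at_top" using \<epsilon> by (intro order_tendstoD(2)) auto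
  moreover have "eventually (\<lambda>A::real. 0 < A) at_top" by (rule eventually_gt_at_top)
  ultimately have "eventually (\<lambda>A. R A < \<epsilon> / 2 \<and> 0 < A) at_top" by (rule eventually_conj)
  then obtain A where A: "R A < \<epsilon> / 2" "0 < A" using eventually_happens'[OF trivial_limit_at_top_linorder] by blast
  define \<kappa> where "\<kappa> = \<epsilon> / (2 * (A + 1))"
  have \<kappa>: "0 < \<kappa>" "\<kappa> * A + \<kappa> = \<epsilon> / 2"
  proof -
    show "0 < \<kappa>" using \<epsilon> A by (simp add: \<kappa>_def)
    have "\<kappa> * (A + 1) = \<epsilon> / 2" using A(2) unfolding \<kappa>_def by (simp add: field_simps)
    then show "\<kappa> * A + \<kappa> = \<epsilon> / 2" by (simp add: algebra_simps)
  qed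
  obtain N where N: "\<And>n z. n \<ge> N \<Longrightarrow> 0 \<le> z \<Longrightarrow> \<bar>(Q ^^ n) (\<lambda>_. indicator {z..z + 1}) x y - D (real n) z * V x y\<bar> \<le> \<kappa> / real n"
    using window_llt[OF y \<kappa>(1), of x] by blast
  show "\<exists>no. \<forall>n\<ge>no. norm (sqrt (real n) * surv n x y - 2 / sqrt (2 * pi * s2) * V x y) < \<epsilon>"
  proof (intro exI allI impI)
    fix n assume n: "n \<ge> Suc N"
    then have n0: "0 < n" "N \<le> n" by auto
    have "\<bar>sqrt (real n) * surv n x y - 2 / sqrt (2 * pi * s2) * V x y\<bar>
      \<le> \<kappa> * A + \<kappa> + (\<bar>V x y\<bar> + 4 * B) / A + 2 / sqrt (2 * pi * s2) * \<bar>V x y\<bar> * exp (- (A\<^sup>2 / (2 * s2)))"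
      by (rule surv_window_estimate[OF y n0(1) A(2) \<kappa>(1)]) (rule N[OF n0(2)])
    then show "norm (sqrt (real n) * surv n x y - 2 / sqrt (2 * pi * s2) * V x y) < \<epsilon>"
      using A(1) \<kappa>(2) unfolding R_def real_norm_def by linarith
  qed
qed

lemma prob_tau_gt_eq: "prob_tau_gt P f x y n = surv n x y"
  unfolding prob_tau_gt_def surv_def using expect_killed[of P x n "\<lambda>_ _. 1" y f] by simp

lemma Vfun_eq:
  assumes y: "- B \<le> y"
  shows "Vfun P f x y = V x y"
proof -
  have "Vfun P f x y = sqrt (2 * pi) * sqrt s2 / 2 * (2 / sqrt (2 * pi * s2) * V x y)"
    unfolding Vfun_def sigma_def prob_tau_gt_eq limI[OF surv_asymp[OF y]] ..
  also have "\<dots> = V x y" using s2_pos by (simp add: real_sqrt_mult)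
  finally show ?thesis .
qed

text \<open>No single jump reaches the positive half line from below \<open>- B\<close>, so the
  first move always kills.\<close>

lemma kpow_below:
  assumes "y < - B" "0 < n"
  shows "(Q ^^ n) G x y = 0"
proof -
  obtain k where k: "n = Suc k" using assms by (cases n) auto
  have "\<not> 0 < y + f x'" for x' using assms(1) B_bounds(1)[of x'] by (simp add: abs_le_iff)
  then show ?thesis unfolding k by (simp add: kstep_def[of P f "(Q ^^ k) G"] step_def)
qed

lemma Vfun_below:
  assumes y: "y < - B"
  shows "Vfun P f x y = 0"
proof -
  have "eventually (\<lambda>n. sqrt (real n) * surv n x y = 0) sequentially"
    using eventually_gt_at_top[of 0] by eventually_elim (simp add: surv_def kpow_below[OF y])
  then have "(\<lambda>n. sqrt (real n) * surv n x y) \<longlonglongrightarrow> 0" by (rule tendsto_eventually)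
  then show ?thesis unfolding Vfun_def prob_tau_gt_eq by (simp add: limI)
qed

section \<open>Translation into the stated form and choice of the constants\<close>

lemma gaussian_density_eq:
  assumes "0 < n" "0 \<le> z"
  shows "2 * a * c * v / (sqrt (2 * pi) * s2 * real n) * phi_plus (z / (sqrt (real n) * sigma P f)) = c * (a * (D (real n) z * v))"
proof -
  have s: "0 < sqrt s2" "0 < sqrt (real n)" using s2_pos assms by auto
  have "(z / (sqrt (real n) * sqrt s2))\<^sup>2 / 2 = z\<^sup>2 / (2 * s2 * real n)"
    using s2_pos by (simp add: power_divide power_mult_distrib)
  moreover have "0 \<le> z / (sqrt (real n) * sqrt s2)" using assms s by simp
  ultimately have pp: "phi_plus (z / (sqrt (real n) * sigma P f)) = z / (sqrt (real n) * sqrt s2) * exp (- (z\<^sup>2 / (2 * s2 * real n)))"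
    by (simp add: phi_plus_def sigma_def)
  show ?thesis unfolding pp D_def phi_def by (simp add: real_sqrt_mult mult_ac)
qed

lemma expect_cells:
  "expect_n P x n (\<lambda>xs. \<psi> ((x # xs) ! n) * (if y + Ssum f xs n \<in> {z..z + a} \<and> tau_gt f y xs n then 1 else 0))
    = (\<Sum>w\<in>UNIV. \<psi> w * (Q ^^ n) (cell w a z) x y)"
proof -
  have "expect_n P x n (\<lambda>xs. \<psi> ((x # xs) ! n) * (if y + Ssum f xs n \<in> {z..z + a} \<and> tau_gt f y xs n then 1 else 0))
     = expect_n P x n (\<lambda>xs. (\<lambda>x v. \<psi> x * indicator {z..z + a} v) ((x # xs) ! n) (y + Ssum f xs n) * (if tau_gt f y xs n then 1 else 0))"
    by (rule arg_cong[of _ _ "expect_n P x n"]) (auto simp: fun_eq_iff indicator_def)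
  also have "\<dots> = (Q ^^ n) (\<lambda>x v. \<psi> x * indicator {z..z + a} v) x y" by (rule expect_killed)
  also have "(\<lambda>x v. \<psi> x * indicator {z..z + a} v) = (\<lambda>x v. \<Sum>w\<in>UNIV. \<psi> w * cell w a z x v)"
    by (simp add: fun_eq_iff cell_def ind_def if_distrib[of "\<lambda>c. _ * (c * _)"] cong: if_cong)
  also have "(Q ^^ n) (\<lambda>x v. \<Sum>w\<in>UNIV. \<psi> w * cell w a z x v) x y = (\<Sum>w\<in>UNIV. \<psi> w * (Q ^^ n) (cell w a z) x y)"
    unfolding kpow_sum[OF finite] kpow_mult ..
  finally show ?thesis .
qed

lemma cells_deviation:
  fixes \<psi> :: "'x \<Rightarrow> real"
  assumes n: "0 < n" and z: "0 \<le> z" and \<psi>: "\<And>x. 0 \<le> \<psi> x"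
    and \<delta>: "\<And>w. real n * \<bar>(Q ^^ n) (cell w a z) x y - a * nu w * (D (real n) z * Vfun P f x y)\<bar> \<le> \<delta>"
  shows "real n * \<bar>expect_n P x n (\<lambda>xs. \<psi> ((x # xs) ! n) * (if y + Ssum f xs n \<in> {z..z + a} \<and> tau_gt f y xs n then 1 else 0))
      - 2 * a * nu_int P \<psi> * Vfun P f x y / (sqrt (2 * pi) * sigma2 P f * real n) * phi_plus (z / (sqrt (real n) * sigma P f))\<bar>
    \<le> real (CARD('x)) * sup_norm \<psi> * \<delta>"
proof -
  have sup: "\<psi> w \<le> sup_norm \<psi>" for w
  proof -
    have "\<bar>\<psi> w\<bar> \<le> sup_norm \<psi>" unfolding sup_norm_def by (rule Max_ge) auto
    then show ?thesis by linarith
  qed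
  have "(\<Sum>w\<in>UNIV. \<psi> w * (Q ^^ n) (cell w a z) x y) - nu_int P \<psi> * (a * (D (real n) z * Vfun P f x y))
      = (\<Sum>w\<in>UNIV. \<psi> w * ((Q ^^ n) (cell w a z) x y - a * nu w * (D (real n) z * Vfun P f x y)))"
    unfolding nu_int_eq sum_distrib_right sum_subtractf[symmetric] by (rule sum.cong) (auto simp: algebra_simps)
  then have "real n * \<bar>(\<Sum>w\<in>UNIV. \<psi> w * (Q ^^ n) (cell w a z) x y) - nu_int P \<psi> * (a * (D (real n) z * Vfun P f x y))\<bar>
      \<le> real n * (\<Sum>w\<in>UNIV. \<bar>\<psi> w * ((Q ^^ n) (cell w a z) x y - a * nu w * (D (real n) z * Vfun P f x y))\<bar>)"
    by (simp only: mult_left_mono[OF sum_abs] of_nat_0_le_iff)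
  also have "\<dots> = (\<Sum>w\<in>UNIV. \<psi> w * (real n * \<bar>(Q ^^ n) (cell w a z) x y - a * nu w * (D (real n) z * Vfun P f x y)\<bar>))"
    unfolding sum_distrib_left by (rule sum.cong) (use \<psi> in \<open>auto simp: abs_mult\<close>)
  also have "\<dots> \<le> (\<Sum>w\<in>(UNIV::'x set). sup_norm \<psi> * \<delta>)"
  proof (rule sum_mono)
    fix w
    have s0: "0 \<le> sup_norm \<psi>" using \<psi>[of w] sup[of w] by linarith
    show "\<psi> w * (real n * \<bar>(Q ^^ n) (cell w a z) x y - a * nu w * (D (real n) z * Vfun P f x y)\<bar>) \<le> sup_norm \<psi> * \<delta>"
      by (intro mult_mono sup \<delta> s0) simp
  qed
  also have "\<dots> = real (CARD('x)) * sup_norm \<psi> * \<delta>" by simp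
  finally show ?thesis unfolding expect_cells gaussian_density_eq[OF n z] .
qed

text \<open>Joins the limit theorem above the threshold with the a priori bound below it, and covers
  starts below \<open>- B\<close>, where both the probability and \<open>Vfun\<close> vanish. The
  threshold is made a function of \<open>\<kappa>\<close> by choice.\<close>

lemma uniform_llt:
  assumes a: "0 < a"
  shows "\<exists>C>0. \<exists>N :: real \<Rightarrow> nat. \<forall>\<kappa> n x w y z. 0 < \<kappa> \<longrightarrow> 2 \<le> n \<longrightarrow> 0 \<le> z \<longrightarrow>
    real n * \<bar>(Q ^^ n) (cell w a z) x y - a * nu w * (D (real n) z * Vfun P f x y)\<bar>
      \<le> (if N \<kappa> \<le> n then \<kappa> * (1 + max y 0) + C * (1 + max y 0)\<^sup>2 / sqrt (real n) else C * (1 + max y 0))"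
proof -
  obtain C1 where C1: "0 < C1" "\<forall>\<kappa>>0. \<exists>N. \<forall>n\<ge>N. \<forall>x w y z. - B \<le> y \<longrightarrow> 0 \<le> z \<longrightarrow>
    \<bar>(Q ^^ n) (cell w a z) x y - a * nu w * (D (real n) z * V x y)\<bar>
      \<le> (\<kappa> * (1 + max y 0) + C1 * (1 + max y 0)\<^sup>2 / sqrt (real n)) / real n"
    by (rule exE[OF conditioned_llt[OF a]], erule conjE, rule that, assumption, assumption)
  have "\<forall>\<kappa>. \<exists>N. 0 < \<kappa> \<longrightarrow> (\<forall>n\<ge>N. \<forall>x w y z. - B \<le> y \<longrightarrow> 0 \<le> z \<longrightarrow>
    \<bar>(Q ^^ n) (cell w a z) x y - a * nu w * (D (real n) z * V x y)\<bar>
      \<le> (\<kappa> * (1 + max y 0) + C1 * (1 + max y 0)\<^sup>2 / sqrt (real n)) / real n)"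
    proof
    fix \<kappa>
    show "\<exists>N. 0 < \<kappa> \<longrightarrow> (\<forall>n\<ge>N. \<forall>x w y z. - B \<le> y \<longrightarrow> 0 \<le> z \<longrightarrow>
    \<bar>(Q ^^ n) (cell w a z) x y - a * nu w * (D (real n) z * V x y)\<bar>
      \<le> (\<kappa> * (1 + max y 0) + C1 * (1 + max y 0)\<^sup>2 / sqrt (real n)) / real n)"
      unfolding ex_simps(6) by (rule spec[OF C1(2)])
  qed
  note ch = choice[OF this]
  obtain N where N: "\<forall>\<kappa>. 0 < \<kappa> \<longrightarrow> (\<forall>n\<ge>N \<kappa>. \<forall>x w y z. - B \<le> y \<longrightarrow> 0 \<le> z \<longrightarrow>
    \<bar>(Q ^^ n) (cell w a z) x y - a * nu w * (D (real n) z * V x y)\<bar>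
      \<le> (\<kappa> * (1 + max y 0) + C1 * (1 + max y 0)\<^sup>2 / sqrt (real n)) / real n)"
    by (rule exE[OF ch], rule that, assumption)
  obtain C2 where C2: "0 < C2" "\<And>n x w y z. 2 \<le> n \<Longrightarrow> (Q ^^ n) (cell w a z) x y \<le> C2 * (1 + max y 0) / real n"
    using killed_cell_apriori[OF a] by blast
  define C where "C = C1 + (C2 + 5 * a * B * Imom 1)"
  have C: "0 < C" "C1 \<le> C" "C2 + 5 * a * B * Imom 1 \<le> C"
    using C1(1) C2(1) a B_ge_1 Imom_nonneg[of 1] by (auto simp: C_def intro!: add_pos_nonneg)
  have "real n * \<bar>(Q ^^ n) (cell w a z) x y - a * nu w * (D (real n) z * Vfun P f x y)\<bar>
      \<le> (if N \<kappa> \<le> n then \<kappa> * (1 + max y 0) + C * (1 + max y 0)\<^sup>2 / sqrt (real n) else C * (1 + max y 0))"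
    if \<kappa>: "0 < \<kappa>" and n: "2 \<le> n" and z: "0 \<le> z" for \<kappa> n x w y z
  proof (cases "- B \<le> y")
    case y: True
    have rn: "0 < real n" using n by simp
    show ?thesis
    proof (cases "N \<kappa> \<le> n")
      case True
      have "\<bar>(Q ^^ n) (cell w a z) x y - a * nu w * (D (real n) z * V x y)\<bar>
        \<le> (\<kappa> * (1 + max y 0) + C1 * (1 + max y 0)\<^sup>2 / sqrt (real n)) / real n"
        by (rule N[rule_format, OF \<kappa> True y z])
      then have "real n * \<bar>(Q ^^ n) (cell w a z) x y - a * nu w * (D (real n) z * V x y)\<bar>
        \<le> \<kappa> * (1 + max y 0) + C1 * (1 + max y 0)\<^sup>2 / sqrt (real n)"
        using rn by (simp add: pos_le_divide_eq mult.commute)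
      also have "\<dots> \<le> \<kappa> * (1 + max y 0) + C * (1 + max y 0)\<^sup>2 / sqrt (real n)"
        using C by (intro add_left_mono divide_right_mono mult_right_mono) auto
      finally show ?thesis using True by (simp add: Vfun_eq[OF y])
    next
      case False
      have anu: "0 \<le> a * nu w" "a * nu w \<le> a" using a nu_nonneg[of w] nu_le_1[of w] by auto
      have "\<bar>a * nu w * (D (real n) z * V x y)\<bar> = (a * nu w) * (\<bar>D (real n) z\<bar> * \<bar>V x y\<bar>)"
        unfolding abs_mult[of "a * nu w"] abs_of_nonneg[OF anu(1)] abs_mult[of "D (real n) z"] ..
      also have "\<dots> \<le> a * (Imom 1 / real n * (5 * B * (1 + max y 0)))"
        using anu a D_bound[OF rn, of z] V_bound[OF y, of x] rn Imom_nonneg[of 1] by (intro mult_mono mult_nonneg_nonneg) auto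
      also have "\<dots> = 5 * a * B * Imom 1 * (1 + max y 0) / real n" by simp
      finally have 1: "\<bar>a * nu w * (D (real n) z * V x y)\<bar> \<le> 5 * a * B * Imom 1 * (1 + max y 0) / real n" .
      have 0: "0 \<le> (Q ^^ n) (cell w a z) x y" by (rule kpow_nonneg) (rule cell_bounds)
      have "\<bar>(Q ^^ n) (cell w a z) x y - a * nu w * (D (real n) z * V x y)\<bar>
        \<le> C2 * (1 + max y 0) / real n + 5 * a * B * Imom 1 * (1 + max y 0) / real n"
        using 0 1 C2(2)[OF n, of w z x y] by linarith
      also have "\<dots> = (C2 + 5 * a * B * Imom 1) * (1 + max y 0) / real n"
        unfolding distrib_right add_divide_distrib ..
      also have "\<dots> \<le> C * (1 + max y 0) / real n"
        using C by (intro divide_right_mono mult_right_mono) auto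
      finally have "real n * \<bar>(Q ^^ n) (cell w a z) x y - a * nu w * (D (real n) z * V x y)\<bar> \<le> C * (1 + max y 0)"
        using rn by (simp add: pos_le_divide_eq mult.commute)
      then show ?thesis using False by (simp add: Vfun_eq[OF y])
    qed
  next
    case False
    have "(Q ^^ n) (cell w a z) x y = 0" by (rule kpow_below) (use False n in auto)
    moreover have "Vfun P f x y = 0" by (rule Vfun_below) (use False in auto)
    moreover have "0 \<le> \<kappa> * (1 + max y 0) + C * (1 + max y 0)\<^sup>2 / sqrt (real n)" "0 \<le> C * (1 + max y 0)"
      using \<kappa> C(1) by (auto intro!: add_nonneg_nonneg mult_nonneg_nonneg)
    ultimately show ?thesis by simp
  qed
  then show ?thesis using C(1) by blast
qed

end

theorem theorem2p4:
  fixes P :: "'x::finite \<Rightarrow> 'x \<Rightarrow> real" and f :: "'x \<Rightarrow> real" and a :: real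
  assumes "stochastic P" and "H1 P" and "H2 P f" and "H3 P f" and "a > 0"
  shows "\<exists>\<epsilon>0. 0 < \<epsilon>0 \<and> \<epsilon>0 < 1/4 \<and>
    (\<exists>c > 0. \<exists>c\<epsilon> :: real \<Rightarrow> real. (\<forall>\<epsilon>. 0 < \<epsilon> \<and> \<epsilon> < \<epsilon>0 \<longrightarrow> c\<epsilon> \<epsilon> > 0) \<and>
      (\<forall>\<epsilon> (\<psi>::'x \<Rightarrow> real) (y::real) (n::nat).
         0 < \<epsilon> \<and> \<epsilon> < \<epsilon>0 \<and> (\<forall>x. \<psi> x \<ge> 0) \<and> real n \<ge> 3 * \<epsilon> powr (-3) \<longrightarrow>
         (\<forall>x (z::real). z \<ge> 0 \<longrightarrow>
            real n * \<bar>expect_n P x n (\<lambda>xs. \<psi> ((x # xs) ! n) *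
                 (if y + Ssum f xs n \<in> {z..z+a} \<and> tau_gt f y xs n then 1 else 0))
              - 2 * a * nu_int P \<psi> * Vfun P f x y / (sqrt (2 * pi) * sigma2 P f * real n)
                * phi_plus (z / (sqrt (real n) * sigma P f))\<bar>
            \<le> c * (1 + max y 0) * sup_norm \<psi> *
               (sqrt \<epsilon> + c\<epsilon> \<epsilon> * (1 + max y 0) / real n powr \<epsilon>))))"
proof -
  interpret centered_walk P f
    by unfold_locales (use assms in auto)
  interpret nonlattice_walk P f
    by unfold_locales (use assms sigma2_pos in auto)
  obtain C and N :: "real \<Rightarrow> nat" where C: "0 < C" and N: "\<And>\<kappa> n x w y z. 0 < \<kappa> \<Longrightarrow> 2 \<le> n \<Longrightarrow> 0 \<le> z \<Longrightarrow>
    real n * \<bar>(Q ^^ n) (cell w a z) x y - a * nu w * (D (real n) z * Vfun P f x y)\<bar>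
      \<le> (if N \<kappa> \<le> n then \<kappa> * (1 + max y 0) + C * (1 + max y 0)\<^sup>2 / sqrt (real n) else C * (1 + max y 0))"
    using uniform_llt[OF assms(5)] by blast
  define K where "K = real (CARD('x))"
  have K: "0 < K" by (simp add: K_def)
  \<comment> \<open>\<open>K\<close> comes from summing over the end states; \<open>C + 1\<close>
    dominates both the coefficient 1 of \<open>sqrt \<epsilon>\<close> and \<open>C\<close>.\<close>
  define c where "c = K * (C + 1)"
  \<comment> \<open>Larger than the threshold for \<open>\<kappa> = sqrt \<epsilon>\<close>. For
    \<open>n\<close> below it, \<open>real n powr \<epsilon> \<le> real n\<close> stays under this
    constant, so the second term on the right is at least 1 and the a priori bound is
    enough.\<close>
  define c\<epsilon> where "c\<epsilon> \<epsilon> = real (N (sqrt \<epsilon>)) + 1" for \<epsilon>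
  have bound: "real n * \<bar>expect_n P x n (\<lambda>xs. \<psi> ((x # xs) ! n) *
                 (if y + Ssum f xs n \<in> {z..z+a} \<and> tau_gt f y xs n then 1 else 0))
              - 2 * a * nu_int P \<psi> * Vfun P f x y / (sqrt (2 * pi) * sigma2 P f * real n)
                * phi_plus (z / (sqrt (real n) * sigma P f))\<bar>
            \<le> c * (1 + max y 0) * sup_norm \<psi> * (sqrt \<epsilon> + c\<epsilon> \<epsilon> * (1 + max y 0) / real n powr \<epsilon>)"
    if \<epsilon>: "0 < \<epsilon>" "\<epsilon> < 1 / 8" and \<psi>: "\<And>x. \<psi> x \<ge> 0" and n: "real n \<ge> 3 * \<epsilon> powr (-3)" and z: "z \<ge> 0"
    for \<epsilon> \<psi> y n x z
  proof -
    define Y where "Y = 1 + max y 0"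
    have Y: "1 \<le> Y" by (simp add: Y_def)
    have "1 powr (-3) \<le> \<epsilon> powr (-3)" using \<epsilon> by (intro powr_mono2') auto
    then have n3: "3 \<le> n" using n by simp
    have s0: "0 \<le> sup_norm \<psi>"
    proof -
      have "\<bar>\<psi> x\<bar> \<le> sup_norm \<psi>" unfolding sup_norm_def by (rule Max_ge) auto
      then show ?thesis by linarith
    qed
    define \<delta> where "\<delta> = (if N (sqrt \<epsilon>) \<le> n then sqrt \<epsilon> * Y + C * Y\<^sup>2 / sqrt (real n) else C * Y)"
    have "\<delta> \<le> (C + 1) * Y * (sqrt \<epsilon> + c\<epsilon> \<epsilon> * Y / real n powr \<epsilon>)"
    proof -
      define u where "u = real n powr \<epsilon>"
      have u: "1 \<le> u" "u \<le> sqrt (real n)" "u \<le> real n"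
      proof -
        show "1 \<le> u" unfolding u_def using n3 \<epsilon> by (intro ge_one_powr_ge_zero) auto
        \<comment> \<open>Above the threshold the true remainder has order 1 / sqrt n, which is
          stronger than the decay with exponent \<open>\<epsilon>\<close> that is claimed.\<close>
        have "real n powr \<epsilon> \<le> real n powr (1 / 2)" using n3 \<epsilon> by (intro powr_mono) auto
        then show "u \<le> sqrt (real n)" unfolding u_def using n3 by (simp add: powr_half_sqrt)
        have "real n powr \<epsilon> \<le> real n powr 1" using n3 \<epsilon> by (intro powr_mono) auto
        then show "u \<le> real n" unfolding u_def using n3 by simp
      qed
      have e0: "0 \<le> sqrt \<epsilon>" using \<epsilon> by simp
      have ce: "1 \<le> c\<epsilon> \<epsilon>" by (simp add: c\<epsilon>_def)
      have main: "C * Y + sqrt \<epsilon> * Y \<le> (C + 1) * Y * (sqrt \<epsilon> + 1)"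
        using C Y e0 by (simp add: algebra_simps)
      show ?thesis
      proof (cases "N (sqrt \<epsilon>) \<le> n")
        case True
        have "C * Y\<^sup>2 / sqrt (real n) \<le> C * Y\<^sup>2 / u" using u C by (intro divide_left_mono mult_pos_pos) auto
        also have "\<dots> = C * Y * (1 * Y / u)" by (simp add: power2_eq_square)
        also have "\<dots> \<le> (C + 1) * Y * (c\<epsilon> \<epsilon> * Y / u)"
          using C Y ce u by (intro mult_mono divide_right_mono) auto
        finally have 1: "C * Y\<^sup>2 / sqrt (real n) \<le> (C + 1) * Y * (c\<epsilon> \<epsilon> * Y / u)" .
        have "1 * (sqrt \<epsilon> * Y) \<le> (C + 1) * (sqrt \<epsilon> * Y)" using C Y e0 by (intro mult_right_mono) auto
        then have "sqrt \<epsilon> * Y + C * Y\<^sup>2 / sqrt (real n) \<le> (C + 1) * (sqrt \<epsilon> * Y) + (C + 1) * Y * (c\<epsilon> \<epsilon> * Y / u)"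
          using 1 by linarith
        also have "\<dots> = (C + 1) * Y * (sqrt \<epsilon> + c\<epsilon> \<epsilon> * Y / u)" by (simp only: distrib_left mult_ac)
        finally show ?thesis using True by (simp add: \<delta>_def u_def)
      next
        case False
        then have "u \<le> c\<epsilon> \<epsilon>" using u(3) by (simp add: c\<epsilon>_def)
        then have "u * 1 \<le> c\<epsilon> \<epsilon> * Y" using Y u by (intro mult_mono) auto
        then have "1 \<le> c\<epsilon> \<epsilon> * Y / u" using u by (simp add: pos_le_divide_eq)
        then have "1 \<le> sqrt \<epsilon> + c\<epsilon> \<epsilon> * Y / u" using e0 by linarith
        then have "C * Y * 1 \<le> (C + 1) * Y * (sqrt \<epsilon> + c\<epsilon> \<epsilon> * Y / u)"
          using C Y e0 by (intro mult_mono) auto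
        then show ?thesis using False by (simp add: \<delta>_def u_def)
      qed
    qed
    then have "K * sup_norm \<psi> * \<delta> \<le> K * sup_norm \<psi> * ((C + 1) * Y * (sqrt \<epsilon> + c\<epsilon> \<epsilon> * Y / real n powr \<epsilon>))"
      using K s0 by (intro mult_left_mono) auto
    also have "\<dots> = c * Y * sup_norm \<psi> * (sqrt \<epsilon> + c\<epsilon> \<epsilon> * Y / real n powr \<epsilon>)" by (simp only: c_def mult_ac)
    finally have 1: "K * sup_norm \<psi> * \<delta> \<le> c * Y * sup_norm \<psi> * (sqrt \<epsilon> + c\<epsilon> \<epsilon> * Y / real n powr \<epsilon>)" .
    have n0: "0 < n" "2 \<le> n" and se: "0 < sqrt \<epsilon>" using n3 \<epsilon> by auto
    show ?thesis
      by (rule order_trans[OF cells_deviation[OF n0(1) z \<psi> N[OF se n0(2) z]] 1[unfolded K_def \<delta>_def Y_def]])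
  qed
  have c: "0 < c" using K C by (simp add: c_def)
  have ce: "0 < c\<epsilon> \<epsilon>" for \<epsilon> by (simp add: c\<epsilon>_def add_nonneg_pos)
  show ?thesis
  \<comment> \<open>\<open>1 / 8\<close> is an arbitrary choice strictly below
    \<open>1 / 4\<close>.\<close>
  proof (rule exI[of _ "1 / 8"], intro conjI)
    show "\<exists>c > 0. \<exists>c\<epsilon> :: real \<Rightarrow> real. (\<forall>\<epsilon>. 0 < \<epsilon> \<and> \<epsilon> < 1 / 8 \<longrightarrow> c\<epsilon> \<epsilon> > 0) \<and>
      (\<forall>\<epsilon> (\<psi>::'x \<Rightarrow> real) (y::real) (n::nat).
         0 < \<epsilon> \<and> \<epsilon> < 1 / 8 \<and> (\<forall>x. \<psi> x \<ge> 0) \<and> real n \<ge> 3 * \<epsilon> powr (-3) \<longrightarrow>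
         (\<forall>x (z::real). z \<ge> 0 \<longrightarrow>
            real n * \<bar>expect_n P x n (\<lambda>xs. \<psi> ((x # xs) ! n) *
                 (if y + Ssum f xs n \<in> {z..z+a} \<and> tau_gt f y xs n then 1 else 0))
              - 2 * a * nu_int P \<psi> * Vfun P f x y / (sqrt (2 * pi) * sigma2 P f * real n)
                * phi_plus (z / (sqrt (real n) * sigma P f))\<bar>
            \<le> c * (1 + max y 0) * sup_norm \<psi> *
               (sqrt \<epsilon> + c\<epsilon> \<epsilon> * (1 + max y 0) / real n powr \<epsilon>)))"
      by (rule exI[of _ c], rule conjI[OF c], rule exI[of _ c\<epsilon>], intro conjI allI impI ce, rule bound) auto
  qed auto
qed

end
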